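(* Let $H_0 = -\sum_{i,j=1}^n \partial_{x_i} a^{ij}(x)\partial_{x_j} + \sum_{j=1}^n b_j(x)\partial_{x_j} + V_0(x)$ on $\mathbb{R}^n$, where $a^{ij}, b_j, V_0$ are complex-valued measurable functions, $a^{ij}, b_j\in C_b^1(\mathbb{R}^n)$, and there is $c>0$ with $\mathrm{Re}\,(a^{ij}(x))_{i,j}\ge c I_n$ for all $x\in\mathbb{R}^n$. Assume that $V_0$ is relatively bounded with respect to $-\Delta$ with relative bound zero, that $\mathrm{Re}\, H_0\ge 0$, and that there exist constants $0<\mu<1$ and $c_0>0$ such that $$|\langle H_0u,u\rangle|\ge c_0\big(\|\nabla u\|^2+\|\langle x\rangle^{-\mu}u\|^2\big)\quad\text{for all } u\in H^2(\mathbb{R}^n),$$ $$\sup_x|\langle x\rangle^{\mu}b_j(x)|<\infty,\quad j=1,\dots,n.$$ Put $\gamma=\frac{2\mu}{1-\mu}$ and let $G_0$ be the (extended) inverse of $H_0$. Then: (a) For any $a>0$ there exists $C_a>0$ such that $$\|e^{-a\langle x\rangle^{1-\mu}}G_0^N\|+\|G_0^Ne^{-a\langle x\rangle^{1-\mu}}\|\le C_a^N N^{\gamma N}\quad\text{for all integers } N\ge 1.$$ (b) There exists a constant $C>0$ such that for every $\chi\in C_0^\infty(\mathbb{R}^n)$ there is $C_\chi>0$ with $$\|\chi(x)G_0^N\|+\|G_0^N\chi(x)\|\le C_\chi C^N N^{\gamma N}\quad\text{for all integers } N\ge 1.$$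
   Context: Notation: $\langle x\rangle=(1+|x|^2)^{1/2}$; $L^{2,s}=L^2(\mathbb{R}^n;\langle x\rangle^{2s}dx)$; $C_b^1$ is the space of $C^1$ functions that are bounded together with their first derivatives; $\|\cdot\|$ is the norm of $L^2(\mathbb{R}^n)$ or of bounded operators on $L^2(\mathbb{R}^n)$. $\mathrm{Re}\,(a^{ij}(x))\ge cI_n$ is meant in the sense of matrices ($\sum_{i,j} \mathrm{Re}\,a^{ij}(x)\xi_i\xi_j\ge c|\xi|^2$ for $\xi\in\mathbb{R}^n$), and $\mathrm{Re}\,H_0\ge0$ means $\mathrm{Re}\langle H_0u,u\rangle\ge0$ for $u\in H^2$. The domain of $H_0$ is $D(H_0)=H^2(\mathbb{R}^n)$. Definition of $G_0$: under the stated hypotheses $H_0$ is bijective from $D(H_0)$ onto its range $R(H_0)$, which is dense in $L^2$. $G_0:R(H_0)\to D(H_0)$ is the algebraic inverse. It maps $\mathcal{D}=\cap_{s\in\mathbb{R}}L^{2,s}$ into itself and extends by density, for every $s\in\mathbb{R}$, to a bounded operator from $L^{2,s}$ to $L^{2,s-2\mu}$, still denoted $G_0$; hence $G_0^N:L^{2,s}\to L^{2,s-2\mu N}$ is well defined for all $N$ and $s$. *)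

theory Defs
  imports "HOL-Analysis.Analysis"
begin

text \<open>
  Elements of function spaces on \<open>\<real>\<^sup>n\<close> are represented by Lebesgue measurable functions
  rather than by their almost-everywhere classes. Operators act on representatives, so
  equations between them are stated almost everywhere.
\<close>

type_synonym 'n cfun = "real ^ 'n \<Rightarrow> complex"

definition jbracket :: "real ^ 'n::finite \<Rightarrow> real" where
  "jbracket x = sqrt (1 + (norm x)\<^sup>2)"


subsection \<open>Weighted \<open>L\<^sup>2\<close> spaces\<close>

definition wL2 :: "real \<Rightarrow> ('n::finite) cfun set" where
  "wL2 s = {f \<in> borel_measurable lebesgue.
              integrable lebesgue (\<lambda>x. jbracket x powr (2 * s) * (cmod (f x))\<^sup>2)}"

definition wL2_norm :: "real \<Rightarrow> ('n::finite) cfun \<Rightarrow> real" where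
  "wL2_norm s f = sqrt (LINT x|lebesgue. jbracket x powr (2 * s) * (cmod (f x))\<^sup>2)"

definition L2 :: "('n::finite) cfun set" where
  "L2 = {f \<in> borel_measurable lebesgue. integrable lebesgue (\<lambda>x. (cmod (f x))\<^sup>2)}"

definition L2_norm :: "('n::finite) cfun \<Rightarrow> real" where
  "L2_norm f = sqrt (LINT x|lebesgue. (cmod (f x))\<^sup>2)"

definition L2_inner :: "('n::finite) cfun \<Rightarrow> 'n cfun \<Rightarrow> complex" where
  "L2_inner f g = (LINT x|lebesgue. f x * cnj (g x))"

text \<open>
  The operator norm is only meaningful for bounded operators (a real supremum of an unbounded
  set is unspecified), and is always used together with \<open>bounded_L2_op\<close>.
\<close>

definition bounded_L2_op :: "(('n::finite) cfun \<Rightarrow> 'n cfun) \<Rightarrow> bool" where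
  "bounded_L2_op T \<longleftrightarrow>
     (\<forall>f\<in>L2. T f \<in> L2) \<and>
     (\<forall>f\<in>L2. \<forall>g\<in>L2. AE x in lebesgue. T (\<lambda>y. f y + g y) x = T f x + T g x) \<and>
     (\<forall>f\<in>L2. \<forall>z. AE x in lebesgue. T (\<lambda>y. z * f y) x = z * T f x) \<and>
     (\<exists>K. \<forall>f\<in>L2. L2_norm (T f) \<le> K * L2_norm f)"

definition L2_opnorm :: "(('n::finite) cfun \<Rightarrow> 'n cfun) \<Rightarrow> real" where
  "L2_opnorm T = (SUP f\<in>{f \<in> L2. L2_norm f \<le> 1}. L2_norm (T f))"


subsection \<open>Classical and weak derivatives, Sobolev spaces\<close>

definition partial :: "'n::finite \<Rightarrow> 'n cfun \<Rightarrow> 'n cfun" where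
  "partial i f x = frechet_derivative f (at x) (axis i 1)"

primrec Ck :: "nat \<Rightarrow> ('n::finite) cfun \<Rightarrow> bool" where
  "Ck 0 f \<longleftrightarrow> continuous_on UNIV f"
| "Ck (Suc k) f \<longleftrightarrow> (\<forall>x. f differentiable (at x)) \<and> (\<forall>i. Ck k (partial i f))"

definition Cb1 :: "('n::finite) cfun set" where
  "Cb1 = {f. Ck 1 f \<and> bounded (range f) \<and> (\<forall>i. bounded (range (partial i f)))}"

definition test_functions :: "('n::finite) cfun set" where
  "test_functions = {f. (\<forall>k. Ck k f) \<and> compact (closure {x. f x \<noteq> 0})}"

definition locally_integrable :: "('n::finite) cfun \<Rightarrow> bool" where
  "locally_integrable f \<longleftrightarrow>
     f \<in> borel_measurable lebesgue \<and> (\<forall>K. compact K \<longrightarrow> set_integrable lebesgue K f)"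

definition has_weak_partial :: "'n::finite \<Rightarrow> 'n cfun \<Rightarrow> 'n cfun \<Rightarrow> bool" where
  "has_weak_partial i u v \<longleftrightarrow>
     locally_integrable u \<and> locally_integrable v \<and>
     (\<forall>\<phi>\<in>test_functions.
        (LINT x|lebesgue. u x * partial i \<phi> x) = - (LINT x|lebesgue. v x * \<phi> x))"

text \<open>A representative of the weak derivative, which is unique almost everywhere if it exists.\<close>

definition weak_partial :: "'n::finite \<Rightarrow> 'n cfun \<Rightarrow> 'n cfun" where
  "weak_partial i u = (SOME v. has_weak_partial i u v)"

primrec sobolev :: "nat \<Rightarrow> ('n::finite) cfun set" where
  "sobolev 0 = L2"
| "sobolev (Suc k) = {u \<in> L2. \<forall>i. \<exists>v\<in>sobolev k. has_weak_partial i u v}"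

definition grad_norm :: "('n::finite) cfun \<Rightarrow> real" where
  "grad_norm u = sqrt (\<Sum>j\<in>UNIV. (L2_norm (weak_partial j u))\<^sup>2)"

definition laplacian :: "('n::finite) cfun \<Rightarrow> 'n cfun" where
  "laplacian u x = (\<Sum>j\<in>UNIV. weak_partial j (weak_partial j u) x)"


subsection \<open>The operator and its extended inverse\<close>

definition elliptic_op ::
  "('n::finite \<Rightarrow> 'n \<Rightarrow> 'n cfun) \<Rightarrow> ('n \<Rightarrow> 'n cfun) \<Rightarrow> 'n cfun \<Rightarrow> 'n cfun \<Rightarrow> 'n cfun" where
  "elliptic_op a b V u x =
     - (\<Sum>i\<in>UNIV. \<Sum>j\<in>UNIV. weak_partial i (\<lambda>y. a i j y * weak_partial j u y) x)
     + (\<Sum>j\<in>UNIV. b j x * weak_partial j u x)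
     + V x * u x"

definition laplacian_bounded_zero :: "('n::finite) cfun \<Rightarrow> bool" where
  "laplacian_bounded_zero V \<longleftrightarrow>
     (\<forall>u\<in>sobolev 2. (\<lambda>x. V x * u x) \<in> L2) \<and>
     (\<forall>\<epsilon>>0. \<exists>K. \<forall>u\<in>sobolev 2.
        L2_norm (\<lambda>x. V x * u x) \<le> \<epsilon> * L2_norm (\<lambda>x. - laplacian u x) + K * L2_norm u)"

text \<open>
  The inverse of \<open>H\<close> from its range onto its domain \<open>H\<^sup>2\<close>; unspecified outside the range.
\<close>

definition alg_inverse :: "(('n::finite) cfun \<Rightarrow> 'n cfun) \<Rightarrow> 'n cfun \<Rightarrow> 'n cfun" where
  "alg_inverse H f = (SOME u. u \<in> sobolev 2 \<and> (AE x in lebesgue. H u x = f x))"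

text \<open>
  The extension by density from \<open>\<Inter>s. wL2 s\<close> to every \<open>wL2 s\<close>, with values in
  \<open>wL2 (s - 2 * \<mu>)\<close>. Since \<open>wL2 s\<close> embeds continuously into \<open>wL2 t\<close> for \<open>t \<le> s\<close>, the
  extensions for different \<open>s\<close> agree, which gives a single operator on the union of the
  \<open>wL2 s\<close>; its powers are ordinary iterates. The predicate depends on \<open>f\<close> only up to null
  sets, hence so does the chosen representative.
\<close>

definition ext_inverse :: "real \<Rightarrow> (('n::finite) cfun \<Rightarrow> 'n cfun) \<Rightarrow> 'n cfun \<Rightarrow> 'n cfun" where
  "ext_inverse \<mu> H f = (SOME u. \<exists>s. f \<in> wL2 s \<and> u \<in> wL2 (s - 2 * \<mu>) \<and>
     (\<exists>F :: nat \<Rightarrow> 'n cfun. (\<forall>k. F k \<in> (\<Inter>t. wL2 t) \<and> alg_inverse H (F k) \<in> wL2 (s - 2 * \<mu>)) \<and>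
        (\<lambda>k. wL2_norm s (\<lambda>x. F k x - f x)) \<longlonglongrightarrow> 0 \<and>
        (\<lambda>k. wL2_norm (s - 2 * \<mu>) (\<lambda>x. alg_inverse H (F k) x - u x)) \<longlonglongrightarrow> 0))"

definition mult_op :: "('n::finite) cfun \<Rightarrow> 'n cfun \<Rightarrow> 'n cfun" where
  "mult_op w f x = w x * f x"

end

theory Submission
  imports Defs "HOL-Computational_Algebra.Polynomial"
begin

text \<open>
  With \<open>r = (R\<^sup>2 + |x|\<^sup>2)\<^bsup>1/2\<^esup>\<close> in place of \<open>\<langle>x\<rangle>\<close>, conjugating the quadratic form of \<open>H\<^sub>0\<close> by the weight
  \<open>r\<^sup>\<tau>\<close> only produces terms that contain the factor \<open>|\<nabla> log r\<^sup>\<tau>| \<le> |\<tau>| R\<^bsup>\<mu>-1\<^esup> \<langle>x\<rangle>\<^bsup>-\<mu>\<^esup>\<close>, and these are absorbed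
  by the coercivity assumption as soon as \<open>|\<tau>| R\<^bsup>\<mu>-1\<^esup>\<close> is small. Hence
  \<open>\<parallel>r\<^bsup>s-2\<mu>\<^esup> G\<^sub>0 f\<parallel> \<le> C \<parallel>r\<^sup>s f\<parallel>\<close> with \<open>C\<close> independent of \<open>|s| \<le> 2\<mu>N\<close>, provided that \<open>R\<close> is a large multiple of
  \<open>N\<^bsup>1/(1-\<mu>)\<^esup>\<close>. Iterating \<open>N\<close> times costs \<open>C\<^sup>N\<close>, and the remaining weight \<open>r\<^bsup>2\<mu>N\<^esup>\<close> is at most
  \<open>K\<^sup>N N\<^bsup>\<gamma>N\<^esup>\<close> on compact sets and against \<open>exp (-a \<langle>x\<rangle>\<^bsup>1-\<mu>\<^esup>)\<close>.

  That rapidly decaying functions lie in the range of \<open>H\<^sub>0\<close> follows in three steps. Testing against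
  \<open>-\<Delta>u\<close> gives an a priori estimate in \<open>H\<^sup>2\<close>; the method of continuity then carries the surjectivity of
  \<open>1 - \<Delta>\<close> over to \<open>H\<^sub>0 + \<epsilon>\<close>; and the weighted estimate makes the solutions converge as \<open>\<epsilon> \<rightarrow> 0\<close>.
  Surjectivity of \<open>1 - \<Delta>\<close> and the density of test functions in \<open>H\<^sup>1\<close> both come from orthogonal projection
  and the fact that a bounded solution of \<open>\<Delta>h = h\<close> vanishes, so no mollification is needed.
\<close>

subsection \<open>Orthogonal projection and the method of continuity\<close>

text \<open>For exponents of size N, a power of \<open>jbracket x\<close> has a logarithmic gradient
  of size N at bounded \<open>x\<close>, too large to absorb; enlarging the weight to
  \<open>rb R\<close> makes it small there. Smallness of N R^(\<mu>-1) forces R of order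
  N^(1/(1-\<mu>)), and R^(2\<mu>N) is then a geometric factor times N^(\<gamma>N): this is the
  origin of \<open>\<gamma>\<close>.

  Each inverse lowers the exponent by 2\<mu> because coercivity controls the function only with the
  weight \<open>jbracket x powr (- \<mu>)\<close>: one \<mu> is lost on the solution and, by
  pairing, one on the data. For the same reason there is no bound of \<open>norm u\<close> by
  \<open>norm (A u)\<close>, so solvability has to pass through a positive shift. Coercivity
  concerns only the modulus of the form; accretivity guarantees that the shift does not decrease
  this modulus, which keeps the weighted constants uniform in \<epsilon>.

  The ellipticity condition sees only real parts of symmetrised coefficients, so complex and
  nonsymmetric coefficients require commuting derivatives in the a priori estimate.\<close>

lemma projection_exists:
  fixes S :: "'a::{real_inner, complete_space} set" and x :: 'a
  assumes S: "subspace S" "closed S"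
  shows "\<exists>y\<in>S. \<forall>z\<in>S. inner (x - y) z = 0"
proof -
  have ne: "S \<noteq> {}" using S(1) subspace_0 by blast
  define d where "d = infdist x S"
  have d_le: "d \<le> norm (x - y)" if "y \<in> S" for y
    using infdist_le[OF that, of x] by (simp add: d_def dist_norm)
  have d0: "0 \<le> d" by (simp add: d_def infdist_nonneg)
  have "\<exists>y\<in>S. norm (x - y) < d + inverse (real (Suc k))" for k
  proof (rule ccontr)
    assume "\<not> ?thesis"
    then have "\<And>y. y \<in> S \<Longrightarrow> d + inverse (real (Suc k)) \<le> dist x y" by (force simp: dist_norm)
    then have "d + inverse (real (Suc k)) \<le> infdist x S"
      unfolding infdist_notempty[OF ne] by (intro cINF_greatest ne) auto
    then show False unfolding d_def by (simp add: field_simps)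
  qed
  then obtain Y where Y: "\<And>k. Y k \<in> S" "\<And>k. norm (x - Y k) < d + inverse (real (Suc k))"
    by metis
  \<comment> \<open>Parallelogram law for \<open>x - Y j\<close> and \<open>x - Y k\<close>; their
    mean is \<open>x\<close> minus a midpoint lying in \<open>S\<close>, hence has norm at least
    \<open>d\<close>.\<close>
  have key: "(norm (Y j - Y k))\<^sup>2 \<le> 2 * (norm (x - Y j))\<^sup>2 + 2 * (norm (x - Y k))\<^sup>2 - 4 * d\<^sup>2" for j k
  proof -
    have m: "(1/2) *\<^sub>R (Y j + Y k) \<in> S"
      using Y(1) S(1) by (intro subspace_scale subspace_add)
    have "(norm (Y j - Y k))\<^sup>2 + 4 * (norm (x - (1/2) *\<^sub>R (Y j + Y k)))\<^sup>2
        = 2 * (norm (x - Y j))\<^sup>2 + 2 * (norm (x - Y k))\<^sup>2"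
      unfolding power2_norm_eq_inner
      by (simp add: inner_diff_left inner_diff_right inner_add_left inner_add_right
          algebra_simps inner_commute del: dot_square_norm)
    moreover have "d\<^sup>2 \<le> (norm (x - (1/2) *\<^sub>R (Y j + Y k)))\<^sup>2"
      using d_le[OF m] d0 by (intro power_mono) auto
    ultimately show ?thesis by linarith
  qed
  have lim: "(\<lambda>k. norm (x - Y k)) \<longlonglongrightarrow> d"
  proof (rule tendsto_sandwich[where f="\<lambda>_. d" and h="\<lambda>k. d + inverse (real (Suc k))"])
    show "(\<lambda>k. d + inverse (real (Suc k))) \<longlonglongrightarrow> d"
      using tendsto_add[OF tendsto_const LIMSEQ_inverse_real_of_nat, of d] by simp
  qed (use d_le Y in \<open>auto intro!: always_eventually less_imp_le\<close>)
  have "Cauchy Y"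
  proof (rule metric_CauchyI)
    fix e :: real assume e: "0 < e"
    have "(\<lambda>k. (norm (x - Y k))\<^sup>2) \<longlonglongrightarrow> d\<^sup>2" by (intro tendsto_intros lim)
    then obtain M where M: "\<And>k. k \<ge> M \<Longrightarrow> (norm (x - Y k))\<^sup>2 < d\<^sup>2 + e\<^sup>2 / 4"
      using order_tendstoD(2)[of _ "d\<^sup>2" sequentially "d\<^sup>2 + e\<^sup>2/4"] e
      by (auto simp: eventually_sequentially)
    show "\<exists>M. \<forall>m\<ge>M. \<forall>n\<ge>M. dist (Y m) (Y n) < e"
    proof (intro exI allI impI)
      fix m n assume "m \<ge> M" "n \<ge> M"
      then have "(norm (Y m - Y n))\<^sup>2 < e\<^sup>2" using key[of m n] M[of m] M[of n] by linarith
      then show "dist (Y m) (Y n) < e" using e by (simp add: dist_norm power2_less_imp_less)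
    qed
  qed
  then obtain y where y: "Y \<longlonglongrightarrow> y" using Cauchy_convergent convergent_def by blast
  have yS: "y \<in> S" using closed_sequentially[OF S(2)] Y(1) y by blast
  have ny: "norm (x - y) = d"
    by (rule LIMSEQ_unique[OF tendsto_norm[OF tendsto_diff[OF tendsto_const y]] lim])
  show ?thesis
  proof (intro bexI[OF _ yS] ballI)
    fix z assume z: "z \<in> S"
    show "inner (x - y) z = 0"
    proof (cases "z = 0")
      case False
      \<comment> \<open>This \<open>t\<close> minimises the quadratic function
        \<open>norm (x - y - t *\<^sub>R z)\<close> squared, so minimality of \<open>y\<close>
        leaves no room for a nonzero inner product.\<close>
      define t where "t = inner (x - y) z / (norm z)\<^sup>2"
      have "y + t *\<^sub>R z \<in> S" using S(1) yS z by (simp add: subspace_add subspace_scale)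
      then have "d\<^sup>2 \<le> (norm (x - (y + t *\<^sub>R z)))\<^sup>2" using d_le d0 by (intro power_mono) auto
      also have "\<dots> = (norm (x - y))\<^sup>2 - 2 * t * inner (x - y) z + t\<^sup>2 * (norm z)\<^sup>2"
        unfolding power2_norm_eq_inner
        by (simp add: inner_diff_left inner_diff_right inner_add_left inner_add_right
          algebra_simps inner_commute power2_eq_square del: dot_square_norm)
      also have "\<dots> = d\<^sup>2 - (inner (x - y) z)\<^sup>2 / (norm z)\<^sup>2"
        using False by (simp add: ny t_def field_simps power2_eq_square)
      finally have "(inner (x - y) z)\<^sup>2 / (norm z)\<^sup>2 \<le> 0" by simp
      then show ?thesis using False by (simp add: divide_le_0_iff)
    qed simp
  qed
qed

lemma subspace_closure:
  fixes T :: "'a::real_normed_vector set"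
  assumes "subspace T" shows "subspace (closure T)"
proof (rule subspaceI)
  show "0 \<in> closure T" using assms closure_subset subspace_0 by blast
next
  fix x y assume "x \<in> closure T" "y \<in> closure T"
  then obtain X Y where "\<And>k. X k \<in> T" "X \<longlonglongrightarrow> x" "\<And>k. Y k \<in> T" "Y \<longlonglongrightarrow> y"
    by (metis closure_sequential)
  then show "x + y \<in> closure T" unfolding closure_sequential
    using assms by (intro exI[of _ "\<lambda>k. X k + Y k"]) (auto intro: tendsto_add subspace_add)
next
  fix c x assume "x \<in> closure T"
  then obtain X where "\<And>k. X k \<in> T" "X \<longlonglongrightarrow> x" by (metis closure_sequential)
  then show "c *\<^sub>R x \<in> closure T" unfolding closure_sequential
    using assms by (intro exI[of _ "\<lambda>k. c *\<^sub>R X k"]) (auto intro: tendsto_scaleR subspace_scale)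
qed

text \<open>The residual of the projection onto \<open>closure T\<close> stays in \<open>G\<close>
  and is orthogonal to \<open>T\<close>. The relative form with \<open>G\<close> serves two density
  statements: \<open>G\<close> is the graph of the weak gradient in one, the whole space in the
  other.\<close>

lemma closure_eq_if_orthogonal_zero:
  fixes T G :: "'a::{real_inner, complete_space} set"
  assumes T: "subspace T" and G: "subspace G" "closed G" and TG: "T \<subseteq> G"
    and orth: "\<And>z. z \<in> G \<Longrightarrow> (\<And>y. y \<in> T \<Longrightarrow> inner z y = 0) \<Longrightarrow> z = 0"
  shows "closure T = G"
proof
  show cl: "closure T \<subseteq> G" using TG G(2) by (rule closure_minimal)
  show "G \<subseteq> closure T"
  proof
    fix x assume x: "x \<in> G"
    obtain y where y: "y \<in> closure T" "\<And>z. z \<in> closure T \<Longrightarrow> inner (x - y) z = 0"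
      using projection_exists[OF subspace_closure[OF T] closed_closure] by blast
    have "x - y \<in> G" using x y(1) cl G(1) by (auto intro: subspace_diff)
    moreover have "\<And>z. z \<in> T \<Longrightarrow> inner (x - y) z = 0" using y(2) closure_subset by blast
    ultimately have "x - y = 0" by (rule orth)
    then show "x \<in> closure T" using y(1) by simp
  qed
qed

text \<open>The estimate compares \<open>Q - P\<close> with the interpolated operator itself, so
  \<open>S\<close> carries no norm and the contraction takes place in the target space. The
  admissible step size depends on \<open>K\<close> only, hence finitely many steps lead from
  \<open>P\<close> to \<open>Q\<close>.\<close>

lemma continuity_method:
  fixes P Q :: "'a::real_vector \<Rightarrow> 'b::banach" and S :: "'a set"
  assumes S: "subspace S"
    and diff: "\<And>u v. u \<in> S \<Longrightarrow> v \<in> S \<Longrightarrow> P (u - v) = P u - P v"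
              "\<And>u v. u \<in> S \<Longrightarrow> v \<in> S \<Longrightarrow> Q (u - v) = Q u - Q v"
    and est: "\<And>t u. 0 \<le> t \<Longrightarrow> t \<le> 1 \<Longrightarrow> u \<in> S \<Longrightarrow>
        norm (Q u - P u) \<le> K * norm ((1 - t) *\<^sub>R P u + t *\<^sub>R Q u)"
    and P: "P ` S = UNIV"
  shows "Q ` S = UNIV"
proof -
  define M where "M t u = (1 - t) *\<^sub>R P u + t *\<^sub>R Q u" for t u
  have Mdiff: "M t (u - v) = M t u - M t v" if "u \<in> S" "v \<in> S" for t u v
    using that by (simp add: M_def diff algebra_simps)
  have step: "M s ` S = UNIV"
    if t: "0 \<le> t" "t \<le> 1" and onto: "M t ` S = UNIV" and st: "\<bar>s - t\<bar> * K \<le> 1/2" for s t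
  proof -
    have "\<exists>u. u \<in> S \<and> M t u = g" for g
    proof -
      have "g \<in> M t ` S" by (simp add: onto)
      then show ?thesis by auto
    qed
    then have "\<forall>g. \<exists>u. u \<in> S \<and> M t u = g" by blast
    from choice[OF this] obtain J where J: "\<And>g. J g \<in> S" "\<And>g. M t (J g) = g" by blast
    have "f \<in> M s ` S" for f
    proof -
      \<comment> \<open>A fixed point \<open>g\<close> satisfies
        \<open>g + (s - t) *\<^sub>R (Q (J g) - P (J g)) = f\<close>, that is, \<open>J g\<close> is
        mapped to \<open>f\<close> by \<open>M s\<close>.\<close>
      define F where "F g = f - (s - t) *\<^sub>R (Q (J g) - P (J g))" for g
      have "dist (F g) (F h) \<le> (1/2) * dist g h" for g h
      proof -
        have "F g - F h = - ((s - t) *\<^sub>R (Q (J g - J h) - P (J g - J h)))"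
          using J(1) by (simp add: F_def diff algebra_simps)
        then have "norm (F g - F h) = \<bar>s - t\<bar> * norm (Q (J g - J h) - P (J g - J h))" by simp
        also have "\<dots> \<le> \<bar>s - t\<bar> * (K * norm (M t (J g - J h)))"
          unfolding M_def using J(1) t S by (intro mult_left_mono est) (auto intro: subspace_diff)
        also have "\<dots> = (\<bar>s - t\<bar> * K) * norm (g - h)" using J by (simp add: Mdiff)
        also have "\<dots> \<le> (1/2) * norm (g - h)" using st by (intro mult_right_mono) auto
        finally show ?thesis by (simp add: dist_norm)
      qed
      then have "\<exists>!g. F g = g" by (intro banach_fix_type[of "1/2"]) auto
      then obtain g where g: "F g = g" by blast
      have "M s (J g) = M t (J g) + (s - t) *\<^sub>R (Q (J g) - P (J g))"
        by (simp add: M_def algebra_simps)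
      also have "\<dots> = f" using g J by (simp add: F_def algebra_simps)
      finally show ?thesis using J(1) by blast
    qed
    then show ?thesis by blast
  qed
  \<comment> \<open>Mesh \<open>1 / n\<close> gives the contraction factor
    \<open>K / n < 1/2\<close>.\<close>
  obtain n :: nat where n: "2 * K < n" "n > 0"
  proof -
    obtain m :: nat where "2 * K < m" using reals_Archimedean2 by blast
    then show ?thesis by (intro that[of "Suc m"]) auto
  qed
  have "k \<le> n \<Longrightarrow> M (real k / n) ` S = UNIV" for k
  proof (induction k)
    case 0 then show ?case using P by (simp add: M_def)
  next
    case (Suc k)
    have eq: "real (Suc k) / n - real k / n = 1 / n" by (simp add: diff_divide_distrib[symmetric])
    have st: "\<bar>real (Suc k) / n - real k / n\<bar> * K \<le> 1/2"
      unfolding eq using n by (simp add: field_simps)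
    have IH: "M (real k / n) ` S = UNIV" using Suc by simp
    have "0 \<le> real k / n" "real k / n \<le> 1" using Suc.prems by auto
    then show ?case by (rule step[OF _ _ IH st])
  qed
  from this[of n] n show ?thesis by (simp add: M_def)
qed

subsection \<open>Partial derivatives\<close>

lemma partial_eqI: "(f has_derivative f') (at x) \<Longrightarrow> partial i f x = f' (axis i 1)"
  by (simp add: partial_def frechet_derivative_at[symmetric])

lemma partial_add:
  "f differentiable (at x) \<Longrightarrow> g differentiable (at x) \<Longrightarrow>
    partial i (\<lambda>x. f x + g x) x = partial i f x + partial i g x"
  unfolding partial_def frechet_derivative_works
  by (rule partial_eqI[unfolded partial_def]) (rule has_derivative_add)

lemma partial_mult:
  "f differentiable (at x) \<Longrightarrow> g differentiable (at x) \<Longrightarrow>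
    partial i (\<lambda>x. f x * g x) x = f x * partial i g x + partial i f x * g x"
  unfolding partial_def frechet_derivative_works
  by (rule partial_eqI[unfolded partial_def]) (rule has_derivative_mult)

lemma partial_const [simp]: "partial i (\<lambda>x. c) x = 0"
  by (simp add: partial_def)

lemma partial_cmult:
  "f differentiable (at x) \<Longrightarrow> partial i (\<lambda>x. c * f x) x = c * partial i f x"
  by (simp add: partial_mult)

lemma partial_linear:
  assumes "bounded_linear h" "f differentiable (at x)"
  shows "partial i (\<lambda>x. h (f x)) x = h (partial i f x)"
  using assms unfolding partial_def frechet_derivative_works
  by (intro partial_eqI[unfolded partial_def]) (rule bounded_linear.has_derivative)

lemma has_derivative_translate:
  fixes f :: "'a::real_normed_vector \<Rightarrow> 'b::real_normed_vector"
  assumes "(f has_derivative f') (at (x + c))"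
  shows "((\<lambda>x. f (x + c)) has_derivative f') (at x)"
proof -
  have "((\<lambda>x. x + c) has_derivative (\<lambda>x. x)) (at x)" by (auto intro!: derivative_eq_intros)
  from diff_chain_at[OF this, of f f'] assms show ?thesis by (simp add: o_def)
qed

lemma partial_translate:
  assumes "f differentiable (at (x + c))"
  shows "partial i (\<lambda>x. f (x + c)) x = partial i f (x + c)"
  using assms unfolding partial_def frechet_derivative_works
  by (intro partial_eqI[unfolded partial_def]) (rule has_derivative_translate)

lemma differentiable_translate:
  fixes f :: "'a::real_normed_vector \<Rightarrow> 'b::real_normed_vector"
  shows "f differentiable (at (x + c)) \<Longrightarrow> (\<lambda>x. f (x + c)) differentiable (at x)"
  using has_derivative_translate unfolding differentiable_def by blast

lemma Ck_SucD: "Ck (Suc k) f \<Longrightarrow> Ck k f"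
proof (induction k arbitrary: f)
  case 0
  then show ?case
    by (auto intro!: continuous_at_imp_continuous_on differentiable_imp_continuous_within)
next
  case (Suc k)
  then show ?case by (metis Ck.simps(2))
qed

lemma Ck_differentiable: "Ck (Suc k) f \<Longrightarrow> f differentiable (at x)"
  by simp

lemma Ck_partial: "Ck (Suc k) f \<Longrightarrow> Ck k (partial i f)"
  by simp

lemma Ck_continuous: "Ck k f \<Longrightarrow> continuous_on UNIV f"
  by (induction k) (auto dest: Ck_SucD simp del: Ck.simps(2))

lemma Ck_const: "Ck k (\<lambda>x. c)"
proof (induction k arbitrary: c)
  case (Suc k)
  have "partial i (\<lambda>x. c) = (\<lambda>x::real^'a. 0)" for i by (rule ext) simp
  then show ?case using Suc by simp
qed simp

lemma Ck_add: "Ck k f \<Longrightarrow> Ck k g \<Longrightarrow> Ck k (\<lambda>x. f x + g x)"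
proof (induction k arbitrary: f g)
  case (Suc k)
  have "partial i (\<lambda>x. f x + g x) = (\<lambda>x. partial i f x + partial i g x)" for i
    using Suc.prems by (intro ext partial_add) auto
  then show ?case using Suc by (auto intro: differentiable_add)
qed (auto intro: continuous_intros)

lemma Ck_mult: "Ck k f \<Longrightarrow> Ck k g \<Longrightarrow> Ck k (\<lambda>x. f x * g x)"
proof (induction k arbitrary: f g)
  case (Suc k)
  have *: "partial i (\<lambda>x. f x * g x) = (\<lambda>x. f x * partial i g x + partial i f x * g x)" for i
    using Suc.prems by (intro ext partial_mult) auto
  have "Ck k f" "Ck k g" using Suc.prems by (auto dest: Ck_SucD simp del: Ck.simps(2))
  then have "Ck k (partial i (\<lambda>x. f x * g x))" for i
    unfolding * using Suc by (intro Ck_add Suc.IH) auto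
  then show ?case using Suc.prems by (auto intro: differentiable_mult)
qed (auto intro: continuous_intros)

lemma Ck_linear: "bounded_linear h \<Longrightarrow> Ck k f \<Longrightarrow> Ck k (\<lambda>x. h (f x))"
proof (induction k arbitrary: f)
  case 0 then show ?case by (auto intro: linear_continuous_on_compose bounded_linear.continuous_on)
next
  case (Suc k)
  have *: "partial i (\<lambda>x. h (f x)) = (\<lambda>x. h (partial i f x))" for i
    using Suc.prems by (intro ext partial_linear) auto
  have "(\<lambda>x. h (f x)) differentiable (at x)" for x
    using bounded_linear.has_derivative[OF Suc.prems(1)] Ck_differentiable[OF Suc.prems(2), of x]
    unfolding differentiable_def by blast
  then show ?case using Suc unfolding Ck.simps * by auto
qed

lemma Ck_translate: "Ck k f \<Longrightarrow> Ck k (\<lambda>x. f (x + c))"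
proof (induction k arbitrary: f)
  case 0
  then show ?case by (auto intro!: continuous_on_compose2[of UNIV f] continuous_intros)
next
  case (Suc k)
  have *: "partial i (\<lambda>x. f (x + c)) = (\<lambda>x. partial i f (x + c))" for i
    using Suc.prems by (intro ext partial_translate) auto
  show ?case using Suc unfolding Ck.simps * by (auto intro: differentiable_translate)
qed

lemma Ck_prod: "(\<And>i. i \<in> I \<Longrightarrow> Ck k (f i)) \<Longrightarrow> Ck k (\<lambda>x. \<Prod>i\<in>I. f i x)"
  by (induction I rule: infinite_finite_induct) (auto intro: Ck_const Ck_mult)

section \<open>Restriction to lines and symmetry of second derivatives\<close>

lemma partial_along_line:
  fixes f :: "'n::finite cfun"
  assumes "f differentiable (at (x + t *\<^sub>R axis i 1))"
  shows "((\<lambda>t. f (x + t *\<^sub>R axis i 1)) has_vector_derivative partial i f (x + t *\<^sub>R axis i 1)) (at t)"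
proof -
  let ?g = "\<lambda>t::real. x + t *\<^sub>R axis i (1::real)"
  have "(?g has_derivative (\<lambda>h. h *\<^sub>R axis i 1)) (at t)" by (auto intro!: derivative_eq_intros)
  moreover have fd: "(f has_derivative frechet_derivative f (at (?g t))) (at (?g t))"
    using assms by (simp add: frechet_derivative_works)
  ultimately have "((f \<circ> ?g) has_derivative (frechet_derivative f (at (?g t)) \<circ> (\<lambda>h. h *\<^sub>R axis i 1))) (at t)"
    by (rule diff_chain_at)
  moreover have "linear (frechet_derivative f (at (?g t)))" using fd has_derivative_linear by blast
  ultimately show ?thesis
    by (simp add: has_vector_derivative_def partial_def o_def linear_scale)
qed

text \<open>The mean value inequality for \<open>f t - t *\<^sub>R c\<close>, on a symmetric
  interval so that \<open>h\<close> may have either sign. It serves the symmetry of second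
  derivatives, the domination of difference quotients and the differentiation of translates.\<close>

lemma mean_value_linearization:
  fixes f :: "real \<Rightarrow> 'b::real_normed_vector"
  assumes f: "\<And>t. (f has_vector_derivative f' t) (at t)"
    and b: "\<And>t. \<bar>t\<bar> \<le> \<bar>h\<bar> \<Longrightarrow> norm (f' t - c) \<le> e"
  shows "norm (f h - f 0 - h *\<^sub>R c) \<le> e * \<bar>h\<bar>"
proof -
  have "norm ((\<lambda>t. f t - t *\<^sub>R c) h - (\<lambda>t. f t - t *\<^sub>R c) 0) \<le> e * norm (h - 0)"
  proof (rule differentiable_bound[where S="{-\<bar>h\<bar>..\<bar>h\<bar>}" and f'="\<lambda>t s. s *\<^sub>R (f' t - c)"])
    fix t assume t: "t \<in> {-\<bar>h\<bar>..\<bar>h\<bar>}"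
    show "((\<lambda>t. f t - t *\<^sub>R c) has_derivative (\<lambda>s. s *\<^sub>R (f' t - c))) (at t within {-\<bar>h\<bar>..\<bar>h\<bar>})"
      using has_derivative_diff[OF has_derivative_at_withinI[OF f[of t, unfolded has_vector_derivative_def]]
          has_derivative_scaleR_left[OF has_derivative_ident]]
      by (simp add: scaleR_diff_right)
    have "e \<ge> 0" using b[OF order_refl] norm_ge_zero order_trans by blast
    then show "onorm (\<lambda>s. s *\<^sub>R (f' t - c)) \<le> e"
      using t mult_right_mono[OF b[of t] abs_ge_zero] by (intro onorm_le) (auto simp: mult.commute abs_le_iff)
  qed auto
  then show ?thesis by (simp add: algebra_simps)
qed

text \<open>Schwarz's theorem: the second difference \<open>D h k l\<close> is symmetric in
  \<open>k\<close> and \<open>l\<close>, and linearising once in each direction shows that, up to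
  o(h^2), it equals h^2 times either mixed derivative.\<close>

lemma partial_commute:
  fixes f :: "'n::finite cfun"
  assumes f: "Ck 2 f"
  shows "partial i (partial j f) x = partial j (partial i f) x"
proof -
  have d0: "f differentiable (at y)" "partial k f differentiable (at y)"
       "continuous_on UNIV (partial k (partial l f))" for y k l
    using f by (auto simp: numeral_2_eq_2)
  define e where "e k = (axis k 1 :: real^'n)" for k
  define D where "D h k l = f (x + h *\<^sub>R e k + h *\<^sub>R e l) - f (x + h *\<^sub>R e k) - f (x + h *\<^sub>R e l) + f x" for h k l
  have main: "\<exists>d>0. \<forall>h. \<bar>h\<bar> < d \<longrightarrow> norm (D h k l - (h*h) *\<^sub>R partial l (partial k f) x) \<le> \<epsilon> * (\<bar>h\<bar> * \<bar>h\<bar>)"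
    if eps: "\<epsilon> > 0" for k l \<epsilon>
  proof -
    let ?c = "partial l (partial k f) x"
    have "isCont (partial l (partial k f)) x" using d0(3) by (simp add: continuous_on_eq_continuous_at)
    then obtain d where d: "d > 0" "\<And>y. dist y x < d \<Longrightarrow> dist (partial l (partial k f) y) ?c < \<epsilon>"
      using eps unfolding continuous_at_eps_delta by blast
    show ?thesis
    proof (intro exI[of _ "d/2"] conjI allI impI)
      fix h :: real assume h: "\<bar>h\<bar> < d/2"
      have near: "norm (partial l (partial k f) (x + s *\<^sub>R e k + t *\<^sub>R e l) - ?c) \<le> \<epsilon>"
        if "\<bar>s\<bar> \<le> \<bar>h\<bar>" "\<bar>t\<bar> \<le> \<bar>h\<bar>" for s t
      proof -
        have "norm (s *\<^sub>R e k + t *\<^sub>R e l) \<le> norm (s *\<^sub>R e k) + norm (t *\<^sub>R e l)" by (rule norm_triangle_ineq)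
        also have "\<dots> < d" using that h by (simp add: e_def)
        finally have "dist (x + s *\<^sub>R e k + t *\<^sub>R e l) x < d" by (simp add: dist_norm add.assoc)
        from d(2)[OF this] show ?thesis by (simp add: dist_norm)
      qed
      have inner_b: "norm (partial k f (x + s *\<^sub>R e k + h *\<^sub>R e l) - partial k f (x + s *\<^sub>R e k) - h *\<^sub>R ?c) \<le> \<epsilon> * \<bar>h\<bar>"
        if "\<bar>s\<bar> \<le> \<bar>h\<bar>" for s
        using mean_value_linearization[of "\<lambda>t. partial k f (x + s *\<^sub>R e k + t *\<^sub>R e l)"
            "\<lambda>t. partial l (partial k f) (x + s *\<^sub>R e k + t *\<^sub>R e l)" h ?c \<epsilon>]
          partial_along_line[OF d0(2)] near that by (simp add: e_def)
      have sw: "x + s *\<^sub>R e k + h *\<^sub>R e l = x + h *\<^sub>R e l + s *\<^sub>R e k" for s by simp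
      \<comment> \<open>The outer linearisation: the derivative in \<open>s\<close> of this
        difference is the quantity that \<open>inner_b\<close> compares with
        \<open>h *\<^sub>R ?c\<close>.\<close>
      have "norm ((\<lambda>s. f (x + h *\<^sub>R e l + s *\<^sub>R e k) - f (x + s *\<^sub>R e k)) h
          - (\<lambda>s. f (x + h *\<^sub>R e l + s *\<^sub>R e k) - f (x + s *\<^sub>R e k)) 0 - h *\<^sub>R (h *\<^sub>R ?c)) \<le> (\<epsilon> * \<bar>h\<bar>) * \<bar>h\<bar>"
        using inner_b unfolding sw
        by (intro mean_value_linearization[where f'="\<lambda>s. partial k f (x + h *\<^sub>R e l + s *\<^sub>R e k) - partial k f (x + s *\<^sub>R e k)"])
          (auto intro!: has_vector_derivative_diff partial_along_line[OF d0(1)] simp: e_def)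
      then show "norm (D h k l - (h*h) *\<^sub>R ?c) \<le> \<epsilon> * (\<bar>h\<bar> * \<bar>h\<bar>)"
        by (simp add: D_def algebra_simps)
    qed (use d in auto)
  qed
  have "norm (partial i (partial j f) x - partial j (partial i f) x) \<le> \<epsilon>" if \<epsilon>: "\<epsilon> > 0" for \<epsilon>
  proof -
    from main[of "\<epsilon>/2" i j] \<epsilon> obtain d1 where d1: "d1 > 0"
      "\<And>h. \<bar>h\<bar> < d1 \<Longrightarrow> norm (D h i j - (h*h) *\<^sub>R partial j (partial i f) x) \<le> \<epsilon>/2 * (\<bar>h\<bar> * \<bar>h\<bar>)" by auto
    from main[of "\<epsilon>/2" j i] \<epsilon> obtain d2 where d2: "d2 > 0"
      "\<And>h. \<bar>h\<bar> < d2 \<Longrightarrow> norm (D h j i - (h*h) *\<^sub>R partial i (partial j f) x) \<le> \<epsilon>/2 * (\<bar>h\<bar> * \<bar>h\<bar>)" by auto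
    define h where "h = min d1 d2 / 2"
    have h: "h > 0" "\<bar>h\<bar> < d1" "\<bar>h\<bar> < d2" using d1(1) d2(1) by (auto simp: h_def)
    have "D h j i = D h i j" by (simp add: D_def algebra_simps)
    then have eq: "(h*h) *\<^sub>R (partial i (partial j f) x - partial j (partial i f) x)
       = (D h i j - (h*h) *\<^sub>R partial j (partial i f) x) - (D h j i - (h*h) *\<^sub>R partial i (partial j f) x)"
      by (simp add: algebra_simps)
    have "norm ((h*h) *\<^sub>R (partial i (partial j f) x - partial j (partial i f) x)) \<le> \<epsilon>/2*(\<bar>h\<bar> * \<bar>h\<bar>) + \<epsilon>/2*(\<bar>h\<bar> * \<bar>h\<bar>)"
      unfolding eq
      using norm_triangle_ineq4[of "D h i j - (h*h) *\<^sub>R partial j (partial i f) x" "D h j i - (h*h) *\<^sub>R partial i (partial j f) x"]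
        d1(2)[OF h(2)] d2(2)[OF h(3)] by linarith
    then have "(h*h) * norm (partial i (partial j f) x - partial j (partial i f) x) \<le> (h*h) * \<epsilon>"
      unfolding norm_scaleR using h(1) by (simp add: field_simps)
    then show ?thesis using h(1) by (simp add: mult_le_cancel_left)
  qed
  then have "norm (partial i (partial j f) x - partial j (partial i f) x) \<le> 0"
    by (meson dense_ge)
  then show ?thesis by simp
qed


subsection \<open>Test functions\<close>

lemma test_functionsI:
  assumes "\<And>k. Ck k f" "compact K" "\<And>x. x \<notin> K \<Longrightarrow> f x = 0"
  shows "f \<in> test_functions"
proof -
  have "{x. f x \<noteq> 0} \<subseteq> K" using assms(3) by blast
  then have "closure {x. f x \<noteq> 0} \<subseteq> K" using assms(2) by (simp add: closure_minimal compact_imp_closed)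
  then have "compact (closure {x. f x \<noteq> 0})"
    using assms(2) by (metis closed_closure compact_Int_closed inf.absorb_iff2)
  then show ?thesis using assms(1) by (simp add: test_functions_def)
qed

lemma test_functionsE:
  assumes "f \<in> test_functions"
  obtains K where "compact K" "\<And>x. x \<notin> K \<Longrightarrow> f x = 0"
  using assms closure_subset[of "{x. f x \<noteq> 0}"] unfolding test_functions_def by blast

lemma test_Ck: "f \<in> test_functions \<Longrightarrow> Ck k f"
  by (simp add: test_functions_def)

lemma test_differentiable: "f \<in> test_functions \<Longrightarrow> f differentiable (at x)"
  using test_Ck[of f "Suc 0"] by simp

lemma partial_zero_outside:
  assumes "compact K" "\<And>x. x \<notin> K \<Longrightarrow> f x = 0" "x \<notin> K"
  shows "partial i f x = 0"
proof -
  have "open (- K)" using assms(1) by (simp add: compact_imp_closed open_Compl)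
  moreover have "((\<lambda>x. 0) has_derivative (\<lambda>h. 0)) (at x)" by simp
  ultimately have "(f has_derivative (\<lambda>h. 0)) (at x)"
    using assms by (intro has_derivative_transform_within_open[of "\<lambda>x. 0" "\<lambda>h. 0" x UNIV "- K" f]) auto
  from partial_eqI[OF this] show ?thesis .
qed

lemma test_partial: 
  assumes "f \<in> test_functions" shows "partial i f \<in> test_functions"
proof -
  obtain K where K: "compact K" "\<And>x. x \<notin> K \<Longrightarrow> f x = 0" using test_functionsE[OF assms] by blast
  show ?thesis
    using test_Ck[OF assms, of "Suc _"] partial_zero_outside[OF K]
    by (intro test_functionsI[OF _ K(1)]) auto
qed

lemma test_add:
  assumes "f \<in> test_functions" "g \<in> test_functions"
  shows "(\<lambda>x. f x + g x) \<in> test_functions"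
proof -
  obtain K where K: "compact K" "\<And>x. x \<notin> K \<Longrightarrow> f x = 0" using test_functionsE[OF assms(1)] by blast
  obtain L where L: "compact L" "\<And>x. x \<notin> L \<Longrightarrow> g x = 0" using test_functionsE[OF assms(2)] by blast
  show ?thesis
    using test_Ck assms K L by (intro test_functionsI[of _ "K \<union> L"]) (auto intro: Ck_add)
qed

lemma test_linear:
  assumes "bounded_linear h" "f \<in> test_functions"
  shows "(\<lambda>x. h (f x)) \<in> test_functions"
proof -
  obtain K where K: "compact K" "\<And>x. x \<notin> K \<Longrightarrow> f x = 0" using test_functionsE[OF assms(2)] by blast
  show ?thesis
    using test_Ck assms K by (intro test_functionsI[of _ K]) (auto intro: Ck_linear simp: linear_0 bounded_linear.linear)
qed

lemma test_cmult: "f \<in> test_functions \<Longrightarrow> (\<lambda>x. c * f x) \<in> test_functions"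
  by (rule test_linear[OF bounded_linear_mult_right])

lemma test_zero: "(\<lambda>x. 0) \<in> test_functions"
  by (rule test_functionsI[of _ "{}"]) (auto intro: Ck_const)

lemma test_cnj: "f \<in> test_functions \<Longrightarrow> (\<lambda>x. cnj (f x)) \<in> test_functions"
  by (rule test_linear[OF bounded_linear_cnj])

lemma test_translate:
  assumes "f \<in> test_functions" shows "(\<lambda>x. f (x + c)) \<in> test_functions"
proof -
  obtain K where K: "compact K" "\<And>x. x \<notin> K \<Longrightarrow> f x = 0" using test_functionsE[OF assms] by blast
  show ?thesis
  proof (rule test_functionsI)
    show "compact ((\<lambda>x. x + - c) ` K)" using K(1) by (intro compact_continuous_image continuous_intros)
    fix x assume "x \<notin> (\<lambda>x. x + - c) ` K"
    then have "x + c \<notin> K" by force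
    then show "f (x + c) = 0" by (rule K(2))
  qed (use assms in \<open>auto intro: Ck_translate test_Ck\<close>)
qed

section \<open>Integration of compactly supported functions\<close>

lemma compact_support_bounded:
  assumes "continuous_on UNIV f" "compact K" "\<And>x. x \<notin> K \<Longrightarrow> f x = 0"
  obtains B where "B \<ge> 0" "\<And>x. norm (f x :: 'b::real_normed_vector) \<le> B"
proof -
  have "bounded (f ` K)"
    using assms by (intro compact_imp_bounded compact_continuous_image) (auto intro: continuous_on_subset)
  then obtain B where B: "B > 0" "\<And>x. x \<in> K \<Longrightarrow> norm (f x) \<le> B"
    unfolding bounded_pos by blast
  show ?thesis
  proof (rule that)
    show "norm (f x) \<le> B" for x using B assms(3)[of x] by (cases "x \<in> K") auto
  qed (use B in simp)
qed

lemma compact_support_integrable: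
  fixes f :: "'a::euclidean_space \<Rightarrow> 'b::{banach, second_countable_topology}"
  assumes "continuous_on UNIV f" "compact K" "\<And>x. x \<notin> K \<Longrightarrow> f x = 0"
  shows "integrable lborel f"
proof -
  have "integrable lborel (\<lambda>x. indicator K x *\<^sub>R f x)"
    using assms by (intro borel_integrable_compact) (auto intro: continuous_on_subset)
  moreover have "(\<lambda>x. indicator K x *\<^sub>R f x) = f" using assms(3) by (auto simp: indicator_def fun_eq_iff)
  ultimately show ?thesis by simp
qed

lemma continuous_lebesgue_measurable:
  "continuous_on UNIV f \<Longrightarrow> f \<in> borel_measurable lebesgue"
  by (intro measurable_completion) (simp add: borel_measurable_continuous_onI)

lemma lborel_integral_translate:
  fixes f :: "'a::euclidean_space \<Rightarrow> 'b::{banach, second_countable_topology}"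
  assumes "f \<in> borel_measurable borel"
  shows "(LINT x|lborel. f (x + c)) = (LINT x|lborel. f x)"
proof -
  have "(LINT x|lborel. f x) = (LINT x|distr lborel borel ((+) c). f x)"
    by (simp add: lborel_distr_plus)
  also have "\<dots> = (LINT x|lborel. f (c + x))" using assms by (intro integral_distr) auto
  finally show ?thesis by (simp add: add.commute)
qed

text \<open>By translation invariance every difference quotient \<open>g k\<close> integrates to
  zero. The quotients converge pointwise to the derivative and are dominated by its supremum on a
  bounded set, so the limit integrates to zero as well.\<close>

lemma integral_partial_zero:
  fixes f :: "'n::finite cfun"
  assumes f: "Ck 1 f" and K: "compact K" "\<And>x. x \<notin> K \<Longrightarrow> f x = 0"
  shows "(LINT x|lebesgue. partial i f x) = 0"
proof -
  let ?e = "axis i (1::real) :: real^'n"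
  have df: "f differentiable (at x)" for x using f by simp
  have cf: "continuous_on UNIV f" using Ck_continuous[OF f] .
  have cp: "continuous_on UNIV (partial i f)" using f by simp
  obtain B where B: "B \<ge> 0" "\<And>x. norm (partial i f x) \<le> B"
    using compact_support_bounded[OF cp K(1) partial_zero_outside[OF K]] by blast
  have lip: "norm (f (x + t *\<^sub>R ?e) - f x) \<le> B * \<bar>t\<bar>" for x t
    using mean_value_linearization[of "\<lambda>t. f (x + t *\<^sub>R ?e)" "\<lambda>t. partial i f (x + t *\<^sub>R ?e)" t 0 B]
      partial_along_line[OF df] B(2) by simp
  define g where "g k x = real (Suc k) *\<^sub>R (f (x + inverse (real (Suc k)) *\<^sub>R ?e) - f x)" for k x
  \<comment> \<open>The increments \<open>inverse (real (Suc k))\<close> are at most 1, so this unit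
    enlargement of \<open>K\<close> contains the supports of all \<open>g k\<close>.\<close>
  define K' where "K' = {x - y | x y. x \<in> K \<and> y \<in> cball 0 1}"
  have K': "compact K'" unfolding K'_def using K(1) by (rule compact_differences) simp
  have gm: "g k \<in> borel_measurable borel" for k
    unfolding g_def
    by (intro borel_measurable_continuous_onI continuous_intros continuous_on_compose2[OF cf]) auto
  have int_g: "(LINT x|lborel. g k x) = 0" for k
  proof -
    have "integrable lborel f" by (rule compact_support_integrable[OF cf K])
    moreover have "integrable lborel (\<lambda>x. f (x + c))" for c
    proof (rule compact_support_integrable)
      show "continuous_on UNIV (\<lambda>x. f (x + c))" by (intro continuous_on_compose2[OF cf] continuous_intros) auto
      show "compact ((\<lambda>x. x + - c) ` K)" using K(1) by (intro compact_continuous_image continuous_intros)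
      fix x assume "x \<notin> (\<lambda>x. x + - c) ` K"
      then have "x + c \<notin> K" by force
      then show "f (x + c) = 0" by (rule K(2))
    qed
    ultimately show ?thesis
      unfolding g_def using borel_measurable_continuous_onI[OF cf]
      by (simp add: lborel_integral_translate)
  qed
  have g0: "g k x = 0" if "x \<notin> K'" for k x
  proof -
    have "x + t *\<^sub>R ?e \<notin> K" if "\<bar>t\<bar> \<le> 1" for t
    proof
      assume "x + t *\<^sub>R ?e \<in> K"
      then have "(x + t *\<^sub>R ?e) - t *\<^sub>R ?e \<in> K'" unfolding K'_def using that
        by (intro CollectI exI conjI refl) auto
      then show False using \<open>x \<notin> K'\<close> by simp
    qed
    from this[of 0] this[of "inverse (real (Suc k))"] show ?thesis
      by (simp add: g_def K(2) inverse_le_1_iff)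
  qed
  have "(\<lambda>k. LINT x|lborel. g k x) \<longlonglongrightarrow> (LINT x|lborel. partial i f x)"
  proof (rule integral_dominated_convergence[where w="\<lambda>x. indicator K' x *\<^sub>R B"])
    show "integrable lborel (\<lambda>x. indicator K' x *\<^sub>R B)"
      by (rule borel_integrable_compact[OF K']) simp
    show "AE x in lborel. (\<lambda>k. g k x) \<longlonglongrightarrow> partial i f x"
    proof (rule AE_I2)
      fix x
      show "(\<lambda>k. g k x) \<longlonglongrightarrow> partial i f x"
      proof (rule metric_LIMSEQ_I)
        fix \<epsilon> :: real assume eps: "\<epsilon> > 0"
        have "isCont (partial i f) x" using cp by (simp add: continuous_on_eq_continuous_at)
        then obtain d where d: "d > 0" "\<And>y. dist y x < d \<Longrightarrow> dist (partial i f y) (partial i f x) < \<epsilon>/2"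
          using eps half_gt_zero[OF eps] unfolding continuous_at_eps_delta by blast
        obtain n0 where n0: "inverse (real (Suc n0)) < d" using reals_Archimedean[OF d(1)] by blast
        show "\<exists>no. \<forall>n\<ge>no. dist (g n x) (partial i f x) < \<epsilon>"
        proof (intro exI allI impI)
          fix k assume "k \<ge> n0"
          define t where "t = inverse (real (Suc k))"
          have "t \<le> inverse (real (Suc n0))"
            unfolding t_def using \<open>k \<ge> n0\<close> by (intro le_imp_inverse_le) auto
          then have "t < d" using n0 by linarith
          then have t: "t > 0" "t < d" "real (Suc k) * t = 1"
            by (auto simp: t_def simp del: of_nat_Suc)
          have "norm (f (x + t *\<^sub>R ?e) - f (x + 0 *\<^sub>R ?e) - t *\<^sub>R partial i f x) \<le> \<epsilon>/2 * \<bar>t\<bar>"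
          proof (rule mean_value_linearization[where f'="\<lambda>t. partial i f (x + t *\<^sub>R ?e)"])
            fix s assume "\<bar>s\<bar> \<le> \<bar>t\<bar>"
            then have "dist (x + s *\<^sub>R ?e) x < d" using t by (simp add: dist_norm)
            from d(2)[OF this] show "norm (partial i f (x + s *\<^sub>R ?e) - partial i f x) \<le> \<epsilon>/2"
              by (simp add: dist_norm)
          qed (rule partial_along_line[OF df])
          then have "real (Suc k) * norm (f (x + t *\<^sub>R ?e) - f x - t *\<^sub>R partial i f x) \<le> real (Suc k) * (\<epsilon>/2 * t)"
            using t(1) by (intro mult_left_mono) auto
          also have "\<dots> = \<epsilon>/2" using t(3) by (metis mult.left_commute mult.right_neutral)
          also have "real (Suc k) * norm (f (x + t *\<^sub>R ?e) - f x - t *\<^sub>R partial i f x)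
              = norm (real (Suc k) *\<^sub>R (f (x + t *\<^sub>R ?e) - f x - t *\<^sub>R partial i f x))" by simp
          also have "real (Suc k) *\<^sub>R (f (x + t *\<^sub>R ?e) - f x - t *\<^sub>R partial i f x)
              = g k x - (real (Suc k) * t) *\<^sub>R partial i f x"
            by (simp only: g_def t_def[symmetric] scaleR_diff_right scaleR_scaleR)
          finally show "dist (g k x) (partial i f x) < \<epsilon>" using eps t(3) by (simp add: dist_norm)
        qed
      qed
    qed
    show "AE x in lborel. norm (g k x) \<le> indicator K' x *\<^sub>R B" for k
    proof (rule AE_I2)
      fix x
      show "norm (g k x) \<le> indicator K' x *\<^sub>R B"
      proof (cases "x \<in> K'")
        case True
        have "norm (g k x) \<le> real (Suc k) * (B * \<bar>inverse (real (Suc k))\<bar>)"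
          unfolding g_def using lip[of x "inverse (real (Suc k))"] by (simp add: mult_left_mono del: of_nat_Suc)
        also have "\<dots> = B" by (simp add: field_simps)
        finally show ?thesis using True by simp
      qed (simp add: g0)
    qed
  qed (use gm cp in \<open>auto intro: borel_measurable_continuous_onI\<close>)
  then have "(LINT x|lborel. partial i f x) = 0" by (simp add: int_g LIMSEQ_const_iff)
  then show ?thesis by (simp add: integral_completion borel_measurable_continuous_onI cp)
qed

subsection \<open>Bump functions\<close>

text \<open>With y = 1/t one has dy/dt = -y^2, so the derivative in t of P(y) exp(-y) is y^2 (P(y) -
  P'(y)) exp(-y); the polynomial \<open>[:0, 0, 1:]\<close> is y^2.\<close>

primrec step_poly :: "nat \<Rightarrow> real poly" where
  "step_poly 0 = 1"
| "step_poly (Suc n) = [:0, 0, 1:] * (step_poly n - pderiv (step_poly n))"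

text \<open>The \<open>n\<close>-th derivative of the function that is \<open>exp (- 1 / t)\<close> for \<open>t > 0\<close> and \<open>0\<close> otherwise.\<close>

definition step_deriv :: "nat \<Rightarrow> real \<Rightarrow> real" where
  "step_deriv n t = (if t > 0 then poly (step_poly n) (1 / t) * exp (- (1 / t)) else 0)"

text \<open>The extra power \<open>k\<close> makes the induction close: splitting off the constant
  coefficient of \<open>pCons a p\<close> turns the remainder into the same statement for
  \<open>p\<close> and \<open>Suc k\<close>.\<close>

lemma tendsto_poly_exp: "((\<lambda>y. y ^ k * poly Q y * exp (- y)) \<longlongrightarrow> (0::real)) at_top"
proof (induction Q arbitrary: k)
  case (pCons a p)
  have "((\<lambda>y. a * (y ^ k / exp y) + y ^ Suc k * poly p y * exp (- y)) \<longlongrightarrow> a * 0 + 0) at_top"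
    by (intro tendsto_intros tendsto_power_div_exp_0 pCons.IH)
  moreover have "(\<lambda>y. a * (y ^ k / exp y) + y ^ Suc k * poly p y * exp (- y)) = (\<lambda>y. y ^ k * poly (pCons a p) y * exp (- y))"
    by (rule ext) (simp add: exp_minus field_simps)
  ultimately show ?case by simp
qed simp

lemma step_deriv_has_derivative:
  "(step_deriv n has_real_derivative step_deriv (Suc n) t) (at t)"
proof -
  consider "t > 0" | "t < 0" | "t = 0" by linarith
  then show ?thesis
  proof cases
    case 1
    have "((\<lambda>t. poly (step_poly n) (1 / t) * exp (- (1 / t))) has_real_derivative step_deriv (Suc n) t) (at t)"
      using 1 by (auto intro!: derivative_eq_intros DERIV_chain2[OF poly_DERIV]
        simp: step_deriv_def field_simps power2_eq_square)
    then show ?thesis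
      by (rule DERIV_cong_ev[OF refl _ refl, THEN iffD1, rotated])
        (use eventually_nhds_in_open[of "{0<..}" t] 1 in \<open>auto simp: step_deriv_def elim: eventually_mono\<close>)
  next
    case 2
    have "((\<lambda>t. 0) has_real_derivative step_deriv (Suc n) t) (at t)"
      using 2 by (simp add: step_deriv_def)
    then show ?thesis
      by (rule DERIV_cong_ev[OF refl _ refl, THEN iffD1, rotated])
        (use eventually_nhds_in_open[of "{..<0}" t] 2 in \<open>auto simp: step_deriv_def elim: eventually_mono\<close>)
  next
    case 3
    \<comment> \<open>The difference quotient at 0. From the right the substitution y = 1/s turns it
      into y P(y) exp(-y), which tends to 0; this is the case \<open>k = 1\<close> of
      \<open>tendsto_poly_exp\<close>.\<close>
    have "((\<lambda>s. step_deriv n s / s) \<longlongrightarrow> 0) (at 0)"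
    proof (rule filterlim_split_at)
      have "((\<lambda>s. 0) \<longlongrightarrow> (0::real)) (at_left 0)" by simp
      then show "((\<lambda>s. step_deriv n s / s) \<longlongrightarrow> 0) (at_left 0)"
        by (rule Lim_transform_eventually)
          (auto simp: step_deriv_def eventually_at_filter intro!: always_eventually)
      have "((\<lambda>y. step_deriv n (inverse y) / inverse y) \<longlongrightarrow> 0) at_top"
        by (rule Lim_transform_eventually[OF tendsto_poly_exp[of 1 "step_poly n"]])
          (rule eventually_mono[OF eventually_gt_at_top[of "0::real"]], simp add: step_deriv_def field_simps)
      then show "((\<lambda>s. step_deriv n s / s) \<longlongrightarrow> 0) (at_right 0)"
        by (simp add: filterlim_at_right_to_top)
    qed
    then show ?thesis using 3 by (simp add: has_field_derivative_iff step_deriv_def)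
  qed
qed

lemma Ck_step:
  "Ck k (\<lambda>x. complex_of_real (step_deriv n (\<alpha> * x $ (i::'n::finite) + \<beta>)))"
proof (induction k arbitrary: n)
  case 0
  have "isCont (step_deriv n) t" for t using step_deriv_has_derivative DERIV_isCont by blast
  then have "continuous_on UNIV (step_deriv n)" by (simp add: continuous_at_imp_continuous_on)
  then show ?case by (auto intro!: continuous_intros continuous_on_compose2[of UNIV "step_deriv n"])
next
  case (Suc k)
  have d: "((\<lambda>x. complex_of_real (step_deriv n (\<alpha> * x $ i + \<beta>))) has_derivative
      (\<lambda>h. complex_of_real (step_deriv (Suc n) (\<alpha> * x $ i + \<beta>) * (\<alpha> * h $ i)))) (at x)" for x :: "real^'n"
  proof -
    have "((\<lambda>x. \<alpha> * x $ i + \<beta>) has_derivative (\<lambda>h. \<alpha> * h $ i)) (at x)"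
      by (auto intro!: derivative_eq_intros bounded_linear.has_derivative[OF bounded_linear_vec_nth])
    moreover have "(step_deriv n has_derivative (\<lambda>h. step_deriv (Suc n) (\<alpha> * x $ i + \<beta>) * h)) (at (\<alpha> * x $ i + \<beta>))"
      using step_deriv_has_derivative by (simp add: has_field_derivative_def)
    ultimately have "((step_deriv n \<circ> (\<lambda>x. \<alpha> * x $ i + \<beta>)) has_derivative
      ((\<lambda>h. step_deriv (Suc n) (\<alpha> * x $ i + \<beta>) * h) \<circ> (\<lambda>h. \<alpha> * h $ i))) (at x)"
      by (rule diff_chain_at)
    from bounded_linear.has_derivative[OF bounded_linear_of_real this] show ?thesis by (simp add: o_def)
  qed
  have p: "partial j (\<lambda>x. complex_of_real (step_deriv n (\<alpha> * x $ i + \<beta>)))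
     = (\<lambda>x. complex_of_real (if j = i then \<alpha> else 0) * complex_of_real (step_deriv (Suc n) (\<alpha> * x $ i + \<beta>)))" for j
    by (rule ext) (auto simp: partial_eqI[OF d] axis_def)
  show ?case unfolding Ck.simps p
    using d Suc by (auto intro!: Ck_mult Ck_const simp: differentiable_def)
qed

text \<open>A product over the coordinates of h(k (x_i - a_i)) h(k (b_i - x_i)), where h(t) is
  exp(-1/t) for t > 0 and 0 otherwise: each factor has values in [0,1], vanishes on the wrong side
  of its face and tends to 1 on the right side. Bounded pointwise convergence with a common support
  is the form in which dominated convergence uses it.\<close>

lemma box_approx:
  fixes a b :: "real^'n::finite"
  obtains \<phi> :: "nat \<Rightarrow> 'n cfun" where
    "\<And>k. \<phi> k \<in> test_functions" "\<And>k x. cmod (\<phi> k x) \<le> 1" "\<And>k x. x \<notin> cbox a b \<Longrightarrow> \<phi> k x = 0"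
    "\<And>x. (\<lambda>k. \<phi> k x) \<longlonglongrightarrow> indicator (box a b) x"
proof
  define h where "h = step_deriv 0"
  have h0: "h t = 0" if "t \<le> 0" for t using that by (simp add: h_def step_deriv_def)
  have h1: "0 \<le> h t" "h t \<le> 1" for t by (auto simp: h_def step_deriv_def)
  have lim: "(\<lambda>k. h (real k * t)) \<longlonglongrightarrow> (if t > 0 then 1 else 0)" for t
  proof (cases "t > 0")
    case True
    have "(\<lambda>k. exp (- (1 / t * (1 / real k)))) \<longlonglongrightarrow> exp (- (1 / t * 0))"
      by (intro tendsto_intros lim_1_over_n)
    then have "(\<lambda>k. exp (- (1 / t * (1 / real k)))) \<longlonglongrightarrow> 1" by simp
    then have "(\<lambda>k. h (real k * t)) \<longlonglongrightarrow> 1"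
      by (rule Lim_transform_eventually)
        (use True in \<open>auto intro!: eventually_mono[OF eventually_gt_at_top[of 0]] simp: h_def step_deriv_def field_simps\<close>)
    then show ?thesis using True by simp
  next
    case False
    then have "h (real k * t) = 0" for k by (intro h0) (simp add: mult_nonneg_nonpos)
    then show ?thesis using False by simp
  qed
  let ?\<phi> = "\<lambda>k x. \<Prod>i\<in>(UNIV::'n set). complex_of_real (h (real k * x $ i + - real k * a $ i)) * complex_of_real (h (- real k * x $ i + real k * b $ i))"
  show out: "?\<phi> k x = 0" if "x \<notin> cbox a b" for k x
  proof -
    obtain i where i: "x $ i < a $ i \<or> b $ i < x $ i" using \<open>x \<notin> cbox a b\<close> by (auto simp: mem_box_cart not_le)
    have "h (real k * x $ i + - real k * a $ i) * h (- real k * x $ i + real k * b $ i) = 0"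
      using i
    proof
      assume "x $ i < a $ i"
      then have "real k * x $ i + - real k * a $ i \<le> 0" by (simp add: mult_left_mono)
      then show ?thesis by (simp add: h0)
    next
      assume "b $ i < x $ i"
      then have "- real k * x $ i + real k * b $ i \<le> 0" by (simp add: mult_left_mono)
      then show ?thesis by (simp add: h0)
    qed
    then have "complex_of_real (h (real k * x $ i + - real k * a $ i)) * complex_of_real (h (- real k * x $ i + real k * b $ i)) = 0"
      by (metis of_real_0 of_real_mult)
    then show ?thesis by (intro prod_zero) auto
  qed
  show "?\<phi> k \<in> test_functions" for k
    by (rule test_functionsI[OF _ compact_cbox[of a b] out])
      (unfold h_def, intro Ck_prod Ck_mult Ck_step)
  show "cmod (?\<phi> k x) \<le> 1" for k x
    unfolding norm_mult prod_norm[symmetric] using h1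
    by (intro prod_le_1) (auto intro!: mult_le_one)
  show "(\<lambda>k. ?\<phi> k x) \<longlonglongrightarrow> indicator (box a b) x" for x
  proof -
    have eq: "real k * x $ i + - real k * a $ i = real k * (x $ i - a $ i)"
       "- real k * x $ i + real k * b $ i = real k * (b $ i - x $ i)" for k i by (auto simp: algebra_simps)
    have "(\<lambda>k. ?\<phi> k x) \<longlonglongrightarrow> (\<Prod>i\<in>(UNIV::'n set). complex_of_real (if x $ i - a $ i > 0 then 1 else 0) * complex_of_real (if b $ i - x $ i > 0 then 1 else 0))"
      unfolding eq by (intro tendsto_intros lim)
    also have "(\<Prod>i\<in>(UNIV::'n set). complex_of_real (if x $ i - a $ i > 0 then 1 else 0) * complex_of_real (if b $ i - x $ i > 0 then 1 else 0)) = indicator (box a b) x"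
    proof (cases "x \<in> box a b")
      case True
      then show ?thesis by (auto simp: mem_box_cart intro!: prod.neutral)
    next
      case False
      then obtain i where "\<not> (a $ i < x $ i \<and> x $ i < b $ i)" by (auto simp: mem_box_cart)
      then show ?thesis using False by (auto intro!: prod_zero)
    qed
    finally show ?thesis .
  qed
qed

subsection \<open>The fundamental lemma of the calculus of variations\<close>

text \<open>On a bounded box the positive and the negative part of \<open>r\<close> are densities of
  two measures that are finite on boxes and agree on them. Boxes are stable under intersection and
  generate the Borel sets, so the measures agree and the two parts are equal almost everywhere,
  which forces both to vanish.\<close>

lemma AE_zero_if_box_integrals_zero_real:
  fixes r :: "'a::euclidean_space \<Rightarrow> real"
  assumes r: "r \<in> borel_measurable borel"
    and int: "\<And>a b. integrable lborel (\<lambda>x. indicator (box a b) x * r x)"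
    and zero: "\<And>a b. (LINT x|lborel. indicator (box a b) x * r x) = 0"
  shows "AE x in lborel. r x = 0"
proof -
  note [measurable] = r
  let ?B = "\<lambda>n::nat. box (- (real n *\<^sub>R One)) (real n *\<^sub>R One) :: 'a set"
  have "AE x in lborel. x \<in> ?B n \<longrightarrow> r x = 0" for n
  proof -
    let ?f = "\<lambda>x. ennreal (max 0 (indicator (?B n) x * r x))"
    let ?g = "\<lambda>x. ennreal (max 0 (- (indicator (?B n) x * r x)))"
    let ?E = "range (\<lambda>(a, b). box a b::'a set)"
    have eq: "emeasure (density lborel ?f) (box a b) = emeasure (density lborel ?g) (box a b)"
      "emeasure (density lborel ?f) (box a b) \<noteq> \<infinity>" for a b
    proof -
      \<comment> \<open>Restricting to the fixed box and measuring another box amounts to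
        integrating \<open>r\<close> over their intersection, again a box.\<close>
      obtain c d where cd: "?B n \<inter> box a b = box c d" using box_Int_box by blast
      let ?h = "\<lambda>x. indicator (box c d) x * r x"
      have ind: "indicator (box c d) x = indicator (?B n) x * (indicator (box a b) x :: real)" for x
        unfolding cd[symmetric] by (simp add: indicator_inter_arith)
      have i1: "integrable lborel (\<lambda>x. max 0 (?h x))" and i2: "integrable lborel (\<lambda>x. max 0 (- ?h x))"
        using int[of c d] by auto
      have "(LINT x|lborel. max 0 (?h x)) - (LINT x|lborel. max 0 (- ?h x)) = (LINT x|lborel. ?h x)"
        unfolding Bochner_Integration.integral_diff[OF i1 i2, symmetric] by (intro Bochner_Integration.integral_cong) auto
      then have same: "(LINT x|lborel. max 0 (?h x)) = (LINT x|lborel. max 0 (- ?h x))" using zero by simp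
      have "emeasure (density lborel ?f) (box a b) = (\<integral>\<^sup>+x. ennreal (max 0 (?h x)) \<partial>lborel)"
        unfolding ind by (subst emeasure_density) (auto intro!: nn_integral_cong simp: indicator_def)
      also have "\<dots> = ennreal (LINT x|lborel. max 0 (?h x))" using i1 by (intro nn_integral_eq_integral) auto
      finally have 1: "emeasure (density lborel ?f) (box a b) = ennreal (LINT x|lborel. max 0 (?h x))" .
      have "emeasure (density lborel ?g) (box a b) = (\<integral>\<^sup>+x. ennreal (max 0 (- ?h x)) \<partial>lborel)"
        unfolding ind by (subst emeasure_density) (auto intro!: nn_integral_cong simp: indicator_def)
      also have "\<dots> = ennreal (LINT x|lborel. max 0 (- ?h x))" using i2 by (intro nn_integral_eq_integral) auto
      finally show "emeasure (density lborel ?f) (box a b) = emeasure (density lborel ?g) (box a b)"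
        using 1 same by simp
      show "emeasure (density lborel ?f) (box a b) \<noteq> \<infinity>" using 1 by simp
    qed
    have "density lborel ?f = density lborel ?g"
    proof (rule measure_eqI_generator_eq)
      show "Int_stable ?E" by (auto simp: Int_stable_def box_Int_box)
      show "?E \<subseteq> Pow UNIV" "sets (density lborel ?f) = sigma_sets UNIV ?E" "sets (density lborel ?g) = sigma_sets UNIV ?E"
        by (simp_all add: borel_eq_box)
      show "range ?B \<subseteq> ?E" "(\<Union>i. ?B i) = UNIV" unfolding UN_box_eq_UNIV by auto
    qed (use eq in auto)
    then have "AE x in lborel. ?f x = ?g x" by (intro sigma_finite_measure.density_unique[OF sigma_finite_lborel]) auto
    then show ?thesis
    proof eventually_elim
      case (elim x)
      then show ?case by (auto simp: max_def ennreal_eq_0_iff split: if_splits)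
    qed
  qed
  then have "AE x in lborel. \<forall>n. x \<in> ?B n \<longrightarrow> r x = 0" unfolding AE_all_countable by blast
  moreover have "\<exists>n. x \<in> ?B n" for x using UN_box_eq_UNIV by blast
  ultimately show ?thesis by (auto elim!: eventually_mono)
qed

lemma AE_zero_if_box_integrals_zero_lebesgue:
  fixes r :: "'a::euclidean_space \<Rightarrow> real"
  assumes r: "r \<in> borel_measurable lebesgue"
    and int: "\<And>a b. integrable lebesgue (\<lambda>x. indicator (box a b) x * r x)"
    and zero: "\<And>a b. (LINT x|lebesgue. indicator (box a b) x * r x) = 0"
  shows "AE x in lebesgue. r x = 0"
proof -
  obtain r' where r': "r' \<in> borel_measurable lborel" "AE x in lborel. r x = r' x"
    using completion_ex_borel_measurable_real[OF r] by blast
  have ae: "AE x in lebesgue. r x = r' x" using r'(2) by (rule AE_completion)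
  have m: "r' \<in> borel_measurable borel" using r'(1) by simp
  have m2: "(\<lambda>x. indicator (box a b) x * r' x) \<in> borel_measurable lborel" for a b using m by measurable
  have "AE x in lborel. r' x = 0"
  proof (rule AE_zero_if_box_integrals_zero_real[OF m])
    fix a b
    have ae2: "AE x in lebesgue. indicator (box a b) x * r x = indicator (box a b) x * r' x"
      using ae by eventually_elim simp
    have "integrable lebesgue (\<lambda>x. indicator (box a b) x * r' x)"
      using int[of a b] ae2 measurable_completion[OF m2] by (subst integrable_cong_AE[symmetric]) auto
    then show "integrable lborel (\<lambda>x. indicator (box a b) x * r' x)"
      using m2 by (simp add: integrable_completion)
    have "(LINT x|lborel. indicator (box a b) x * r' x) = (LINT x|lebesgue. indicator (box a b) x * r' x)"
      using m2 by (simp add: integral_completion)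
    also have "\<dots> = (LINT x|lebesgue. indicator (box a b) x * r x)"
      using int[of a b] ae2 measurable_completion[OF m2] by (intro integral_cong_AE) auto
    finally show "(LINT x|lborel. indicator (box a b) x * r' x) = 0" using zero by simp
  qed
  then have "AE x in lebesgue. r' x = 0" by (rule AE_completion)
  with ae show ?thesis by eventually_elim simp
qed

text \<open>Dominated convergence along \<open>box_approx\<close> turns the vanishing pairings into
  vanishing integrals over boxes, and these determine the real and the imaginary part.\<close>

lemma fundamental_lemma:
  fixes v :: "'n::finite cfun"
  assumes v: "locally_integrable v"
    and zero: "\<And>\<phi>. \<phi> \<in> test_functions \<Longrightarrow> (LINT x|lebesgue. v x * \<phi> x) = 0"
  shows "AE x in lebesgue. v x = 0"
proof -
  have vm: "v \<in> borel_measurable lebesgue" using v by (simp add: locally_integrable_def)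
  have vi: "integrable lebesgue (\<lambda>x. indicator (cbox a b) x *\<^sub>R v x)" for a b
    using v compact_cbox unfolding locally_integrable_def set_integrable_def by blast
  have vib: "integrable lebesgue (\<lambda>x. v x * indicator (box a b) x)" for a b
  proof (rule Bochner_Integration.integrable_bound[OF vi[of a b]])
    have "indicator (box a b) \<in> borel_measurable lebesgue" by (intro borel_measurable_indicator) auto
    then show "(\<lambda>x. v x * indicator (box a b) x) \<in> borel_measurable lebesgue"
      using vm by (intro borel_measurable_times)
  qed (use box_subset_cbox in \<open>auto simp: indicator_def intro!: AE_I2\<close>)
  have box0: "(LINT x|lebesgue. v x * indicator (box a b) x) = 0" for a b
  proof -
    obtain \<phi> :: "nat \<Rightarrow> 'n cfun" where \<phi>:
      "\<And>k. \<phi> k \<in> test_functions" "\<And>k x. cmod (\<phi> k x) \<le> 1" "\<And>k x. x \<notin> cbox a b \<Longrightarrow> \<phi> k x = 0"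
      "\<And>x. (\<lambda>k. \<phi> k x) \<longlonglongrightarrow> indicator (box a b) x" using box_approx[of a b] by blast
    have "(\<lambda>k. LINT x|lebesgue. v x * \<phi> k x) \<longlonglongrightarrow> (LINT x|lebesgue. v x * indicator (box a b) x)"
    proof (rule integral_dominated_convergence)
      show "integrable lebesgue (\<lambda>x. norm (indicator (cbox a b) x *\<^sub>R v x))" using vi by (rule integrable_norm)
      show "AE x in lebesgue. (\<lambda>k. v x * \<phi> k x) \<longlonglongrightarrow> v x * indicator (box a b) x"
        by (intro AE_I2 tendsto_intros \<phi>)
      show "AE x in lebesgue. norm (v x * \<phi> k x) \<le> norm (indicator (cbox a b) x *\<^sub>R v x)" for k
        using \<phi>(2)[of k] \<phi>(3)[of _ k] by (intro AE_I2) (auto simp: indicator_def norm_mult mult_left_le)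
      show "(\<lambda>x. v x * \<phi> k x) \<in> borel_measurable lebesgue" for k
        using continuous_lebesgue_measurable[OF Ck_continuous[OF test_Ck[OF \<phi>(1)]]] vm by simp
    qed (use vib in auto)
    then show ?thesis using zero[OF \<phi>(1)] by (simp add: LIMSEQ_const_iff)
  qed
  have "AE x in lebesgue. Re (v x) = 0"
  proof (rule AE_zero_if_box_integrals_zero_lebesgue)
    fix a b
    have eq: "(\<lambda>x. Re (v x * indicator (box a b) x)) = (\<lambda>x. indicator (box a b) x * Re (v x))"
      by (auto simp: indicator_def)
    show "integrable lebesgue (\<lambda>x. indicator (box a b) x * Re (v x))"
      using integrable_Re[OF vib[of a b]] unfolding eq .
    show "(LINT x|lebesgue. indicator (box a b) x * Re (v x)) = 0"
      using integral_Re[OF vib[of a b]] box0[of a b] unfolding eq by simp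
  qed (use vm in simp)
  moreover have "AE x in lebesgue. Im (v x) = 0"
  proof (rule AE_zero_if_box_integrals_zero_lebesgue)
    fix a b
    have eq: "(\<lambda>x. Im (v x * indicator (box a b) x)) = (\<lambda>x. indicator (box a b) x * Im (v x))"
      by (auto simp: indicator_def)
    show "integrable lebesgue (\<lambda>x. indicator (box a b) x * Im (v x))"
      using integrable_Im[OF vib[of a b]] unfolding eq .
    show "(LINT x|lebesgue. indicator (box a b) x * Im (v x)) = 0"
      using integral_Im[OF vib[of a b]] box0[of a b] unfolding eq by simp
  qed (use vm in simp)
  ultimately show ?thesis by eventually_elim (simp add: complex_eq_iff)
qed

subsection \<open>The Hilbert space of square integrable functions modulo null sets\<close>

lemma borel_measurable_cnj [measurable (raw), simp]:
  "f \<in> borel_measurable M \<Longrightarrow> (\<lambda>x. cnj (f x)) \<in> borel_measurable M"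
  by (rule measurable_compose[OF _ borel_measurable_continuous_onI]) (auto intro: continuous_intros)

lemma L2_D: "f \<in> L2 \<Longrightarrow> f \<in> borel_measurable lebesgue" "f \<in> L2 \<Longrightarrow> integrable lebesgue (\<lambda>x. (cmod (f x))\<^sup>2)"
  by (auto simp: L2_def)

lemma L2_bound:
  assumes "f \<in> L2" "g \<in> borel_measurable lebesgue" "AE x in lebesgue. cmod (g x) \<le> B * cmod (f x)"
  shows "g \<in> L2"
proof -
  have "integrable lebesgue (\<lambda>x. B\<^sup>2 * (cmod (f x))\<^sup>2)" using L2_D(2)[OF assms(1)] by simp
  then have "integrable lebesgue (\<lambda>x. (cmod (g x))\<^sup>2)"
  proof (rule Bochner_Integration.integrable_bound)
    show "AE x in lebesgue. norm ((cmod (g x))\<^sup>2) \<le> norm (B\<^sup>2 * (cmod (f x))\<^sup>2)"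
      using assms(3)
    proof eventually_elim
      case (elim x)
      then have "(cmod (g x))\<^sup>2 \<le> (B * cmod (f x))\<^sup>2" by (intro power_mono) auto
      then show ?case by (simp add: power_mult_distrib)
    qed
  qed (use assms(2) in measurable)
  then show ?thesis using assms(2) by (simp add: L2_def)
qed

lemma L2_zero: "(\<lambda>x. 0) \<in> L2" by (simp add: L2_def)

lemma L2_add:
  assumes "f \<in> L2" "g \<in> L2" shows "(\<lambda>x. f x + g x) \<in> L2"
proof -
  have m: "f \<in> borel_measurable lebesgue" "g \<in> borel_measurable lebesgue" using assms by (auto dest: L2_D)
  have "integrable lebesgue (\<lambda>x. 2 * (cmod (f x))\<^sup>2 + 2 * (cmod (g x))\<^sup>2)"
    using L2_D(2)[OF assms(1)] L2_D(2)[OF assms(2)] by simp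
  then have "integrable lebesgue (\<lambda>x. (cmod (f x + g x))\<^sup>2)"
  proof (rule Bochner_Integration.integrable_bound)
    have "(cmod (a + b))\<^sup>2 \<le> 2 * (cmod a)\<^sup>2 + 2 * (cmod b)\<^sup>2" for a b
    proof -
      have "(cmod (a + b))\<^sup>2 \<le> (cmod a + cmod b)\<^sup>2" by (intro power_mono norm_triangle_ineq) simp
      also have "\<dots> \<le> 2 * (cmod a)\<^sup>2 + 2 * (cmod b)\<^sup>2"
        using sum_squares_bound[of "cmod a" "cmod b"] by (simp add: power2_sum)
      finally show ?thesis .
    qed
    then show "AE x in lebesgue. norm ((cmod (f x + g x))\<^sup>2) \<le> norm (2 * (cmod (f x))\<^sup>2 + 2 * (cmod (g x))\<^sup>2)"
      by (intro AE_I2) simp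
  qed (use m in measurable)
  then show ?thesis using m by (simp add: L2_def)
qed

lemma L2_cmult: "f \<in> L2 \<Longrightarrow> (\<lambda>x. c * f x) \<in> L2"
  by (rule L2_bound[where B="cmod c"]) (auto dest: L2_D(1) simp: norm_mult)

lemma L2_diff: "f \<in> L2 \<Longrightarrow> g \<in> L2 \<Longrightarrow> (\<lambda>x. f x - g x) \<in> L2"
  using L2_add[of f "\<lambda>x. - 1 * g x"] L2_cmult[of g "-1"] by simp

lemma L2_AE_cong:
  "f \<in> L2 \<Longrightarrow> g \<in> borel_measurable lebesgue \<Longrightarrow> AE x in lebesgue. f x = g x \<Longrightarrow> g \<in> L2"
  by (rule L2_bound[where B=1]) (auto elim: eventually_mono)

lemma L2_mult_cnj_integrable:
  assumes "f \<in> L2" "g \<in> L2" shows "integrable lebesgue (\<lambda>x. f x * cnj (g x))"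
proof (rule Bochner_Integration.integrable_bound)
  show "integrable lebesgue (\<lambda>x. (cmod (f x))\<^sup>2 + (cmod (g x))\<^sup>2)" using L2_D(2)[OF assms(1)] L2_D(2)[OF assms(2)] by simp
  have "cmod a * cmod b \<le> (cmod a)\<^sup>2 + (cmod b)\<^sup>2" for a b
    using sum_squares_bound[of "cmod a" "cmod b"] mult_nonneg_nonneg[OF norm_ge_zero[of a] norm_ge_zero[of b]] by linarith
  then show "AE x in lebesgue. norm (f x * cnj (g x)) \<le> norm ((cmod (f x))\<^sup>2 + (cmod (g x))\<^sup>2)"
    by (intro AE_I2) (simp add: norm_mult)
qed (use L2_D(1)[OF assms(1)] L2_D(1)[OF assms(2)] in simp)

text \<open>The quotient by null sets is made a type so that type class instances, and with them the
  abstract projection and fixed point results, apply to it. \<open>cls\<close> passes from a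
  function to its class, \<open>fn\<close> back to a chosen representative.\<close>

typedef (overloaded) ('n::finite) l2 = "{S. \<exists>f\<in>(L2::'n cfun set). S = {g\<in>L2. AE x in lebesgue. g x = f x}}"
  using L2_zero by blast

definition cls :: "('n::finite) cfun \<Rightarrow> 'n l2" where
  "cls f = Abs_l2 {g\<in>L2. AE x in lebesgue. g x = f x}"

definition fn :: "('n::finite) l2 \<Rightarrow> 'n cfun" where
  "fn u = (SOME f. f \<in> Rep_l2 u)"

lemma fn_Rep: "fn u \<in> Rep_l2 u"
proof -
  obtain f where "f \<in> L2" "Rep_l2 u = {g\<in>L2. AE x in lebesgue. g x = f x}" using Rep_l2[of u] by blast
  then have "f \<in> Rep_l2 u" by simp
  then show ?thesis unfolding fn_def by (rule someI[of "\<lambda>f. f \<in> Rep_l2 u"])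
qed

lemma fn_L2 [simp]: "fn u \<in> L2"
  using fn_Rep[of u] Rep_l2[of u] by auto

lemma fn_measurable [measurable, simp]: "fn u \<in> borel_measurable lebesgue"
  using L2_D(1)[OF fn_L2] .

lemma cls_eqI:
  assumes "AE x in lebesgue. f x = g x" shows "cls f = cls g"
proof -
  have "(AE x in lebesgue. h x = f x) \<longleftrightarrow> (AE x in lebesgue. h x = g x)" for h
  proof
    assume "AE x in lebesgue. h x = f x"
    with assms show "AE x in lebesgue. h x = g x" by eventually_elim simp
  next
    assume "AE x in lebesgue. h x = g x"
    with assms show "AE x in lebesgue. h x = f x" by eventually_elim simp
  qed
  then show ?thesis by (simp add: cls_def)
qed

lemma Rep_cls: "f \<in> L2 \<Longrightarrow> Rep_l2 (cls f) = {g\<in>L2. AE x in lebesgue. g x = f x}"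
  unfolding cls_def by (rule Abs_l2_inverse) auto

lemma fn_cls: "f \<in> L2 \<Longrightarrow> AE x in lebesgue. fn (cls f) x = f x"
  using fn_Rep[of "cls f"] by (simp add: Rep_cls)

lemma cls_fn [simp]: "cls (fn u) = u"
proof -
  obtain f where f: "f \<in> L2" "Rep_l2 u = {g\<in>L2. AE x in lebesgue. g x = f x}" using Rep_l2[of u] by blast
  then have "AE x in lebesgue. fn u x = f x" using fn_Rep[of u] by auto
  then have "cls (fn u) = cls f" by (rule cls_eqI)
  also have "\<dots> = u" unfolding Rep_l2_inject[symmetric] by (simp only: Rep_cls[OF f(1)] f(2))
  finally show ?thesis .
qed

lemma cls_eq_iff: "f \<in> L2 \<Longrightarrow> g \<in> L2 \<Longrightarrow> cls f = cls g \<longleftrightarrow> (AE x in lebesgue. f x = g x)"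
proof
  assume a: "f \<in> L2" "g \<in> L2" "cls f = cls g"
  show "AE x in lebesgue. f x = g x" using fn_cls[OF a(1)] fn_cls[OF a(2)] unfolding a(3)
    by eventually_elim simp
qed (rule cls_eqI)

lemma l2_eqI: "AE x in lebesgue. fn u x = fn v x \<Longrightarrow> u = v"
  using cls_eqI[of "fn u" "fn v"] by simp

text \<open>The space is treated as a real Hilbert space, with the real part of the usual pairing.
  Complex scalars act through \<open>mul\<close> with a constant multiplier, and the full
  sesquilinear pairing is kept as \<open>cinner\<close>.\<close>

instantiation l2 :: (finite) real_inner
begin

definition "0 = cls (\<lambda>x. 0)"
definition "u + v = cls (\<lambda>x. fn u x + fn v x)"
definition "u - v = cls (\<lambda>x. fn u x - fn v x)"
definition "- u = cls (\<lambda>x. - 1 * fn u x)"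
definition "r *\<^sub>R u = cls (\<lambda>x. complex_of_real r * fn u x)"
definition "inner u v = Re (LINT x|lebesgue. fn u x * cnj (fn v x))"
definition "norm u = sqrt (inner u (u::'a l2))"
definition "dist u v = norm (u - (v::'a l2))"
definition "sgn u = scaleR (inverse (norm u)) (u::'a l2)"
definition "(uniformity :: ('a l2 \<times> 'a l2) filter) = (INF e\<in>{0 <..}. principal {(x, y). dist x y < e})"
definition "open (U :: 'a l2 set) \<longleftrightarrow> (\<forall>x\<in>U. eventually (\<lambda>(x', y). x' = x \<longrightarrow> y \<in> U) uniformity)"

lemma fn_add: "AE x in lebesgue. fn (u + v) x = fn u x + fn (v::'a l2) x"
  unfolding plus_l2_def by (rule fn_cls) (simp add: L2_add)

lemma fn_diff: "AE x in lebesgue. fn (u - v) x = fn u x - fn (v::'a l2) x"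
  unfolding minus_l2_def by (rule fn_cls) (simp add: L2_diff)

lemma fn_uminus: "AE x in lebesgue. fn (- u) x = - fn (u::'a l2) x"
  unfolding uminus_l2_def using fn_cls[OF L2_cmult[OF fn_L2, of "-1" u]] by simp

lemma fn_scaleR: "AE x in lebesgue. fn (r *\<^sub>R u) x = complex_of_real r * fn (u::'a l2) x"
  unfolding scaleR_l2_def by (rule fn_cls) (simp add: L2_cmult)

lemma fn_zero: "AE x in lebesgue. fn (0::'a l2) x = 0"
  unfolding zero_l2_def by (rule fn_cls) (rule L2_zero)

instance
proof
  fix u v w :: "'a l2" and r s :: real
  show "u + v + w = u + (v + w)"
    using fn_add[of "u+v" w] fn_add[of u v] fn_add[of u "v+w"] fn_add[of v w]
    by (intro l2_eqI) (auto elim!: eventually_rev_mp)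
  show "u + v = v + u"
    using fn_add[of u v] fn_add[of v u]  by (intro l2_eqI) (auto elim!: eventually_rev_mp)
  show "0 + u = u"
    using fn_add[of 0 u] fn_zero by (intro l2_eqI) (auto elim!: eventually_rev_mp)
  show "- u + u = 0"
    using fn_add[of "-u" u] fn_uminus[of u] fn_zero by (intro l2_eqI) (auto elim!: eventually_rev_mp)
  show "u - v = u + - v"
    using fn_add[of u "-v"] fn_uminus[of v] fn_diff[of u v] by (intro l2_eqI) (auto elim!: eventually_rev_mp)
  show "r *\<^sub>R (u + v) = r *\<^sub>R u + r *\<^sub>R v"
    using fn_add[of u v] fn_add[of "r *\<^sub>R u" "r *\<^sub>R v"] fn_scaleR[of r u] fn_scaleR[of r v] fn_scaleR[of r "u+v"]
    by (intro l2_eqI) (auto elim!: eventually_rev_mp simp: algebra_simps)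
  show "(r + s) *\<^sub>R u = r *\<^sub>R u + s *\<^sub>R u"
    using fn_add[of "r *\<^sub>R u" "s *\<^sub>R u"] fn_scaleR[of r u] fn_scaleR[of s u] fn_scaleR[of "r+s" u]
    by (intro l2_eqI) (auto elim!: eventually_rev_mp simp: algebra_simps)
  show "r *\<^sub>R s *\<^sub>R u = (r * s) *\<^sub>R u"
    using fn_scaleR[of r "s *\<^sub>R u"] fn_scaleR[of s u] fn_scaleR[of "r * s" u]
    by (intro l2_eqI) (auto elim!: eventually_rev_mp simp: algebra_simps)
  show "1 *\<^sub>R u = u"
    using fn_scaleR[of 1 u] by (intro l2_eqI) (auto elim!: eventually_rev_mp)
  show "dist u v = norm (u - v)" by (simp add: dist_l2_def)
  show "sgn u = scaleR (inverse (norm u)) u" by (simp add: sgn_l2_def)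
  show "norm u = sqrt (inner u u)" by (simp add: norm_l2_def)
  show "inner u v = inner v u"
  proof -
    have "(LINT x|lebesgue. fn v x * cnj (fn u x)) = cnj (LINT x|lebesgue. fn u x * cnj (fn v x))"
      unfolding Bochner_Integration.integral_cnj[symmetric] by (simp add: mult.commute)
    then show ?thesis by (simp add: inner_l2_def)
  qed
  show "inner (u + v) w = inner u w + inner v w"
  proof -
    have "(LINT x|lebesgue. fn (u + v) x * cnj (fn w x)) = (LINT x|lebesgue. fn u x * cnj (fn w x) + fn v x * cnj (fn w x))"
      using fn_add[of u v] by (intro integral_cong_AE) (auto elim!: eventually_mono simp: algebra_simps)
    then show ?thesis by (simp add: inner_l2_def L2_mult_cnj_integrable)
  qed
  show "inner (r *\<^sub>R u) v = r * inner u v"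
  proof -
    have "(LINT x|lebesgue. fn (r *\<^sub>R u) x * cnj (fn v x)) = (LINT x|lebesgue. of_real r * (fn u x * cnj (fn v x)))"
      using fn_scaleR[of r u] by (intro integral_cong_AE) (auto elim!: eventually_mono simp: algebra_simps)
    then show ?thesis by (simp add: inner_l2_def L2_mult_cnj_integrable)
  qed
  have inn: "inner u u = (LINT x|lebesgue. (cmod (fn u x))\<^sup>2)"
  proof -
    have "(LINT x|lebesgue. fn u x * cnj (fn u x)) = (LINT x|lebesgue. complex_of_real ((cmod (fn u x))\<^sup>2))"
      by (intro Bochner_Integration.integral_cong) (auto simp only: complex_norm_square)
    then show ?thesis unfolding inner_l2_def integral_complex_of_real by simp
  qed
  then show "0 \<le> inner u u" by simp
  show "inner u u = 0 \<longleftrightarrow> u = 0"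
  proof
    assume "inner u u = 0"
    then have "AE x in lebesgue. (cmod (fn u x))\<^sup>2 = 0"
      unfolding inn using L2_D(2)[OF fn_L2] by (subst (asm) integral_nonneg_eq_0_iff_AE) auto
    then show "u = 0" using fn_zero by (intro l2_eqI) (auto elim!: eventually_rev_mp)
  next
    assume "u = 0"
    then have "AE x in lebesgue. (cmod (fn u x))\<^sup>2 = 0" using fn_zero by (auto elim!: eventually_rev_mp)
    then have "(LINT x|lebesgue. (cmod (fn u x))\<^sup>2) = (LINT x|(lebesgue::(real^'a) measure). 0)"
      by (intro integral_cong_AE) auto
    then show "inner u u = 0" unfolding inn by simp
  qed
qed (simp_all add: uniformity_l2_def open_l2_def)

end

definition cinner :: "('n::finite) l2 \<Rightarrow> 'n l2 \<Rightarrow> complex" where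
  "cinner u v = (LINT x|lebesgue. fn u x * cnj (fn v x))"

lemma inner_cinner: "inner u v = Re (cinner u v)"
  by (simp add: inner_l2_def cinner_def)

lemma cinner_self: "cinner u u = complex_of_real (LINT x|lebesgue. (cmod (fn u x))\<^sup>2)"
proof -
  have "cinner u u = (LINT x|lebesgue. complex_of_real ((cmod (fn u x))\<^sup>2))"
    unfolding cinner_def by (intro Bochner_Integration.integral_cong) (auto simp only: complex_norm_square)
  then show ?thesis unfolding integral_complex_of_real .
qed

lemma norm_l2_sq: "(norm u)\<^sup>2 = (LINT x|lebesgue. (cmod (fn u x))\<^sup>2)"
  unfolding power2_norm_eq_inner inner_cinner cinner_self by simp

lemma nn_norm_l2: "(\<integral>\<^sup>+x. ennreal ((cmod (fn u x))\<^sup>2) \<partial>lebesgue) = ennreal ((norm u)\<^sup>2)"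
  unfolding norm_l2_sq using L2_D(2)[OF fn_L2] by (intro nn_integral_eq_integral) auto

lemma norm_cls: "f \<in> L2 \<Longrightarrow> norm (cls f) = L2_norm f"
proof -
  assume f: "f \<in> L2"
  have "(norm (cls f))\<^sup>2 = (LINT x|lebesgue. (cmod (f x))\<^sup>2)"
    unfolding norm_l2_sq using fn_cls[OF f] L2_D(1)[OF f]
    by (intro integral_cong_AE) (auto elim!: eventually_mono)
  then show ?thesis by (simp add: L2_norm_def real_sqrt_unique)
qed

lemma cinner_cls: "f \<in> L2 \<Longrightarrow> g \<in> L2 \<Longrightarrow> cinner (cls f) (cls g) = L2_inner f g"
  unfolding cinner_def L2_inner_def using fn_cls[of f] fn_cls[of g] L2_D(1)[of f] L2_D(1)[of g]
  by (intro integral_cong_AE) (auto elim!: eventually_rev_mp)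

lemma cinner_commute: "cinner v u = cnj (cinner u v)"
  unfolding cinner_def Bochner_Integration.integral_cnj[symmetric] by (simp add: mult.commute)

lemma cinner_add_left: "cinner (u + v) w = cinner u w + cinner v w"
proof -
  have "(LINT x|lebesgue. fn (u + v) x * cnj (fn w x)) = (LINT x|lebesgue. fn u x * cnj (fn w x) + fn v x * cnj (fn w x))"
    using fn_add[of u v] by (intro integral_cong_AE) (auto elim!: eventually_mono simp: algebra_simps)
  then show ?thesis by (simp add: cinner_def L2_mult_cnj_integrable)
qed

lemma cinner_add_right: "cinner w (u + v) = cinner w u + cinner w v"
  by (metis cinner_add_left cinner_commute complex_cnj_add)

lemma cinner_scaleR_left: "cinner (r *\<^sub>R u) v = r *\<^sub>R cinner u v"
proof -
  have "(LINT x|lebesgue. fn (r *\<^sub>R u) x * cnj (fn v x)) = (LINT x|lebesgue. of_real r * (fn u x * cnj (fn v x)))"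
    using fn_scaleR[of r u] by (intro integral_cong_AE) (auto elim!: eventually_mono simp: algebra_simps)
  then show ?thesis by (simp add: cinner_def L2_mult_cnj_integrable scaleR_conv_of_real)
qed

lemma cinner_scaleR_right: "cinner v (r *\<^sub>R u) = r *\<^sub>R cinner v u"
  by (metis cinner_commute cinner_scaleR_left complex_cnj_scaleR)

subsection \<open>Multiplication operators\<close>

definition bdd_mult :: "('n::finite) cfun \<Rightarrow> bool" where
  "bdd_mult m \<longleftrightarrow> m \<in> borel_measurable lebesgue \<and> bounded (range m)"

definition mul :: "('n::finite) cfun \<Rightarrow> 'n l2 \<Rightarrow> 'n l2" where
  "mul m u = cls (\<lambda>x. m x * fn u x)"

lemma bmE: 
  assumes "bdd_mult m" obtains B where "B > 0" "\<And>x. cmod (m x) \<le> B"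
proof -
  have "bounded (range m)" using assms by (simp add: bdd_mult_def)
  then show thesis unfolding bounded_pos using that by auto
qed

lemma bmI: "m \<in> borel_measurable lebesgue \<Longrightarrow> (\<And>x. cmod (m x) \<le> B) \<Longrightarrow> bdd_mult m"
  unfolding bdd_mult_def bounded_iff by auto

lemma bdd_mult_measurable: "bdd_mult m \<Longrightarrow> m \<in> borel_measurable lebesgue" by (simp add: bdd_mult_def)

lemma bdd_mult_const [simp]: "bdd_mult (\<lambda>x. c)" by (rule bmI[of _ "cmod c"]) auto

lemma bdd_mult_mult: assumes "bdd_mult m" "bdd_mult k" shows "bdd_mult (\<lambda>x. m x * k x)"
proof -
  obtain B where B: "B > 0" "\<And>x. cmod (m x) \<le> B" using bmE[OF assms(1)] by blast
  obtain C where C: "C > 0" "\<And>x. cmod (k x) \<le> C" using bmE[OF assms(2)] by blast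
  show ?thesis using assms B C
    by (intro bmI[of _ "B * C"]) (auto simp: norm_mult bdd_mult_def less_imp_le intro!: mult_mono)
qed

lemma bdd_mult_cnj: assumes "bdd_mult m" shows "bdd_mult (\<lambda>x. cnj (m x))"
proof -
  obtain B where B: "B > 0" "\<And>x. cmod (m x) \<le> B" using bmE[OF assms(1)] by blast
  show ?thesis using assms B by (intro bmI[of _ B]) (auto simp: bdd_mult_def)
qed

lemma L2_mult_bdd_mult:
  assumes "bdd_mult m" "f \<in> L2" shows "(\<lambda>x. m x * f x) \<in> L2"
proof -
  obtain B where B: "B > 0" "\<And>x. cmod (m x) \<le> B" using bmE[OF assms(1)] by blast
  show ?thesis
  proof (rule L2_bound[OF assms(2)])
    show "(\<lambda>x. m x * f x) \<in> borel_measurable lebesgue"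
      using bdd_mult_measurable[OF assms(1)] L2_D(1)[OF assms(2)] by simp
    show "AE x in lebesgue. cmod (m x * f x) \<le> B * cmod (f x)"
      by (intro AE_I2) (simp add: norm_mult B(2) mult_right_mono)
  qed
qed

lemma fn_mul: "bdd_mult m \<Longrightarrow> AE x in lebesgue. fn (mul m u) x = m x * fn u x"
  unfolding mul_def by (rule fn_cls) (simp add: L2_mult_bdd_mult)

lemma mul_cls: "bdd_mult m \<Longrightarrow> f \<in> L2 \<Longrightarrow> mul m (cls f) = cls (\<lambda>x. m x * f x)"
  unfolding mul_def using fn_cls[of f] by (intro cls_eqI) (auto elim: eventually_mono)

lemma mul_add: "bdd_mult m \<Longrightarrow> mul m (u + v) = mul m u + mul m v"
  using fn_mul[of m u] fn_mul[of m v] fn_mul[of m "u+v"] fn_add[of "mul m u" "mul m v"] fn_add[of u v]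
  by (intro l2_eqI) (auto elim!: eventually_rev_mp simp: algebra_simps)

lemma mul_diff: assumes m: "bdd_mult m" shows "mul m (u - v) = mul m u - mul m v"
proof (rule l2_eqI)
  show "AE x in lebesgue. fn (mul m (u - v)) x = fn (mul m u - mul m v) x"
    using fn_mul[OF m, of u] fn_mul[OF m, of v] fn_mul[OF m, of "u-v"] fn_diff[of "mul m u" "mul m v"] fn_diff[of u v]
    by eventually_elim (simp add: right_diff_distrib)
qed

lemma mul_scaleR: "bdd_mult m \<Longrightarrow> mul m (r *\<^sub>R u) = r *\<^sub>R mul m u"
  using fn_mul[of m u] fn_mul[of m "r *\<^sub>R u"] fn_scaleR[of r "mul m u"] fn_scaleR[of r u]
  by (intro l2_eqI) (auto elim!: eventually_rev_mp simp: algebra_simps)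

lemma mul_mul: "bdd_mult m \<Longrightarrow> bdd_mult k \<Longrightarrow> mul m (mul k u) = mul (\<lambda>x. m x * k x) u"
  using fn_mul[of m "mul k u"] fn_mul[of k u] fn_mul[OF bdd_mult_mult, of m k u]
  by (intro l2_eqI) (auto elim!: eventually_rev_mp simp: algebra_simps)

lemma mul_of_real: "mul (\<lambda>x. complex_of_real r) u = r *\<^sub>R u"
  by (simp add: mul_def scaleR_l2_def)

lemma cinner_mul_left: "bdd_mult m \<Longrightarrow> cinner (mul m u) v = cinner u (mul (\<lambda>x. cnj (m x)) v)"
  unfolding cinner_def using fn_mul[of m u] fn_mul[OF bdd_mult_cnj, of m v]
  by (intro integral_cong_AE) (auto elim!: eventually_rev_mp)

lemma cinner_cmul_left: "cinner (mul (\<lambda>x. z) u) v = z * cinner u v"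
proof -
  have "cinner (mul (\<lambda>x. z) u) v = (LINT x|lebesgue. z * (fn u x * cnj (fn v x)))"
    unfolding cinner_def using fn_mul[OF bdd_mult_const, of z u]
    by (intro integral_cong_AE) (auto elim!: eventually_rev_mp)
  then show ?thesis by (simp add: cinner_def)
qed

lemma norm_le_AE:
  assumes "c \<ge> 0" "AE x in lebesgue. cmod (fn u x) \<le> c * cmod (fn v x)"
  shows "norm u \<le> c * norm v"
proof -
  have "(norm u)\<^sup>2 \<le> (LINT x|lebesgue. c\<^sup>2 * (cmod (fn v x))\<^sup>2)"
    unfolding norm_l2_sq
  proof (rule integral_mono_AE)
    show "AE x in lebesgue. (cmod (fn u x))\<^sup>2 \<le> c\<^sup>2 * (cmod (fn v x))\<^sup>2"
      using assms(2) by eventually_elim (metis norm_ge_zero power_mono power_mult_distrib)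
  qed (auto simp: L2_D(2))
  also have "\<dots> = (c * norm v)\<^sup>2" by (simp add: norm_l2_sq power_mult_distrib)
  finally show ?thesis using assms(1) by (simp add: abs_le_square_iff[symmetric])
qed

lemma norm_mul_le:
  assumes "bdd_mult m" "\<And>x. cmod (m x) \<le> c" shows "norm (mul m u) \<le> c * norm u"
proof (rule norm_le_AE)
  show "0 \<le> c" using assms(2) norm_ge_zero order_trans by blast
  show "AE x in lebesgue. cmod (fn (mul m u) x) \<le> c * cmod (fn u x)"
    using fn_mul[OF assms(1), of u] by eventually_elim (simp add: norm_mult assms(2) mult_right_mono)
qed

lemma norm_mul_le_mul:
  assumes "bdd_mult m" "bdd_mult k" "c \<ge> 0" "\<And>x. cmod (m x) \<le> c * cmod (k x)" shows "norm (mul m u) \<le> c * norm (mul k u)"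
proof (rule norm_le_AE[OF assms(3)])
  show "AE x in lebesgue. cmod (fn (mul m u) x) \<le> c * cmod (fn (mul k u) x)"
    using fn_mul[OF assms(1), of u] fn_mul[OF assms(2), of u]
  proof eventually_elim
    case (elim x)
    show ?case unfolding elim norm_mult using mult_right_mono[OF assms(4) norm_ge_zero, of x "fn u x"]
      by (simp add: mult.assoc)
  qed
qed

text \<open>Multiplying \<open>u\<close> by a unimodular constant makes the pairing real and
  nonnegative, so the real Cauchy-Schwarz inequality suffices.\<close>

lemma cmod_cinner_le: "cmod (cinner u v) \<le> norm u * norm v"
proof (cases "cinner u v = 0")
  case False
  define z where "z = cnj (cinner u v) / cmod (cinner u v)"
  have z: "cmod z = 1" using False by (simp add: z_def norm_divide)
  have "z * cinner u v = cmod (cinner u v)"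
  proof -
    have "cnj (cinner u v) * cinner u v = complex_of_real ((cmod (cinner u v))\<^sup>2)" unfolding complex_norm_square by (rule mult.commute)
    then have "z * cinner u v = complex_of_real ((cmod (cinner u v))\<^sup>2 / cmod (cinner u v))" by (simp add: z_def)
    then show ?thesis by (simp add: power2_eq_square)
  qed
  then have "cmod (cinner u v) = Re (cinner (mul (\<lambda>x. z) u) v)" by (simp add: cinner_cmul_left)
  also have "\<dots> \<le> norm (mul (\<lambda>x. z) u) * norm v" unfolding inner_cinner[symmetric] by (rule norm_cauchy_schwarz)
  also have "\<dots> \<le> (1 * norm u) * norm v" by (intro mult_right_mono norm_mul_le) (auto simp: z)
  finally show ?thesis by simp
qed simp

interpretation cinner: bounded_bilinear cinner
proof
  show "\<exists>K. \<forall>a b. norm (cinner a b) \<le> norm a * norm b * K" using cmod_cinner_le by (intro exI[of _ 1] allI) simp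
qed (simp_all add: cinner_add_left cinner_add_right cinner_scaleR_left cinner_scaleR_right)

lemma bounded_linear_mul: assumes "bdd_mult m" shows "bounded_linear (mul m)"
proof -
  obtain B where B: "B > 0" "\<And>x. cmod (m x) \<le> B" using bmE[OF assms(1)] by blast
  show ?thesis using norm_mul_le[OF assms B(2)] assms
    by (intro bounded_linear_intro[where K=B]) (auto simp: mul_add mul_scaleR mult.commute)
qed

subsection \<open>Completeness\<close>

text \<open>The Riesz-Fischer argument: a rapidly Cauchy subsequence converges pointwise almost
  everywhere, and Fatou's lemma shows that the pointwise limit is also the limit in norm.\<close>

instance l2 :: (finite) complete_space
proof
  fix X :: "nat \<Rightarrow> 'a l2" assume X: "Cauchy X"
  have "\<exists>M. \<forall>m\<ge>M. \<forall>n\<ge>M. norm (X m - X n) < (1/4) ^ k" for k :: nat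
    using CauchyD[OF X, of "(1/4)^k"] by simp
  then obtain M where M: "\<And>k m n. m \<ge> M k \<Longrightarrow> n \<ge> M k \<Longrightarrow> norm (X m - X n) < (1/4) ^ (k::nat)"
    by metis
  \<comment> \<open>Adding \<open>k\<close> makes the index strictly increasing; the sum makes it at
    least \<open>M k\<close>.\<close>
  define s where "s k = k + (\<Sum>i\<le>k. M i)" for k
  have s: "strict_mono s" by (rule strict_monoI_Suc) (simp add: s_def)
  have sM: "M k \<le> s k" for k unfolding s_def by (simp add: member_le_sum trans_le_add2)
  define d where "d k = X (s (Suc k)) - X (s k)" for k
  have dn: "(norm (d k))\<^sup>2 \<le> (1/16)^k" for k
  proof -
    have "s k < s (Suc k)" using s by (simp add: strict_mono_Suc_iff)
    then have "M k \<le> s (Suc k)" using sM[of k] by linarith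
    then have "norm (d k) \<le> (1/4)^k" unfolding d_def using M[of k] sM[of k] by (auto intro: less_imp_le)
    then have "(norm (d k))\<^sup>2 \<le> ((1/4)^k)\<^sup>2" by (intro power_mono) auto
    also have "\<dots> = (1/16)^k" by (simp add: power2_eq_square power_mult_distrib[symmetric])
    finally show ?thesis .
  qed
  \<comment> \<open>The squared norms decay like (1/16)^k. Spending a factor 4^k keeps the series
    summable and yields, at almost every point, the bound of \<open>fn (d k) x\<close> by a constant
    times (1/2)^k.\<close>
  have "(\<integral>\<^sup>+x. (\<Sum>k. ennreal (4^k * (cmod (fn (d k) x))\<^sup>2)) \<partial>lebesgue) = (\<Sum>k. \<integral>\<^sup>+x. ennreal (4^k * (cmod (fn (d k) x))\<^sup>2) \<partial>lebesgue)"
    by (intro nn_integral_suminf) simp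
  also have "\<dots> = (\<Sum>k. ennreal (4^k * (norm (d k))\<^sup>2))"
    by (simp add: ennreal_mult nn_integral_cmult nn_norm_l2)
  also have "\<dots> \<le> (\<Sum>k. ennreal ((1/4)^k))"
  proof (intro suminf_le ennreal_leI)
    fix k
    have "4^k * (norm (d k))\<^sup>2 \<le> 4^k * (1/16)^k" using dn[of k] by (intro mult_left_mono) auto
    also have "\<dots> = (4 * (1/16))^k" by (simp only: power_mult_distrib)
    also have "\<dots> = (1/4)^k" by simp
    finally show "4^k * (norm (d k))\<^sup>2 \<le> (1/4)^k" .
  qed auto
  also have "\<dots> = ennreal (\<Sum>k. (1/4)^k)"
    by (rule suminf_ennreal2) (auto intro: summable_geometric)
  also have "\<dots> < \<infinity>" by (rule ennreal_less_top[folded infinity_ennreal_def])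
  finally have fin: "(\<integral>\<^sup>+x. (\<Sum>k. ennreal (4^k * (cmod (fn (d k) x))\<^sup>2)) \<partial>lebesgue) \<noteq> \<infinity>" by simp
  have "AE x in lebesgue. (\<Sum>k. ennreal (4^k * (cmod (fn (d k) x))\<^sup>2)) \<noteq> \<infinity>"
    by (rule nn_integral_PInf_AE[OF _ fin]) simp
  moreover have "AE x in lebesgue. \<forall>k. fn (d k) x = fn (X (s (Suc k))) x - fn (X (s k)) x"
    unfolding AE_all_countable d_def using fn_diff by blast
  ultimately have conv: "AE x in lebesgue. convergent (\<lambda>k. fn (X (s k)) x)"
  proof eventually_elim
    case (elim x)
    define S where "S = (\<Sum>k. ennreal (4^k * (cmod (fn (d k) x))\<^sup>2))"
    obtain r where r: "S = ennreal r" "r \<ge> 0" using elim(1) unfolding S_def[symmetric] by (cases S) auto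
    have bd: "cmod (fn (d k) x) \<le> sqrt r * (1/2)^k" for k
    proof -
      have "(\<Sum>i\<in>{k}. ennreal (4^i * (cmod (fn (d i) x))\<^sup>2)) \<le> S"
        unfolding S_def by (intro sum_le_suminf) auto
      then have "ennreal (4^k * (cmod (fn (d k) x))\<^sup>2) \<le> ennreal r" by (simp add: r)
      then have "4^k * (cmod (fn (d k) x))\<^sup>2 \<le> r" using r by (simp add: ennreal_le_iff)
      then have "sqrt (4^k * (cmod (fn (d k) x))\<^sup>2) \<le> sqrt r" by simp
      moreover have "sqrt (4^k) = (2::real)^k" by (simp add: real_sqrt_power)
      ultimately have "2^k * cmod (fn (d k) x) \<le> sqrt r" by (simp add: real_sqrt_mult)
      then show ?thesis by (simp add: field_simps power_one_over)
    qed
    have "summable (\<lambda>k. fn (d k) x)"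
      by (rule summable_comparison_test'[where g="\<lambda>k. sqrt r * (1/2)^k" and N=0])
        (use bd in \<open>auto intro!: summable_mult summable_geometric\<close>)
    then have "convergent (\<lambda>n. \<Sum>k<n. fn (d k) x)" by (simp add: summable_iff_convergent)
    moreover have "(\<Sum>k<n. fn (d k) x) = fn (X (s n)) x - fn (X (s 0)) x" for n
      using elim(2) sum_lessThan_telescope[of "\<lambda>k. fn (X (s k)) x" n] by simp
    ultimately have "convergent (\<lambda>n. fn (X (s n)) x - fn (X (s 0)) x)" by simp
    then have "convergent (\<lambda>n. (fn (X (s n)) x - fn (X (s 0)) x) + fn (X (s 0)) x)"
      by (intro convergent_add convergent_const)
    then show ?case by simp
  qed
  define f where "f x = lim (\<lambda>k. fn (X (s k)) x)" for x
  have fm: "f \<in> borel_measurable lebesgue" unfolding f_def by (rule borel_measurable_lim_metric) simp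
  have flim: "AE x in lebesgue. (\<lambda>k. fn (X (s k)) x) \<longlonglongrightarrow> f x"
    using conv by eventually_elim (simp add: f_def convergent_LIMSEQ_iff)
  \<comment> \<open>Fatou's lemma in \<open>k\<close> with \<open>j\<close> fixed transfers the
    Cauchy bound to the difference from the limit.\<close>
  have fatou: "(\<integral>\<^sup>+x. ennreal ((cmod (f x - fn (X (s j)) x))\<^sup>2) \<partial>lebesgue) \<le> ennreal (((1/4)^j)\<^sup>2)" for j
  proof -
    have "AE x in lebesgue. \<forall>k. fn (X (s k) - X (s j)) x = fn (X (s k)) x - fn (X (s j)) x"
      unfolding AE_all_countable using fn_diff by blast
    with flim have "AE x in lebesgue. ennreal ((cmod (f x - fn (X (s j)) x))\<^sup>2) = liminf (\<lambda>k. ennreal ((cmod (fn (X (s k) - X (s j)) x))\<^sup>2))"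
    proof eventually_elim
      case (elim x)
      have "(\<lambda>k. ennreal ((cmod (fn (X (s k) - X (s j)) x))\<^sup>2)) \<longlonglongrightarrow> ennreal ((cmod (f x - fn (X (s j)) x))\<^sup>2)"
        using elim by (intro tendsto_ennrealI tendsto_intros) (auto intro!: tendsto_intros)
      from lim_imp_Liminf[OF _ this] show ?case by simp
    qed
    then have "(\<integral>\<^sup>+x. ennreal ((cmod (f x - fn (X (s j)) x))\<^sup>2) \<partial>lebesgue) = (\<integral>\<^sup>+x. liminf (\<lambda>k. ennreal ((cmod (fn (X (s k) - X (s j)) x))\<^sup>2)) \<partial>lebesgue)"
      by (rule nn_integral_cong_AE)
    also have "\<dots> \<le> liminf (\<lambda>k. \<integral>\<^sup>+x. ennreal ((cmod (fn (X (s k) - X (s j)) x))\<^sup>2) \<partial>lebesgue)"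
      by (rule nn_integral_liminf) simp
    also have "\<dots> = liminf (\<lambda>k. ennreal ((norm (X (s k) - X (s j)))\<^sup>2))" by (simp add: nn_norm_l2)
    also have "\<dots> \<le> liminf (\<lambda>k. ennreal (((1/4)^j)\<^sup>2))"
    proof (intro Liminf_mono eventually_mono[OF eventually_ge_at_top[of j]] ennreal_leI power_mono)
      fix k assume "j \<le> k"
      then have "M j \<le> s k" using sM[of j] s by (meson order_trans strict_mono_less_eq)
      then show "norm (X (s k) - X (s j)) \<le> (1/4)^j" using M[of j] sM[of j] by (auto intro: less_imp_le)
    qed auto
    also have "\<dots> = ennreal (((1/4)^j)\<^sup>2)" by (simp add: Liminf_const)
    finally show ?thesis .
  qed
  have dL2: "(\<lambda>x. f x - fn (X (s j)) x) \<in> L2" for j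
  proof -
    have "integrable lebesgue (\<lambda>x. (cmod (f x - fn (X (s j)) x))\<^sup>2)"
      using fm fatou[of j] by (intro integrableI_bounded) (auto intro: le_less_trans)
    then show ?thesis using fm by (simp add: L2_def)
  qed
  have fL2: "f \<in> L2" using L2_add[OF dL2[of 0] fn_L2[of "X (s 0)"]] by simp
  have bound: "norm (X (s j) - cls f) \<le> (1/4)^j" for j
  proof -
    have ae: "AE x in lebesgue. ennreal ((cmod (fn (cls f - X (s j)) x))\<^sup>2) = ennreal ((cmod (f x - fn (X (s j)) x))\<^sup>2)"
      using fn_diff[of "cls f" "X (s j)"] fn_cls[OF fL2] by eventually_elim simp
    have "ennreal ((norm (cls f - X (s j)))\<^sup>2) \<le> ennreal (((1/4)^j)\<^sup>2)"
      unfolding nn_norm_l2[symmetric] nn_integral_cong_AE[OF ae] by (rule fatou)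
    then have "(norm (cls f - X (s j)))\<^sup>2 \<le> ((1/4)^j)\<^sup>2" by (simp add: ennreal_le_iff)
    then show ?thesis by (simp add: abs_le_square_iff[symmetric] norm_minus_commute)
  qed
  have "(\<lambda>j. X (s j) - cls f) \<longlonglongrightarrow> 0"
    by (rule Lim_null_comparison[OF always_eventually[OF allI[OF bound]]]) (simp add: LIMSEQ_realpow_zero)
  then have "(X \<circ> s) \<longlonglongrightarrow> cls f" by (simp add: o_def LIM_zero_iff)
  then have "X \<longlonglongrightarrow> cls f" by (rule Cauchy_converges_subseq[OF X s])
  then show "convergent X" by (rule convergentI)
qed

instance l2 :: (finite) banach ..

subsection \<open>Weak derivatives of classes\<close>

lemma compact_support_L2:
  fixes f :: "'n::finite cfun"
  assumes "continuous_on UNIV f" "compact K" "\<And>x. x \<notin> K \<Longrightarrow> f x = 0"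
  shows "f \<in> L2"
proof -
  have c: "continuous_on UNIV (\<lambda>x. (cmod (f x))\<^sup>2)" using assms(1) by (intro continuous_intros)
  have "integrable lborel (\<lambda>x. (cmod (f x))\<^sup>2)"
    by (rule compact_support_integrable[OF c assms(2)]) (simp add: assms(3))
  then have "integrable lebesgue (\<lambda>x. (cmod (f x))\<^sup>2)"
    using borel_measurable_continuous_onI[OF c] by (simp add: integrable_completion)
  then show ?thesis using continuous_lebesgue_measurable[OF assms(1)] by (simp add: L2_def)
qed

lemma test_L2:
  assumes "\<phi> \<in> test_functions" shows "\<phi> \<in> L2"
proof -
  obtain K where "compact K" "\<And>x. x \<notin> K \<Longrightarrow> \<phi> x = 0" using test_functionsE[OF assms] by blast
  then show ?thesis using compact_support_L2 Ck_continuous[OF test_Ck[OF assms]] by blast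
qed

lemma L2_locally_integrable: assumes "f \<in> L2" shows "locally_integrable f"
  unfolding locally_integrable_def
proof (intro conjI allI impI)
  show m: "f \<in> borel_measurable lebesgue" using assms by (rule L2_D)
  fix K :: "(real^'a) set" assume K: "compact K"
  show "set_integrable lebesgue K f" unfolding set_integrable_def
  proof (rule Bochner_Integration.integrable_bound)
    have "integrable lborel (\<lambda>x. indicator K x *\<^sub>R (1::real))" by (rule borel_integrable_compact[OF K]) simp
    then have "integrable lebesgue (\<lambda>x. indicator K x *\<^sub>R (1::real))"
      using K by (subst integrable_completion) (auto intro!: borel_measurable_indicator borel_compact)
    then show "integrable lebesgue (\<lambda>x. indicator K x *\<^sub>R (1::real) + (cmod (f x))\<^sup>2)" using L2_D(2)[OF assms] by simp
    have "indicator K \<in> borel_measurable lebesgue" using K by (intro borel_measurable_indicator) (simp add: borel_compact)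
    then show "(\<lambda>x. indicator K x *\<^sub>R f x) \<in> borel_measurable lebesgue" using m by (intro borel_measurable_scaleR)
    have "t \<le> 1 + t\<^sup>2" if "t \<ge> 0" for t :: real
      using sum_squares_bound[of 1 t] that by simp
    then show "AE x in lebesgue. norm (indicator K x *\<^sub>R f x) \<le> norm (indicator K x *\<^sub>R 1 + (cmod (f x))\<^sup>2)"
      by (intro AE_I2) (auto simp: indicator_def)
  qed
qed

lemma cls_add: "f \<in> L2 \<Longrightarrow> g \<in> L2 \<Longrightarrow> cls (\<lambda>x. f x + g x) = cls f + cls g"
  unfolding plus_l2_def using fn_cls[of f] fn_cls[of g] by (intro cls_eqI) (auto elim!: eventually_rev_mp)

lemma cls_diff: "f \<in> L2 \<Longrightarrow> g \<in> L2 \<Longrightarrow> cls (\<lambda>x. f x - g x) = cls f - cls g"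
  unfolding minus_l2_def using fn_cls[of f] fn_cls[of g] by (intro cls_eqI) (auto elim!: eventually_rev_mp)

lemma cls_cmult: "f \<in> L2 \<Longrightarrow> cls (\<lambda>x. c * f x) = mul (\<lambda>x. c) (cls f)"
  by (simp add: mul_cls)

lemma cls_scaleR: "f \<in> L2 \<Longrightarrow> cls (\<lambda>x. complex_of_real c * f x) = c *\<^sub>R cls f"
  by (simp add: cls_cmult mul_of_real)

lemma cls_zero: "cls (\<lambda>x. 0) = 0" by (simp add: zero_l2_def)

lemma L2_sum: "(\<And>i. i \<in> I \<Longrightarrow> f i \<in> L2) \<Longrightarrow> (\<lambda>x. \<Sum>i\<in>I. f i x) \<in> L2"
  by (induction I rule: infinite_finite_induct) (auto intro: L2_zero L2_add)

lemma cls_sum: "(\<And>i. i \<in> I \<Longrightarrow> f i \<in> L2) \<Longrightarrow> cls (\<lambda>x. \<Sum>i\<in>I. f i x) = (\<Sum>i\<in>I. cls (f i))"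
  by (induction I rule: infinite_finite_induct) (auto simp: cls_zero cls_add L2_sum)

lemma cinner_test_zero:
  assumes "\<And>\<phi>. \<phi> \<in> test_functions \<Longrightarrow> cinner v (cls \<phi>) = 0" shows "v = 0"
proof -
  have "AE x in lebesgue. fn v x = 0"
  proof (rule fundamental_lemma)
    fix \<phi> :: "'a cfun" assume \<phi>: "\<phi> \<in> test_functions"
    have "(LINT x|lebesgue. fn v x * \<phi> x) = L2_inner (fn v) (\<lambda>x. cnj (\<phi> x))" by (simp add: L2_inner_def)
    also have "\<dots> = cinner v (cls (\<lambda>x. cnj (\<phi> x)))" using cinner_cls[OF fn_L2 test_L2[OF test_cnj[OF \<phi>]], of v] by simp
    finally show "(LINT x|lebesgue. fn v x * \<phi> x) = 0" using assms[OF test_cnj[OF \<phi>]] by simp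
  qed (simp add: L2_locally_integrable)
  then have "cls (fn v) = cls (\<lambda>x. 0)" by (rule cls_eqI)
  then show ?thesis by (simp add: cls_zero)
qed

text \<open>\<open>cinner\<close> conjugates its second argument, whereas
  \<open>has_weak_partial\<close> integrates against the test function itself. The two notions agree
  because test functions are closed under conjugation.\<close>

definition weak_deriv :: "'n::finite \<Rightarrow> 'n l2 \<Rightarrow> 'n l2 \<Rightarrow> bool" where
  "weak_deriv i u v \<longleftrightarrow> (\<forall>\<phi>\<in>test_functions. cinner u (cls (partial i \<phi>)) = - cinner v (cls \<phi>))"

lemma partial_cnj: "f differentiable (at x) \<Longrightarrow> partial i (\<lambda>x. cnj (f x)) x = cnj (partial i f x)"
  by (rule partial_linear[OF bounded_linear_cnj])

lemma has_weak_partial_iff_weak_deriv: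
  assumes "f \<in> L2" "g \<in> L2"
  shows "has_weak_partial i f g \<longleftrightarrow> weak_deriv i (cls f) (cls g)"
proof -
  have eq: "cinner (cls h) (cls \<phi>) = (LINT x|lebesgue. h x * cnj (\<phi> x))" if "h \<in> L2" "\<phi> \<in> test_functions" for h \<phi>
    using cinner_cls[OF that(1) test_L2[OF that(2)]] by (simp add: L2_inner_def)
  have pc: "partial i (\<lambda>x. cnj (\<phi> x)) = (\<lambda>x. cnj (partial i \<phi> x))" if "\<phi> \<in> test_functions" for \<phi>
    using test_differentiable[OF that] by (intro ext partial_cnj)
  show ?thesis
  proof
    assume h: "has_weak_partial i f g"
    show "weak_deriv i (cls f) (cls g)" unfolding weak_deriv_def
    proof
      fix \<phi> :: "'a cfun" assume \<phi>: "\<phi> \<in> test_functions"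
      have "(LINT x|lebesgue. f x * partial i (\<lambda>x. cnj (\<phi> x)) x) = - (LINT x|lebesgue. g x * cnj (\<phi> x))"
        using h test_cnj[OF \<phi>] unfolding has_weak_partial_def by blast
      then show "cinner (cls f) (cls (partial i \<phi>)) = - cinner (cls g) (cls \<phi>)"
        unfolding eq[OF assms(1) test_partial[OF \<phi>]] eq[OF assms(2) \<phi>] pc[OF \<phi>] .
    qed
  next
    assume w: "weak_deriv i (cls f) (cls g)"
    show "has_weak_partial i f g" unfolding has_weak_partial_def
    proof (intro conjI ballI)
      fix \<phi> :: "'a cfun" assume \<phi>: "\<phi> \<in> test_functions"
      have "cinner (cls f) (cls (partial i (\<lambda>x. cnj (\<phi> x)))) = - cinner (cls g) (cls (\<lambda>x. cnj (\<phi> x)))"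
        using w test_cnj[OF \<phi>] unfolding weak_deriv_def by blast
      then show "(LINT x|lebesgue. f x * partial i \<phi> x) = - (LINT x|lebesgue. g x * \<phi> x)"
        unfolding eq[OF assms(1) test_partial[OF test_cnj[OF \<phi>]]] eq[OF assms(2) test_cnj[OF \<phi>]] by (simp add: pc[OF \<phi>])
    qed (use assms L2_locally_integrable in auto)
  qed
qed

lemma weak_deriv_unique: assumes "weak_deriv i u v" "weak_deriv i u w" shows "v = w"
proof -
  have "v - w = 0"
    by (rule cinner_test_zero) (use assms in \<open>simp add: weak_deriv_def cinner.diff_left\<close>)
  then show ?thesis by simp
qed

lemma weak_deriv_add: "weak_deriv i u v \<Longrightarrow> weak_deriv i u' v' \<Longrightarrow> weak_deriv i (u + u') (v + v')"
  by (simp add: weak_deriv_def cinner.add_left)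

lemma weak_deriv_diff: "weak_deriv i u v \<Longrightarrow> weak_deriv i u' v' \<Longrightarrow> weak_deriv i (u - u') (v - v')"
  by (simp add: weak_deriv_def cinner.diff_left)

lemma weak_deriv_scaleR: "weak_deriv i u v \<Longrightarrow> weak_deriv i (r *\<^sub>R u) (r *\<^sub>R v)"
  by (simp add: weak_deriv_def cinner.scaleR_left)

lemma weak_deriv_zero: "weak_deriv i 0 0"
  by (simp add: weak_deriv_def cinner.zero_left)

lemma weak_deriv_closed:
  assumes "\<And>k. weak_deriv i (U k) (V k)" "U \<longlonglongrightarrow> u" "V \<longlonglongrightarrow> v" shows "weak_deriv i u v"
  unfolding weak_deriv_def
proof
  fix \<phi> :: "'a cfun" assume \<phi>: "\<phi> \<in> test_functions"
  have "(\<lambda>k. cinner (U k) (cls (partial i \<phi>))) \<longlonglongrightarrow> cinner u (cls (partial i \<phi>))"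
    by (intro cinner.tendsto assms tendsto_const)
  moreover have "(\<lambda>k. - cinner (V k) (cls \<phi>)) \<longlonglongrightarrow> - cinner v (cls \<phi>)"
    by (intro tendsto_minus cinner.tendsto assms tendsto_const)
  moreover have "(\<lambda>k. cinner (U k) (cls (partial i \<phi>))) = (\<lambda>k. - cinner (V k) (cls \<phi>))"
    using assms(1) \<phi> by (auto simp: weak_deriv_def)
  ultimately show "cinner u (cls (partial i \<phi>)) = - cinner v (cls \<phi>)" by (metis LIMSEQ_unique)
qed

lemma weak_deriv_C1:
  fixes f :: "'n::finite cfun"
  assumes f: "Ck 1 f" and K: "compact K" "\<And>x. x \<notin> K \<Longrightarrow> f x = 0"
  shows "weak_deriv i (cls f) (cls (partial i f))"
  unfolding weak_deriv_def
proof
  fix \<phi> :: "'n cfun" assume \<phi>: "\<phi> \<in> test_functions"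
  have fL: "f \<in> L2" by (rule compact_support_L2[OF Ck_continuous[OF f] K])
  have pL: "partial i f \<in> L2" 
    by (rule compact_support_L2[OF _ K(1) partial_zero_outside[OF K]]) (use f in auto)
  note \<phi>L = test_L2[OF \<phi>] and p\<phi>L = test_L2[OF test_partial[OF \<phi>]]
  have c1: "Ck 1 (\<lambda>x. cnj (\<phi> x))" using test_Ck[OF test_cnj[OF \<phi>]] .
  have "0 = (LINT x|lebesgue. partial i (\<lambda>x. f x * cnj (\<phi> x)) x)"
    by (rule integral_partial_zero[symmetric, OF Ck_mult[OF f c1] K(1)]) (simp add: K(2))
  also have "\<dots> = (LINT x|lebesgue. f x * cnj (partial i \<phi> x) + partial i f x * cnj (\<phi> x))"
    using f c1 test_differentiable[OF \<phi>] by (intro Bochner_Integration.integral_cong refl) (simp add: partial_mult partial_cnj)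
  also have "\<dots> = L2_inner f (partial i \<phi>) + L2_inner (partial i f) \<phi>"
    using L2_mult_cnj_integrable[OF fL p\<phi>L] L2_mult_cnj_integrable[OF pL \<phi>L]
    by (simp add: L2_inner_def)
  finally show "cinner (cls f) (cls (partial i \<phi>)) = - cinner (cls (partial i f)) (cls \<phi>)"
    unfolding cinner_cls[OF fL p\<phi>L] cinner_cls[OF pL \<phi>L] by (simp add: eq_neg_iff_add_eq_0)
qed

lemma weak_deriv_test:
  assumes "\<phi> \<in> test_functions" shows "weak_deriv i (cls \<phi>) (cls (partial i \<phi>))"
proof -
  obtain K where "compact K" "\<And>x. x \<notin> K \<Longrightarrow> \<phi> x = 0" using test_functionsE[OF assms] by blast
  then show ?thesis using weak_deriv_C1[OF test_Ck[OF assms]] by blast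
qed

subsection \<open>A maximum principle\<close>

lemma second_derivative_at_max:
  fixes p :: "real \<Rightarrow> real"
  assumes p: "\<And>t. (p has_real_derivative p' t) (at t)" and p': "(p' has_real_derivative D) (at 0)"
    and max: "\<And>t. p t \<le> p 0"
  shows "D \<le> 0"
proof (rule ccontr)
  assume "\<not> D \<le> 0"
  then have D: "D > 0" by simp
  have z: "p' 0 = 0" by (rule DERIV_local_max[OF p zero_less_one]) (use max in auto)
  obtain d where d: "d > 0" "\<And>h. 0 < h \<Longrightarrow> h < d \<Longrightarrow> p' 0 < p' (0 + h)"
    using DERIV_pos_inc_right[OF p' D] by blast
  have "\<exists>z. 0 < z \<and> z < d/2 \<and> p (d/2) - p 0 = (d/2 - 0) * p' z"
    by (rule MVT2) (use d p in auto)
  then obtain s where s: "0 < s" "s < d/2" "p (d/2) - p 0 = (d/2 - 0) * p' s" by blast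
  have "p' s > 0" using d(2)[of s] s z d(1) by simp
  then have "(d/2 - 0) * p' s > 0" using d(1) by simp
  then show False using max[of "d/2"] s(3) by linarith
qed

text \<open>A bounded function need not attain its supremum, hence the correction by
  \<open>\<delta>\<close> times the squared norm. At the maximum of the corrected function each
  \<open>h2 i\<close> is at most \<open>2 * \<delta>\<close>, so \<open>sub\<close> bounds the value
  of \<open>h\<close> there by a multiple of \<open>\<delta>\<close>, and \<open>\<delta>\<close> is
  arbitrary. Here \<open>h1\<close> and \<open>h2\<close> are the first and the pure second
  derivatives along the axes.\<close>

lemma maximum_principle:
  fixes h :: "real^'n::finite \<Rightarrow> real"
  assumes cont: "continuous_on UNIV h" and bd: "\<And>x. \<bar>h x\<bar> \<le> B"
    and h1: "\<And>i x t. ((\<lambda>t. h (x + t *\<^sub>R axis i 1)) has_real_derivative h1 i (x + t *\<^sub>R axis i 1)) (at t)"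
    and h2: "\<And>i x t. ((\<lambda>t. h1 i (x + t *\<^sub>R axis i 1)) has_real_derivative h2 i (x + t *\<^sub>R axis i 1)) (at t)"
    and sub: "\<And>x. h x \<le> (\<Sum>i\<in>UNIV. h2 i x)"
  shows "h x \<le> 0"
proof (rule field_le_epsilon)
  fix e :: real assume e: "e > 0"
  define n where "n = real CARD('n)"
  \<comment> \<open>Chosen for the given point \<open>x\<close> so that the final bound
    \<open>\<delta> * (2 * n + (norm x)\<^sup>2)\<close> does not exceed \<open>e\<close>.\<close>
  define \<delta> where "\<delta> = e / (2 * n + (norm x)\<^sup>2 + 1)"
  have n: "n \<ge> 0" by (simp add: n_def)
  have den: "2 * n + (norm x)\<^sup>2 + 1 > 0" using n zero_le_power2[of "norm x"] by linarith
  have \<delta>: "\<delta> > 0" using e den by (simp add: \<delta>_def)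
  define g where "g x = h x - \<delta> * (norm x)\<^sup>2" for x
  have B: "B \<ge> 0" using bd[of 0] by linarith
  \<comment> \<open>Beyond this radius the correction exceeds \<open>2 * B\<close>, so
    \<open>g\<close> is at most \<open>- B \<le> g 0\<close> and its maximum lies in the
    ball.\<close>
  define R where "R = sqrt (2 * B / \<delta>)"
  have R: "\<delta> * R\<^sup>2 = 2 * B" "R \<ge> 0" using \<delta> B by (auto simp: R_def)
  have "\<exists>x0\<in>cball 0 R. \<forall>y\<in>cball 0 R. g y \<le> g x0"
    unfolding g_def using R(2)
    by (intro continuous_attains_sup) (auto intro!: continuous_intros continuous_on_subset[OF cont])
  then obtain x0 where x0: "x0 \<in> cball 0 R" "\<And>y. y \<in> cball 0 R \<Longrightarrow> g y \<le> g x0" by blast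
  have gmax: "g y \<le> g x0" for y
  proof (cases "y \<in> cball 0 R")
    case False
    then have "R\<^sup>2 \<le> (norm y)\<^sup>2" using R(2) by (intro power_mono) auto
    then have "\<delta> * R\<^sup>2 \<le> \<delta> * (norm y)\<^sup>2" using \<delta> by simp
    then have "g y \<le> - B" using bd[of y] R(1) by (simp add: g_def)
    also have "\<dots> \<le> g 0" using bd[of 0] by (simp add: g_def)
    also have "\<dots> \<le> g x0" using x0(2)[of 0] R(2) by simp
    finally show ?thesis .
  qed (use x0 in simp)
  have "h2 i x0 \<le> 2 * \<delta>" for i
  proof -
    define p where "p t = h (x0 + t *\<^sub>R axis i 1) - \<delta> * ((norm x0)\<^sup>2 + 2 * t * x0 $ i + t\<^sup>2)" for t
    define p' where "p' t = h1 i (x0 + t *\<^sub>R axis i 1) - \<delta> * (2 * x0 $ i + 2 * t)" for t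
    have pg: "p t = g (x0 + t *\<^sub>R axis i 1)" for t
    proof -
      have "(norm (x0 + t *\<^sub>R axis i 1))\<^sup>2 = (norm x0)\<^sup>2 + 2 * t * x0 $ i + t\<^sup>2"
        unfolding power2_norm_eq_inner
        by (simp add: inner_add_left inner_add_right inner_axis inner_axis_axis inner_commute[of "axis i 1"] power2_eq_square algebra_simps del: dot_square_norm)
      then show ?thesis by (simp add: p_def g_def)
    qed
    have "h2 i x0 - 2 * \<delta> \<le> 0"
    proof (rule second_derivative_at_max)
      show "(p has_real_derivative p' t) (at t)" for t
        unfolding p_def p'_def by (auto intro!: derivative_eq_intros h1)
      show "(p' has_real_derivative (h2 i x0 - 2 * \<delta>)) (at 0)"
        unfolding p'_def using h2[of i x0 0] by (auto intro!: derivative_eq_intros)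
      show "p t \<le> p 0" for t unfolding pg using gmax by simp
    qed
    then show ?thesis by simp
  qed
  then have "(\<Sum>i\<in>UNIV. h2 i x0) \<le> (\<Sum>i\<in>(UNIV::'n set). 2 * \<delta>)" by (intro sum_mono) auto
  then have "h x0 \<le> 2 * n * \<delta>" using sub[of x0] by (simp add: n_def)
  moreover have "0 \<le> \<delta> * (norm x0)\<^sup>2" using \<delta> by simp
  ultimately have "g x0 \<le> 2 * n * \<delta>" unfolding g_def by linarith
  then have "h x \<le> 2 * n * \<delta> + \<delta> * (norm x)\<^sup>2" using gmax[of x] by (simp add: g_def)
  also have "\<dots> = \<delta> * (2 * n + (norm x)\<^sup>2)" by (simp add: algebra_simps)
  also have "\<dots> \<le> \<delta> * (2 * n + (norm x)\<^sup>2 + 1)" using \<delta> by (intro mult_left_mono) auto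
  also have "\<dots> = e" using den by (simp add: \<delta>_def)
  finally show "h x \<le> 0 + e" by simp
qed

subsection \<open>Translates of test functions\<close>

lemma test_lipschitz:
  assumes "\<psi> \<in> test_functions"
  obtains L where "L \<ge> 0" "\<And>x y. cmod (\<psi> x - \<psi> y) \<le> L * norm (x - y)"
proof -
  have "\<exists>B\<ge>0. \<forall>x. cmod (partial i \<psi> x) \<le> B" for i
  proof -
    obtain K where K: "compact K" "\<And>x. x \<notin> K \<Longrightarrow> partial i \<psi> x = 0" using test_functionsE[OF test_partial[OF assms]] by blast
    show ?thesis using compact_support_bounded[OF Ck_continuous[OF test_Ck[OF test_partial[OF assms]]] K] by blast
  qed
  then obtain B where B: "\<And>i. B i \<ge> 0" "\<And>i x. cmod (partial i \<psi> x) \<le> B i" by metis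
  show thesis
  proof (rule that)
    show "(\<Sum>i\<in>UNIV. B i) \<ge> 0" using B by (simp add: sum_nonneg)
    fix x y
    show "cmod (\<psi> x - \<psi> y) \<le> (\<Sum>i\<in>UNIV. B i) * norm (x - y)"
    proof (rule differentiable_bound[where S=UNIV and f'="\<lambda>x. frechet_derivative \<psi> (at x)"])
      fix x
      show d: "(\<psi> has_derivative frechet_derivative \<psi> (at x)) (at x)"
        using test_differentiable[OF assms] by (simp add: frechet_derivative_works)
      show "onorm (frechet_derivative \<psi> (at x)) \<le> (\<Sum>i\<in>UNIV. B i)"
      proof (rule onorm_le)
        fix v :: "real^'a"
        have lin: "linear (frechet_derivative \<psi> (at x))" using d has_derivative_linear by blast
        have "v = (\<Sum>i\<in>UNIV. (v $ i) *\<^sub>R axis i 1)"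
          using basis_expansion[of v] by (simp add: scalar_mult_eq_scaleR)
        then have "frechet_derivative \<psi> (at x) v = frechet_derivative \<psi> (at x) (\<Sum>i\<in>UNIV. (v $ i) *\<^sub>R axis i 1)"
          by (rule arg_cong)
        also have "\<dots> = (\<Sum>i\<in>UNIV. (v $ i) *\<^sub>R partial i \<psi> x)"
          by (simp add: linear_sum[OF lin] linear_scale[OF lin] partial_def)
        finally have eq: "frechet_derivative \<psi> (at x) v = (\<Sum>i\<in>UNIV. (v $ i) *\<^sub>R partial i \<psi> x)" .
        have "cmod (frechet_derivative \<psi> (at x) v) \<le> (\<Sum>i\<in>UNIV. norm ((v $ i) *\<^sub>R partial i \<psi> x))"
          unfolding eq by (rule norm_sum)
        also have "\<dots> \<le> (\<Sum>i\<in>UNIV. norm v * B i)"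
          by (intro sum_mono) (simp add: B mult_mono component_le_norm_cart)
        also have "\<dots> = (\<Sum>i\<in>UNIV. B i) * norm v"
          unfolding sum_distrib_right by (rule sum.cong) (simp_all add: mult.commute)
        finally show "cmod (frechet_derivative \<psi> (at x) v) \<le> (\<Sum>i\<in>UNIV. B i) * norm v" .
      qed
    qed auto
  qed
qed

lemma norm_cls_bounded_support:
  assumes "f \<in> L2" "compact K" "\<And>x. x \<notin> K \<Longrightarrow> f x = 0" "\<And>x. cmod (f x) \<le> B"
  shows "norm (cls f) \<le> B * sqrt (measure lborel K)"
proof -
  have B: "B \<ge> 0" using assms(4) norm_ge_zero order_trans by blast
  have i: "integrable lborel (\<lambda>x. indicator K x *\<^sub>R B\<^sup>2)" by (rule borel_integrable_compact[OF assms(2)]) simp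
  have m: "(\<lambda>x. indicator K x *\<^sub>R B\<^sup>2) \<in> borel_measurable lborel" using i by (rule borel_measurable_integrable)
  have "(norm (cls f))\<^sup>2 = (LINT x|lebesgue. (cmod (f x))\<^sup>2)" by (simp add: norm_cls[OF assms(1)] L2_norm_def)
  also have "\<dots> \<le> (LINT x|lebesgue. indicator K x *\<^sub>R B\<^sup>2)"
  proof (rule integral_mono[OF L2_D(2)[OF assms(1)]])
    show "integrable lebesgue (\<lambda>x. indicator K x *\<^sub>R B\<^sup>2)" unfolding integrable_completion[OF m] by (rule i)
    show "(cmod (f x))\<^sup>2 \<le> indicator K x *\<^sub>R B\<^sup>2" for x
      using power_mono[OF assms(4)[of x], of 2] assms(3)[of x] by (cases "x \<in> K") auto
  qed
  also have "\<dots> = (LINT x|lborel. indicator K x *\<^sub>R B\<^sup>2)" using m by (rule integral_completion)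
  also have "\<dots> = measure lborel K *\<^sub>R B\<^sup>2"
    using assms(2)
    by (intro has_bochner_integral_integral_eq has_bochner_integral_indicator) (auto simp: borel_compact intro: emeasure_compact_finite[unfolded infinity_ennreal_def])
  also have "\<dots> = (B * sqrt (measure lborel K))\<^sup>2" by (simp add: power_mult_distrib)
  finally have sq: "(norm (cls f))\<^sup>2 \<le> (B * sqrt (measure lborel K))\<^sup>2" .
  show ?thesis by (rule power2_le_imp_le[OF sq]) (use B in simp)
qed

lemma norm_cls_translate:
  assumes "\<psi> \<in> test_functions" shows "norm (cls (\<lambda>y. \<psi> (y + x))) = norm (cls \<psi>)"
proof -
  have c: "continuous_on UNIV \<psi>" using Ck_continuous[OF test_Ck[OF assms]] .
  have m: "(\<lambda>y. (cmod (\<psi> y))\<^sup>2) \<in> borel_measurable borel"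
    by (intro borel_measurable_continuous_onI continuous_intros c)
  have m': "(\<lambda>y. (cmod (\<psi> (y + x)))\<^sup>2) \<in> borel_measurable borel"
    using m by measurable
  have "(LINT y|lebesgue. (cmod (\<psi> (y + x)))\<^sup>2) = (LINT y|lebesgue. (cmod (\<psi> y))\<^sup>2)"
    using lborel_integral_translate[OF m, of x] m m' by (simp add: integral_completion)
  then show ?thesis
    by (simp add: norm_cls test_L2 test_translate assms L2_norm_def)
qed


lemma compact_enlarge:
  assumes "compact (K :: 'a::{euclidean_space} set)"
  obtains K' where "compact K'" "\<And>x z. norm z \<le> 1 \<Longrightarrow> x \<notin> K' \<Longrightarrow> x + z \<notin> K"
proof
  show "compact {x - y | x y. x \<in> K \<and> y \<in> cball 0 1}" using assms by (rule compact_differences) simp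
  fix x z :: 'a assume "norm z \<le> 1" "x \<notin> {x - y | x y. x \<in> K \<and> y \<in> cball 0 1}"
  then show "x + z \<notin> K" using diff_add_cancel[of x z] by (force simp: add_diff_cancel)
qed

lemma translate_continuous:
  assumes \<psi>: "\<psi> \<in> test_functions"
  shows "continuous_on UNIV (\<lambda>x. cls (\<lambda>y. \<psi> (y + x)))"
proof -
  obtain K where K: "compact K" "\<And>x. x \<notin> K \<Longrightarrow> \<psi> x = 0" using test_functionsE[OF \<psi>] by blast
  obtain K' where K': "compact K'" "\<And>x z. norm z \<le> 1 \<Longrightarrow> x \<notin> K' \<Longrightarrow> x + z \<notin> K" using compact_enlarge[OF K(1)] by blast
  obtain L where L: "L \<ge> 0" "\<And>x y. cmod (\<psi> x - \<psi> y) \<le> L * norm (x - y)" using test_lipschitz[OF \<psi>] by blast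
  define m where "m = sqrt (measure lborel K')"
  have m: "m \<ge> 0" by (simp add: m_def)
  have bnd: "norm (cls (\<lambda>y. \<psi> (y + (x + z))) - cls (\<lambda>y. \<psi> (y + x))) \<le> L * norm z * m" if z: "norm z \<le> 1" for x z
  proof -
    have "\<And>c. (\<lambda>y. \<psi> (y + c)) \<in> L2" using test_L2[OF test_translate[OF \<psi>]] .
    note tL = this
    have "norm (cls (\<lambda>y. \<psi> (y + z) - \<psi> (y + 0))) \<le> L * norm z * m" unfolding m_def
    proof (rule norm_cls_bounded_support[OF L2_diff[OF tL tL] K'(1)])
      fix y
      show "cmod (\<psi> (y + z) - \<psi> (y + 0)) \<le> L * norm z" using L(2)[of "y + z" "y + 0"] by simp
      assume "y \<notin> K'"
      then show "\<psi> (y + z) - \<psi> (y + 0) = 0" using K'(2)[OF z] K'(2)[of 0 y] K(2) by simp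
    qed
    moreover have "(\<lambda>y. \<psi> (y + z) - \<psi> (y + 0)) \<in> test_functions"
      using test_add[OF test_translate[OF \<psi>, of z] test_cmult[OF test_translate[OF \<psi>, of 0], of "-1"]] by simp
    from norm_cls_translate[OF this, of x]
    have "norm (cls (\<lambda>y. \<psi> (y + (x + z)) - \<psi> (y + x))) = norm (cls (\<lambda>y. \<psi> (y + z) - \<psi> (y + 0)))" by (simp add: add.assoc)
    ultimately show ?thesis using cls_diff[OF tL[of "x+z"] tL[of x]] by simp
  qed
  have "isCont (\<lambda>x. cls (\<lambda>y. \<psi> (y + x))) x" for x
    unfolding isCont_iff
  proof (rule LIM_zero_cancel, rule Lim_null_comparison)
    have "\<forall>\<^sub>F z in at 0. norm (z::real^'a) \<le> 1"
      by (rule eventually_at_in_open'[THEN eventually_mono, of "ball 0 1"]) auto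
    then show "\<forall>\<^sub>F z in at 0. norm (cls (\<lambda>y. \<psi> (y + (x + z))) - cls (\<lambda>y. \<psi> (y + x))) \<le> L * norm z * m"
      by eventually_elim (rule bnd)
    have "((\<lambda>z. L * norm (z::real^'a) * m) \<longlongrightarrow> L * norm (0::real^'a) * m) (at 0)" by (intro tendsto_intros)
    then show "((\<lambda>z. L * norm (z::real^'a) * m) \<longlongrightarrow> 0) (at 0)" by simp
  qed
  then show ?thesis by (simp add: continuous_at_imp_continuous_on)
qed

text \<open>The first order Taylor error of the translate is at most
  \<open>L * \<bar>s\<bar> * \<bar>s\<bar>\<close> pointwise, with \<open>L\<close> a Lipschitz
  constant of \<open>partial i \<psi>\<close>, and is supported in a fixed compact set up to
  translation. Its norm is therefore quadratic in \<open>s\<close>, so translation is differentiable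
  in the space of classes and any continuous functional inherits this.\<close>

lemma translate_derivative:
  assumes \<psi>: "\<psi> \<in> test_functions"
  shows "((\<lambda>t. cls (\<lambda>y. \<psi> (y + (x + t *\<^sub>R axis i 1)))) has_vector_derivative
      cls (\<lambda>y. partial i \<psi> (y + (x + t *\<^sub>R axis i 1)))) (at t)"
proof -
  define e where "e = (axis i 1 :: real^'a)"
  have e1: "norm e = 1" by (simp add: e_def)
  define T where "T \<phi> t = cls (\<lambda>y. \<phi> (y + (x + t *\<^sub>R e)))" for \<phi> t
  note p\<psi> = test_partial[OF \<psi>, of i] and pp\<psi> = test_partial[OF test_partial[OF \<psi>, of i], of i]
  obtain K where K: "compact K" "\<And>x. x \<notin> K \<Longrightarrow> \<psi> x = 0" using test_functionsE[OF \<psi>] by blast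
  have pK: "\<And>x. x \<notin> K \<Longrightarrow> partial i \<psi> x = 0" by (rule partial_zero_outside[OF K])
  obtain K' where K': "compact K'" "\<And>x z. norm z \<le> 1 \<Longrightarrow> x \<notin> K' \<Longrightarrow> x + z \<notin> K" using compact_enlarge[OF K(1)] by blast
  obtain L where L: "L \<ge> 0" "\<And>x y. cmod (partial i \<psi> x - partial i \<psi> y) \<le> L * norm (x - y)"
    using test_lipschitz[OF p\<psi>] by blast
  define m where "m = sqrt (measure lborel K')"
  have bnd: "norm (T \<psi> (t + s) - T \<psi> t - s *\<^sub>R T (partial i \<psi>) t) \<le> (L * \<bar>s\<bar> * \<bar>s\<bar>) * m" if s: "\<bar>s\<bar> \<le> 1" for s
  proof -
    define \<phi> where "\<phi> y = \<psi> (y + s *\<^sub>R e) + (- 1 * \<psi> y + - complex_of_real s * partial i \<psi> y)" for y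
    have \<phi>t: "\<phi> \<in> test_functions"
      unfolding \<phi>_def by (intro test_add test_cmult test_translate \<psi> p\<psi>)
    have "norm (cls \<phi>) \<le> (L * \<bar>s\<bar> * \<bar>s\<bar>) * m" unfolding m_def
    proof (rule norm_cls_bounded_support[OF test_L2[OF \<phi>t] K'(1)])
      fix y
      have "norm ((\<lambda>s. \<psi> (y + s *\<^sub>R e)) s - (\<lambda>s. \<psi> (y + s *\<^sub>R e)) 0 - s *\<^sub>R partial i \<psi> y) \<le> (L * \<bar>s\<bar>) * \<bar>s\<bar>"
      proof (rule mean_value_linearization)
        show "((\<lambda>s. \<psi> (y + s *\<^sub>R e)) has_vector_derivative partial i \<psi> (y + r *\<^sub>R e)) (at r)" for r
          unfolding e_def by (rule partial_along_line[OF test_differentiable[OF \<psi>]])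
        fix r assume "\<bar>r\<bar> \<le> \<bar>s\<bar>"
        then show "cmod (partial i \<psi> (y + r *\<^sub>R e) - partial i \<psi> y) \<le> L * \<bar>s\<bar>"
          using L(2)[of "y + r *\<^sub>R e" y] L(1) e1 mult_left_mono[of "\<bar>r\<bar>" "\<bar>s\<bar>" L] by simp
      qed
      then show "cmod (\<phi> y) \<le> L * \<bar>s\<bar> * \<bar>s\<bar>" by (simp add: \<phi>_def scaleR_conv_of_real algebra_simps)
      assume "y \<notin> K'"
      then show "\<phi> y = 0" using K'(2)[of "s *\<^sub>R e" y] K'(2)[of 0 y] s e1 K(2) pK by (simp add: \<phi>_def)
    qed
    moreover have "T \<psi> (t + s) - T \<psi> t - s *\<^sub>R T (partial i \<psi>) t = cls (\<lambda>y. \<phi> (y + (x + t *\<^sub>R e)))"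
    proof -
      have L2s: "(\<lambda>y. \<psi> (y + c)) \<in> L2" "(\<lambda>y. partial i \<psi> (y + c)) \<in> L2" for c
        using test_L2[OF test_translate[OF \<psi>]] test_L2[OF test_translate[OF p\<psi>]] by blast+
      have "cls (\<lambda>y. \<phi> (y + (x + t *\<^sub>R e))) = cls (\<lambda>y. \<psi> (y + (x + (t + s) *\<^sub>R e)) - \<psi> (y + (x + t *\<^sub>R e)) - complex_of_real s * partial i \<psi> (y + (x + t *\<^sub>R e)))"
        by (simp add: \<phi>_def algebra_simps)
      also have "\<dots> = T \<psi> (t + s) - T \<psi> t - s *\<^sub>R T (partial i \<psi>) t"
        unfolding T_def by (subst cls_diff | simp add: L2s L2_diff L2_cmult cls_scaleR)+
      finally show ?thesis ..
    qed
    ultimately show ?thesis using norm_cls_translate[OF \<phi>t, of "x + t *\<^sub>R e"] by simp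
  qed
  have "((\<lambda>s. (T \<psi> (t + s) - T \<psi> t - s *\<^sub>R T (partial i \<psi>) t) /\<^sub>R norm s) \<longlongrightarrow> 0) (at 0)"
  proof (rule Lim_null_comparison)
    have "\<forall>\<^sub>F s in at 0. norm (s::real) < 1"
      by (rule eventually_at_in_open'[THEN eventually_mono, of "ball 0 1"]) auto
    then show "\<forall>\<^sub>F s in at 0. norm ((T \<psi> (t + s) - T \<psi> t - s *\<^sub>R T (partial i \<psi>) t) /\<^sub>R norm s) \<le> L * \<bar>s\<bar> * m"
    proof eventually_elim
      case (elim s)
      show ?case
      proof (cases "s = 0")
        case False
        have "norm ((T \<psi> (t + s) - T \<psi> t - s *\<^sub>R T (partial i \<psi>) t) /\<^sub>R norm s)
            = norm (T \<psi> (t + s) - T \<psi> t - s *\<^sub>R T (partial i \<psi>) t) / \<bar>s\<bar>"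
          unfolding norm_scaleR by (simp add: divide_inverse mult.commute)
        also have "\<dots> \<le> (L * \<bar>s\<bar> * \<bar>s\<bar>) * m / \<bar>s\<bar>" using bnd[of s] elim by (intro divide_right_mono) auto
        also have "\<dots> = L * \<bar>s\<bar> * m" using False by simp
        finally show ?thesis .
      qed simp
    qed
    have "((\<lambda>z. L * \<bar>z\<bar> * m) \<longlongrightarrow> L * \<bar>0\<bar> * m) (at 0)" by (intro tendsto_intros)
    then show "((\<lambda>z. L * \<bar>z\<bar> * m) \<longlongrightarrow> 0) (at 0)" by simp
  qed
  from tendsto_norm_zero[OF this] have "(T \<psi> has_vector_derivative T (partial i \<psi>) t) (at t)"
    unfolding has_vector_derivative_def has_derivative_at by (simp add: bounded_linear_scaleR_left divide_inverse_commute)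
  then show ?thesis unfolding T_def e_def .
qed

text \<open>Pairing \<open>u\<close> with all translates of a test function turns the hypothesis into a bounded
  classical solution of \<open>\<Delta>h = h\<close>, which vanishes by the maximum principle.\<close>

lemma helmholtz_orthogonal_zero:
  fixes u :: "'n::finite l2"
  assumes u: "\<And>\<phi>. \<phi> \<in> test_functions \<Longrightarrow>
    inner u (cls \<phi>) = inner u (cls (\<lambda>x. \<Sum>i\<in>UNIV. partial i (partial i \<phi>) x))"
  shows "u = 0"
proof -
  \<comment> \<open>The maximum principle bounds from above only; both signs of \<open>u\<close> are
    needed to get zero.\<close>
  have nonpos: "inner w (cls \<psi>) \<le> 0" if \<psi>: "\<psi> \<in> test_functions" and w: "w = u \<or> w = - u" for w \<psi>
  proof -
    define h where "h \<phi> x = inner w (cls (\<lambda>y. \<phi> (y + x)))" for \<phi> :: "'n cfun" and x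
    have der: "((\<lambda>t. h \<phi> (x + t *\<^sub>R axis i 1)) has_real_derivative h (partial i \<phi>) (x + t *\<^sub>R axis i 1)) (at t)"
      if "\<phi> \<in> test_functions" for \<phi> x i t
      unfolding has_real_derivative_iff_has_vector_derivative h_def
      by (rule bounded_linear.has_vector_derivative[OF bounded_linear_inner_right translate_derivative[OF that]])
    have "h \<psi> 0 \<le> 0"
    proof (rule maximum_principle)
      show "continuous_on UNIV (h \<psi>)" unfolding h_def
        by (intro continuous_on_inner continuous_on_const translate_continuous[OF \<psi>])
      show "\<bar>h \<psi> x\<bar> \<le> norm w * norm (cls \<psi>)" for x
        unfolding h_def norm_cls_translate[OF \<psi>, of x, symmetric] by (rule Cauchy_Schwarz_ineq2)
      show "((\<lambda>t. h \<psi> (x + t *\<^sub>R axis i 1)) has_real_derivative h (partial i \<psi>) (x + t *\<^sub>R axis i 1)) (at t)" for i x t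
        by (rule der[OF \<psi>])
      show "((\<lambda>t. h (partial i \<psi>) (x + t *\<^sub>R axis i 1)) has_real_derivative h (partial i (partial i \<psi>)) (x + t *\<^sub>R axis i 1)) (at t)" for i x t
        by (rule der[OF test_partial[OF \<psi>]])
      fix x
      define \<phi> where "\<phi> y = \<psi> (y + x)" for y
      have \<phi>: "\<phi> \<in> test_functions" unfolding \<phi>_def by (rule test_translate[OF \<psi>])
      have p: "partial i \<phi> = (\<lambda>y. partial i \<psi> (y + x))" for i
        unfolding \<phi>_def by (intro ext partial_translate test_differentiable \<psi>)
      have pp: "partial i (partial i \<phi>) = (\<lambda>y. partial i (partial i \<psi>) (y + x))" for i
        unfolding p by (intro ext partial_translate test_differentiable test_partial \<psi>)
      have "inner w (cls \<phi>) = inner w (cls (\<lambda>x. \<Sum>i\<in>UNIV. partial i (partial i \<phi>) x))"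
        using u[OF \<phi>] w by (auto simp: inner_minus_left)
      also have "\<dots> = (\<Sum>i\<in>UNIV. h (partial i (partial i \<psi>)) x)"
        unfolding h_def pp[symmetric] by (subst cls_sum) (auto intro: test_L2 test_partial \<phi> simp: inner_sum_right)
      finally show "h \<psi> x \<le> (\<Sum>i\<in>UNIV. h (partial i (partial i \<psi>)) x)" by (simp add: h_def \<phi>_def[abs_def])
    qed
    then show ?thesis by (simp add: h_def)
  qed
  have zero: "inner u (cls \<psi>) = 0" if "\<psi> \<in> test_functions" for \<psi>
    using nonpos[OF that, of u] nonpos[OF that, of "- u"] by simp
  show ?thesis
  proof (rule cinner_test_zero)
    fix \<psi> :: "'n cfun" assume \<psi>: "\<psi> \<in> test_functions"
    have "Re (cinner u (cls \<psi>)) = 0" using zero[OF \<psi>] by (simp add: inner_cinner)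
    \<comment> \<open>The hypothesis concerns the real pairing. Testing with
      \<open>\<i> * \<psi>\<close> turns the imaginary part of the complex pairing into a real
      one.\<close>
    moreover have "cinner u (cls (\<lambda>x. \<i> * \<psi> x)) = - \<i> * cinner u (cls \<psi>)"
      unfolding cls_cmult[OF test_L2[OF \<psi>]] by (subst (1 2) cinner_commute) (simp add: cinner_cmul_left)
    then have "Im (cinner u (cls \<psi>)) = 0" using zero[OF test_cmult[OF \<psi>, of \<i>]] by (simp add: inner_cinner)
    ultimately show "cinner u (cls \<psi>) = 0" by (simp add: complex_eq_iff)
  qed
qed

subsection \<open>The Sobolev space \<open>H\<^sup>1\<close>\<close>

definition H1 :: "('n::finite) l2 set" where
  "H1 = {u. \<forall>i. \<exists>v. weak_deriv i u v}"

definition D :: "'n::finite \<Rightarrow> 'n l2 \<Rightarrow> 'n l2" where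
  "D i u = (THE v. weak_deriv i u v)"

lemma D_eqI: "weak_deriv i u v \<Longrightarrow> D i u = v"
  unfolding D_def using weak_deriv_unique by blast

lemma weak_deriv_D: "u \<in> H1 \<Longrightarrow> weak_deriv i u (D i u)"
  using D_eqI unfolding H1_def by fastforce

lemma H1I: "(\<And>i. weak_deriv i u (v i)) \<Longrightarrow> u \<in> H1"
  unfolding H1_def by blast

lemma H1_add: "u \<in> H1 \<Longrightarrow> v \<in> H1 \<Longrightarrow> u + v \<in> H1"
  by (rule H1I) (rule weak_deriv_add[OF weak_deriv_D weak_deriv_D])

lemma H1_scaleR: "u \<in> H1 \<Longrightarrow> r *\<^sub>R u \<in> H1"
  by (rule H1I) (rule weak_deriv_scaleR[OF weak_deriv_D])

lemma H1_zero: "0 \<in> H1" by (rule H1I) (rule weak_deriv_zero)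

lemma D_add: "u \<in> H1 \<Longrightarrow> v \<in> H1 \<Longrightarrow> D i (u + v) = D i u + D i v"
  by (rule D_eqI) (rule weak_deriv_add[OF weak_deriv_D weak_deriv_D])

lemma D_diff: "u \<in> H1 \<Longrightarrow> v \<in> H1 \<Longrightarrow> D i (u - v) = D i u - D i v"
  by (rule D_eqI) (rule weak_deriv_diff[OF weak_deriv_D weak_deriv_D])

lemma D_scaleR: "u \<in> H1 \<Longrightarrow> D i (r *\<^sub>R u) = r *\<^sub>R D i u"
  by (rule D_eqI) (rule weak_deriv_scaleR[OF weak_deriv_D])

lemma D_zero: "D i 0 = 0" by (rule D_eqI) (rule weak_deriv_zero)

lemma H1_test: "\<phi> \<in> test_functions \<Longrightarrow> cls \<phi> \<in> H1"
  by (rule H1I) (rule weak_deriv_test)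

lemma D_test: "\<phi> \<in> test_functions \<Longrightarrow> D i (cls \<phi>) = cls (partial i \<phi>)"
  by (rule D_eqI) (rule weak_deriv_test)

lemma D_closed:
  assumes "\<And>k. U k \<in> H1" "U \<longlonglongrightarrow> u" "\<And>i. (\<lambda>k. D i (U k)) \<longlonglongrightarrow> d i"
  shows "u \<in> H1" "D i u = d i"
proof -
  have w: "weak_deriv i u (d i)" for i by (rule weak_deriv_closed[OF weak_deriv_D[OF assms(1)] assms(2,3)])
  show "u \<in> H1" using w by (rule H1I)
  show "D i u = d i" using w by (rule D_eqI)
qed

text \<open>Density of test functions in the graph of the weak gradient, a closed subspace of a
  product Hilbert space. If (w, W) in the graph is orthogonal to all test graphs, moving the
  derivatives onto the test function shows that \<open>w\<close> pairs equally with \<phi> and with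
  its Laplacian, so \<open>helmholtz_orthogonal_zero\<close> gives w = 0, and W = 0 follows by
  uniqueness.\<close>

lemma H1_approx:
  fixes u :: "'n::finite l2"
  assumes u: "u \<in> H1"
  obtains \<phi> :: "nat \<Rightarrow> 'n cfun" where "\<And>k. \<phi> k \<in> test_functions" "(\<lambda>k. cls (\<phi> k)) \<longlonglongrightarrow> u"
    "\<And>i. (\<lambda>k. cls (partial i (\<phi> k))) \<longlonglongrightarrow> D i u"
proof -
  define G where "G = {p :: 'n l2 \<times> ('n l2 ^ 'n). \<forall>i. weak_deriv i (fst p) (snd p $ i)}"
  define emb where "emb \<phi> = (cls \<phi>, (\<chi> i. cls (partial i \<phi>)) :: ('n l2 ^ 'n))" for \<phi> :: "'n cfun"
  define T where "T = emb ` test_functions"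
  have "closure T = G"
  proof (rule closure_eq_if_orthogonal_zero)
    show "subspace T"
    proof (rule subspaceI)
      have "partial i (\<lambda>x. 0) = (\<lambda>x::real^'n. 0)" for i by (rule ext) simp
      then have "emb (\<lambda>x. 0) = 0" by (simp add: emb_def zero_prod_def zero_vec_def cls_zero)
      then show "0 \<in> T" unfolding T_def using test_zero by (metis imageI)
    next
      fix p q assume "p \<in> T" "q \<in> T"
      then obtain \<phi> \<psi> where \<phi>: "\<phi> \<in> test_functions" "\<psi> \<in> test_functions" "p = emb \<phi>" "q = emb \<psi>" unfolding T_def by blast
      have pa: "partial i (\<lambda>x. \<phi> x + \<psi> x) = (\<lambda>x. partial i \<phi> x + partial i \<psi> x)" for i
        by (intro ext partial_add test_differentiable \<phi>)
      have "p + q = emb (\<lambda>x. \<phi> x + \<psi> x)"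
        by (simp add: \<phi> emb_def cls_add pa test_L2 test_partial vec_eq_iff)
      then show "p + q \<in> T" unfolding T_def using test_add \<phi> by blast
    next
      fix c p assume "p \<in> T"
      then obtain \<phi> where \<phi>: "\<phi> \<in> test_functions" "p = emb \<phi>" unfolding T_def by blast
      have pa: "partial i (\<lambda>x. complex_of_real c * \<phi> x) = (\<lambda>x. complex_of_real c * partial i \<phi> x)" for i
        by (intro ext partial_cmult test_differentiable \<phi>)
      have "c *\<^sub>R p = emb (\<lambda>x. complex_of_real c * \<phi> x)"
        by (simp add: \<phi> emb_def cls_scaleR pa test_L2 test_partial vec_eq_iff)
      then show "c *\<^sub>R p \<in> T" unfolding T_def using test_cmult \<phi> by blast
    qed
    show "subspace G"
      by (rule subspaceI) (auto simp: G_def weak_deriv_zero weak_deriv_add weak_deriv_scaleR)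
    show "closed G" unfolding closed_sequential_limits
    proof (intro allI impI)
      fix X l assume "(\<forall>n. X n \<in> G) \<and> X \<longlonglongrightarrow> l"
      then have X: "\<And>n i. weak_deriv i (fst (X n)) (snd (X n) $ i)" "X \<longlonglongrightarrow> l" by (auto simp: G_def)
      show "l \<in> G" unfolding G_def
        using weak_deriv_closed[OF X(1) tendsto_fst[OF X(2)] tendsto_vec_nth[OF tendsto_snd[OF X(2)]]] by simp
    qed
    show "T \<subseteq> G" by (auto simp: T_def G_def emb_def weak_deriv_test)
    fix z assume z: "z \<in> G" "\<And>y. y \<in> T \<Longrightarrow> inner z y = 0"
    obtain w W where zw: "z = (w, W)" by (cases z)
    have wW: "weak_deriv i w (W $ i)" for i using z(1) by (simp add: G_def zw)
    have "w = 0"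
    proof (rule helmholtz_orthogonal_zero)
      fix \<phi> :: "'n cfun" assume \<phi>: "\<phi> \<in> test_functions"
      have "inner z (emb \<phi>) = 0" using z(2) \<phi> by (simp add: T_def)
      then have "inner w (cls \<phi>) = - (\<Sum>i\<in>UNIV. inner (W $ i) (cls (partial i \<phi>)))"
        by (simp add: zw emb_def inner_Pair inner_vec_def eq_neg_iff_add_eq_0)
      also have "\<dots> = (\<Sum>i\<in>UNIV. inner w (cls (partial i (partial i \<phi>))))"
        using wW test_partial[OF \<phi>] unfolding inner_cinner weak_deriv_def by (simp add: sum_negf[symmetric])
      also have "\<dots> = inner w (cls (\<lambda>x. \<Sum>i\<in>UNIV. partial i (partial i \<phi>) x))"
        by (subst cls_sum) (auto intro: test_L2 test_partial \<phi> simp: inner_sum_right)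
      finally show "inner w (cls \<phi>) = inner w (cls (\<lambda>x. \<Sum>i\<in>UNIV. partial i (partial i \<phi>) x))" .
    qed
    moreover from this have "W $ i = 0" for i using wW[of i] weak_deriv_unique weak_deriv_zero by blast
    ultimately show "z = 0" by (simp add: zw zero_prod_def vec_eq_iff)
  qed
  moreover have "(u, \<chi> i. D i u) \<in> G" using weak_deriv_D[OF u] by (simp add: G_def)
  ultimately have "(u, \<chi> i. D i u) \<in> closure T" by simp
  then obtain X where X: "\<And>k. X k \<in> T" "X \<longlonglongrightarrow> (u, \<chi> i. D i u)" unfolding closure_sequential by blast
  have "\<exists>\<psi>. \<psi> \<in> test_functions \<and> X k = emb \<psi>" for k using X(1)[of k] by (auto simp: T_def)
  then obtain \<phi> where \<phi>: "\<And>k. \<phi> k \<in> test_functions" "\<And>k. X k = emb (\<phi> k)" by metis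
  show thesis
  proof (rule that[OF \<phi>(1)])
    show "(\<lambda>k. cls (\<phi> k)) \<longlonglongrightarrow> u" using tendsto_fst[OF X(2)] by (simp add: \<phi> emb_def)
    show "(\<lambda>k. cls (partial i (\<phi> k))) \<longlonglongrightarrow> D i u" for i
      using tendsto_vec_nth[OF tendsto_snd[OF X(2)], of i] by (simp add: \<phi> emb_def)
  qed
qed

lemma cinner_D_left:
  assumes u: "u \<in> H1" and v: "v \<in> H1" shows "cinner (D i u) v = - cinner u (D i v)"
proof -
  obtain \<phi> where \<phi>: "\<And>k. \<phi> k \<in> test_functions" "(\<lambda>k. cls (\<phi> k)) \<longlonglongrightarrow> v"
    "\<And>i. (\<lambda>k. cls (partial i (\<phi> k))) \<longlonglongrightarrow> D i v" using H1_approx[OF v] by blast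
  have "(\<lambda>k. cinner (D i u) (cls (\<phi> k))) \<longlonglongrightarrow> cinner (D i u) v" by (intro cinner.tendsto tendsto_const \<phi>)
  moreover have "(\<lambda>k. - cinner u (cls (partial i (\<phi> k)))) \<longlonglongrightarrow> - cinner u (D i v)"
    by (intro tendsto_minus cinner.tendsto tendsto_const \<phi>)
  moreover have "(\<lambda>k. - cinner u (cls (partial i (\<phi> k)))) = (\<lambda>k. cinner (D i u) (cls (\<phi> k)))"
    using weak_deriv_D[OF u, of i] \<phi>(1) by (simp add: weak_deriv_def)
  ultimately show ?thesis using LIMSEQ_unique by metis
qed

text \<open>For a test function in the second slot both sides are minus the pairing of
  \<open>u\<close> with the same mixed derivative; density gives the rest. This version of commuting
  derivatives uses one derivative of each factor only, and it drives \<open>hessian_Lap\<close>,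
  \<open>swap_bound\<close> and \<open>principal_part\<close>.\<close>

lemma cinner_D_swap:
  assumes u: "u \<in> H1" and v: "v \<in> H1" shows "cinner (D i u) (D j v) = cinner (D j u) (D i v)"
proof -
  obtain \<phi> where \<phi>: "\<And>k. \<phi> k \<in> test_functions" "(\<lambda>k. cls (\<phi> k)) \<longlonglongrightarrow> v"
    "\<And>i. (\<lambda>k. cls (partial i (\<phi> k))) \<longlonglongrightarrow> D i v" using H1_approx[OF v] by blast
  have "cinner (D i u) (cls (partial j (\<phi> k))) = cinner (D j u) (cls (partial i (\<phi> k)))" for k
  proof -
    have "cinner (D i u) (cls (partial j (\<phi> k))) = - cinner u (cls (partial i (partial j (\<phi> k))))"
      using weak_deriv_D[OF u, of i] test_partial[OF \<phi>(1)] by (simp add: weak_deriv_def)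
    also have "partial i (partial j (\<phi> k)) = partial j (partial i (\<phi> k))"
      by (rule ext) (rule partial_commute[OF test_Ck[OF \<phi>(1)]])
    also have "- cinner u (cls (partial j (partial i (\<phi> k)))) = cinner (D j u) (cls (partial i (\<phi> k)))"
      using weak_deriv_D[OF u, of j] test_partial[OF \<phi>(1)] by (simp add: weak_deriv_def)
    finally show ?thesis .
  qed
  moreover have "(\<lambda>k. cinner (D i u) (cls (partial j (\<phi> k)))) \<longlonglongrightarrow> cinner (D i u) (D j v)" by (intro cinner.tendsto tendsto_const \<phi>)
  moreover have "(\<lambda>k. cinner (D j u) (cls (partial i (\<phi> k)))) \<longlonglongrightarrow> cinner (D j u) (D i v)" by (intro cinner.tendsto tendsto_const \<phi>)
  ultimately show ?thesis using LIMSEQ_unique by (metis (no_types, lifting) ext)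
qed

lemma Cb1_bdd_mult: "a \<in> Cb1 \<Longrightarrow> bdd_mult a"
  unfolding bdd_mult_def Cb1_def using Ck_continuous[of 1 a] continuous_lebesgue_measurable by blast

lemma Cb1_partial_bdd_mult: "a \<in> Cb1 \<Longrightarrow> bdd_mult (partial i a)"
  unfolding bdd_mult_def Cb1_def using Ck_partial[of 0 a] Ck_continuous[of 0 "partial i a"] continuous_lebesgue_measurable by auto

lemma Cb1_differentiable: "a \<in> Cb1 \<Longrightarrow> a differentiable (at x)"
  by (simp add: Cb1_def)

text \<open>For test functions the product is compactly supported and C^1, where the classical rule
  applies; both sides are continuous under the convergence supplied by
  \<open>H1_approx\<close>.\<close>

lemma Leibniz:
  assumes a: "a \<in> Cb1" and u: "u \<in> H1"
  shows "weak_deriv i (mul a u) (mul (partial i a) u + mul a (D i u))"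
proof -
  obtain \<phi> where \<phi>: "\<And>k. \<phi> k \<in> test_functions" "(\<lambda>k. cls (\<phi> k)) \<longlonglongrightarrow> u"
    "\<And>i. (\<lambda>k. cls (partial i (\<phi> k))) \<longlonglongrightarrow> D i u" using H1_approx[OF u] by blast
  have bma: "bdd_mult a" "bdd_mult (partial i a)" using Cb1_bdd_mult[OF a] Cb1_partial_bdd_mult[OF a] by auto
  show ?thesis
  proof (rule weak_deriv_closed[where U="\<lambda>k. mul a (cls (\<phi> k))"
        and V="\<lambda>k. mul (partial i a) (cls (\<phi> k)) + mul a (cls (partial i (\<phi> k)))"])
    fix k
    obtain K where K: "compact K" "\<And>x. x \<notin> K \<Longrightarrow> \<phi> k x = 0" using test_functionsE[OF \<phi>(1)] by blast
    have "weak_deriv i (cls (\<lambda>x. a x * \<phi> k x)) (cls (partial i (\<lambda>x. a x * \<phi> k x)))"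
      by (rule weak_deriv_C1[OF _ K(1)]) (use a test_Ck[OF \<phi>(1)] K(2) in \<open>auto simp: Cb1_def intro!: Ck_mult simp del: Ck.simps One_nat_def\<close>)
    also have "partial i (\<lambda>x. a x * \<phi> k x) = (\<lambda>x. a x * partial i (\<phi> k) x + partial i a x * \<phi> k x)"
      by (intro ext partial_mult Cb1_differentiable[OF a] test_differentiable \<phi>)
    also have "cls \<dots> = mul (partial i a) (cls (\<phi> k)) + mul a (cls (partial i (\<phi> k)))"
      using bma \<phi>(1) by (subst cls_add) (auto intro: L2_mult_bdd_mult test_L2 test_partial simp: mul_cls test_L2 test_partial)
    also have "cls (\<lambda>x. a x * \<phi> k x) = mul a (cls (\<phi> k))" using bma \<phi>(1) by (simp add: mul_cls test_L2)
    finally show "weak_deriv i (mul a (cls (\<phi> k))) (mul (partial i a) (cls (\<phi> k)) + mul a (cls (partial i (\<phi> k))))" .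
  qed (intro tendsto_add bounded_linear.tendsto[OF bounded_linear_mul] bma \<phi>)+
qed

lemma H1_mul: "a \<in> Cb1 \<Longrightarrow> u \<in> H1 \<Longrightarrow> mul a u \<in> H1"
  by (rule H1I) (rule Leibniz)

lemma D_mul: "a \<in> Cb1 \<Longrightarrow> u \<in> H1 \<Longrightarrow> D i (mul a u) = mul (partial i a) u + mul a (D i u)"
  by (rule D_eqI) (rule Leibniz)

subsection \<open>The Sobolev space \<open>H\<^sup>2\<close> and the Laplacian\<close>

definition H2 :: "('n::finite) l2 set" where
  "H2 = {u \<in> H1. \<forall>i. D i u \<in> H1}"

definition Lap :: "('n::finite) l2 \<Rightarrow> 'n l2" where
  "Lap u = (\<Sum>i\<in>UNIV. D i (D i u))"

lemma H2_H1: "u \<in> H2 \<Longrightarrow> u \<in> H1" and H2_D: "u \<in> H2 \<Longrightarrow> D i u \<in> H1"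
  by (auto simp: H2_def)

lemma subspace_H2: "subspace H2"
  by (rule subspaceI) (auto simp: H2_def H1_zero D_zero D_add D_scaleR intro: H1_add H1_scaleR)

lemma H2_diff: "u \<in> H2 \<Longrightarrow> v \<in> H2 \<Longrightarrow> u - v \<in> H2"
  by (rule subspace_diff[OF subspace_H2])

lemma Lap_diff: "u \<in> H2 \<Longrightarrow> v \<in> H2 \<Longrightarrow> Lap (u - v) = Lap u - Lap v"
  by (simp add: Lap_def D_diff H2_H1 H2_D sum_subtractf)

lemma D_commute: assumes "u \<in> H2" shows "D i (D j u) = D j (D i u)"
proof -
  have "D i (D j u) - D j (D i u) = 0"
  proof (rule cinner_test_zero)
    fix \<phi> :: "'a cfun" assume \<phi>: "\<phi> \<in> test_functions"
    have p: "partial i (partial j \<phi>) = partial j (partial i \<phi>)"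
      by (rule ext) (rule partial_commute[OF test_Ck[OF \<phi>]])
    have *: "cinner (D k (D l u)) (cls \<phi>) = cinner u (cls (partial l (partial k \<phi>)))" for k l
      using weak_deriv_D[OF H2_D[OF assms], of k l] weak_deriv_D[OF H2_H1[OF assms], of l] \<phi> test_partial[OF \<phi>, of k]
      unfolding weak_deriv_def by (metis minus_equation_iff)
    show "cinner (D i (D j u) - D j (D i u)) (cls \<phi>) = 0"
      by (simp add: cinner.diff_left * p)
  qed
  then show ?thesis by simp
qed

definition grad_sq :: "('n::finite) l2 \<Rightarrow> real" where
  "grad_sq u = (\<Sum>i\<in>UNIV. (norm (D i u))\<^sup>2)"

lemma grad_sq_nonneg: "grad_sq u \<ge> 0" by (simp add: grad_sq_def sum_nonneg)

lemma norm_D_le_grad_sq: "(norm (D i u))\<^sup>2 \<le> grad_sq u"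
  unfolding grad_sq_def by (rule member_le_sum) auto

lemma inner_D_left: "u \<in> H1 \<Longrightarrow> v \<in> H1 \<Longrightarrow> inner (D i u) v = - inner u (D i v)"
  by (simp add: inner_cinner cinner_D_left)

lemma inner_Lap: "u \<in> H2 \<Longrightarrow> inner (Lap u) u = - grad_sq u"
  by (simp add: Lap_def grad_sq_def inner_sum_left inner_D_left H2_D H2_H1 power2_norm_eq_inner sum_negf)

lemma grad_sq_le: "u \<in> H2 \<Longrightarrow> grad_sq u \<le> norm (Lap u) * norm u"
  using inner_Lap[of u] norm_cauchy_schwarz[of "- Lap u" u] by (simp add: inner_minus_left)

text \<open>Swapping one derivative between the factors turns
  \<open>inner (D i (D i u)) (D j (D j u))\<close> into a squared norm. Hence the Laplacian controls
  every second derivative, and the later estimates can be stated with \<open>norm u\<close> and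
  \<open>norm (Lap u)\<close> alone.\<close>

lemma hessian_Lap:
  assumes u: "u \<in> H2" shows "(\<Sum>j\<in>UNIV. grad_sq (D j u)) = (norm (Lap u))\<^sup>2"
proof -
  have *: "inner (D i (D i u)) (D j (D j u)) = (norm (D i (D j u)))\<^sup>2" for i j
    using cinner_D_swap[OF H2_D[OF u, of i] H2_D[OF u, of j], of i j] D_commute[OF u, of i j]
    by (simp add: inner_cinner power2_norm_eq_inner)
  have "(norm (Lap u))\<^sup>2 = (\<Sum>j\<in>UNIV. \<Sum>i\<in>UNIV. inner (D i (D i u)) (D j (D j u)))"
    unfolding power2_norm_eq_inner Lap_def by (simp add: inner_sum_left inner_sum_right)
  then show ?thesis by (simp add: * grad_sq_def)
qed

lemma norm_D2_le: assumes "u \<in> H2" shows "norm (D i (D j u)) \<le> norm (Lap u)"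
proof -
  have "(norm (D i (D j u)))\<^sup>2 \<le> grad_sq (D j u)" by (rule norm_D_le_grad_sq)
  also have "\<dots> \<le> (\<Sum>j\<in>UNIV. grad_sq (D j u))" by (rule member_le_sum) (auto simp: grad_sq_nonneg)
  finally show ?thesis unfolding hessian_Lap[OF assms] by (rule power2_le_imp_le) simp
qed

lemma norm_D_le: assumes "u \<in> H2" shows "norm (D i u) \<le> norm u + norm (Lap u)"
proof (rule power2_le_imp_le)
  have "(norm (D i u))\<^sup>2 \<le> norm (Lap u) * norm u" using norm_D_le_grad_sq grad_sq_le[OF assms] order_trans by blast
  also have "\<dots> \<le> (norm u + norm (Lap u))\<^sup>2" by (simp add: power2_sum)
  finally show "(norm (D i u))\<^sup>2 \<le> (norm u + norm (Lap u))\<^sup>2" .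
qed simp

lemma Cauchy_bound:
  assumes "Cauchy U" "Cauchy W" "\<And>m n. norm (Y m - Y n) \<le> norm (U m - U n) + norm (W m - W n)"
  shows "Cauchy (Y :: nat \<Rightarrow> 'a::real_normed_vector)"
proof (rule CauchyI)
  fix e :: real assume e: "e > 0"
  obtain M where M: "\<And>m n. m \<ge> M \<Longrightarrow> n \<ge> M \<Longrightarrow> norm (U m - U n) < e/2" using CauchyD[OF assms(1), of "e/2"] e by auto
  obtain N where N: "\<And>m n. m \<ge> N \<Longrightarrow> n \<ge> N \<Longrightarrow> norm (W m - W n) < e/2" using CauchyD[OF assms(2), of "e/2"] e by auto
  show "\<exists>M. \<forall>m\<ge>M. \<forall>n\<ge>M. norm (Y m - Y n) < e"
  proof (intro exI[of _ "max M N"] allI impI)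
    fix m n assume "max M N \<le> m" "max M N \<le> n"
    then show "norm (Y m - Y n) < e" using assms(3)[of m n] M[of m n] N[of m n] by simp
  qed
qed

text \<open>All derivatives up to order two are Cauchy, being controlled by the two given sequences,
  and weak derivatives are closed under limits.\<close>

lemma H2_complete:
  assumes U: "\<And>k. U k \<in> H2" and C: "Cauchy U" "Cauchy (\<lambda>k. Lap (U k))"
  obtains u where "u \<in> H2" "U \<longlonglongrightarrow> u" "(\<lambda>k. Lap (U k)) \<longlonglongrightarrow> Lap u"
proof -
  have c1: "Cauchy (\<lambda>k. D i (U k))" for i
    by (rule Cauchy_bound[OF C]) (simp add: D_diff[symmetric] Lap_diff[symmetric] H2_H1 U norm_D_le H2_diff)
  have c2: "Cauchy (\<lambda>k. D j (D i (U k)))" for i j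
    by (rule Cauchy_bound[OF C])
      (simp add: D_diff[symmetric] Lap_diff[symmetric] H2_H1 H2_D U norm_D2_le H2_diff add_increasing)
  obtain u where u: "U \<longlonglongrightarrow> u" using C(1) Cauchy_convergent convergent_def by blast
  have "\<forall>i. \<exists>d. (\<lambda>k. D i (U k)) \<longlonglongrightarrow> d" using c1 Cauchy_convergent convergent_def by blast
  then obtain d where d: "\<And>i. (\<lambda>k. D i (U k)) \<longlonglongrightarrow> d i" by metis
  have "\<forall>i j. \<exists>d. (\<lambda>k. D j (D i (U k))) \<longlonglongrightarrow> d" using c2 Cauchy_convergent convergent_def by blast
  then obtain dd where dd: "\<And>i j. (\<lambda>k. D j (D i (U k))) \<longlonglongrightarrow> dd i j" by metis
  have 1: "u \<in> H1" "D i u = d i" for i using D_closed[OF H2_H1[OF U] u d] by auto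
  have 2: "d i \<in> H1" "D j (d i) = dd i j" for i j using D_closed[OF H2_D[OF U] d dd] by auto
  show thesis
  proof
    show "u \<in> H2" using 1 2 by (simp add: H2_def)
    show "U \<longlonglongrightarrow> u" by fact
    show "(\<lambda>k. Lap (U k)) \<longlonglongrightarrow> Lap u" unfolding Lap_def 1 2 by (intro tendsto_sum dd)
  qed
qed

lemma H2_test: "\<phi> \<in> test_functions \<Longrightarrow> cls \<phi> \<in> H2"
  by (simp add: H2_def H1_test D_test test_partial)

lemma Lap_test: "\<phi> \<in> test_functions \<Longrightarrow> Lap (cls \<phi>) = cls (\<lambda>x. \<Sum>i\<in>UNIV. partial i (partial i \<phi>) x)"
  by (simp add: Lap_def D_test test_partial cls_sum test_L2)

lemma helmholtz_norm:
  assumes u: "u \<in> H2" shows "norm u \<le> norm (u - Lap u)" "norm (Lap u) \<le> 2 * norm (u - Lap u)"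
proof -
  have "(norm u)\<^sup>2 \<le> inner (u - Lap u) u"
    using inner_Lap[OF u] grad_sq_nonneg[of u] by (simp add: inner_diff_left power2_norm_eq_inner)
  also have "\<dots> \<le> norm (u - Lap u) * norm u" by (rule norm_cauchy_schwarz)
  finally show 1: "norm u \<le> norm (u - Lap u)"
    by (cases "norm u = 0") (auto simp: power2_eq_square)
  show "norm (Lap u) \<le> 2 * norm (u - Lap u)"
    using 1 norm_triangle_ineq4[of u "u - Lap u"] by simp
qed

text \<open>The range is dense because its orthogonal complement is covered by
  \<open>helmholtz_orthogonal_zero\<close>, and closed because \<open>helmholtz_norm\<close> makes
  preimages of a Cauchy sequence Cauchy in H^2.\<close>

lemma helmholtz_onto: "(\<lambda>u. u - Lap u) ` H2 = (UNIV :: 'n::finite l2 set)"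
proof -
  define T :: "'n l2 set" where "T = (\<lambda>\<phi>. cls \<phi> - Lap (cls \<phi>)) ` test_functions"
  have cl: "closure T = UNIV"
  proof (rule closure_eq_if_orthogonal_zero)
    show "subspace T"
    proof (rule subspaceI)
      show "0 \<in> T" unfolding T_def by (rule image_eqI[OF _ test_zero]) (simp add: cls_zero Lap_def D_zero)
    next
      fix p q assume "p \<in> T" "q \<in> T"
      then obtain \<phi> \<psi> where \<phi>: "\<phi> \<in> test_functions" "\<psi> \<in> test_functions"
        "p = cls \<phi> - Lap (cls \<phi>)" "q = cls \<psi> - Lap (cls \<psi>)" unfolding T_def by blast
      have "p + q = cls (\<lambda>x. \<phi> x + \<psi> x) - Lap (cls (\<lambda>x. \<phi> x + \<psi> x))"
        using \<phi> by (simp add: cls_add test_L2 Lap_def D_add H1_test D_test test_partial sum.distrib)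
      then show "p + q \<in> T" unfolding T_def using test_add \<phi> by blast
    next
      fix c p assume "p \<in> T"
      then obtain \<phi> where \<phi>: "\<phi> \<in> test_functions" "p = cls \<phi> - Lap (cls \<phi>)" unfolding T_def by blast
      have "c *\<^sub>R p = cls (\<lambda>x. complex_of_real c * \<phi> x) - Lap (cls (\<lambda>x. complex_of_real c * \<phi> x))"
        using \<phi> by (simp add: cls_scaleR test_L2 Lap_def D_scaleR H1_test D_test test_partial scaleR_sum_right scaleR_diff_right)
      then show "c *\<^sub>R p \<in> T" unfolding T_def using test_cmult \<phi> by blast
    qed
    fix z :: "'n l2" assume z: "\<And>y. y \<in> T \<Longrightarrow> inner z y = 0"
    show "z = 0"
    proof (rule helmholtz_orthogonal_zero)
      fix \<phi> :: "'n cfun" assume \<phi>: "\<phi> \<in> test_functions"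
      have "inner z (cls \<phi> - Lap (cls \<phi>)) = 0" using z \<phi> by (simp add: T_def)
      then show "inner z (cls \<phi>) = inner z (cls (\<lambda>x. \<Sum>i\<in>UNIV. partial i (partial i \<phi>) x))"
        by (simp add: inner_diff_right Lap_test[OF \<phi>])
    qed
  qed auto
  have "f \<in> (\<lambda>u. u - Lap u) ` H2" for f :: "'n l2"
  proof -
    have "f \<in> closure T" by (simp add: cl)
    then obtain X where X: "\<And>k. X k \<in> T" "X \<longlonglongrightarrow> f" unfolding closure_sequential by blast
    have "\<exists>u. u \<in> H2 \<and> X k = u - Lap u" for k using X(1)[of k] H2_test by (auto simp: T_def)
    then obtain U where U: "\<And>k. U k \<in> H2" "\<And>k. X k = U k - Lap (U k)" by metis
    have C: "Cauchy X" using X(2) by (rule LIMSEQ_imp_Cauchy)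
    have bnd: "norm (U m - U n) \<le> norm (X m - X n) + norm (X m - X n)"
         "norm (Lap (U m) - Lap (U n)) \<le> norm (X m - X n) + norm (X m - X n)" for m n
    proof -
      have "X m - X n = (U m - U n) - Lap (U m - U n)" by (simp add: U Lap_diff)
      then have eq: "norm (U m - U n - Lap (U m - U n)) = norm (X m - X n)" by simp
      show "norm (U m - U n) \<le> norm (X m - X n) + norm (X m - X n)"
         "norm (Lap (U m) - Lap (U n)) \<le> norm (X m - X n) + norm (X m - X n)"
        using helmholtz_norm[OF H2_diff[OF U(1) U(1)], of m n] norm_ge_zero[of "X m - X n"]
        unfolding Lap_diff[OF U(1) U(1), symmetric] eq by linarith+
    qed
    have "Cauchy U" by (rule Cauchy_bound[OF C C bnd(1)])
    moreover have "Cauchy (\<lambda>k. Lap (U k))" by (rule Cauchy_bound[OF C C bnd(2)])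
    ultimately obtain u where u: "u \<in> H2" "U \<longlonglongrightarrow> u" "(\<lambda>k. Lap (U k)) \<longlonglongrightarrow> Lap u"
      by (rule H2_complete[of U, OF U(1)])
    have "X \<longlonglongrightarrow> u - Lap u" unfolding U(2) by (intro tendsto_diff u)
    then have "f = u - Lap u" using X(2) LIMSEQ_unique by blast
    then show ?thesis using u(1) by blast
  qed
  then show ?thesis by blast
qed

subsection \<open>Second order operators on \<open>H\<^sup>2\<close>\<close>

definition grad_len :: "('n::finite) l2 \<Rightarrow> real" where "grad_len u = sqrt (grad_sq u)"

lemma grad_len_nonneg [simp]: "grad_len u \<ge> 0" by (simp add: grad_len_def grad_sq_nonneg)

lemma grad_len_sq: "(grad_len u)\<^sup>2 = grad_sq u" by (simp add: grad_len_def grad_sq_nonneg)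

lemma norm_D_le_grad_len: "norm (D i u) \<le> grad_len u"
  unfolding grad_len_def by (rule real_le_rsqrt) (rule norm_D_le_grad_sq)

lemma grad_len_D_le: "u \<in> H2 \<Longrightarrow> grad_len (D k u) \<le> norm (Lap u)"
  unfolding grad_len_def using hessian_Lap[of u]
  by (intro real_le_lsqrt) (auto intro!: member_le_sum simp: grad_sq_nonneg simp flip: hessian_Lap)

lemma finite_bdd_mult_bound:
  fixes m :: "'i::finite \<Rightarrow> 'n::finite cfun"
  assumes "\<And>i. bdd_mult (m i)"
  obtains M where "M \<ge> 0" "\<And>i x. cmod (m i x) \<le> M"
proof -
  have "\<forall>i. \<exists>B>0. \<forall>x. cmod (m i x) \<le> B" using bmE[OF assms] by metis
  then obtain B where B: "\<And>i. B i > 0" "\<And>i x. cmod (m i x) \<le> B i" by metis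
  show thesis
  proof (rule that[of "\<Sum>i\<in>UNIV. B i"])
    fix i x
    have "B i \<le> (\<Sum>i\<in>UNIV. B i)" using B(1) by (intro member_le_sum) (auto intro: less_imp_le)
    then show "cmod (m i x) \<le> (\<Sum>i\<in>UNIV. B i)" using B(2)[of i x] by linarith
  qed (simp add: sum_nonneg B less_imp_le)
qed

lemma cinner_mul_integral:
  assumes "bdd_mult m"
  shows "cinner (mul m u) v = (LINT x|lebesgue. m x * fn u x * cnj (fn v x))"
    and "integrable lebesgue (\<lambda>x. m x * fn u x * cnj (fn v x))"
proof -
  show "cinner (mul m u) v = (LINT x|lebesgue. m x * fn u x * cnj (fn v x))"
    unfolding cinner_def using fn_mul[OF assms, of u] bdd_mult_measurable[OF assms]
    by (intro integral_cong_AE) (auto elim!: eventually_mono)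
  show "integrable lebesgue (\<lambda>x. m x * fn u x * cnj (fn v x))"
    using L2_mult_cnj_integrable[OF L2_mult_bdd_mult[OF assms fn_L2[of u]] fn_L2[of v]] .
qed

text \<open>Adding the term with \<open>i\<close> and \<open>j\<close> exchanged leaves twice
  \<open>R i j\<close> times the real part of p_i times the conjugate of p_j, so imaginary parts of
  \<open>R\<close> drop out and the real hypothesis applies to the real and imaginary parts of
  \<open>p\<close> separately.\<close>

lemma elliptic_complex:
  fixes R :: "'n::finite \<Rightarrow> 'n \<Rightarrow> complex" and p :: "'n \<Rightarrow> complex"
  assumes "\<And>\<xi> :: real^'n. (\<Sum>i\<in>UNIV. \<Sum>j\<in>UNIV. Re (R i j) * \<xi> $ i * \<xi> $ j) \<ge> c * (norm \<xi>)\<^sup>2"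
  shows "(\<Sum>i\<in>UNIV. \<Sum>j\<in>UNIV. Re (R i j * p j * cnj (p i) + R i j * p i * cnj (p j)))
     \<ge> 2 * c * (\<Sum>i\<in>UNIV. (cmod (p i))\<^sup>2)"
proof -
  define \<xi> where "\<xi> = (\<chi> i. Re (p i))"
  define \<eta> where "\<eta> = (\<chi> i. Im (p i))"
  have "(\<Sum>i\<in>UNIV. \<Sum>j\<in>UNIV. Re (R i j * p j * cnj (p i) + R i j * p i * cnj (p j)))
     = 2 * (\<Sum>i\<in>UNIV. \<Sum>j\<in>UNIV. Re (R i j) * \<xi> $ i * \<xi> $ j) + 2 * (\<Sum>i\<in>UNIV. \<Sum>j\<in>UNIV. Re (R i j) * \<eta> $ i * \<eta> $ j)"
    by (simp add: \<xi>_def \<eta>_def sum_distrib_left sum.distrib[symmetric] algebra_simps)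
  moreover have "(norm \<xi>)\<^sup>2 + (norm \<eta>)\<^sup>2 = (\<Sum>i\<in>UNIV. (cmod (p i))\<^sup>2)"
    by (simp add: norm_vec_def L2_set_def sum_nonneg \<xi>_def \<eta>_def sum.distrib[symmetric] cmod_power2)
  ultimately show ?thesis using assms[of \<xi>] assms[of \<eta>]
    by (simp flip: \<open>_ = (\<Sum>i\<in>UNIV. (cmod (p i))\<^sup>2)\<close> add: algebra_simps)
qed

definition elliptic_cls ::
  "('n::finite \<Rightarrow> 'n \<Rightarrow> 'n cfun) \<Rightarrow> ('n \<Rightarrow> 'n cfun) \<Rightarrow> ('n l2 \<Rightarrow> 'n l2) \<Rightarrow> 'n l2 \<Rightarrow> 'n l2" where
  "elliptic_cls a b V u = - (\<Sum>i\<in>UNIV. \<Sum>j\<in>UNIV. D i (mul (a i j) (D j u))) + (\<Sum>j\<in>UNIV. mul (b j) (D j u)) + V u"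

text \<open>The potential enters as a map \<open>V\<close> on classes, since a relatively bounded
  multiplier is in general an unbounded operator: on H^2 it is known only through its additivity and
  its relative bound.\<close>

locale elliptic_l2 =
  fixes a :: "'n::finite \<Rightarrow> 'n \<Rightarrow> 'n cfun" and b :: "'n \<Rightarrow> 'n cfun" and V :: "'n l2 \<Rightarrow> 'n l2"
    and A :: "'n l2 \<Rightarrow> 'n l2" and c :: real
  assumes A_def: "A = elliptic_cls a b V"
    and a: "\<And>i j. a i j \<in> Cb1" and b: "\<And>j. bdd_mult (b j)" and c: "c > 0"
    and elliptic: "\<And>x (\<xi> :: real ^ 'n). (\<Sum>i\<in>UNIV. \<Sum>j\<in>UNIV. Re (a i j x) * \<xi> $ i * \<xi> $ j) \<ge> c * (norm \<xi>)\<^sup>2"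
    and V_diff: "\<And>u v. u \<in> H2 \<Longrightarrow> v \<in> H2 \<Longrightarrow> V (u - v) = V u - V v"
    and V_bound: "\<And>\<epsilon>. \<epsilon> > 0 \<Longrightarrow> \<exists>K. \<forall>u\<in>H2. norm (V u) \<le> \<epsilon> * norm (Lap u) + K * norm u"
    and accretive: "\<And>u. u \<in> H2 \<Longrightarrow> Re (cinner (A u) u) \<ge> 0"
begin

lemma a_bdd_mult: "bdd_mult (a i j)" "bdd_mult (partial k (a i j))"
  by (rule Cb1_bdd_mult[OF a], rule Cb1_partial_bdd_mult[OF a])

lemma coefficient_bound:
  obtains M where "M \<ge> 0" "\<And>i j x. cmod (a i j x) \<le> M" "\<And>i j k x. cmod (partial k (a i j) x) \<le> M" "\<And>j x. cmod (b j x) \<le> M"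
proof -
  obtain M1 where 1: "M1 \<ge> 0" "\<And>i x. cmod (a (fst i) (snd i) x) \<le> M1"
    using finite_bdd_mult_bound[of "\<lambda>i. a (fst i) (snd i)"] a_bdd_mult by blast
  obtain M2 where 2: "M2 \<ge> 0" "\<And>i x. cmod (partial (fst i) (a (fst (snd i)) (snd (snd i))) x) \<le> M2"
    using finite_bdd_mult_bound[of "\<lambda>i. partial (fst i) (a (fst (snd i)) (snd (snd i)))"] a_bdd_mult by blast
  obtain M3 where 3: "M3 \<ge> 0" "\<And>i x. cmod (b i x) \<le> M3"
    using finite_bdd_mult_bound[of b] b by blast
  show thesis
  proof (rule that[of "M1 + M2 + M3"])
    show "cmod (a i j x) \<le> M1 + M2 + M3" for i j x using 1(2)[of "(i,j)" x] 2(1) 3(1) by simp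
    show "cmod (partial k (a i j) x) \<le> M1 + M2 + M3" for i j k x using 2(2)[of "(k,i,j)" x] 1(1) 3(1) by simp
    show "cmod (b j x) \<le> M1 + M2 + M3" for j x using 3(2)[of j x] 1(1) 2(1) by simp
  qed (use 1 2 3 in simp)
qed

lemma A_diff: "u \<in> H2 \<Longrightarrow> v \<in> H2 \<Longrightarrow> A (u - v) = A u - A v"
  unfolding A_def elliptic_cls_def
  by (simp add: D_diff H2_H1 H2_D mul_diff a_bdd_mult b H1_mul a V_diff sum_subtractf)

lemma ellipticity_integrated:
  fixes p :: "'n \<Rightarrow> 'n l2"
  shows "(\<Sum>i\<in>UNIV. \<Sum>j\<in>UNIV. inner (mul (a i j) (p j)) (p i) + inner (mul (a i j) (p i)) (p j))
    \<ge> 2 * c * (\<Sum>i\<in>UNIV. (norm (p i))\<^sup>2)"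
proof -
  let ?F = "\<lambda>i j x. Re (a i j x * fn (p j) x * cnj (fn (p i) x) + a i j x * fn (p i) x * cnj (fn (p j) x))"
  have int: "integrable lebesgue (?F i j)" for i j
    by (intro integrable_Re Bochner_Integration.integrable_add cinner_mul_integral a_bdd_mult)
  have eq: "inner (mul (a i j) (p j)) (p i) + inner (mul (a i j) (p i)) (p j) = (LINT x|lebesgue. ?F i j x)" for i j
  proof -
    note 1 = cinner_mul_integral[OF a_bdd_mult(1), of i j "p j" "p i"] and 2 = cinner_mul_integral[OF a_bdd_mult(1), of i j "p i" "p j"]
    have "(LINT x|lebesgue. ?F i j x) = Re (LINT x|lebesgue. a i j x * fn (p j) x * cnj (fn (p i) x) + a i j x * fn (p i) x * cnj (fn (p j) x))"
      by (rule integral_Re) (intro Bochner_Integration.integrable_add 1 2)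
    then show ?thesis unfolding inner_cinner 1(1) 2(1) by (simp only: Bochner_Integration.integral_add[OF 1(2) 2(2)] plus_complex.sel)
  qed
  have "2 * c * (\<Sum>i\<in>UNIV. (norm (p i))\<^sup>2) = (LINT x|lebesgue. 2 * c * (\<Sum>i\<in>UNIV. (cmod (fn (p i) x))\<^sup>2))"
    by (simp add: norm_l2_sq L2_D(2))
  also have "\<dots> \<le> (LINT x|lebesgue. (\<Sum>i\<in>UNIV. \<Sum>j\<in>UNIV. ?F i j x))"
  proof (rule integral_mono)
    show "integrable lebesgue (\<lambda>x. \<Sum>i\<in>UNIV. \<Sum>j\<in>UNIV. ?F i j x)"
      by (intro Bochner_Integration.integrable_sum int)
    show "2 * c * (\<Sum>i\<in>UNIV. (cmod (fn (p i) x))\<^sup>2) \<le> (\<Sum>i\<in>UNIV. \<Sum>j\<in>UNIV. ?F i j x)" for x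
      by (rule elliptic_complex[OF elliptic])
  qed (simp add: L2_D(2))
  also have "\<dots> = (\<Sum>i\<in>UNIV. \<Sum>j\<in>UNIV. LINT x|lebesgue. ?F i j x)"
    using int by (simp only: Bochner_Integration.integral_sum Bochner_Integration.integrable_sum)
  finally show ?thesis by (simp only: eq)
qed

text \<open>Only the antisymmetric part of the coefficients is not controlled by the ellipticity
  condition; its contribution loses one derivative because second derivatives commute.\<close>

lemma swap_bound:
  assumes \<alpha>: "\<alpha> \<in> Cb1" and M: "\<And>k x. cmod (partial k \<alpha> x) \<le> M" and v: "v \<in> H1"
  shows "\<bar>inner (mul \<alpha> (D j v)) (D i v) - inner (mul \<alpha> (D i v)) (D j v)\<bar> \<le> 2 * M * norm v * grad_len v"
proof -
  have M0: "M \<ge> 0" using M norm_ge_zero order_trans by blast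
  have e: "mul \<alpha> (D k v) = D k (mul \<alpha> v) - mul (partial k \<alpha>) v" for k by (simp add: D_mul[OF \<alpha> v])
  have s: "inner (D j (mul \<alpha> v)) (D i v) = inner (D i (mul \<alpha> v)) (D j v)"
    by (simp add: inner_cinner cinner_D_swap[OF H1_mul[OF \<alpha> v] v])
  have b1: "\<bar>inner (mul (partial k \<alpha>) v) (D l v)\<bar> \<le> M * norm v * grad_len v" for k l
  proof -
    have "\<bar>inner (mul (partial k \<alpha>) v) (D l v)\<bar> \<le> norm (mul (partial k \<alpha>) v) * norm (D l v)"
      by (rule Cauchy_Schwarz_ineq2)
    also have "\<dots> \<le> (M * norm v) * grad_len v"
      using M0 by (intro mult_mono norm_mul_le Cb1_partial_bdd_mult \<alpha> M norm_D_le_grad_len) auto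
    finally show ?thesis .
  qed
  have "inner (mul \<alpha> (D j v)) (D i v) - inner (mul \<alpha> (D i v)) (D j v)
     = inner (mul (partial i \<alpha>) v) (D j v) - inner (mul (partial j \<alpha>) v) (D i v)"
    unfolding e inner_diff_left s by simp
  then show ?thesis using b1[of i j] b1[of j i] by linarith
qed

text \<open>\<open>swap_bound\<close> replaces the exchanged terms of
  \<open>ellipticity_integrated\<close> by the original ones. The error contains a single gradient
  factor, hence is of lower order than \<open>grad_sq v\<close>.\<close>

lemma Garding:
  assumes M: "\<And>i j k x. cmod (partial k (a i j) x) \<le> M" and v: "v \<in> H1"
  shows "(\<Sum>i\<in>UNIV. \<Sum>j\<in>UNIV. inner (mul (a i j) (D j v)) (D i v))
    \<ge> c * grad_sq v - (\<Sum>i\<in>(UNIV::'n set). \<Sum>j\<in>(UNIV::'n set). M) * norm v * grad_len v"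
proof -
  have "2 * c * grad_sq v \<le> (\<Sum>i\<in>UNIV. \<Sum>j\<in>UNIV. inner (mul (a i j) (D j v)) (D i v) + inner (mul (a i j) (D i v)) (D j v))"
    unfolding grad_sq_def by (rule ellipticity_integrated)
  also have "\<dots> \<le> (\<Sum>i\<in>UNIV. \<Sum>j\<in>UNIV. 2 * inner (mul (a i j) (D j v)) (D i v) + 2 * M * norm v * grad_len v)"
  proof (intro sum_mono)
    fix i j
    show "inner (mul (a i j) (D j v)) (D i v) + inner (mul (a i j) (D i v)) (D j v)
      \<le> 2 * inner (mul (a i j) (D j v)) (D i v) + 2 * M * norm v * grad_len v"
      using swap_bound[where \<alpha>="a i j" and i=i and j=j, OF a M v] by linarith
  qed
  also have "\<dots> = 2 * (\<Sum>i\<in>UNIV. \<Sum>j\<in>UNIV. inner (mul (a i j) (D j v)) (D i v)) + 2 * ((\<Sum>i\<in>(UNIV::'n set). \<Sum>j\<in>(UNIV::'n set). M) * norm v * grad_len v)"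
    by (simp add: sum.distrib sum_distrib_left)
  finally show ?thesis by linarith
qed

lemma lower_order_bound:
  assumes \<epsilon>: "\<epsilon> > 0"
  shows "\<exists>K. K \<ge> 0 \<and> (\<forall>u\<in>H2. norm ((\<Sum>j\<in>UNIV. mul (b j) (D j u)) + V u) \<le> K * grad_len u + \<epsilon> * norm (Lap u) + K * norm u)"
proof -
  obtain M where M: "M \<ge> 0" "\<And>j x. cmod (b j x) \<le> M" using coefficient_bound by metis
  obtain K where K: "\<And>u. u \<in> H2 \<Longrightarrow> norm (V u) \<le> \<epsilon> * norm (Lap u) + K * norm u" using V_bound[OF \<epsilon>] by blast
  define K' where "K' = real CARD('n) * M + \<bar>K\<bar>"
  have "0 \<le> real CARD('n) * M" using M(1) by simp
  then have K': "K' \<ge> 0" "real CARD('n) * M \<le> K'" "K \<le> K'" unfolding K'_def by linarith+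
  have "norm ((\<Sum>j\<in>UNIV. mul (b j) (D j u)) + V u) \<le> K' * grad_len u + \<epsilon> * norm (Lap u) + K' * norm u" if u: "u \<in> H2" for u
  proof -
    have "norm (\<Sum>j\<in>UNIV. mul (b j) (D j u)) \<le> (\<Sum>j\<in>(UNIV::'n set). M * grad_len u)"
    proof (rule sum_norm_le)
      fix j
      have "norm (mul (b j) (D j u)) \<le> M * norm (D j u)" by (rule norm_mul_le[OF b M(2)])
      also have "\<dots> \<le> M * grad_len u" by (intro mult_left_mono norm_D_le_grad_len M)
      finally show "norm (mul (b j) (D j u)) \<le> M * grad_len u" .
    qed
    also have "\<dots> = real CARD('n) * M * grad_len u" by simp
    also have "\<dots> \<le> K' * grad_len u" by (intro mult_right_mono K') simp
    finally have "norm (\<Sum>j\<in>UNIV. mul (b j) (D j u)) \<le> K' * grad_len u" .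
    moreover have "norm (V u) \<le> \<epsilon> * norm (Lap u) + K' * norm u"
      using K[OF u] mult_right_mono[OF K'(3) norm_ge_zero[of u]] by linarith
    ultimately show ?thesis using norm_triangle_ineq[of "\<Sum>j\<in>UNIV. mul (b j) (D j u)" "V u"] by linarith
  qed
  then show ?thesis using K' by blast
qed

lemma grad_len_interpolation:
  assumes "u \<in> H2" "\<delta> > 0" shows "grad_len u \<le> \<delta> * norm (Lap u) + norm u / \<delta>"
proof (rule power2_le_imp_le)
  have "(grad_len u)\<^sup>2 \<le> norm (Lap u) * norm u" using grad_sq_le[OF assms(1)] by (simp add: grad_len_sq)
  also have "\<dots> = (\<delta> * norm (Lap u)) * (norm u / \<delta>)" using assms(2) by simp
  also have "\<dots> \<le> (\<delta> * norm (Lap u) + norm u / \<delta>)\<^sup>2"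
  proof -
    have nn: "0 \<le> \<delta> * norm (Lap u)" "0 \<le> norm u / \<delta>" using assms(2) by auto
    have "x * y \<le> (x + y)\<^sup>2" if "0 \<le> x" "0 \<le> y" for x y :: real
      using that by (simp add: power2_sum)
    from this[OF nn] show ?thesis .
  qed
  finally show "(grad_len u)\<^sup>2 \<le> (\<delta> * norm (Lap u) + norm u / \<delta>)\<^sup>2" .
qed (use assms in auto)

text \<open>Exchanging \<open>D i\<close> and \<open>D k\<close> between the factors produces, for
  each \<open>k\<close>, the principal form of \<open>D k u\<close>, to which \<open>Garding\<close>
  applies, plus a term in which \<open>D k\<close> falls on the coefficients. Each of the two
  contributes one copy of the error, whence the factor 2.\<close>

lemma principal_part:
  assumes M: "M \<ge> 0" "\<And>i j k x. cmod (partial k (a i j) x) \<le> M" and u: "u \<in> H2"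
  shows "inner (\<Sum>i\<in>UNIV. \<Sum>j\<in>UNIV. D i (mul (a i j) (D j u))) (Lap u)
    \<ge> c * (norm (Lap u))\<^sup>2 - 2 * (\<Sum>k\<in>(UNIV::'n set). \<Sum>i\<in>(UNIV::'n set). \<Sum>j\<in>(UNIV::'n set). M) * grad_len u * norm (Lap u)"
proof -
  let ?X = "norm (Lap u)"
  have e: "inner (D i (mul (a i j) (D j u))) (D k (D k u))
     = inner (mul (a i j) (D j (D k u))) (D i (D k u)) + inner (mul (partial k (a i j)) (D j u)) (D i (D k u))" for i j k
  proof -
    have "inner (D i (mul (a i j) (D j u))) (D k (D k u)) = inner (D k (mul (a i j) (D j u))) (D i (D k u))"
      unfolding inner_cinner by (simp add: cinner_D_swap[OF H1_mul[OF a H2_D[OF u]] H2_D[OF u]])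
    then show ?thesis by (simp add: D_mul[OF a H2_D[OF u]] inner_add_left D_commute[OF u, of k j])
  qed
  have lo: "- (M * grad_len u * ?X) \<le> inner (mul (partial k (a i j)) (D j u)) (D i (D k u))" for i j k
  proof -
    have "\<bar>inner (mul (partial k (a i j)) (D j u)) (D i (D k u))\<bar> \<le> norm (mul (partial k (a i j)) (D j u)) * norm (D i (D k u))"
      by (rule Cauchy_Schwarz_ineq2)
    also have "\<dots> \<le> (M * norm (D j u)) * ?X"
      using M(1) by (intro mult_mono norm_mul_le a_bdd_mult M(2) norm_D2_le u) auto
    also have "\<dots> \<le> (M * grad_len u) * ?X"
      by (intro mult_right_mono mult_left_mono M norm_D_le_grad_len) auto
    finally show ?thesis by linarith
  qed
  let ?N = "\<Sum>i\<in>(UNIV::'n set). \<Sum>j\<in>(UNIV::'n set). M"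
  have N: "?N \<ge> 0" using M(1) by (intro sum_nonneg)
  have "inner (\<Sum>i\<in>UNIV. \<Sum>j\<in>UNIV. D i (mul (a i j) (D j u))) (Lap u)
    = (\<Sum>k\<in>UNIV. \<Sum>i\<in>UNIV. \<Sum>j\<in>UNIV. inner (mul (a i j) (D j (D k u))) (D i (D k u)) + inner (mul (partial k (a i j)) (D j u)) (D i (D k u)))"
    unfolding Lap_def inner_sum_left inner_sum_right e by simp
  also have "\<dots> = (\<Sum>k\<in>UNIV. (\<Sum>i\<in>UNIV. \<Sum>j\<in>UNIV. inner (mul (a i j) (D j (D k u))) (D i (D k u)))
      + (\<Sum>i\<in>UNIV. \<Sum>j\<in>UNIV. inner (mul (partial k (a i j)) (D j u)) (D i (D k u))))"
    by (simp add: sum.distrib)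
  also have "\<dots> \<ge> (\<Sum>k\<in>UNIV. (c * grad_sq (D k u) - ?N * grad_len u * ?X) + (\<Sum>i\<in>(UNIV::'n set). \<Sum>j\<in>(UNIV::'n set). - (M * grad_len u * ?X)))"
  proof (intro sum_mono add_mono lo)
    fix k
    have "norm (D k u) * grad_len (D k u) \<le> grad_len u * ?X"
      by (intro mult_mono norm_D_le_grad_len grad_len_D_le u) auto
    then have "?N * norm (D k u) * grad_len (D k u) \<le> ?N * grad_len u * ?X"
      using mult_left_mono[OF _ N, of "norm (D k u) * grad_len (D k u)" "grad_len u * ?X"] by (simp only: mult.assoc)
    then show "c * grad_sq (D k u) - ?N * grad_len u * ?X \<le> (\<Sum>i\<in>UNIV. \<Sum>j\<in>UNIV. inner (mul (a i j) (D j (D k u))) (D i (D k u)))"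
      using Garding[OF M(2) H2_D[OF u], of k] by linarith
  qed
  also have "(\<Sum>k\<in>UNIV. (c * grad_sq (D k u) - ?N * grad_len u * ?X) + (\<Sum>i\<in>(UNIV::'n set). \<Sum>j\<in>(UNIV::'n set). - (M * grad_len u * ?X)))
     = c * ?X\<^sup>2 - 2 * (\<Sum>k\<in>(UNIV::'n set). ?N) * grad_len u * ?X"
    unfolding hessian_Lap[OF u, symmetric] by (simp add: sum.distrib sum_subtractf sum_distrib_left algebra_simps)
  finally show ?thesis .
qed

text \<open>Of the constant \<open>c\<close> from \<open>principal_part\<close>, one quarter is
  spent on the relative bound of the potential and another on the gradient terms, which
  interpolation splits between \<open>norm (Lap u)\<close> and \<open>norm u\<close>.\<close>

lemma a_priori_inner:
  "\<exists>K\<ge>0. \<forall>u\<in>H2. inner (A u) (- Lap u) \<ge> c / 2 * (norm (Lap u))\<^sup>2 - K * norm (Lap u) * norm u"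
proof -
  obtain M where M: "M \<ge> 0" "\<And>i j k x. cmod (partial k (a i j) x) \<le> M" using coefficient_bound by metis
  define C where "C = 2 * (\<Sum>k\<in>(UNIV::'n set). \<Sum>i\<in>(UNIV::'n set). \<Sum>j\<in>(UNIV::'n set). M)"
  have C: "C \<ge> 0" using M(1) by (simp add: C_def sum_nonneg)
  have "c / 4 > 0" using c by simp
  from lower_order_bound[OF this] obtain L where L: "L \<ge> 0" "\<And>u. u \<in> H2 \<Longrightarrow>
      norm ((\<Sum>j\<in>UNIV. mul (b j) (D j u)) + V u) \<le> L * grad_len u + c / 4 * norm (Lap u) + L * norm u" by blast
  \<comment> \<open>The interpolation parameter is tuned so that
    \<open>(C + L) * \<delta> \<le> c / 4\<close>; the added 1 keeps the denominator
    positive.\<close>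
  define \<delta> where "\<delta> = c / 4 / (C + L + 1)"
  have \<delta>: "\<delta> > 0" "(C + L) * \<delta> \<le> c / 4" using c C L(1) by (auto simp: \<delta>_def field_simps)
  have "inner (A u) (- Lap u) \<ge> c / 2 * (norm (Lap u))\<^sup>2 - (L + (C + L) / \<delta>) * norm (Lap u) * norm u" if u: "u \<in> H2" for u
  proof -
    let ?X = "norm (Lap u)" and ?B = "(\<Sum>j\<in>UNIV. mul (b j) (D j u)) + V u"
    let ?P = "\<Sum>i\<in>UNIV. \<Sum>j\<in>UNIV. D i (mul (a i j) (D j u))"
    have "inner (A u) (- Lap u) = inner ?P (Lap u) - inner ?B (Lap u)"
      by (simp add: A_def elliptic_cls_def inner_add_left inner_minus_left inner_diff_left inner_minus_right)
    moreover have "inner ?P (Lap u) \<ge> c * ?X\<^sup>2 - C * grad_len u * ?X" using principal_part[OF M u] by (simp add: C_def)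
    moreover have "inner ?B (Lap u) \<le> (L * grad_len u + c / 4 * ?X + L * norm u) * ?X"
      using norm_cauchy_schwarz[of ?B "Lap u"] mult_right_mono[OF L(2)[OF u] norm_ge_zero[of "Lap u"]] by linarith
    moreover have "(C + L) * grad_len u * ?X \<le> (c / 4 * ?X + (C + L) / \<delta> * norm u) * ?X"
    proof (intro mult_right_mono)
      have "(C + L) * grad_len u \<le> (C + L) * (\<delta> * ?X + norm u / \<delta>)"
        using C L(1) by (intro mult_left_mono grad_len_interpolation u \<delta>) auto
      also have "\<dots> = ((C + L) * \<delta>) * ?X + (C + L) / \<delta> * norm u" by (simp add: algebra_simps)
      also have "\<dots> \<le> c / 4 * ?X + (C + L) / \<delta> * norm u" by (intro add_mono mult_right_mono \<delta>) auto
      finally show "(C + L) * grad_len u \<le> c / 4 * ?X + (C + L) / \<delta> * norm u" .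
    qed simp
    ultimately show ?thesis by (simp add: algebra_simps power2_eq_square)
  qed
  moreover have "L + (C + L) / \<delta> \<ge> 0" using L(1) C \<delta>(1) by simp
  ultimately show ?thesis by blast
qed

lemma A_bound: "\<exists>K\<ge>0. \<forall>u\<in>H2. norm (A u) \<le> K * (norm u + norm (Lap u))"
proof -
  obtain M where M: "M \<ge> 0" "\<And>i j x. cmod (a i j x) \<le> M" "\<And>i j k x. cmod (partial k (a i j) x) \<le> M" using coefficient_bound by metis
  obtain L where L: "L \<ge> 0" "\<And>u. u \<in> H2 \<Longrightarrow>
      norm ((\<Sum>j\<in>UNIV. mul (b j) (D j u)) + V u) \<le> L * grad_len u + 1 * norm (Lap u) + L * norm u" 
    using lower_order_bound[of 1] by auto
  define K where "K = 2 * (real CARD('n) * (real CARD('n) * M)) + 2 * L + 1"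
  have "norm (A u) \<le> K * (norm u + norm (Lap u))" if u: "u \<in> H2" for u
  proof -
    let ?S = "norm u + norm (Lap u)"
    have g: "grad_len u \<le> ?S" using grad_len_interpolation[OF u, of 1] by simp
    have "norm (D i (mul (a i j) (D j u))) \<le> 2 * M * ?S" for i j
    proof -
      have "norm (D i (mul (a i j) (D j u))) \<le> norm (mul (partial i (a i j)) (D j u)) + norm (mul (a i j) (D i (D j u)))"
        unfolding D_mul[OF a H2_D[OF u]] by (rule norm_triangle_ineq)
      also have "\<dots> \<le> M * norm (D j u) + M * norm (D i (D j u))"
        by (intro add_mono norm_mul_le a_bdd_mult M)
      also have "\<dots> \<le> M * ?S + M * ?S"
        using norm_D_le[OF u, of j] norm_D2_le[OF u, of i j] M(1) by (intro add_mono mult_left_mono) (auto intro: order_trans)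
      finally show ?thesis by simp
    qed
    then have "norm (\<Sum>i\<in>UNIV. \<Sum>j\<in>UNIV. D i (mul (a i j) (D j u))) \<le> (\<Sum>i\<in>(UNIV::'n set). \<Sum>j\<in>(UNIV::'n set). 2 * M * ?S)"
      by (intro sum_norm_le)
    also have "\<dots> = 2 * (real CARD('n) * (real CARD('n) * M)) * ?S" by simp
    finally have 1: "norm (\<Sum>i\<in>UNIV. \<Sum>j\<in>UNIV. D i (mul (a i j) (D j u))) \<le> 2 * (real CARD('n) * (real CARD('n) * M)) * ?S" .
    have "L * grad_len u + 1 * norm (Lap u) + L * norm u \<le> L * ?S + 1 * ?S + L * ?S"
      using L(1) g by (intro add_mono mult_left_mono) auto
    then have 2: "norm ((\<Sum>j\<in>UNIV. mul (b j) (D j u)) + V u) \<le> (2 * L + 1) * ?S" using L(2)[OF u] by (simp add: algebra_simps)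
    have "A u = (\<Sum>j\<in>UNIV. mul (b j) (D j u)) + V u - (\<Sum>i\<in>UNIV. \<Sum>j\<in>UNIV. D i (mul (a i j) (D j u)))"
      by (simp add: A_def elliptic_cls_def)
    then have "norm (A u) \<le> norm ((\<Sum>j\<in>UNIV. mul (b j) (D j u)) + V u) + norm (\<Sum>i\<in>UNIV. \<Sum>j\<in>UNIV. D i (mul (a i j) (D j u)))"
      by (simp add: norm_triangle_ineq4)
    then show ?thesis using 1 2 unfolding K_def by (simp add: algebra_simps)
  qed
  moreover have "K \<ge> 0" using M(1) L(1) by (simp add: K_def)
  ultimately show ?thesis by blast
qed

text \<open>Divide \<open>a_priori_inner\<close> by \<open>norm (Lap u)\<close>. The graph norm of
  \<open>A\<close> thus dominates the norm of H^2, which yields closedness of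
  \<open>A\<close>.\<close>

lemma Lap_bound: "\<exists>K\<ge>0. \<forall>u\<in>H2. norm (Lap u) \<le> K * (norm (A u) + norm u)"
proof -
  obtain K where K: "K \<ge> 0" "\<And>u. u \<in> H2 \<Longrightarrow> inner (A u) (- Lap u) \<ge> c / 2 * (norm (Lap u))\<^sup>2 - K * norm (Lap u) * norm u"
    using a_priori_inner by blast
  have "norm (Lap u) \<le> (2 * (1 + K) / c) * (norm (A u) + norm u)" if u: "u \<in> H2" for u
  proof (cases "norm (Lap u) = 0")
    case True then show ?thesis using K(1) c by simp
  next
    case False
    then have X: "norm (Lap u) > 0" by simp
    have "c / 2 * (norm (Lap u))\<^sup>2 \<le> norm (A u) * norm (Lap u) + K * norm (Lap u) * norm u"
      using K(2)[OF u] norm_cauchy_schwarz[of "A u" "- Lap u"] by simp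
    then have "(c / 2 * norm (Lap u)) * norm (Lap u) \<le> (norm (A u) + K * norm u) * norm (Lap u)"
      by (simp add: power2_eq_square algebra_simps)
    then have "c / 2 * norm (Lap u) \<le> norm (A u) + K * norm u" using X by simp
    also have "\<dots> \<le> (1 + K) * (norm (A u) + norm u)" using K(1) by (simp add: algebra_simps)
    finally show ?thesis using c by (simp add: field_simps)
  qed
  moreover have "2 * (1 + K) / c \<ge> 0" using K(1) c by simp
  ultimately show ?thesis by blast
qed

text \<open>Continuity from \<open>u - Lap u\<close> to \<open>A u + l *\<^sub>R u\<close>. Pairing
  the interpolated operator with \<open>u\<close> bounds \<open>norm u\<close>, by accretivity;
  pairing it with \<open>- Lap u\<close> bounds \<open>norm (Lap u)\<close>, by
  \<open>a_priori_inner\<close>. Both lower bounds hold at the two end points, hence for all convex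
  combinations uniformly in \<open>t\<close>.\<close>

lemma resolvent_onto:
  assumes l: "l > 0" shows "(\<lambda>u. A u + l *\<^sub>R u) ` H2 = UNIV"
proof -
  obtain K where K: "K \<ge> 0" "\<And>u. u \<in> H2 \<Longrightarrow> inner (A u) (- Lap u) \<ge> c / 2 * (norm (Lap u))\<^sup>2 - K * norm (Lap u) * norm u"
    using a_priori_inner by blast
  obtain L where L: "L \<ge> 0" "\<And>u. u \<in> H2 \<Longrightarrow> norm (A u) \<le> L * (norm u + norm (Lap u))" using A_bound by blast
  \<comment> \<open>\<open>l'\<close> and \<open>c'\<close> are the smaller of the coercivity
    constants at the two end points: 1 for the model operator, \<open>l\<close> and
    \<open>c / 2\<close> for the shifted \<open>A\<close>.\<close>
  define l' where "l' = min 1 l"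
  define c' where "c' = min 1 (c / 2)"
  have l': "l' > 0" "l' \<le> 1" "l' \<le> l" and c': "c' > 0" "c' \<le> 1" "c' \<le> c / 2" using l c by (auto simp: l'_def c'_def)
  define C where "C = (L + l + 1) * (1 / l' + (1 + K / l') / c')"
  show ?thesis
  proof (rule continuity_method[where P="\<lambda>u. u - Lap u" and K=C and S=H2])
    show "subspace H2" by (rule subspace_H2)
    show "(\<lambda>u. u - Lap u) ` H2 = UNIV" by (rule helmholtz_onto)
    fix t and u :: "'n l2" assume t: "(0::real) \<le> t" "t \<le> 1" and u: "u \<in> H2"
    define m where "m = (1 - t) *\<^sub>R (u - Lap u) + t *\<^sub>R (A u + l *\<^sub>R u)"
    let ?X = "norm (Lap u)" and ?Y = "norm u"
    have "l' * ?Y\<^sup>2 \<le> inner m u"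
    proof -
      have "inner m u = (1 - t) * (?Y\<^sup>2 + grad_sq u) + t * (inner (A u) u + l * ?Y\<^sup>2)"
        unfolding m_def by (simp add: inner_add_left inner_diff_left inner_Lap[OF u] power2_norm_eq_inner)
      moreover have "(1 - t) * (?Y\<^sup>2 + grad_sq u) \<ge> (1 - t) * (l' * ?Y\<^sup>2)"
        using t l' grad_sq_nonneg[of u] mult_right_mono[of l' 1 "?Y\<^sup>2"] by (intro mult_left_mono) auto
      moreover have "t * (inner (A u) u + l * ?Y\<^sup>2) \<ge> t * (l' * ?Y\<^sup>2)"
        using t l' accretive[OF u] mult_right_mono[of l' l "?Y\<^sup>2"] by (intro mult_left_mono) (auto simp: inner_cinner)
      ultimately show ?thesis by (simp add: algebra_simps)
    qed
    also have "\<dots> \<le> norm m * ?Y" by (rule norm_cauchy_schwarz)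
    finally have "(l' * ?Y) * ?Y \<le> norm m * ?Y" by (simp add: power2_eq_square algebra_simps)
    then have "l' * ?Y \<le> norm m" by (cases "?Y = 0") (auto simp: mult_le_cancel_right)
    then have Y: "?Y \<le> (1 / l') * norm m" using l' by (simp add: field_simps)
    have "c' * ?X\<^sup>2 - K * ?X * ?Y \<le> inner m (- Lap u)"
    proof -
      have e: "inner m (- Lap u) = (1 - t) * (grad_sq u + ?X\<^sup>2) + t * (inner (A u) (- Lap u) + l * grad_sq u)"
        unfolding m_def using inner_Lap[OF u]
        by (simp add: inner_add_left inner_diff_left power2_norm_eq_inner inner_commute[of u] algebra_simps)
      have KXY: "K * ?X * ?Y \<ge> 0" using K(1) by simp
      have "(1 - t) * (grad_sq u + ?X\<^sup>2) \<ge> (1 - t) * (c' * ?X\<^sup>2 - K * ?X * ?Y)"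
        using t KXY grad_sq_nonneg[of u] mult_right_mono[OF c'(2), of "?X\<^sup>2"] by (intro mult_left_mono) auto
      moreover have "t * (inner (A u) (- Lap u) + l * grad_sq u) \<ge> t * (c' * ?X\<^sup>2 - K * ?X * ?Y)"
      proof (intro mult_left_mono t)
        have "l * grad_sq u \<ge> 0" using l grad_sq_nonneg[of u] by simp
        then show "c' * ?X\<^sup>2 - K * ?X * ?Y \<le> inner (A u) (- Lap u) + l * grad_sq u"
          using K(2)[OF u] mult_right_mono[OF c'(3), of "?X\<^sup>2"] by simp
      qed
      ultimately show ?thesis unfolding e by (simp add: algebra_simps)
    qed
    also have "\<dots> \<le> norm m * ?X" using norm_cauchy_schwarz[of m "- Lap u"] by simp
    finally have "(c' * ?X) * ?X \<le> (norm m + K * ?Y) * ?X" by (simp add: power2_eq_square algebra_simps)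
    then have "c' * ?X \<le> norm m + K * ?Y" using K(1) by (cases "?X = 0") (auto simp: mult_le_cancel_right)
    also have "\<dots> \<le> norm m + K * ((1 / l') * norm m)" by (intro add_left_mono mult_left_mono Y K)
    finally have X: "?X \<le> ((1 + K / l') / c') * norm m" using c' by (simp add: field_simps)
    have "norm ((A u + l *\<^sub>R u) - (u - Lap u)) \<le> norm (A u) + (l + 1) * ?Y + ?X"
    proof -
      have eq: "(A u + l *\<^sub>R u) - (u - Lap u) = (A u + (l - 1) *\<^sub>R u) + Lap u" by (simp add: algebra_simps)
      have "norm ((A u + l *\<^sub>R u) - (u - Lap u)) \<le> norm (A u) + \<bar>l - 1\<bar> * ?Y + ?X"
        unfolding eq
        using norm_triangle_ineq[of "A u + (l - 1) *\<^sub>R u" "Lap u"] norm_triangle_ineq[of "A u" "(l - 1) *\<^sub>R u"]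
        by simp
      moreover have "\<bar>l - 1\<bar> * ?Y \<le> (l + 1) * ?Y" using l by (intro mult_right_mono) auto
      ultimately show ?thesis by linarith
    qed
    also have "\<dots> \<le> L * (?Y + ?X) + (l + 1) * ?Y + (l + 1) * ?X"
      using L(2)[OF u] mult_right_mono[of 1 "l + 1" ?X] l by simp
    also have "\<dots> = (L + l + 1) * (?Y + ?X)" by (simp add: algebra_simps)
    also have "\<dots> \<le> (L + l + 1) * ((1 / l') * norm m + ((1 + K / l') / c') * norm m)"
      using L(1) l by (intro mult_left_mono add_mono X Y) auto
    also have "\<dots> = C * norm m" unfolding C_def by (simp only: mult.assoc distrib_right)
    finally show "norm ((A u + l *\<^sub>R u) - (u - Lap u)) \<le> C * norm ((1 - t) *\<^sub>R (u - Lap u) + t *\<^sub>R (A u + l *\<^sub>R u))"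
      unfolding m_def .
  qed (simp_all add: A_diff Lap_diff algebra_simps)
qed

end

subsection \<open>Weights\<close>

definition rb :: "real \<Rightarrow> real ^ 'n::finite \<Rightarrow> real" where
  "rb R x = sqrt (R\<^sup>2 + (norm x)\<^sup>2)"

lemma jbracket_rb: "jbracket = rb 1"
  by (simp add: jbracket_def rb_def fun_eq_iff)

lemma rb_sq: "(rb R x)\<^sup>2 = R\<^sup>2 + (norm x)\<^sup>2" by (simp add: rb_def)

lemma rb_pos: "R > 0 \<Longrightarrow> rb R x > 0" by (simp add: rb_def add_pos_nonneg)

lemma rb_ge_R: "R \<ge> 0 \<Longrightarrow> R \<le> rb R x" unfolding rb_def by (rule real_le_rsqrt) simp

lemma rb_ge_norm: "norm x \<le> rb R x" unfolding rb_def by (rule real_le_rsqrt) simp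

lemma rb_ge_jbracket: "R \<ge> 1 \<Longrightarrow> jbracket x \<le> rb R x"
  by (simp add: jbracket_def rb_def)

lemma rb_le: "R \<ge> 0 \<Longrightarrow> rb R x \<le> R + norm x"
  unfolding rb_def by (rule real_le_lsqrt) (auto simp: power2_sum)

lemma jbracket_ge_1: "1 \<le> jbracket x" unfolding jbracket_rb by (rule rb_ge_R) simp

lemma rb_le_jbracket: assumes "R \<ge> 1" shows "rb R x \<le> R * jbracket x"
proof -
  have "1 * 1 \<le> R * R" using assms by (intro mult_mono) auto
  then have "1 * (norm x)\<^sup>2 \<le> R\<^sup>2 * (norm x)\<^sup>2" by (intro mult_right_mono) (auto simp: power2_eq_square)
  then have "R\<^sup>2 + (norm x)\<^sup>2 \<le> (R * jbracket x)\<^sup>2"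
    by (simp add: power_mult_distrib jbracket_def algebra_simps)
  then show ?thesis unfolding rb_def using assms jbracket_ge_1[of x] by (intro real_le_lsqrt) auto
qed

lemma continuous_rb: "continuous_on UNIV (rb R)"
  unfolding rb_def[abs_def] by (intro continuous_intros)

definition rw :: "real \<Rightarrow> real \<Rightarrow> 'n::finite cfun" where
  "rw R s x = complex_of_real (rb R x powr s)"

lemma rw_measurable [measurable, simp]: "R > 0 \<Longrightarrow> rw R s \<in> borel_measurable lebesgue"
  unfolding rw_def[abs_def]
  by (intro continuous_lebesgue_measurable continuous_intros continuous_rb) (auto simp: rb_pos less_imp_neq[symmetric] dest: rb_pos)

lemma cmod_rw: "cmod (rw R s x) = rb R x powr s" by (simp add: rw_def)

lemma rw_add: "R > 0 \<Longrightarrow> rw R s x * rw R t x = rw R (s + t) x"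
  by (simp add: rw_def powr_add)

lemma rw_nonzero: "R > 0 \<Longrightarrow> rw R s x \<noteq> 0" using rb_pos[of R x] by (simp add: rw_def)

lemma rw_zero: "R > 0 \<Longrightarrow> rw R 0 x = 1" using rb_pos[of R x] by (simp add: rw_def)

lemma cnj_rw: "cnj (rw R s x) = rw R s x" by (simp add: rw_def)

lemma rb_powr_le_1: "R \<ge> 1 \<Longrightarrow> s \<le> 0 \<Longrightarrow> rb R x powr s \<le> 1"
  using rb_ge_R[of R x] powr_mono[of s 0 "rb R x"] by simp

lemma bdd_mult_rw: "R \<ge> 1 \<Longrightarrow> s \<le> 0 \<Longrightarrow> bdd_mult (rw R s)"
  by (rule bmI[of _ 1]) (auto simp: cmod_rw rb_powr_le_1)

lemma L2_rw_mono:
  assumes R: "R \<ge> 1" and f: "f \<in> borel_measurable lebesgue" and L: "(\<lambda>x. rw R s x * f x) \<in> L2" and t: "t \<le> s"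
  shows "(\<lambda>x. rw R t x * f x) \<in> L2"
proof -
  have "(\<lambda>x. rw R (t - s) x * (rw R s x * f x)) \<in> L2"
    using t by (intro L2_mult_bdd_mult bdd_mult_rw R L) simp
  moreover have "rw R (t - s) x * (rw R s x * f x) = rw R t x * f x" for x
    using R rw_add[of R "t - s" x s] by (simp add: mult.assoc[symmetric])
  ultimately show ?thesis by simp
qed

text \<open>The function \<open>wt R \<delta> \<tau>\<close> regularises \<open>rb R x powr \<tau>\<close>: for \<open>\<delta> > 0\<close> it is bounded whatever the
  sign of \<open>\<tau>\<close>, and \<open>wt_log R \<delta> \<tau>\<close> is its logarithmic gradient.\<close>

definition wt :: "real \<Rightarrow> real \<Rightarrow> real \<Rightarrow> 'n::finite cfun" where
  "wt R \<delta> \<tau> x = complex_of_real ((1 / (rb R x)\<^sup>2 + \<delta>) powr (- \<tau> / 2))"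

definition wt_log :: "real \<Rightarrow> real \<Rightarrow> real \<Rightarrow> 'n::finite \<Rightarrow> 'n cfun" where
  "wt_log R \<delta> \<tau> i x = complex_of_real (\<tau> * x $ i / ((rb R x)\<^sup>2 + \<delta> * ((rb R x)\<^sup>2)\<^sup>2))"

context
  fixes R \<delta> \<tau> :: real
  assumes R: "R \<ge> 1" and \<delta>: "\<delta> \<ge> 0"
begin

lemma rb_sq_ge: "1 \<le> (rb R x)\<^sup>2"
  using rb_ge_R[of R x] R power_mono[of 1 "rb R x" 2] by simp

lemma rb_sq_derivative: "((\<lambda>x. (rb R x)\<^sup>2) has_derivative (\<lambda>h. 2 * inner x h)) (at x)"
  unfolding rb_sq power2_norm_eq_inner
  by (auto intro!: derivative_eq_intros simp: inner_commute)

lemma wt_derivative: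
  fixes x :: "real^'n::finite"
  shows "(wt R \<delta> \<tau> has_derivative (\<lambda>h. complex_of_real (\<tau> * inner x h / ((rb R x)\<^sup>2 + \<delta> * ((rb R x)\<^sup>2)\<^sup>2)) * wt R \<delta> \<tau> x)) (at x)"
proof -
  define S where "S x = (rb R x)\<^sup>2" for x :: "real^'n"
  have dS: "(S has_derivative (\<lambda>h. 2 * inner x h)) (at x)"
    unfolding S_def[abs_def] by (rule rb_sq_derivative)
  have s: "S x \<ge> 1" unfolding S_def by (rule rb_sq_ge)
  have pos: "1 / S x + \<delta> > 0" using s \<delta> by (intro add_pos_nonneg divide_pos_pos) auto
  have "((\<lambda>x. 1 / S x + \<delta>) has_derivative (\<lambda>h. - (2 * inner x h) / (S x)\<^sup>2)) (at x)"
    using s by (auto intro!: derivative_eq_intros dS simp: field_simps power2_eq_square)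
  then have d: "((\<lambda>x. (1 / S x + \<delta>) powr (- \<tau> / 2)) has_derivative
     (\<lambda>h. (1 / S x + \<delta>) powr (- \<tau> / 2) * (0 * ln (1 / S x + \<delta>) + (- (2 * inner x h) / (S x)\<^sup>2) * (- \<tau> / 2) / (1 / S x + \<delta>)))) (at x)"
    using pos by (intro has_derivative_powr) auto
  have "(S x)\<^sup>2 * (1 / S x + \<delta>) = S x + \<delta> * (S x)\<^sup>2" using s by (simp add: field_simps power2_eq_square)
  then have e: "(- (2 * inner x h) / (S x)\<^sup>2) * (- \<tau> / 2) / (1 / S x + \<delta>) = \<tau> * inner x h / (S x + \<delta> * (S x)\<^sup>2)" for h
    by (simp add: divide_divide_eq_left mult.commute)
  show ?thesis unfolding wt_def[abs_def] S_def[symmetric]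
    by (rule has_derivative_eq_rhs[OF bounded_linear.has_derivative[OF bounded_linear_of_real d[unfolded e]]])
      (simp add: fun_eq_iff mult.commute)
qed

lemma partial_wt: "partial i (wt R \<delta> \<tau>) x = wt_log R \<delta> \<tau> i x * wt R \<delta> \<tau> x"
  unfolding partial_eqI[OF wt_derivative] wt_log_def by (simp add: inner_axis)

lemma wt_log_derivative:
  fixes x :: "real^'n::finite"
  shows "(wt_log R \<delta> \<tau> i has_derivative (\<lambda>h. complex_of_real (\<tau> * (h $ i / ((rb R x)\<^sup>2 + \<delta> * ((rb R x)\<^sup>2)\<^sup>2)
     - x $ i * ((1 + 2 * \<delta> * (rb R x)\<^sup>2) * (2 * inner x h)) / ((rb R x)\<^sup>2 + \<delta> * ((rb R x)\<^sup>2)\<^sup>2)\<^sup>2)))) (at x)"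
proof -
  define S where "S x = (rb R x)\<^sup>2" for x :: "real^'n"
  have dS: "(S has_derivative (\<lambda>h. 2 * inner x h)) (at x)"
    unfolding S_def[abs_def] by (rule rb_sq_derivative)
  have s: "S x \<ge> 1" unfolding S_def by (rule rb_sq_ge)
  define q where "q x = S x + \<delta> * (S x)\<^sup>2" for x
  have q: "q x > 0" unfolding q_def using s \<delta> by (intro add_pos_nonneg) auto
  have dq: "(q has_derivative (\<lambda>h. (1 + 2 * \<delta> * S x) * (2 * inner x h))) (at x)"
    unfolding q_def[abs_def] by (auto intro!: derivative_eq_intros dS simp: algebra_simps power2_eq_square)
  have dx: "((\<lambda>x. x $ i) has_derivative (\<lambda>h. h $ i)) (at x)"
    by (rule bounded_linear_imp_has_derivative[OF bounded_linear_vec_nth])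
  have "((\<lambda>x. \<tau> * x $ i / q x) has_derivative
      (\<lambda>h. \<tau> * (h $ i / q x - x $ i * ((1 + 2 * \<delta> * S x) * (2 * inner x h)) / (q x)\<^sup>2))) (at x)"
    using q by (auto intro!: derivative_eq_intros dq dx simp: field_simps power2_eq_square)
  from bounded_linear.has_derivative[OF bounded_linear_of_real this] show ?thesis
    unfolding wt_log_def[abs_def] q_def S_def .
qed

lemma wt_denominator: "(rb R x)\<^sup>2 \<le> (rb R x)\<^sup>2 + \<delta> * ((rb R x)\<^sup>2)\<^sup>2" "1 \<le> (rb R x)\<^sup>2 + \<delta> * ((rb R x)\<^sup>2)\<^sup>2"
  using rb_sq_ge[of x] \<delta> by (auto simp: add_increasing2)

lemma cmod_wt_log: "cmod (wt_log R \<delta> \<tau> i x) \<le> \<bar>\<tau>\<bar> / rb R x"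
proof -
  have r: "rb R x > 0" by (rule rb_pos) (use R in simp)
  have "cmod (wt_log R \<delta> \<tau> i x) = \<bar>\<tau>\<bar> * \<bar>x $ i\<bar> / ((rb R x)\<^sup>2 + \<delta> * ((rb R x)\<^sup>2)\<^sup>2)"
    using wt_denominator(2)[of x] by (simp add: wt_log_def norm_divide norm_mult del: of_real_add of_real_mult of_real_divide of_real_power) (simp add: abs_mult)
  also have "\<dots> \<le> \<bar>\<tau>\<bar> * rb R x / (rb R x)\<^sup>2"
    using order_trans[OF component_le_norm_cart rb_ge_norm, of x i R] wt_denominator[of x] r
    by (intro frac_le mult_left_mono) auto
  also have "\<dots> = \<bar>\<tau>\<bar> / rb R x" using r by (simp add: power2_eq_square)
  finally show ?thesis .
qed

lemma wt_log_Cb1: "wt_log R \<delta> \<tau> i \<in> Cb1"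
proof -
  have dif: "wt_log R \<delta> \<tau> i differentiable (at x)" for x
    using wt_log_derivative by (rule differentiableI)
  have p: "partial k (wt_log R \<delta> \<tau> i) x = complex_of_real (\<tau> * (axis k 1 $ i / ((rb R x)\<^sup>2 + \<delta> * ((rb R x)\<^sup>2)\<^sup>2)
     - x $ i * ((1 + 2 * \<delta> * (rb R x)\<^sup>2) * (2 * x $ k)) / ((rb R x)\<^sup>2 + \<delta> * ((rb R x)\<^sup>2)\<^sup>2)\<^sup>2))" for k x
    unfolding partial_eqI[OF wt_log_derivative] by (simp add: inner_axis)
  have nz: "(rb R x)\<^sup>2 + \<delta> * ((rb R x)\<^sup>2)\<^sup>2 \<noteq> 0" for x using wt_denominator(2)[of x] by linarith
  have cont: "continuous_on UNIV (partial k (wt_log R \<delta> \<tau> i))" for k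
    unfolding p[abs_def] using nz by (intro continuous_intros continuous_rb) auto
  \<comment> \<open>The 5 is 1 from differentiating the numerator plus 4 from differentiating the
    denominator.\<close>
  have bd: "cmod (partial k (wt_log R \<delta> \<tau> i) x) \<le> \<bar>\<tau>\<bar> * 5" for k x
  proof -
    let ?s = "(rb R x)\<^sup>2"
    let ?q = "?s + \<delta> * ?s\<^sup>2"
    have 1: "\<bar>axis k 1 $ i / ?q\<bar> \<le> 1"
      using wt_denominator(2)[of x] by (auto simp: axis_def)
    have q: "?q = ?s * (1 + \<delta> * ?s)" by (simp add: algebra_simps power2_eq_square)
    have "\<bar>x $ i\<bar> \<le> rb R x" "\<bar>x $ k\<bar> \<le> rb R x"
      using order_trans[OF component_le_norm_cart rb_ge_norm] by blast+
    then have "\<bar>x $ i\<bar> * \<bar>x $ k\<bar> \<le> ?s" unfolding power2_eq_square by (intro mult_mono) auto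
    then have "\<bar>x $ i\<bar> * \<bar>x $ k\<bar> * (2 * (1 + 2 * \<delta> * ?s)) \<le> ?s * (4 * (1 + \<delta> * ?s))"
    proof (rule mult_mono)
      have "0 \<le> \<delta> * ?s" using \<delta> by simp
      then show "2 * (1 + 2 * \<delta> * ?s) \<le> 4 * (1 + \<delta> * ?s)" "0 \<le> 2 * (1 + 2 * \<delta> * ?s)" by simp_all
    qed auto
    also have "\<dots> = 4 * ?q" unfolding q by simp
    also have "\<dots> \<le> 4 * ?q\<^sup>2" by (intro mult_left_mono self_le_power wt_denominator) auto
    finally have le: "\<bar>x $ i\<bar> * \<bar>x $ k\<bar> * (2 * (1 + 2 * \<delta> * ?s)) / ?q\<^sup>2 \<le> 4"
      using wt_denominator(2)[of x] by (simp add: divide_le_eq)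
    have eq: "\<bar>x $ i * ((1 + 2 * \<delta> * ?s) * (2 * x $ k)) / ?q\<^sup>2\<bar> = \<bar>x $ i\<bar> * \<bar>x $ k\<bar> * (2 * (1 + 2 * \<delta> * ?s)) / ?q\<^sup>2"
      using \<delta> by (simp add: abs_mult)
    have 2: "\<bar>x $ i * ((1 + 2 * \<delta> * ?s) * (2 * x $ k)) / ?q\<^sup>2\<bar> \<le> 4" unfolding eq by (rule le)
    show ?thesis unfolding p norm_of_real abs_mult
      using 1 2 by (intro mult_left_mono) linarith+
  qed
  have b0: "cmod (wt_log R \<delta> \<tau> i x) \<le> \<bar>\<tau>\<bar>" for x
  proof -
    have "\<bar>\<tau>\<bar> / rb R x \<le> \<bar>\<tau>\<bar> / 1" using rb_ge_R[of R x] R by (intro divide_left_mono) auto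
    then show ?thesis using cmod_wt_log[of i x] by simp
  qed
  have "bounded (range (wt_log R \<delta> \<tau> i))"
    unfolding bounded_iff using b0 by (intro exI[of _ "\<bar>\<tau>\<bar>"]) auto
  moreover have "bounded (range (partial k (wt_log R \<delta> \<tau> i)))" for k
    unfolding bounded_iff using bd by (intro exI[of _ "\<bar>\<tau>\<bar> * 5"]) auto
  ultimately show ?thesis unfolding Cb1_def using dif cont by simp
qed

lemma cmod_wt: "cmod (wt R \<delta> \<tau> x) = (1 / (rb R x)\<^sup>2 + \<delta>) powr (- \<tau> / 2)"
  by (simp add: wt_def)

lemma rb_powr_eq: "rb R x powr \<tau> = (1 / (rb R x)\<^sup>2) powr (- \<tau> / 2)"
proof -
  have r: "rb R x > 0" by (rule rb_pos) (use R in simp)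
  then have "(1 / (rb R x)\<^sup>2) = rb R x powr (-2)" by (simp add: powr_minus powr_numeral inverse_eq_divide)
  then show ?thesis by (simp add: powr_powr)
qed

lemma wt_bounded:
  assumes "\<delta> > 0 \<or> \<tau> \<le> 0" obtains B where "\<And>x :: real^'n::finite. cmod (wt R \<delta> \<tau> x) \<le> B"
proof (cases "\<tau> \<le> 0")
  case True
  show thesis
  proof
    fix x :: "real^'n"
    have "1 / (rb R x)\<^sup>2 + \<delta> \<le> 1 + \<delta>" using rb_sq_ge[of x] by (simp add: divide_le_eq_1)
    then show "cmod (wt R \<delta> \<tau> x) \<le> (1 + \<delta>) powr (- \<tau> / 2)" unfolding cmod_wt
      using True \<delta> by (intro powr_mono2) auto
  qed
next
  case False
  then have d: "\<delta> > 0" using assms by simp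
  show thesis
  proof
    fix x :: "real^'n"
    show "cmod (wt R \<delta> \<tau> x) \<le> \<delta> powr (- \<tau> / 2)" unfolding cmod_wt
      using False d by (intro powr_mono2') auto
  qed
qed

lemma wt_Cb1: assumes "\<delta> > 0 \<or> \<tau> \<le> 0" shows "(wt R \<delta> \<tau> :: 'n::finite cfun) \<in> Cb1"
proof -
  obtain B where B: "\<And>x :: real^'n. cmod (wt R \<delta> \<tau> x) \<le> B" using wt_bounded[OF assms] by blast
  have dif: "(wt R \<delta> \<tau> :: 'n cfun) differentiable (at x)" for x
    using wt_derivative by (rule differentiableI)
  then have cw: "continuous_on UNIV (wt R \<delta> \<tau> :: 'n cfun)"
    by (intro continuous_at_imp_continuous_on ballI differentiable_imp_continuous_within)
  have ct: "continuous_on UNIV (wt_log R \<delta> \<tau> i :: 'n cfun)" for i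
    using Ck_continuous[of 1 "wt_log R \<delta> \<tau> i :: 'n cfun"] wt_log_Cb1[of i] unfolding Cb1_def by blast
  have p: "partial i (wt R \<delta> \<tau> :: 'n cfun) = (\<lambda>x. wt_log R \<delta> \<tau> i x * wt R \<delta> \<tau> x)" for i
    by (rule ext) (rule partial_wt)
  have "bdd_mult (wt R \<delta> \<tau> :: 'n cfun)" by (rule bmI[OF continuous_lebesgue_measurable[OF cw] B])
  moreover from this have "bdd_mult (\<lambda>x. wt_log R \<delta> \<tau> i x * wt R \<delta> \<tau> (x :: real^'n))" for i
    by (rule bdd_mult_mult[OF Cb1_bdd_mult[OF wt_log_Cb1]])
  moreover have "continuous_on UNIV (\<lambda>x. wt_log R \<delta> \<tau> i x * wt R \<delta> \<tau> (x :: real^'n))" for i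
    by (intro continuous_on_mult ct cw)
  ultimately show ?thesis unfolding Cb1_def mem_Collect_eq using dif by (simp add: p bdd_mult_def)
qed

text \<open>For nonnegative \<open>\<tau>\<close> the parameter \<open>\<delta>\<close> only lowers
  the weight, so bounds of the data by the unregularised weight are uniform in
  \<open>\<delta>\<close>.\<close>

lemma cmod_wt_le: "\<tau> \<ge> 0 \<or> \<delta> = 0 \<Longrightarrow> cmod (wt R \<delta> \<tau> x) \<le> rb R x powr \<tau>"
  unfolding cmod_wt rb_powr_eq using \<delta> rb_sq_ge[of x]
  by (cases "\<delta> = 0") (auto intro!: powr_mono2' simp: zero_less_divide_iff)

lemma cnj_wt: "cnj (wt R \<delta> \<tau> x) = wt R \<delta> \<tau> x" "cnj (wt_log R \<delta> \<tau> i x) = wt_log R \<delta> \<tau> i x"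
  by (simp_all add: wt_def wt_log_def)

text \<open>Write \<open>1 / rb R x\<close> as the product of the powers \<open>\<mu> - 1\<close>
  and \<open>- \<mu>\<close> of \<open>rb R x\<close>. Both exponents are nonpositive, so
  \<open>rb R x \<ge> R\<close> bounds the first factor and \<open>rb R x \<ge> jbracket x\<close>
  the second. This is how a large \<open>R\<close> pays for a large \<open>\<tau>\<close>.\<close>

lemma cmod_wt_log_le:
  assumes "\<mu> \<le> 1" "0 \<le> \<mu>" shows "cmod (wt_log R \<delta> \<tau> i x) \<le> \<bar>\<tau>\<bar> * R powr (\<mu> - 1) * cmod (rw 1 (- \<mu>) x)"
proof -
  have r: "rb R x > 0" "jbracket x > 0" "R > 0" using R rb_pos[of R x] jbracket_ge_1[of x] by auto
  have "\<bar>\<tau>\<bar> / rb R x = \<bar>\<tau>\<bar> * (rb R x powr (\<mu> - 1) * rb R x powr (- \<mu>))"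
  proof -
    have "rb R x powr (\<mu> - 1) * rb R x powr (- \<mu>) = rb R x powr (- 1)" unfolding powr_add[symmetric] by simp
    then show ?thesis using powr_neg_one[OF r(1)] by simp
  qed
  also have "\<dots> \<le> \<bar>\<tau>\<bar> * (R powr (\<mu> - 1) * jbracket x powr (- \<mu>))"
    using assms r R rb_ge_R[of R x] rb_ge_jbracket[OF R, of x]
    by (intro mult_left_mono mult_mono powr_mono2') auto
  finally show ?thesis using cmod_wt_log[of i x] by (simp add: cmod_rw jbracket_rb mult.assoc)
qed

end

lemma wt_zero: "R \<ge> 1 \<Longrightarrow> wt R 0 \<tau> x = rw R \<tau> x"
  by (simp add: wt_def rw_def rb_powr_eq[OF _ order_refl, where R=R and \<tau>=\<tau> and x=x])

lemma wt_tendsto: "R \<ge> 1 \<Longrightarrow> (\<lambda>k. wt R (1 / real k) \<tau> x) \<longlonglongrightarrow> rw R \<tau> x"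
proof -
  assume R: "R \<ge> 1"
  have "rb R x > 0" by (rule rb_pos) (use R in simp)
  then have "0 < 1 / (rb R x)\<^sup>2" by simp
  then have "(\<lambda>k. complex_of_real ((1 / (rb R x)\<^sup>2 + 1 / real k) powr (- \<tau> / 2))) \<longlonglongrightarrow> complex_of_real ((1 / (rb R x)\<^sup>2 + 0) powr (- \<tau> / 2))"
    by (intro tendsto_intros lim_1_over_n) auto
  then show ?thesis by (simp add: wt_def rw_def rb_powr_eq[OF R order_refl, where \<tau>=\<tau> and x=x])
qed

text \<open>A uniform norm bound survives pointwise limits even where norm convergence is unknown;
  this removes the regularisation of growing weights.\<close>

lemma L2_fatou:
  fixes g :: "nat \<Rightarrow> 'n::finite cfun"
  assumes g: "\<And>k. g k \<in> L2" "\<And>k. norm (cls (g k)) \<le> B" and lim: "\<And>x. (\<lambda>k. g k x) \<longlonglongrightarrow> f x"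
  shows "f \<in> L2" "norm (cls f) \<le> B"
proof -
  have fm: "f \<in> borel_measurable lebesgue" by (rule borel_measurable_LIMSEQ_metric[OF L2_D(1)[OF g(1)] lim])
  have B: "B \<ge> 0" using g(2)[of 0] norm_ge_zero order_trans by blast
  have nn: "(\<integral>\<^sup>+x. ennreal ((cmod (h x))\<^sup>2) \<partial>lebesgue) = ennreal ((norm (cls h))\<^sup>2)" if "h \<in> L2" for h :: "'n cfun"
  proof -
    have "AE x in lebesgue. ennreal ((cmod (h x))\<^sup>2) = ennreal ((cmod (fn (cls h) x))\<^sup>2)"
      using fn_cls[OF that] by eventually_elim simp
    then show ?thesis unfolding nn_norm_l2[symmetric] by (rule nn_integral_cong_AE)
  qed
  have "ennreal ((cmod (f x))\<^sup>2) = liminf (\<lambda>k. ennreal ((cmod (g k x))\<^sup>2))" for x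
  proof -
    have "(\<lambda>k. ennreal ((cmod (g k x))\<^sup>2)) \<longlonglongrightarrow> ennreal ((cmod (f x))\<^sup>2)"
      by (intro tendsto_ennrealI tendsto_intros lim)
    from lim_imp_Liminf[OF _ this] show ?thesis by simp
  qed
  then have "(\<integral>\<^sup>+x. ennreal ((cmod (f x))\<^sup>2) \<partial>lebesgue) = (\<integral>\<^sup>+x. liminf (\<lambda>k. ennreal ((cmod (g k x))\<^sup>2)) \<partial>lebesgue)" by simp
  also have "\<dots> \<le> liminf (\<lambda>k. \<integral>\<^sup>+x. ennreal ((cmod (g k x))\<^sup>2) \<partial>lebesgue)"
    using L2_D(1)[OF g(1)] by (intro nn_integral_liminf) simp
  also have "\<dots> \<le> liminf (\<lambda>k. ennreal (B\<^sup>2))"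
    unfolding nn[OF g(1)] using g(2) by (intro Liminf_mono always_eventually allI ennreal_leI power_mono) auto
  also have "\<dots> = ennreal (B\<^sup>2)" by (simp add: Liminf_const)
  finally have le: "(\<integral>\<^sup>+x. ennreal ((cmod (f x))\<^sup>2) \<partial>lebesgue) \<le> ennreal (B\<^sup>2)" .
  have "integrable lebesgue (\<lambda>x. (cmod (f x))\<^sup>2)"
    using fm le by (intro integrableI_bounded) (auto intro: le_less_trans)
  then show fL: "f \<in> L2" using fm by (simp add: L2_def)
  have "(norm (cls f))\<^sup>2 \<le> B\<^sup>2" using le unfolding nn[OF fL] by (simp add: ennreal_le_iff)
  then show "norm (cls f) \<le> B" by (rule power2_le_imp_le) (rule B)
qed

subsection \<open>Weighted estimates\<close>

text \<open>\<open>V_mul\<close> says that the potential behaves like a multiplication, so that it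
  is unchanged when the form is conjugated by a weight.\<close>

locale coercive_l2 = elliptic_l2 a b V A c
  for a :: "'n::finite \<Rightarrow> 'n \<Rightarrow> 'n cfun" and b V A c +
  fixes \<mu> c0 Bb :: real
  assumes \<mu>: "0 < \<mu>" "\<mu> < 1" and c0: "c0 > 0"
    and coercive: "\<And>u. u \<in> H2 \<Longrightarrow> cmod (cinner (A u) u) \<ge> c0 * (grad_sq u + (norm (mul (rw 1 (- \<mu>)) u))\<^sup>2)"
    and b_decay: "\<And>j x. cmod (rw 1 \<mu> x * b j x) \<le> Bb"
    and V_mul: "\<And>w u. w \<in> Cb1 \<Longrightarrow> u \<in> H2 \<Longrightarrow> mul w u \<in> H2 \<Longrightarrow> V (mul w u) = mul w (V u)"
begin

lemma cinner_A:
  assumes u: "u \<in> H2" and v: "v \<in> H1"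
  shows "cinner (A u) v = (\<Sum>i\<in>UNIV. \<Sum>j\<in>UNIV. cinner (mul (a i j) (D j u)) (D i v)) + (\<Sum>j\<in>UNIV. cinner (mul (b j) (D j u)) v) + cinner (V u) v"
  unfolding A_def elliptic_cls_def
  by (simp add: cinner.add_left cinner.diff_left cinner.minus_left cinner.sum_left cinner_D_left[OF H1_mul[OF a H2_D[OF u]] v] sum_negf)

text \<open>Prescribing the derivative of \<open>w\<close> as a bounded C^1 multiple
  \<open>\<theta> i\<close> of \<open>w\<close> itself makes the first derivatives of the product
  lie in H^1 again, so multiplication by the weight preserves H^2.\<close>

lemma H2_mul:
  assumes w: "w \<in> Cb1" "\<And>i. \<theta> i \<in> Cb1" "\<And>i x. partial i w x = \<theta> i x * w x" and u: "u \<in> H2"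
  shows "mul w u \<in> H2" "D i (mul w u) = mul (\<theta> i) (mul w u) + mul w (D i u)"
proof -
  have H1: "mul w u \<in> H1" by (rule H1_mul[OF w(1) H2_H1[OF u]])
  have p: "partial i w = (\<lambda>x. \<theta> i x * w x)" for i using w(3) by blast
  have D: "D i (mul w u) = mul (\<theta> i) (mul w u) + mul w (D i u)" for i
    unfolding D_mul[OF w(1) H2_H1[OF u]] by (simp add: p mul_mul Cb1_bdd_mult w)
  then show "D i (mul w u) = mul (\<theta> i) (mul w u) + mul w (D i u)" .
  show "mul w u \<in> H2" unfolding H2_def using H1 D by (auto intro: H1_add H1_mul w H2_D u)
qed

text \<open>Conjugation replaces \<open>D j\<close> by \<open>D j\<close> minus
  \<open>\<theta> j\<close> in the first slot and \<open>D i\<close> by \<open>D i\<close> plus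
  \<open>\<theta> i\<close> in the second, because
  \<open>mul w (D i u) = D i v - mul (\<theta> i) v\<close> and
  \<open>D i (mul w v) = mul w (D i v + mul (\<theta> i) v)\<close>. Expanding leaves the form of
  \<open>v\<close> and terms with a factor \<theta>.\<close>

lemma conjugated_form:
  assumes w: "w \<in> Cb1" "\<And>i. \<theta> i \<in> Cb1" "\<And>i x. partial i w x = \<theta> i x * w x"
    and real: "\<And>x. cnj (w x) = w x" and u: "u \<in> H2"
  defines "v \<equiv> mul w u"
  shows "cinner (mul w (A u)) v = cinner (A v) v
    + (\<Sum>i\<in>UNIV. \<Sum>j\<in>UNIV. cinner (mul (a i j) (D j v)) (mul (\<theta> i) v) - cinner (mul (a i j) (mul (\<theta> j) v)) (D i v)
        - cinner (mul (a i j) (mul (\<theta> j) v)) (mul (\<theta> i) v))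
    - (\<Sum>j\<in>UNIV. cinner (mul (b j) (mul (\<theta> j) v)) v)"
proof -
  have v: "v \<in> H2" unfolding v_def by (rule H2_mul(1)[OF w u])
  have bw: "bdd_mult w" "bdd_mult (\<theta> i)" for i using Cb1_bdd_mult w by auto
  have adj: "cinner (mul w x) y = cinner x (mul w y)" for x y using cinner_mul_left[OF bw(1)] by (simp add: real)
  have wD: "mul w (D i u) = D i v - mul (\<theta> i) v" for i
    unfolding v_def H2_mul(2)[OF w u] by simp
  have Dwv: "D i (mul w v) = mul w (D i v + mul (\<theta> i) v)" for i
    unfolding H2_mul(2)[OF w v] by (simp add: mul_add bw mul_mul mult.commute add.commute)
  have com: "mul w (mul m x) = mul m (mul w x)" if "bdd_mult m" for m x
    using that bw by (simp add: mul_mul mult.commute)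
  have "cinner (mul w (A u)) v = cinner (A u) (mul w v)" by (rule adj)
  also have "\<dots> = (\<Sum>i\<in>UNIV. \<Sum>j\<in>UNIV. cinner (mul (a i j) (D j u)) (D i (mul w v))) + (\<Sum>j\<in>UNIV. cinner (mul (b j) (D j u)) (mul w v)) + cinner (V u) (mul w v)"
    by (rule cinner_A[OF u H1_mul[OF w(1) H2_H1[OF v]]])
  also have "\<dots> = (\<Sum>i\<in>UNIV. \<Sum>j\<in>UNIV. cinner (mul (a i j) (D j v - mul (\<theta> j) v)) (D i v + mul (\<theta> i) v)) + (\<Sum>j\<in>UNIV. cinner (mul (b j) (D j v - mul (\<theta> j) v)) v) + cinner (V v) v"
    unfolding Dwv adj[symmetric] com[OF a_bdd_mult(1)] com[OF b] wD
    using V_mul[OF w(1) u] v by (simp add: v_def)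
  also have "\<dots> = cinner (A v) v
    + (\<Sum>i\<in>UNIV. \<Sum>j\<in>UNIV. cinner (mul (a i j) (D j v)) (mul (\<theta> i) v) - cinner (mul (a i j) (mul (\<theta> j) v)) (D i v)
        - cinner (mul (a i j) (mul (\<theta> j) v)) (mul (\<theta> i) v))
    - (\<Sum>j\<in>UNIV. cinner (mul (b j) (mul (\<theta> j) v)) v)"
    unfolding cinner_A[OF v H2_H1[OF v]]
    by (simp add: mul_diff a_bdd_mult b cinner.diff_left cinner.add_right sum.distrib sum_subtractf)
  finally show ?thesis .
qed

lemma cmod_cinner_mul_le:
  assumes "bdd_mult m" "\<And>x. cmod (m x) \<le> M" "norm x \<le> X" "norm y \<le> Y"
  shows "cmod (cinner (mul m x) y) \<le> M * (X * Y)"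
proof -
  have M0: "0 \<le> M" using assms(2) norm_ge_zero order_trans by blast
  have X0: "0 \<le> X" using assms(3) norm_ge_zero order_trans by blast
  have "cmod (cinner (mul m x) y) \<le> norm (mul m x) * norm y" by (rule cmod_cinner_le)
  also have "\<dots> \<le> (M * norm x) * norm y" by (intro mult_right_mono norm_mul_le assms) auto
  also have "\<dots> \<le> (M * X) * Y" using M0 X0 assms by (intro mult_mono mult_left_mono) auto
  finally show ?thesis by (simp add: mult.assoc)
qed

text \<open>With Y and Z the norms of the gradient of v and of v with weight
  \<open>rw 1 (- \<mu>)\<close>, the conjugation terms are at most \<eta> C (Y^2 + Z^2), which half
  of the coercivity absorbs. The source is written as \<open>mul \<rho> F\<close> with
  \<open>\<rho>\<close> dominated by \<open>rw 1 (- \<mu>)\<close>, so that its pairing with v costs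
  one Z, which is then divided out. A general \<open>\<rho>\<close> lets data and solution be
  measured with the same family of weights \<open>rb R\<close>.\<close>

lemma weighted_energy:
  obtains \<eta>0 where "\<eta>0 > 0" "\<And>w \<theta> \<eta> u l \<rho> F.
    \<lbrakk>w \<in> Cb1; \<And>i. \<theta> i \<in> Cb1; \<And>i x. partial i w x = \<theta> i x * w x; \<And>x. cnj (w x) = w x;
     \<And>i x. cmod (\<theta> i x) \<le> \<eta> * cmod (rw 1 (- \<mu>) x); 0 \<le> \<eta>; \<eta> \<le> \<eta>0; u \<in> H2; 0 \<le> l;
     bdd_mult \<rho>; \<And>x. cmod (\<rho> x) \<le> cmod (rw 1 (- \<mu>) x); \<And>x. cnj (\<rho> x) = \<rho> x; mul \<rho> F = mul w (A u + l *\<^sub>R u)\<rbrakk>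
     \<Longrightarrow> norm (mul \<rho> (mul w u)) \<le> 2 / c0 * norm F"
proof -
  obtain M where M: "M \<ge> 0" "\<And>i j x. cmod (a i j x) \<le> M" using coefficient_bound by metis
  define n where "n = real CARD('n)"
  have n: "n \<ge> 0" by (simp add: n_def)
  have Bb: "Bb \<ge> 0" using b_decay norm_ge_zero order_trans by blast
  \<comment> \<open>Each of the n^2 second order entries yields three terms bounded through
    \<open>M\<close>; each of the n first order entries yields one bounded through
    \<open>Bb\<close>.\<close>
  define C where "C = n * (n * (3 * M)) + n * Bb"
  have C: "C \<ge> 0" using M(1) n Bb by (simp add: C_def)
  \<comment> \<open>The cap 1 gives \<open>\<eta> * \<eta> \<le> \<eta>\<close>, so the term
    quadratic in \<theta> is also linear in \<eta>; the other bound keeps the total perturbation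
    below half of \<open>c0\<close>.\<close>
  define \<eta>0 where "\<eta>0 = min 1 (c0 / (2 * (C + 1)))"
  have \<eta>0: "\<eta>0 > 0" "\<eta>0 \<le> 1" "\<eta>0 * C \<le> c0 / 2"
  proof -
    show "\<eta>0 > 0" "\<eta>0 \<le> 1" using c0 C by (auto simp: \<eta>0_def)
    have "\<eta>0 * C \<le> c0 / (2 * (C + 1)) * (C + 1)" using c0 C by (intro mult_mono) (auto simp: \<eta>0_def)
    also have "\<dots> = c0 / 2" using C by (simp add: field_simps)
    finally show "\<eta>0 * C \<le> c0 / 2" .
  qed
  show thesis
  proof (rule that[OF \<eta>0(1)])
    fix w :: "'n cfun" and \<theta> :: "'n \<Rightarrow> 'n cfun" and \<eta> l :: real and u F :: "'n l2" and \<rho> :: "'n cfun"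
    assume w: "w \<in> Cb1" "\<And>i. \<theta> i \<in> Cb1" "\<And>i x. partial i w x = \<theta> i x * w x" and real: "\<And>x. cnj (w x) = w x"
      and \<theta>: "\<And>i x. cmod (\<theta> i x) \<le> \<eta> * cmod (rw 1 (- \<mu>) x)" and \<eta>: "0 \<le> \<eta>" "\<eta> \<le> \<eta>0" and u: "u \<in> H2" and l: "0 \<le> l"
      and \<rho>: "bdd_mult \<rho>" "\<And>x. cmod (\<rho> x) \<le> cmod (rw 1 (- \<mu>) x)" "\<And>x. cnj (\<rho> x) = \<rho> x"
      and F: "mul \<rho> F = mul w (A u + l *\<^sub>R u)"
    define v where "v = mul w u"
    have v: "v \<in> H2" unfolding v_def by (rule H2_mul(1)[OF w u])
    let ?j = "rw 1 (- \<mu>) :: 'n cfun"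
    have bj: "bdd_mult ?j" using \<mu> by (intro bdd_mult_rw) auto
    have bw: "bdd_mult w" "bdd_mult (\<theta> i)" for i using Cb1_bdd_mult w by auto
    define Y where "Y = grad_len v"
    define Z where "Z = norm (mul ?j v)"
    have YZ: "Y \<ge> 0" "Z \<ge> 0" by (auto simp: Y_def Z_def)
    have \<theta>v: "norm (mul (\<theta> i) v) \<le> \<eta> * Z" for i
      unfolding Z_def by (intro norm_mul_le_mul bw bj \<eta> \<theta>)
    have Dv: "norm (D i v) \<le> Y" for i unfolding Y_def by (rule norm_D_le_grad_len)
    define E1 where "E1 = (\<Sum>i\<in>UNIV. \<Sum>j\<in>UNIV. cinner (mul (a i j) (D j v)) (mul (\<theta> i) v) - cinner (mul (a i j) (mul (\<theta> j) v)) (D i v)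
        - cinner (mul (a i j) (mul (\<theta> j) v)) (mul (\<theta> i) v))"
    define E2 where "E2 = (\<Sum>j\<in>UNIV. cinner (mul (b j) (mul (\<theta> j) v)) v)"
    have q: "\<eta> * \<eta> \<le> \<eta>" using \<eta> \<eta>0(2) mult_left_mono[of \<eta> 1 \<eta>] by simp
    have yz: "2 * (Y * Z) \<le> Y\<^sup>2 + Z\<^sup>2" using sum_squares_bound[of Y Z] by simp
    have "cmod (cinner (mul (a i j) (D j v)) (mul (\<theta> i) v) - cinner (mul (a i j) (mul (\<theta> j) v)) (D i v)
        - cinner (mul (a i j) (mul (\<theta> j) v)) (mul (\<theta> i) v)) \<le> \<eta> * (3 * M) * (Y\<^sup>2 + Z\<^sup>2)" for i j
    proof -
      have 1: "cmod (cinner (mul (a i j) (D j v)) (mul (\<theta> i) v)) \<le> M * (Y * (\<eta> * Z))"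
        by (rule cmod_cinner_mul_le[OF a_bdd_mult(1) M(2) Dv \<theta>v])
      have 2: "cmod (cinner (mul (a i j) (mul (\<theta> j) v)) (D i v)) \<le> M * ((\<eta> * Z) * Y)"
        by (rule cmod_cinner_mul_le[OF a_bdd_mult(1) M(2) \<theta>v Dv])
      have 3: "cmod (cinner (mul (a i j) (mul (\<theta> j) v)) (mul (\<theta> i) v)) \<le> M * ((\<eta> * Z) * (\<eta> * Z))"
        by (rule cmod_cinner_mul_le[OF a_bdd_mult(1) M(2) \<theta>v \<theta>v])
      have "M * ((\<eta> * Z) * (\<eta> * Z)) = (\<eta> * \<eta>) * (M * Z\<^sup>2)" by (simp add: power2_eq_square)
      also have "\<dots> \<le> \<eta> * (M * (Y\<^sup>2 + Z\<^sup>2))" using q M(1) \<eta>(1) by (intro mult_mono mult_left_mono) auto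
      finally have e3: "M * ((\<eta> * Z) * (\<eta> * Z)) \<le> \<eta> * (M * (Y\<^sup>2 + Z\<^sup>2))" .
      have "\<eta> * (M * (2 * (Y * Z))) \<le> \<eta> * (M * (Y\<^sup>2 + Z\<^sup>2))" using \<eta>(1) M(1) yz by (intro mult_left_mono)
      then have "M * (Y * (\<eta> * Z)) + M * ((\<eta> * Z) * Y) \<le> \<eta> * (M * (Y\<^sup>2 + Z\<^sup>2))" by (simp add: algebra_simps)
      moreover have "\<eta> * (3 * M) * (Y\<^sup>2 + Z\<^sup>2) = 3 * (\<eta> * (M * (Y\<^sup>2 + Z\<^sup>2)))" by simp
      moreover have "0 \<le> \<eta> * (M * (Y\<^sup>2 + Z\<^sup>2))" using \<eta>(1) M(1) by simp
      ultimately show ?thesis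
        using 1 2 3 e3 norm_triangle_ineq4[of "cinner (mul (a i j) (D j v)) (mul (\<theta> i) v) - cinner (mul (a i j) (mul (\<theta> j) v)) (D i v)" "cinner (mul (a i j) (mul (\<theta> j) v)) (mul (\<theta> i) v)"]
          norm_triangle_ineq4[of "cinner (mul (a i j) (D j v)) (mul (\<theta> i) v)" "cinner (mul (a i j) (mul (\<theta> j) v)) (D i v)"]
        by linarith
    qed
    then have "cmod E1 \<le> (\<Sum>i\<in>(UNIV::'n set). \<Sum>j\<in>(UNIV::'n set). \<eta> * (3 * M) * (Y\<^sup>2 + Z\<^sup>2))"
      unfolding E1_def by (intro sum_norm_le)
    also have "\<dots> = \<eta> * (n * (n * (3 * M))) * (Y\<^sup>2 + Z\<^sup>2)" by (simp add: n_def)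
    finally have E1: "cmod E1 \<le> \<eta> * (n * (n * (3 * M))) * (Y\<^sup>2 + Z\<^sup>2)" .
    have "cmod (cinner (mul (b j) (mul (\<theta> j) v)) v) \<le> \<eta> * Bb * (Y\<^sup>2 + Z\<^sup>2)" for j
    proof -
      \<comment> \<open>A first order term carries no gradient of v, so it must supply the weight
        \<open>rw 1 (- \<mu>)\<close> twice: once from \<theta>, once from the decay of
        \<open>b j\<close>. Here \<open>k\<close> collects what remains after one weight is moved to
        the second factor.\<close>
      define k where "k x = rw 1 \<mu> x * b j x * \<theta> j x" for x
      have kb: "cmod (k x) \<le> (\<eta> * Bb) * cmod (?j x)" for x
        unfolding k_def norm_mult[of "rw 1 \<mu> x * b j x"]
        using mult_mono[OF b_decay[of x j] \<theta>[of j x]] Bb by (simp add: algebra_simps)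
      have km: "bdd_mult k"
      proof (rule bmI)
        show "k \<in> borel_measurable lebesgue"
          unfolding k_def[abs_def] using bdd_mult_measurable[OF b] bdd_mult_measurable[OF bw(2)] by simp
        show "cmod (k x) \<le> (\<eta> * Bb) * 1" for x
          using kb[of x] mult_left_mono[OF rb_powr_le_1[of 1 "- \<mu>" x], of "\<eta> * Bb"] \<mu> \<eta> Bb by (simp add: cmod_rw)
      qed
      have "mul (b j) (mul (\<theta> j) v) = mul ?j (mul k v)"
      proof -
        have "b j x * \<theta> j x = ?j x * k x" for x
          using rw_add[of 1 "- \<mu>" x \<mu>] by (simp add: k_def rw_zero mult.assoc[symmetric])
        then show ?thesis by (simp add: mul_mul b bw bj km)
      qed
      then have "cinner (mul (b j) (mul (\<theta> j) v)) v = cinner (mul k v) (mul ?j v)"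
        using cinner_mul_left[OF bj, of "mul k v" v] by (simp add: cnj_rw)
      then have "cmod (cinner (mul (b j) (mul (\<theta> j) v)) v) \<le> norm (mul k v) * Z"
        unfolding Z_def by (simp add: cmod_cinner_le)
      also have "\<dots> \<le> ((\<eta> * Bb) * Z) * Z"
        unfolding Z_def using \<eta> Bb by (intro mult_right_mono norm_mul_le_mul km bj kb) auto
      also have "\<dots> = \<eta> * Bb * Z\<^sup>2" by (simp add: power2_eq_square)
      also have "\<dots> \<le> \<eta> * Bb * (Y\<^sup>2 + Z\<^sup>2)" using \<eta> Bb by (intro mult_left_mono) auto
      finally show ?thesis .
    qed
    then have "cmod E2 \<le> (\<Sum>j\<in>(UNIV::'n set). \<eta> * Bb * (Y\<^sup>2 + Z\<^sup>2))"
      unfolding E2_def by (intro sum_norm_le)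
    also have "\<dots> = \<eta> * (n * Bb) * (Y\<^sup>2 + Z\<^sup>2)" by (simp add: n_def)
    finally have E2: "cmod E2 \<le> \<eta> * (n * Bb) * (Y\<^sup>2 + Z\<^sup>2)" .
    have "\<eta> * C * (Y\<^sup>2 + Z\<^sup>2) = \<eta> * (n * (n * (3 * M))) * (Y\<^sup>2 + Z\<^sup>2) + \<eta> * (n * Bb) * (Y\<^sup>2 + Z\<^sup>2)"
      unfolding C_def by (simp add: algebra_simps)
    moreover have "\<eta> * C * (Y\<^sup>2 + Z\<^sup>2) \<le> c0 / 2 * (Y\<^sup>2 + Z\<^sup>2)"
      using \<eta>0(3) mult_right_mono[OF \<eta>(2) C] by (intro mult_right_mono) auto
    ultimately have E: "cmod (E1 - E2) \<le> c0 / 2 * (Y\<^sup>2 + Z\<^sup>2)"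
      using E1 E2 norm_triangle_ineq4[of E1 E2] by linarith
    have form: "cinner (mul w (A u)) v = cinner (A v) v + E1 - E2"
      unfolding E1_def E2_def v_def by (rule conjugated_form[OF w real u])
    have "cinner (mul w (A u + l *\<^sub>R u)) v = cinner (mul w (A u)) v + l *\<^sub>R cinner v v"
      by (simp add: mul_add bw mul_scaleR cinner.add_left cinner.scaleR_left v_def)
    then have id: "cinner (A v) v + l *\<^sub>R cinner v v = cinner (mul \<rho> F) v - (E1 - E2)" using form by (simp add: F)
    have "c0 * (Y\<^sup>2 + Z\<^sup>2) \<le> cmod (cinner (A v) v)"
      using coercive[OF v] by (simp add: Y_def Z_def grad_len_sq)
    also have "\<dots> \<le> cmod (cinner (A v) v + l *\<^sub>R cinner v v)"
    proof -
      have "cinner v v = complex_of_real ((norm v)\<^sup>2)" by (simp add: cinner_self norm_l2_sq)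
      then have e: "cinner (A v) v + l *\<^sub>R cinner v v = cinner (A v) v + complex_of_real (l * (norm v)\<^sup>2)" by (simp add: scaleR_conv_of_real)
      have "0 \<le> l * (norm v)\<^sup>2" using l by simp
      \<comment> \<open>Since the real part is nonnegative, adding a nonnegative real number can
        only enlarge the modulus; this is what makes the bound uniform in \<open>l\<close>.\<close>
      then have "(Re (cinner (A v) v))\<^sup>2 \<le> (Re (cinner (A v) v) + l * (norm v)\<^sup>2)\<^sup>2"
        using accretive[OF v] by (intro power_mono) auto
      then show ?thesis unfolding e by (simp add: cmod_def)
    qed
    also have "\<dots> \<le> cmod (cinner (mul \<rho> F) v) + cmod (E1 - E2)" unfolding id by (rule norm_triangle_ineq4)
    finally have "c0 * (Y\<^sup>2 + Z\<^sup>2) - c0 / 2 * (Y\<^sup>2 + Z\<^sup>2) \<le> cmod (cinner (mul \<rho> F) v)" using E by linarith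
    moreover have "c0 / 2 * Z\<^sup>2 \<le> c0 * (Y\<^sup>2 + Z\<^sup>2) - c0 / 2 * (Y\<^sup>2 + Z\<^sup>2)"
      using c0 by (simp add: field_simps)
    moreover have \<rho>Z: "norm (mul \<rho> v) \<le> 1 * Z"
      unfolding Z_def by (rule norm_mul_le_mul[OF \<rho>(1) bj]) (use \<rho>(2) in auto)
    moreover have "cmod (cinner (mul \<rho> F) v) \<le> norm F * Z"
    proof -
      have "cmod (cinner (mul \<rho> F) v) = cmod (cinner F (mul \<rho> v))" using cinner_mul_left[OF \<rho>(1), of F v] \<rho>(3) by simp
      also have "\<dots> \<le> norm F * norm (mul \<rho> v)" by (rule cmod_cinner_le)
      also have "\<dots> \<le> norm F * Z" using \<rho>Z by (intro mult_left_mono) auto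
      finally show ?thesis .
    qed
    ultimately have "(c0 / 2 * Z) * Z \<le> norm F * Z" by (simp add: power2_eq_square)
    then have "c0 / 2 * Z \<le> norm F" using YZ(2) by (cases "Z = 0") (auto simp: mult_le_cancel_right)
    then have "Z \<le> 2 / c0 * norm F" using c0 by (simp add: field_simps)
    then show "norm (mul \<rho> (mul w u)) \<le> 2 / c0 * norm F" using \<rho>Z by (simp add: v_def)
  qed
qed

text \<open>The loss of 2\<mu> is split evenly around the weight of exponent
  \<open>s - \<mu>\<close>: the data gain a factor \<open>rw R \<mu>\<close> and the solution a
  factor \<open>rw R (- \<mu>)\<close>. For nonpositive exponent the weight is already bounded;
  otherwise the regularised weights are used, since the decay of \<open>u\<close> is part of the
  conclusion, and \<open>L2_fatou\<close> passes to the limit.\<close>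

lemma weighted_estimate:
  obtains \<eta>0 where "\<eta>0 > 0" "\<And>R s l u. \<lbrakk>R \<ge> 1; \<bar>s - \<mu>\<bar> * R powr (\<mu> - 1) \<le> \<eta>0; l \<ge> 0; u \<in> H2;
      (\<lambda>x. rw R s x * fn (A u + l *\<^sub>R u) x) \<in> L2\<rbrakk>
    \<Longrightarrow> (\<lambda>x. rw R (s - 2 * \<mu>) x * fn u x) \<in> L2 \<and>
       norm (cls (\<lambda>x. rw R (s - 2 * \<mu>) x * fn u x)) \<le> 2 / c0 * norm (cls (\<lambda>x. rw R s x * fn (A u + l *\<^sub>R u) x))"
proof -
  obtain \<eta>0 where \<eta>0: "\<eta>0 > 0" "\<And>w \<theta> \<eta> u l \<rho> F.
    \<lbrakk>w \<in> Cb1; \<And>i. \<theta> i \<in> Cb1; \<And>i x. partial i w x = \<theta> i x * w x; \<And>x. cnj (w x) = w x;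
     \<And>i x. cmod (\<theta> i x) \<le> \<eta> * cmod (rw 1 (- \<mu>) x); 0 \<le> \<eta>; \<eta> \<le> \<eta>0; u \<in> H2; 0 \<le> l;
     bdd_mult \<rho>; \<And>x. cmod (\<rho> x) \<le> cmod (rw 1 (- \<mu>) x); \<And>x. cnj (\<rho> x) = \<rho> x; mul \<rho> F = mul w (A u + l *\<^sub>R u)\<rbrakk>
     \<Longrightarrow> norm (mul \<rho> (mul w u)) \<le> 2 / c0 * norm F" using weighted_energy by blast
  show thesis
  proof (rule that[OF \<eta>0(1)])
    fix R s l :: real and u :: "'n l2"
    assume R: "R \<ge> 1" and s: "\<bar>s - \<mu>\<bar> * R powr (\<mu> - 1) \<le> \<eta>0" and l: "l \<ge> 0" and u: "u \<in> H2"
      and fL: "(\<lambda>x. rw R s x * fn (A u + l *\<^sub>R u) x) \<in> L2"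
    define \<tau> where "\<tau> = s - \<mu>"
    define f where "f = fn (A u + l *\<^sub>R u)"
    have R0: "R > 0" using R by simp
    have fm: "f \<in> borel_measurable lebesgue" by (simp add: f_def)
    have b\<rho>: "bdd_mult (rw R (- \<mu>) :: 'n cfun)" using \<mu> R by (intro bdd_mult_rw) auto
    have main: "norm (cls (\<lambda>x. rw R (- \<mu>) x * (wt R \<delta> \<tau> x * fn u x))) \<le> 2 / c0 * norm (cls (\<lambda>x. rw R s x * f x))
        \<and> (\<lambda>x. rw R (- \<mu>) x * (wt R \<delta> \<tau> x * fn u x)) \<in> L2"
      if \<delta>: "\<delta> \<ge> 0" "\<delta> > 0 \<or> \<tau> \<le> 0" "\<tau> \<ge> 0 \<or> \<delta> = 0" for \<delta>
    proof -
      let ?w = "wt R \<delta> \<tau> :: 'n cfun"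
      have w: "?w \<in> Cb1" by (rule wt_Cb1[OF R \<delta>(1,2)])
      have bw: "bdd_mult ?w" by (rule Cb1_bdd_mult[OF w])
      have gb: "cmod (rw R \<mu> x * (?w x * f x)) \<le> 1 * cmod (rw R s x * f x)" for x
      proof -
        have "rb R x powr \<mu> * cmod (?w x) \<le> rb R x powr \<mu> * rb R x powr \<tau>"
          by (intro mult_left_mono cmod_wt_le R \<delta>) auto
        also have "\<dots> = rb R x powr s" by (simp add: powr_add[symmetric] \<tau>_def)
        finally show ?thesis by (simp add: norm_mult cmod_rw mult_right_mono mult.assoc[symmetric])
      qed
      have gL: "(\<lambda>x. rw R \<mu> x * (?w x * f x)) \<in> L2"
      proof (rule L2_bound[OF fL[folded f_def]])
        show "(\<lambda>x. rw R \<mu> x * (?w x * f x)) \<in> borel_measurable lebesgue"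
          by (intro borel_measurable_times rw_measurable R0 bdd_mult_measurable[OF bw] fm)
        show "AE x in lebesgue. cmod (rw R \<mu> x * (?w x * f x)) \<le> 1 * cmod (rw R s x * f x)"
          using gb by (rule AE_I2)
      qed
      \<comment> \<open>The factor \<open>rw R \<mu>\<close> compensates
        \<open>\<rho> = rw R (- \<mu>)\<close>; as \<mu> + \<tau> = s, the norm of \<open>F\<close>
        is at most that of the data with weight \<open>rw R s\<close>.\<close>
      define F where "F = cls (\<lambda>x. rw R \<mu> x * (?w x * f x))"
      have FF: "mul (rw R (- \<mu>)) F = mul ?w (A u + l *\<^sub>R u)"
      proof -
        have e2: "rw R (- \<mu>) x * (rw R \<mu> x * (?w x * f x)) = ?w x * f x" for x
          using rw_add[OF R0, of "- \<mu>" x \<mu>] R0 by (simp add: rw_zero mult.assoc[symmetric])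
        show ?thesis unfolding F_def mul_cls[OF b\<rho> gL] e2 by (simp add: mul_def f_def)
      qed
      have est: "norm (mul (rw R (- \<mu>)) (mul ?w u)) \<le> 2 / c0 * norm F"
      proof (rule \<eta>0(2)[where \<theta>="\<lambda>i. wt_log R \<delta> \<tau> i" and \<eta>="\<bar>\<tau>\<bar> * R powr (\<mu> - 1)" and w="?w" and l=l])
        show "?w \<in> Cb1" by fact
        show "wt_log R \<delta> \<tau> i \<in> Cb1" for i :: 'n by (rule wt_log_Cb1[OF R \<delta>(1)])
        show "partial i ?w x = wt_log R \<delta> \<tau> i x * ?w x" for i x by (rule partial_wt[OF R \<delta>(1)])
        show "cnj (?w x) = ?w x" for x by (rule cnj_wt(1)[OF R \<delta>(1)])
        show "cmod (wt_log R \<delta> \<tau> i x) \<le> \<bar>\<tau>\<bar> * R powr (\<mu> - 1) * cmod (rw 1 (- \<mu>) x)" for i :: 'n and x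
          using \<mu> by (intro cmod_wt_log_le R \<delta>(1)) auto
        show "\<bar>\<tau>\<bar> * R powr (\<mu> - 1) \<le> \<eta>0" using s by (simp add: \<tau>_def)
        show "cmod (rw R (- \<mu>) x) \<le> cmod (rw 1 (- \<mu>) x)" for x :: "real^'n"
          using \<mu> rb_ge_jbracket[OF R, of x] jbracket_ge_1[of x] unfolding cmod_rw jbracket_rb[symmetric]
          by (intro powr_mono2') auto
        show "mul (rw R (- \<mu>)) F = mul ?w (A u + l *\<^sub>R u)" by (rule FF)
      qed (use l u b\<rho> in \<open>auto simp: cnj_rw\<close>)
      have "norm F \<le> 1 * norm (cls (\<lambda>x. rw R s x * f x))"
        unfolding F_def
      proof (rule norm_le_AE)
        show "AE x in lebesgue. cmod (fn (cls (\<lambda>x. rw R \<mu> x * (?w x * f x))) x) \<le> 1 * cmod (fn (cls (\<lambda>x. rw R s x * f x)) x)"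
          using fn_cls[OF gL] fn_cls[OF fL[folded f_def]]
        proof eventually_elim
          case (elim x)
          show ?case unfolding elim by (rule gb)
        qed
      qed simp
      then have "2 / c0 * norm F \<le> 2 / c0 * norm (cls (\<lambda>x. rw R s x * f x))"
        using c0 by (intro mult_left_mono) auto
      with est have "norm (mul (rw R (- \<mu>)) (mul ?w u)) \<le> 2 / c0 * norm (cls (\<lambda>x. rw R s x * f x))"
        by (rule order_trans)
      moreover have "mul (rw R (- \<mu>)) (mul ?w u) = cls (\<lambda>x. rw R (- \<mu>) x * (?w x * fn u x))"
        unfolding mul_def[of ?w] by (rule mul_cls[OF b\<rho> L2_mult_bdd_mult[OF bw fn_L2]])
      ultimately show ?thesis using L2_mult_bdd_mult[OF b\<rho> L2_mult_bdd_mult[OF bw fn_L2]] by simp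
    qed
    have e: "rw R (- \<mu>) x * (rw R \<tau> x * fn u x) = rw R (s - 2 * \<mu>) x * fn u x" for x
    proof -
      have \<tau>s: "- \<mu> + \<tau> = s - 2 * \<mu>" by (simp add: \<tau>_def)
      show ?thesis unfolding mult.assoc[symmetric] rw_add[OF R0] \<tau>s ..
    qed
    show "(\<lambda>x. rw R (s - 2 * \<mu>) x * fn u x) \<in> L2 \<and>
       norm (cls (\<lambda>x. rw R (s - 2 * \<mu>) x * fn u x)) \<le> 2 / c0 * norm (cls (\<lambda>x. rw R s x * fn (A u + l *\<^sub>R u) x))"
    proof (cases "\<tau> \<le> 0")
      case True
      show ?thesis using main[of 0] True unfolding wt_zero[OF R] e f_def by simp
    next
      case False
      let ?g = "\<lambda>k x. rw R (- \<mu>) x * (wt R (1 / real (Suc k)) \<tau> x * fn u x)"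
      have g: "?g k \<in> L2" "norm (cls (?g k)) \<le> 2 / c0 * norm (cls (\<lambda>x. rw R s x * f x))" for k
        using main[of "1 / real (Suc k)"] False by auto
      have lim: "(\<lambda>k. ?g k x) \<longlonglongrightarrow> rw R (s - 2 * \<mu>) x * fn u x" for x
        unfolding e[symmetric] by (intro tendsto_intros LIMSEQ_Suc[OF wt_tendsto[OF R]])
      show ?thesis using L2_fatou[OF g lim] by (simp add: f_def)
    qed
  qed
qed

end

subsection \<open>Solvability for rapidly decaying data\<close>

lemma rb_powr_equiv:
  assumes R: "R \<ge> 1"
  shows "rb R x powr s \<le> R powr \<bar>s\<bar> * rb 1 x powr s" "rb 1 x powr s \<le> R powr \<bar>s\<bar> * rb R x powr s"
proof -
  have pos: "rb 1 x > 0" "rb R x > 0" by (rule rb_pos, use R in simp)+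
  have le: "rb 1 x \<le> rb R x" "rb R x \<le> R * rb 1 x"
    using rb_ge_jbracket[OF R, of x] rb_le_jbracket[OF R, of x] by (auto simp: jbracket_rb)
  have R1: "R powr \<bar>s\<bar> \<ge> 1" using R by (rule ge_one_powr_ge_zero) simp
  show "rb R x powr s \<le> R powr \<bar>s\<bar> * rb 1 x powr s"
  proof (cases "s \<ge> 0")
    case True
    have "rb R x powr s \<le> (R * rb 1 x) powr s" using True le pos by (intro powr_mono2) auto
    then show ?thesis using True R pos by (simp add: powr_mult)
  next
    case False
    have "rb R x powr s \<le> rb 1 x powr s" using False le pos by (intro powr_mono2') auto
    also have "\<dots> \<le> R powr \<bar>s\<bar> * rb 1 x powr s" using mult_right_mono[OF R1, of "rb 1 x powr s"] by simp
    finally show ?thesis .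
  qed
  show "rb 1 x powr s \<le> R powr \<bar>s\<bar> * rb R x powr s"
  proof (cases "s \<ge> 0")
    case True
    have "rb 1 x powr s \<le> rb R x powr s" using True le pos by (intro powr_mono2) auto
    also have "\<dots> \<le> R powr \<bar>s\<bar> * rb R x powr s" using mult_right_mono[OF R1, of "rb R x powr s"] by simp
    finally show ?thesis .
  next
    case False
    have "R powr s * rb 1 x powr s = (R * rb 1 x) powr s" using R pos by (simp add: powr_mult)
    also have "\<dots> \<le> rb R x powr s" using False le pos by (intro powr_mono2') auto
    finally have "R powr (- s) * (R powr s * rb 1 x powr s) \<le> R powr (- s) * rb R x powr s"
      by (intro mult_left_mono) auto
    moreover have "R powr (- s) * R powr s = 1" using R by (simp add: powr_add[symmetric])
    ultimately show ?thesis using False by (simp add: mult.assoc[symmetric])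
  qed
qed

lemma L2_rw_equiv:
  assumes R: "R \<ge> 1" and f: "f \<in> borel_measurable lebesgue"
  shows "(\<lambda>x. rw R s x * f x) \<in> L2 \<longleftrightarrow> (\<lambda>x. rw 1 s x * f x) \<in> L2"
proof
  assume L: "(\<lambda>x. rw R s x * f x) \<in> L2"
  show "(\<lambda>x. rw 1 s x * f x) \<in> L2"
  proof (rule L2_bound[OF L])
    show "AE x in lebesgue. cmod (rw 1 s x * f x) \<le> R powr \<bar>s\<bar> * cmod (rw R s x * f x)"
      using mult_right_mono[OF rb_powr_equiv(2)[OF R] norm_ge_zero]
      by (intro AE_I2) (simp add: norm_mult cmod_rw mult.assoc[symmetric])
  qed (use f in simp)
next
  assume L: "(\<lambda>x. rw 1 s x * f x) \<in> L2"
  show "(\<lambda>x. rw R s x * f x) \<in> L2"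
  proof (rule L2_bound[OF L])
    show "AE x in lebesgue. cmod (rw R s x * f x) \<le> R powr \<bar>s\<bar> * cmod (rw 1 s x * f x)"
      using mult_right_mono[OF rb_powr_equiv(1)[OF R] norm_ge_zero]
      by (intro AE_I2) (simp add: norm_mult cmod_rw mult.assoc[symmetric])
  qed (use f R in simp)
qed

lemma exists_scale:
  fixes \<mu> \<eta> \<kappa> :: real
  assumes "\<mu> < 1" "\<eta> > 0" obtains M where "M \<ge> 1" "\<kappa> * M powr (\<mu> - 1) \<le> \<eta>"
proof -
  have "((\<lambda>M. \<kappa> * M powr (\<mu> - 1)) \<longlongrightarrow> \<kappa> * 0) at_top"
    using assms by (intro tendsto_intros tendsto_neg_powr filterlim_ident) auto
  then have "eventually (\<lambda>M. \<kappa> * M powr (\<mu> - 1) < \<eta>) at_top"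
    using assms by (intro order_tendstoD(2)) auto
  then have "eventually (\<lambda>M. M \<ge> 1 \<and> \<kappa> * M powr (\<mu> - 1) \<le> \<eta>) at_top"
    using eventually_ge_at_top[of 1] by eventually_elim auto
  then show thesis using that eventually_happens by (metis (no_types, lifting) trivial_limit_at_top_linorder)
qed

context coercive_l2
begin

text \<open>By \<open>Lap_bound\<close> a sequence converging in graph norm is Cauchy in H^2, and
  \<open>A\<close> is bounded from H^2.\<close>

lemma A_closed:
  assumes U: "\<And>k. U k \<in> H2" "U \<longlonglongrightarrow> u" "(\<lambda>k. A (U k)) \<longlonglongrightarrow> f"
  shows "u \<in> H2 \<and> A u = f"
proof -
  obtain K where K: "K \<ge> 0" "\<And>u. u \<in> H2 \<Longrightarrow> norm (Lap u) \<le> K * (norm (A u) + norm u)" using Lap_bound by blast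
  obtain L where L: "L \<ge> 0" "\<And>u. u \<in> H2 \<Longrightarrow> norm (A u) \<le> L * (norm u + norm (Lap u))" using A_bound by blast
  have CU: "Cauchy U" "Cauchy (\<lambda>k. A (U k))" using U LIMSEQ_imp_Cauchy by blast+
  have "Cauchy (\<lambda>k. K *\<^sub>R A (U k))" "Cauchy (\<lambda>k. K *\<^sub>R U k)"
    using bounded_linear.Cauchy[OF bounded_linear_scaleR_right] CU by blast+
  then have "Cauchy (\<lambda>k. Lap (U k))"
  proof (rule Cauchy_bound)
    fix m n
    have "norm (Lap (U m) - Lap (U n)) \<le> K * (norm (A (U m - U n)) + norm (U m - U n))"
      unfolding Lap_diff[OF U(1) U(1), symmetric] by (rule K(2)[OF H2_diff[OF U(1) U(1)]])
    then show "norm (Lap (U m) - Lap (U n)) \<le> norm (K *\<^sub>R A (U m) - K *\<^sub>R A (U n)) + norm (K *\<^sub>R U m - K *\<^sub>R U n)"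
      using K(1) by (simp add: A_diff[OF U(1) U(1)] scaleR_diff_right[symmetric] distrib_left)
  qed
  then obtain v where v: "v \<in> H2" "U \<longlonglongrightarrow> v" "(\<lambda>k. Lap (U k)) \<longlonglongrightarrow> Lap v"
    by (rule H2_complete[of U, OF U(1) CU(1)])
  have vu: "v = u" using v(2) U(2) LIMSEQ_unique by blast
  have "(\<lambda>k. A (U k) - A v) \<longlonglongrightarrow> 0"
  proof (rule Lim_null_comparison[OF always_eventually], rule allI)
    fix k
    show "norm (A (U k) - A v) \<le> L * (norm (U k - v) + norm (Lap (U k) - Lap v))"
      unfolding A_diff[OF U(1) v(1), symmetric] Lap_diff[OF U(1) v(1), symmetric]
      by (rule L(2)[OF H2_diff[OF U(1) v(1)]])
    have "(\<lambda>k. L * (norm (U k - v) + norm (Lap (U k) - Lap v))) \<longlonglongrightarrow> L * (norm (v - v) + norm (Lap v - Lap v))"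
      by (intro tendsto_intros v)
    then show "(\<lambda>k. L * (norm (U k - v) + norm (Lap (U k) - Lap v))) \<longlonglongrightarrow> 0" by simp
  qed
  then have "(\<lambda>k. A (U k)) \<longlonglongrightarrow> A v" by (simp add: LIM_zero_iff)
  then have "A v = f" using U(3) LIMSEQ_unique by blast
  then show ?thesis using v(1) vu by simp
qed

text \<open>The solutions of \<open>(A + \<epsilon>) u = f\<close> form a Cauchy family as \<open>\<epsilon> \<rightarrow> 0\<close>, because the weighted
  estimate can be applied twice when \<open>f\<close> decays fast enough.\<close>

lemma solve:
  assumes f: "\<And>s. (\<lambda>x. rw 1 s x * fn f x) \<in> L2"
  shows "\<exists>u\<in>H2. A u = f"
proof -
  obtain \<eta>0 where \<eta>0: "\<eta>0 > 0" "\<And>R s l u. \<lbrakk>R \<ge> 1; \<bar>s - \<mu>\<bar> * R powr (\<mu> - 1) \<le> \<eta>0; l \<ge> 0; u \<in> H2;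
      (\<lambda>x. rw R s x * fn (A u + l *\<^sub>R u) x) \<in> L2\<rbrakk>
    \<Longrightarrow> (\<lambda>x. rw R (s - 2 * \<mu>) x * fn u x) \<in> L2 \<and>
       norm (cls (\<lambda>x. rw R (s - 2 * \<mu>) x * fn u x)) \<le> 2 / c0 * norm (cls (\<lambda>x. rw R s x * fn (A u + l *\<^sub>R u) x))"
    using weighted_estimate by blast
  \<comment> \<open>Exponents 4\<mu> and 2\<mu> are used below, at distances 3\<mu> and \<mu> from
    \<mu>; one \<open>R\<close> admissible for the larger distance serves both.\<close>
  obtain R where R: "R \<ge> 1" "(3 * \<mu>) * R powr (\<mu> - 1) \<le> \<eta>0" using exists_scale[OF \<mu>(2) \<eta>0(1)] by blast
  have s4: "\<bar>4 * \<mu> - \<mu>\<bar> * R powr (\<mu> - 1) \<le> \<eta>0" using R \<mu> by simp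
  have "\<mu> * R powr (\<mu> - 1) \<le> (3 * \<mu>) * R powr (\<mu> - 1)" using \<mu> by (intro mult_right_mono) auto
  then have "\<mu> * R powr (\<mu> - 1) \<le> \<eta>0" using R(2) by linarith
  then have s2: "\<bar>2 * \<mu> - \<mu>\<bar> * R powr (\<mu> - 1) \<le> \<eta>0" using \<mu> by simp
  have fR: "(\<lambda>x. rw R s x * fn f x) \<in> L2" for s using f by (simp add: L2_rw_equiv[OF R(1)])
  define \<epsilon> where "\<epsilon> k = inverse (real (Suc k))" for k
  have \<epsilon>: "\<epsilon> k > 0" for k by (simp add: \<epsilon>_def)
  have \<epsilon>0: "\<epsilon> \<longlonglongrightarrow> 0" unfolding \<epsilon>_def by (rule LIMSEQ_inverse_real_of_nat)
  have "\<exists>u. u \<in> H2 \<and> A u + \<epsilon> k *\<^sub>R u = f" for k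
  proof -
    have "f \<in> (\<lambda>u. A u + \<epsilon> k *\<^sub>R u) ` H2" using resolvent_onto[OF \<epsilon>, of k] by simp
    then show ?thesis by blast
  qed
  then obtain U where U: "\<And>k. U k \<in> H2" "\<And>k. A (U k) + \<epsilon> k *\<^sub>R U k = f" by metis
  define B where "B = 2 / c0 * norm (cls (\<lambda>x. rw R (4 * \<mu>) x * fn f x))"
  have b1: "(\<lambda>x. rw R (2 * \<mu>) x * fn (U k) x) \<in> L2 \<and> norm (cls (\<lambda>x. rw R (2 * \<mu>) x * fn (U k) x)) \<le> B" for k
  proof -
    have "4 * \<mu> - 2 * \<mu> = 2 * \<mu>" by simp
    then show ?thesis using \<eta>0(2)[OF R(1) s4, of "\<epsilon> k" "U k"] \<epsilon>[of k] U[of k] fR[of "4 * \<mu>"] by (simp add: B_def)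
  qed
  have b2: "norm (U j - U k) \<le> \<bar>\<epsilon> k - \<epsilon> j\<bar> * (2 / c0 * B)" for j k
  proof -
    have Uj: "U j - U k \<in> H2" by (rule H2_diff[OF U(1) U(1)])
    \<comment> \<open>The difference of two solutions has a solution as its source. The first use of
      the estimate bounds that source with exponent 2\<mu> uniformly, the second brings it down to
      exponent 0, with the small factor \<open>\<epsilon> k - \<epsilon> j\<close> in front.\<close>
    have eq: "A (U j - U k) + \<epsilon> j *\<^sub>R (U j - U k) = (\<epsilon> k - \<epsilon> j) *\<^sub>R U k"
    proof -
      have "A (U j) = f - \<epsilon> j *\<^sub>R U j" "A (U k) = f - \<epsilon> k *\<^sub>R U k"
        using U(2)[of j] U(2)[of k] by (metis add_diff_cancel_right')+
      then show ?thesis by (simp add: A_diff[OF U(1) U(1)] algebra_simps)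
    qed
    let ?g = "\<lambda>x. complex_of_real (\<epsilon> k - \<epsilon> j) * (rw R (2 * \<mu>) x * fn (U k) x)"
    have gL: "?g \<in> L2" by (rule L2_cmult) (use b1 in blast)
    have ae: "AE x in lebesgue. ?g x = rw R (2 * \<mu>) x * fn (A (U j - U k) + \<epsilon> j *\<^sub>R (U j - U k)) x"
      unfolding eq using fn_scaleR[of "\<epsilon> k - \<epsilon> j" "U k"] by eventually_elim simp
    have L: "(\<lambda>x. rw R (2 * \<mu>) x * fn (A (U j - U k) + \<epsilon> j *\<^sub>R (U j - U k)) x) \<in> L2"
      by (rule L2_AE_cong[OF gL _ ae]) (use R in simp)
    have n: "cls (\<lambda>x. rw R (2 * \<mu>) x * fn (A (U j - U k) + \<epsilon> j *\<^sub>R (U j - U k)) x) = (\<epsilon> k - \<epsilon> j) *\<^sub>R cls (\<lambda>x. rw R (2 * \<mu>) x * fn (U k) x)"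
      unfolding cls_eqI[OF ae, symmetric] by (rule cls_scaleR) (use b1 in blast)
    have z: "(\<lambda>x. rw R (2 * \<mu> - 2 * \<mu>) x * fn (U j - U k) x) = fn (U j - U k)"
      using R by (simp add: rw_zero)
    have "norm (U j - U k) \<le> 2 / c0 * (\<bar>\<epsilon> k - \<epsilon> j\<bar> * norm (cls (\<lambda>x. rw R (2 * \<mu>) x * fn (U k) x)))"
      using \<eta>0(2)[OF R(1) s2 _ Uj L] \<epsilon>[of j] unfolding n z by simp
    also have "\<dots> \<le> 2 / c0 * (\<bar>\<epsilon> k - \<epsilon> j\<bar> * B)" using b1[of k] c0 by (intro mult_left_mono) auto
    finally show ?thesis by (simp add: mult_ac)
  qed
  have "Cauchy (\<lambda>k. (2 / c0 * B) *\<^sub>R \<epsilon> k)"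
    by (rule LIMSEQ_imp_Cauchy[OF tendsto_scaleR[OF tendsto_const \<epsilon>0]])
  then have "Cauchy U"
  proof (rule Cauchy_bound[where W="\<lambda>k. 0 :: real"])
    show "Cauchy (\<lambda>k::nat. 0 :: real)" by (rule LIMSEQ_imp_Cauchy[OF tendsto_const])
    have "B \<ge> 0" using c0 by (simp add: B_def)
    then have nn: "0 \<le> 2 / c0 * B" using c0 by simp
    show "norm (U m - U n) \<le> norm ((2 / c0 * B) *\<^sub>R \<epsilon> m - (2 / c0 * B) *\<^sub>R \<epsilon> n) + norm (0 - 0 :: real)" for m n
    proof -
      have "norm (K *\<^sub>R x - K *\<^sub>R y) = \<bar>x - y\<bar> * K" if "K \<ge> 0" for K x y :: real
        using that by (simp add: right_diff_distrib[symmetric] abs_mult mult.commute)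
      from this[OF nn] show ?thesis using b2[of m n] abs_minus_commute[of "\<epsilon> m" "\<epsilon> n"] by simp
    qed
  qed
  then obtain u where u: "U \<longlonglongrightarrow> u" using Cauchy_convergent convergent_def by blast
  have "(\<lambda>k. f - \<epsilon> k *\<^sub>R U k) \<longlonglongrightarrow> f - 0 *\<^sub>R u" by (intro tendsto_intros \<epsilon>0 u)
  moreover have "f - \<epsilon> k *\<^sub>R U k = A (U k)" for k using U(2)[of k] by (metis add_diff_cancel_right')
  ultimately have "(\<lambda>k. A (U k)) \<longlonglongrightarrow> f" by simp
  then show ?thesis using A_closed[OF U(1) u] by blast
qed

lemma A_inj:
  assumes "u \<in> H2" "v \<in> H2" "A u = A v" shows "u = v"
proof -
  define w where "w = u - v"
  have w: "w \<in> H2" "A w = 0" using assms by (simp_all add: w_def H2_diff A_diff)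
  have b: "bdd_mult (rw 1 (- \<mu>) :: 'n cfun)" using \<mu> by (intro bdd_mult_rw) auto
  have "c0 * (grad_sq w + (norm (mul (rw 1 (- \<mu>)) w))\<^sup>2) \<le> 0"
    using coercive[OF w(1)] by (simp add: w(2) cinner.zero_left)
  then have "grad_sq w + (norm (mul (rw 1 (- \<mu>)) w))\<^sup>2 \<le> 0" using c0 by (simp add: mult_le_0_iff)
  then have "(norm (mul (rw 1 (- \<mu>)) w))\<^sup>2 = 0" using grad_sq_nonneg[of w] by (intro antisym) (linarith, simp)
  then have "mul (rw 1 (- \<mu>)) w = 0" by simp
  then have "AE x in lebesgue. rw 1 (- \<mu>) x * fn w x = 0"
    using fn_mul[OF b, of w] fn_zero by (auto elim!: eventually_rev_mp)
  then have "AE x in lebesgue. fn w x = fn 0 x"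
    using fn_zero
  proof eventually_elim
    case (elim x)
    then show ?case using rw_nonzero[of 1 "- \<mu>" x] by simp
  qed
  then have "w = 0" by (rule l2_eqI)
  then show ?thesis by (simp add: w_def)
qed

end

subsection \<open>Representatives of weak derivatives\<close>

lemma locally_integrable_mult_test:
  assumes v: "locally_integrable v" and \<phi>: "\<phi> \<in> test_functions"
  shows "integrable lebesgue (\<lambda>x. v x * \<phi> x)"
proof -
  obtain K where K: "compact K" "\<And>x. x \<notin> K \<Longrightarrow> \<phi> x = 0" using test_functionsE[OF \<phi>] by blast
  obtain B where B: "B \<ge> 0" "\<And>x. norm (\<phi> x) \<le> B"
    using compact_support_bounded[OF Ck_continuous[OF test_Ck[OF \<phi>]] K] by blast
  have "integrable lebesgue (\<lambda>x. indicator K x *\<^sub>R v x)"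
    using v K(1) unfolding locally_integrable_def set_integrable_def by blast
  then have "integrable lebesgue (\<lambda>x. B *\<^sub>R (indicator K x *\<^sub>R v x))" by (rule integrable_scaleR_right)
  then show ?thesis
  proof (rule Bochner_Integration.integrable_bound)
    show "(\<lambda>x. v x * \<phi> x) \<in> borel_measurable lebesgue"
      using v continuous_lebesgue_measurable[OF Ck_continuous[OF test_Ck[OF \<phi>]]]
      unfolding locally_integrable_def by (intro borel_measurable_times) auto
    show "AE x in lebesgue. norm (v x * \<phi> x) \<le> norm (B *\<^sub>R (indicator K x *\<^sub>R v x))"
    proof (rule AE_I2)
      fix x
      show "norm (v x * \<phi> x) \<le> norm (B *\<^sub>R (indicator K x *\<^sub>R v x))"
        using mult_left_mono[OF B(2)[of x], of "cmod (v x)"] B(1) K(2)[of x]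
        by (cases "x \<in> K") (auto simp: norm_mult mult.commute)
    qed
  qed
qed

lemma has_weak_partial_unique:
  assumes "has_weak_partial i f v" "has_weak_partial i f w"
  shows "AE x in lebesgue. v x = w x"
proof -
  have lv: "locally_integrable v" "locally_integrable w" using assms by (auto simp: has_weak_partial_def)
  have "locally_integrable (\<lambda>x. v x - w x)"
    using lv unfolding locally_integrable_def by auto
  moreover have "(LINT x|lebesgue. (v x - w x) * \<phi> x) = 0" if \<phi>: "\<phi> \<in> test_functions" for \<phi>
  proof -
    have "(LINT x|lebesgue. (v x - w x) * \<phi> x) = (LINT x|lebesgue. v x * \<phi> x) - (LINT x|lebesgue. w x * \<phi> x)"
      unfolding left_diff_distrib by (intro Bochner_Integration.integral_diff locally_integrable_mult_test lv \<phi>)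
    moreover have "- (LINT x|lebesgue. v x * \<phi> x) = - (LINT x|lebesgue. w x * \<phi> x)"
      using assms \<phi> unfolding has_weak_partial_def by metis
    ultimately show ?thesis by simp
  qed
  ultimately have "AE x in lebesgue. v x - w x = 0" by (rule fundamental_lemma)
  then show ?thesis by eventually_elim simp
qed

text \<open>\<open>weak_partial\<close> is an arbitrary choice among locally integrable weak
  derivatives. Their uniqueness almost everywhere identifies the choice with a representative of
  \<open>D i (cls f)\<close>.\<close>

lemma weak_partial_L2:
  assumes f: "f \<in> L2" and H: "cls f \<in> H1"
  shows "weak_partial i f \<in> L2" "cls (weak_partial i f) = D i (cls f)"
proof -
  have h: "has_weak_partial i f (fn (D i (cls f)))"
    using weak_deriv_D[OF H, of i] by (simp add: has_weak_partial_iff_weak_deriv[OF f])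
  then have h': "has_weak_partial i f (weak_partial i f)" unfolding weak_partial_def by (rule someI[of "has_weak_partial i f"])
  have ae: "AE x in lebesgue. fn (D i (cls f)) x = weak_partial i f x" by (rule has_weak_partial_unique[OF h h'])
  have "weak_partial i f \<in> borel_measurable lebesgue" using h' by (simp add: has_weak_partial_def locally_integrable_def)
  then show "weak_partial i f \<in> L2" by (rule L2_AE_cong[OF fn_L2 _ ae])
  show "cls (weak_partial i f) = D i (cls f)" using cls_eqI[OF ae] by simp
qed

lemma sobolev_1_iff: "f \<in> sobolev (Suc 0) \<longleftrightarrow> f \<in> L2 \<and> cls f \<in> H1"
proof
  assume "f \<in> sobolev (Suc 0)"
  then have f: "f \<in> L2" "\<And>i. \<exists>v\<in>L2. has_weak_partial i f v" by auto
  then have "\<exists>v. weak_deriv i (cls f) v" for i using has_weak_partial_iff_weak_deriv by blast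
  then show "f \<in> L2 \<and> cls f \<in> H1" using f by (simp add: H1_def)
next
  assume f: "f \<in> L2 \<and> cls f \<in> H1"
  then have "has_weak_partial i f (fn (D i (cls f)))" for i
    using weak_deriv_D[of "cls f" i] by (simp add: has_weak_partial_iff_weak_deriv)
  then show "f \<in> sobolev (Suc 0)" using f by (auto intro!: bexI[OF _ fn_L2])
qed

lemma sobolev_2_iff: "f \<in> sobolev 2 \<longleftrightarrow> f \<in> L2 \<and> cls f \<in> H2"
proof
  assume "f \<in> sobolev 2"
  then have f: "f \<in> L2" "\<And>i. \<exists>v\<in>sobolev (Suc 0). has_weak_partial i f v" by (auto simp: numeral_2_eq_2)
  have "\<exists>v\<in>H1. weak_deriv i (cls f) v" for i using f(2)[of i] f(1) has_weak_partial_iff_weak_deriv sobolev_1_iff by blast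
  then have w: "\<exists>v. v \<in> H1 \<and> weak_deriv i (cls f) v" for i by blast
  then have "cls f \<in> H1" unfolding H1_def by blast
  moreover have "D i (cls f) \<in> H1" for i using w[of i] D_eqI by blast
  ultimately show "f \<in> L2 \<and> cls f \<in> H2" using f by (simp add: H2_def)
next
  assume f: "f \<in> L2 \<and> cls f \<in> H2"
  have "has_weak_partial i f (fn (D i (cls f)))" for i
    using f weak_deriv_D[OF H2_H1, of "cls f" i] by (simp add: has_weak_partial_iff_weak_deriv)
  moreover have "fn (D i (cls f)) \<in> sobolev (Suc 0)" for i
    unfolding sobolev_1_iff using f by (simp add: H2_def)
  ultimately show "f \<in> sobolev 2" using f by (simp add: numeral_2_eq_2 del: sobolev.simps(2)) (simp add: sobolev.simps(2)[of "Suc 0"] del: sobolev.simps(2), blast)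
qed

lemma laplacian_L2:
  assumes f: "f \<in> sobolev 2" shows "laplacian f \<in> L2" "cls (laplacian f) = Lap (cls f)"
proof -
  have f': "f \<in> L2" "cls f \<in> H2" using f by (auto simp: sobolev_2_iff)
  note 1 = weak_partial_L2[OF f'(1) H2_H1[OF f'(2)]]
  have 2: "weak_partial j (weak_partial j f) \<in> L2" "cls (weak_partial j (weak_partial j f)) = D j (D j (cls f))" for j
    using weak_partial_L2[OF 1(1)[of j], of j] H2_D[OF f'(2), of j] by (auto simp: 1(2))
  show "laplacian f \<in> L2" unfolding laplacian_def[abs_def] by (intro L2_sum 2)
  show "cls (laplacian f) = Lap (cls f)" unfolding laplacian_def[abs_def] Lap_def by (simp add: cls_sum 2)
qed

lemma grad_norm_grad_len:
  assumes f: "f \<in> sobolev 2" shows "grad_norm f = grad_len (cls f)"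
proof -
  have f': "f \<in> L2" "cls f \<in> H1" using f by (auto simp: sobolev_2_iff H2_H1)
  have "L2_norm (weak_partial j f) = norm (D j (cls f))" for j
    using weak_partial_L2[OF f', of j] norm_cls[of "weak_partial j f"] by simp
  then show ?thesis by (simp add: grad_norm_def grad_len_def grad_sq_def)
qed

definition pot :: "('n::finite) cfun \<Rightarrow> 'n l2 \<Rightarrow> 'n l2" where
  "pot V0 u = cls (\<lambda>x. V0 x * fn u x)"

text \<open>Every function differentiated in \<open>elliptic_op\<close> has its class in H^1, so
  \<open>weak_partial_L2\<close> translates the pointwise expression term by term into the one on
  classes.\<close>

lemma elliptic_op_L2:
  assumes a: "\<And>i j. a i j \<in> Cb1" and b: "\<And>j. bdd_mult (b j)" and V: "laplacian_bounded_zero V0" and f: "f \<in> sobolev 2"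
  shows "elliptic_op a b V0 f \<in> L2" "cls (elliptic_op a b V0 f) = elliptic_cls a b (pot V0) (cls f)"
proof -
  have f': "f \<in> L2" "cls f \<in> H2" using f by (auto simp: sobolev_2_iff)
  note 1 = weak_partial_L2[OF f'(1) H2_H1[OF f'(2)]]
  have ag: "(\<lambda>y. a i j y * weak_partial j f y) \<in> L2" "cls (\<lambda>y. a i j y * weak_partial j f y) = mul (a i j) (D j (cls f))" for i j
    using L2_mult_bdd_mult[OF Cb1_bdd_mult[OF a] 1(1), of i j j] mul_cls[OF Cb1_bdd_mult[OF a] 1(1), of i j j] by (auto simp: 1(2))
  have "cls (\<lambda>y. a i j y * weak_partial j f y) \<in> H1" for i j
    unfolding ag(2) by (rule H1_mul[OF a H2_D[OF f'(2)]])
  note 2 = weak_partial_L2[OF ag(1) this]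
  have bg: "(\<lambda>y. b j y * weak_partial j f y) \<in> L2" "cls (\<lambda>y. b j y * weak_partial j f y) = mul (b j) (D j (cls f))" for j
    using L2_mult_bdd_mult[OF b 1(1), of j j] mul_cls[OF b 1(1), of j j] by (auto simp: 1(2))
  have Vf: "(\<lambda>x. V0 x * f x) \<in> L2" using V f by (simp add: laplacian_bounded_zero_def)
  have Vc: "cls (\<lambda>x. V0 x * f x) = pot V0 (cls f)"
    unfolding pot_def using fn_cls[OF f'(1)] by (intro cls_eqI) (auto elim: eventually_mono)
  let ?P = "\<lambda>x. \<Sum>i\<in>UNIV. \<Sum>j\<in>UNIV. weak_partial i (\<lambda>y. a i j y * weak_partial j f y) x"
  let ?Q = "\<lambda>x. \<Sum>j\<in>UNIV. b j x * weak_partial j f x"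
  have P: "?P \<in> L2" "cls ?P = (\<Sum>i\<in>UNIV. \<Sum>j\<in>UNIV. D i (mul (a i j) (D j (cls f))))"
    by (intro L2_sum 2) (simp add: cls_sum L2_sum 2 ag)
  have Q: "?Q \<in> L2" "cls ?Q = (\<Sum>j\<in>UNIV. mul (b j) (D j (cls f)))"
    by (intro L2_sum bg) (simp add: cls_sum bg)
  have e: "elliptic_op a b V0 f = (\<lambda>x. (?Q x - ?P x) + V0 x * f x)"
    by (rule ext) (simp add: elliptic_op_def)
  show "elliptic_op a b V0 f \<in> L2" unfolding e by (intro L2_add L2_diff P Q Vf)
  show "cls (elliptic_op a b V0 f) = elliptic_cls a b (pot V0) (cls f)"
    unfolding e cls_add[OF L2_diff[OF Q(1) P(1)] Vf] cls_diff[OF Q(1) P(1)] P(2) Q(2) Vc elliptic_cls_def by simp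
qed

lemma fn_sobolev: "u \<in> H2 \<Longrightarrow> fn u \<in> sobolev 2"
  by (simp add: sobolev_2_iff)

lemma coercive_l2_elliptic_op:
  fixes a :: "'n::finite \<Rightarrow> 'n \<Rightarrow> 'n cfun"
  assumes V0_meas: "V0 \<in> borel_measurable lebesgue"
    and a: "\<And>i j. a i j \<in> Cb1" and b: "\<And>j. b j \<in> Cb1" and c: "c > 0"
    and elliptic: "\<And>x (\<xi> :: real ^ 'n).
           (\<Sum>i\<in>UNIV. \<Sum>j\<in>UNIV. Re (a i j x) * \<xi> $ i * \<xi> $ j) \<ge> c * (norm \<xi>)\<^sup>2"
    and V: "laplacian_bounded_zero V0"
    and accretive: "\<And>u. u \<in> sobolev 2 \<Longrightarrow> Re (L2_inner (elliptic_op a b V0 u) u) \<ge> 0"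
    and mu: "0 < \<mu>" "\<mu> < 1" and c0: "c0 > 0"
    and coercive: "\<And>u. u \<in> sobolev 2 \<Longrightarrow>
           cmod (L2_inner (elliptic_op a b V0 u) u) \<ge>
             c0 * ((grad_norm u)\<^sup>2 + (L2_norm (\<lambda>x. of_real (jbracket x powr (- \<mu>)) * u x))\<^sup>2)"
    and b_decay: "\<And>j. bdd_above (range (\<lambda>x. cmod (of_real (jbracket x powr \<mu>) * b j x)))"
  shows "\<exists>Bb. coercive_l2 a b (pot V0) (elliptic_cls a b (pot V0)) c \<mu> c0 Bb"
proof -
  have bb: "bdd_mult (b j)" for j using b by (rule Cb1_bdd_mult)
  note op = elliptic_op_L2[OF a bb V]
  have VL: "(\<lambda>x. V0 x * fn u x) \<in> L2" if "u \<in> H2" for u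
    using V fn_sobolev[OF that] by (simp add: laplacian_bounded_zero_def)
  have inn: "L2_inner (elliptic_op a b V0 (fn u)) (fn u) = cinner (elliptic_cls a b (pot V0) u) u" if "u \<in> H2" for u
    using op[OF fn_sobolev[OF that]] cinner_cls[of "elliptic_op a b V0 (fn u)" "fn u"] by simp
  have "\<forall>j. \<exists>B. \<forall>x. cmod (of_real (jbracket x powr \<mu>) * b j x) \<le> B"
    using b_decay unfolding bdd_above_def by blast
  then obtain B where B: "\<And>j x. cmod (of_real (jbracket x powr \<mu>) * b j x) \<le> B j" by metis
  have "coercive_l2 a b (pot V0) (elliptic_cls a b (pot V0)) c \<mu> c0 (\<Sum>j\<in>UNIV. B j)"
  proof (unfold_locales)
    fix u v :: "'n l2" assume u: "u \<in> H2" and v: "v \<in> H2"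
    show "pot V0 (u - v) = pot V0 u - pot V0 v"
      unfolding pot_def cls_diff[OF VL[OF u] VL[OF v], symmetric]
      using fn_diff[of u v] by (intro cls_eqI) (auto elim: eventually_mono simp: right_diff_distrib)
  next
    fix \<epsilon> :: real assume "\<epsilon> > 0"
    then obtain K where K: "\<And>f. f \<in> sobolev 2 \<Longrightarrow>
        L2_norm (\<lambda>x. V0 x * f x) \<le> \<epsilon> * L2_norm (\<lambda>x. - laplacian f x) + K * L2_norm f"
      using V unfolding laplacian_bounded_zero_def by blast
    have "norm (pot V0 u) \<le> \<epsilon> * norm (Lap u) + K * norm u" if u: "u \<in> H2" for u :: "'n l2"
    proof -
      have "L2_norm (\<lambda>x. - laplacian (fn u) x) = norm (Lap u)"
        using laplacian_L2[OF fn_sobolev[OF u]] norm_cls[of "laplacian (fn u)"] by (simp add: L2_norm_def)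
      then show ?thesis using K[OF fn_sobolev[OF u]] norm_cls[OF VL[OF u]] norm_cls[OF fn_L2[of u]] by (simp add: pot_def)
    qed
    then show "\<exists>K. \<forall>u\<in>H2. norm (pot V0 (u :: 'n l2)) \<le> \<epsilon> * norm (Lap u) + K * norm u" by blast
  next
    fix u :: "'n l2" assume u: "u \<in> H2"
    show "0 \<le> Re (cinner (elliptic_cls a b (pot V0) u) u)"
      using accretive[OF fn_sobolev[OF u]] by (simp add: inn[OF u])
    have bj: "bdd_mult (rw 1 (- \<mu>) :: 'n cfun)" using mu by (intro bdd_mult_rw) auto
    have "L2_norm (\<lambda>x. of_real (jbracket x powr (- \<mu>)) * fn u x) = norm (mul (rw 1 (- \<mu>)) u)"
      using norm_cls[OF L2_mult_bdd_mult[OF bj fn_L2[of u]]] by (simp add: mul_def rw_def jbracket_rb)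
    then show "c0 * (grad_sq u + (norm (mul (rw 1 (- \<mu>)) u))\<^sup>2) \<le> cmod (cinner (elliptic_cls a b (pot V0) u) u)"
      using coercive[OF fn_sobolev[OF u]] by (simp add: inn[OF u] grad_norm_grad_len[OF fn_sobolev[OF u]] grad_len_sq)
  next
    fix j x
    have nn: "0 \<le> B i" for i using B[of _ i] norm_ge_zero order_trans by blast
    have "B j \<le> (\<Sum>j\<in>UNIV. B j)" using nn by (intro member_le_sum) auto
    then show "cmod (rw 1 \<mu> x * b j x) \<le> (\<Sum>j\<in>UNIV. B j)"
      using B[of x j] by (simp add: rw_def jbracket_rb)
  next
    fix w :: "'n cfun" and u :: "'n l2" assume w: "w \<in> Cb1" and u: "u \<in> H2"
    show "pot V0 (mul w u) = mul w (pot V0 u)"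
      unfolding pot_def mul_cls[OF Cb1_bdd_mult[OF w] VL[OF u]]
      using fn_mul[OF Cb1_bdd_mult[OF w], of u] by (intro cls_eqI) (auto elim: eventually_mono)
  qed (use a bb c elliptic mu c0 in auto)
  then show ?thesis by blast
qed

subsection \<open>Weighted spaces\<close>

text \<open>The map from the weighted space into \<open>l2\<close> given by multiplication with its
  weight. For \<open>R = 1\<close> it is an isometry for \<open>wL2_norm\<close>; other
  \<open>R\<close> give equivalent norms.\<close>

definition WR :: "real \<Rightarrow> real \<Rightarrow> ('n::finite) cfun \<Rightarrow> 'n l2" where
  "WR R s f = cls (\<lambda>x. rw R s x * f x)"

lemma cmod_rw_mult_sq: "(cmod (rw 1 s x * f x))\<^sup>2 = jbracket x powr (2 * s) * (cmod (f x))\<^sup>2"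
proof -
  have "jbracket x powr (2 * s) = (jbracket x powr s)\<^sup>2"
    unfolding power2_eq_square powr_add[symmetric] by simp
  then show ?thesis by (simp add: norm_mult cmod_rw jbracket_rb power_mult_distrib)
qed

lemma wL2_iff: "f \<in> wL2 s \<longleftrightarrow> f \<in> borel_measurable lebesgue \<and> (\<lambda>x. rw 1 s x * f x) \<in> L2"
  unfolding wL2_def L2_def mem_Collect_eq cmod_rw_mult_sq by auto

lemma wL2_measurable: "f \<in> wL2 s \<Longrightarrow> f \<in> borel_measurable lebesgue" by (simp add: wL2_iff)

lemma wL2_L2: "R \<ge> 1 \<Longrightarrow> f \<in> wL2 s \<Longrightarrow> (\<lambda>x. rw R s x * f x) \<in> L2"
  using L2_rw_equiv[of R f s] by (simp add: wL2_iff)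

lemma wL2I: "R \<ge> 1 \<Longrightarrow> f \<in> borel_measurable lebesgue \<Longrightarrow> (\<lambda>x. rw R s x * f x) \<in> L2 \<Longrightarrow> f \<in> wL2 s"
  using L2_rw_equiv[of R f s] by (simp add: wL2_iff)

lemma wL2_norm_WR: "f \<in> wL2 s \<Longrightarrow> wL2_norm s f = norm (WR 1 s f)"
  unfolding WR_def norm_cls[OF wL2_L2[OF order_refl]] wL2_norm_def L2_norm_def cmod_rw_mult_sq ..

lemma wL2_lin:
  assumes "f \<in> wL2 s" "g \<in> wL2 s" shows "(\<lambda>x. f x + z * g x) \<in> wL2 s"
proof -
  have "(\<lambda>x. rw 1 s x * f x + z * (rw 1 s x * g x)) \<in> L2"
    using assms by (intro L2_add L2_cmult wL2_L2) auto
  moreover have "(\<lambda>x. f x + z * g x) \<in> borel_measurable lebesgue"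
    using wL2_measurable[OF assms(1)] wL2_measurable[OF assms(2)] by simp
  ultimately show ?thesis by (simp add: wL2_iff algebra_simps)
qed

lemma WR_lin:
  assumes "R \<ge> 1" "f \<in> wL2 s" "g \<in> wL2 s"
  shows "WR R s (\<lambda>x. f x + z * g x) = WR R s f + mul (\<lambda>x. z) (WR R s g)"
proof -
  have "WR R s (\<lambda>x. f x + z * g x) = cls (\<lambda>x. rw R s x * f x + z * (rw R s x * g x))"
    by (simp add: WR_def algebra_simps)
  also have "\<dots> = WR R s f + mul (\<lambda>x. z) (WR R s g)"
    unfolding WR_def using assms by (simp add: cls_add L2_cmult wL2_L2 cls_cmult)
  finally show ?thesis .
qed

lemma mul_minus_one: "mul (\<lambda>x. - 1) u = - u"
  using mul_of_real[of "-1" u] by simp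

lemma WR_diff:
  assumes "R \<ge> 1" "f \<in> wL2 s" "g \<in> wL2 s"
  shows "WR R s (\<lambda>x. f x - g x) = WR R s f - WR R s g"
  using WR_lin[OF assms, of "-1"] by (simp add: mul_minus_one)

lemma wL2_diff: "f \<in> wL2 s \<Longrightarrow> g \<in> wL2 s \<Longrightarrow> (\<lambda>x. f x - g x) \<in> wL2 s"
  using wL2_lin[of f s g "-1"] by simp

lemma wL2_cong:
  assumes "f \<in> wL2 s" "AE x in lebesgue. f x = g x" "g \<in> borel_measurable lebesgue" shows "g \<in> wL2 s"
proof -
  have "AE x in lebesgue. rw 1 s x * f x = rw 1 s x * g x" using assms(2) by eventually_elim simp
  then have "(\<lambda>x. rw 1 s x * g x) \<in> L2"
    by (rule L2_AE_cong[OF wL2_L2[OF order_refl assms(1)], rotated]) (use assms(3) in simp)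
  then show ?thesis using assms(3) by (simp add: wL2_iff)
qed

lemma WR_cong: "AE x in lebesgue. f x = g x \<Longrightarrow> WR R s f = WR R s g"
  unfolding WR_def by (rule cls_eqI) (auto elim: eventually_mono)

lemma WR_eq_0:
  assumes R: "R \<ge> 1" and f: "f \<in> wL2 s" and z: "WR R s f = 0" shows "AE x in lebesgue. f x = 0"
proof -
  have "AE x in lebesgue. rw R s x * f x = 0"
    using z cls_eq_iff[OF wL2_L2[OF R f] L2_zero] by (simp add: WR_def cls_zero)
  then show ?thesis
  proof eventually_elim
    case (elim x)
    then show ?case using R rw_nonzero[of R s x] by simp
  qed
qed

lemma wL2_mono: "f \<in> wL2 s \<Longrightarrow> t \<le> s \<Longrightarrow> f \<in> wL2 t"
  using L2_rw_mono[of 1 f s t] by (simp add: wL2_iff)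

lemma WR_mono: "f \<in> wL2 s \<Longrightarrow> t \<le> s \<Longrightarrow> WR 1 t f = mul (rw 1 (t - s)) (WR 1 s f)"
proof -
  assume a: "f \<in> wL2 s" "t \<le> s"
  have e: "rw 1 (t - s) x * (rw 1 s x * f x) = rw 1 t x * f x" for x
    unfolding mult.assoc[symmetric] rw_add[OF zero_less_one] by simp
  show ?thesis unfolding WR_def using a by (simp add: mul_cls bdd_mult_rw wL2_L2 e)
qed

text \<open>Changing \<open>R\<close> at fixed exponent is a bounded multiplication. So convergence
  may be tested with \<open>R = 1\<close>, as in the definition of the extension, while the
  estimates use an \<open>R\<close> adapted to the exponent.\<close>

lemma WR_scale:
  assumes R: "R \<ge> 1" "R' \<ge> 1"
  obtains m where "bdd_mult m" "\<And>f. f \<in> wL2 s \<Longrightarrow> WR R' s f = mul m (WR R s (f :: 'n::finite cfun))"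
proof
  let ?m = "\<lambda>x :: real^'n. rw R' s x * rw R (- s) x"
  have nz: "rw R (- s) x * rw R s x = 1" for x :: "real^'n"
    using R by (subst rw_add) (auto simp: rw_zero)
  show bdd_mult: "bdd_mult ?m"
  proof (rule bmI)
    show "?m \<in> borel_measurable lebesgue" using R by simp
    fix x :: "real^'n"
    have r: "rb R x > 0" by (rule rb_pos) (use R in simp)
    have "rb R' x powr s \<le> R' powr \<bar>s\<bar> * rb 1 x powr s" by (rule rb_powr_equiv(1)[OF R(2)])
    also have "\<dots> \<le> R' powr \<bar>s\<bar> * (R powr \<bar>s\<bar> * rb R x powr s)" by (intro mult_left_mono rb_powr_equiv(2) R) auto
    finally have "rb R' x powr s * rb R x powr (- s) \<le> (R' powr \<bar>s\<bar> * (R powr \<bar>s\<bar> * rb R x powr s)) * rb R x powr (- s)"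
      by (intro mult_right_mono) auto
    also have "\<dots> = R' powr \<bar>s\<bar> * R powr \<bar>s\<bar> * (rb R x powr s * rb R x powr (- s))" by simp
    also have "rb R x powr s * rb R x powr (- s) = 1" using r by (simp add: powr_add[symmetric])
    finally show "cmod (?m x) \<le> R' powr \<bar>s\<bar> * R powr \<bar>s\<bar>" by (simp add: norm_mult cmod_rw)
  qed
  fix f :: "'n cfun" assume f: "f \<in> wL2 s"
  have e: "?m x * (rw R s x * f x) = rw R' s x * f x" for x
  proof -
    have "?m x * (rw R s x * f x) = rw R' s x * (rw R (- s) x * rw R s x) * f x" by (simp only: mult_ac)
    then show ?thesis by (simp add: nz)
  qed
  show "WR R' s f = mul ?m (WR R s f)" unfolding WR_def mul_cls[OF bdd_mult wL2_L2[OF R(1) f]] e ..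
qed

lemma WR_tendsto_scale:
  fixes F :: "nat \<Rightarrow> 'n::finite cfun"
  assumes "R \<ge> 1" "R' \<ge> 1" "\<And>k. F k \<in> wL2 s" "f \<in> wL2 s" "(\<lambda>k. WR R s (F k)) \<longlonglongrightarrow> WR R s f"
  shows "(\<lambda>k. WR R' s (F k)) \<longlonglongrightarrow> WR R' s f"
proof -
  obtain m where m: "bdd_mult m" "\<And>f :: 'n cfun. f \<in> wL2 s \<Longrightarrow> WR R' s f = mul m (WR R s f)" using WR_scale[OF assms(1,2)] by blast
  show ?thesis using bounded_linear.tendsto[OF bounded_linear_mul[OF m(1)] assms(5)] by (simp add: m(2) assms)
qed

lemma WR_tendsto_mono:
  assumes "t \<le> s" "\<And>k. F k \<in> wL2 s" "f \<in> wL2 s" "(\<lambda>k. WR 1 s (F k)) \<longlonglongrightarrow> WR 1 s f"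
  shows "(\<lambda>k. WR 1 t (F k)) \<longlonglongrightarrow> WR 1 t f"
proof -
  have b: "bdd_mult (rw 1 (t - s))" using assms(1) by (intro bdd_mult_rw) auto
  show ?thesis using bounded_linear.tendsto[OF bounded_linear_mul[OF b] assms(4)]
    by (simp only: WR_mono[OF assms(2,1)] WR_mono[OF assms(3,1)])
qed

lemma wL2_tendsto_iff:
  assumes "\<And>k. F k \<in> wL2 s" "f \<in> wL2 s"
  shows "(\<lambda>k. wL2_norm s (\<lambda>x. F k x - f x)) \<longlonglongrightarrow> 0 \<longleftrightarrow> (\<lambda>k. WR 1 s (F k)) \<longlonglongrightarrow> WR 1 s f"
  unfolding wL2_norm_WR[OF wL2_diff[OF assms]] WR_diff[OF order_refl assms] tendsto_norm_zero_iff LIM_zero_iff ..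

section \<open>Approximation by truncation to balls\<close>

lemma bdd_mult_truncation: "bdd_mult (\<lambda>x :: real^'n::finite. indicator (cball 0 (real k)) x)"
proof (rule bmI)
  show "(\<lambda>x :: real^'n. indicator (cball 0 (real k)) x :: complex) \<in> borel_measurable lebesgue"
    by (intro borel_measurable_indicator) simp
  show "cmod (indicator (cball 0 (real k)) x) \<le> 1" for x :: "real^'n" by (simp add: indicator_def)
qed

lemma mul_truncation_tendsto: "(\<lambda>k. mul (\<lambda>x. indicator (cball 0 (real k)) x) v) \<longlonglongrightarrow> (v :: 'n::finite l2)"
proof -
  note b = bdd_mult_truncation
  have m: "(\<lambda>x. (cmod ((indicator (cball 0 (real k)) x - 1) * fn v x))\<^sup>2) \<in> borel_measurable lebesgue" for k
  proof -
    have "(\<lambda>x. (indicator (cball 0 (real k)) x - 1) * fn v x) \<in> borel_measurable lebesgue"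
      by (intro borel_measurable_times borel_measurable_diff borel_measurable_const bdd_mult_measurable[OF b] fn_measurable)
    then show ?thesis by simp
  qed
  have sq: "(norm (mul (\<lambda>x. indicator (cball 0 (real k)) x) v - v))\<^sup>2
     = (LINT x|lebesgue. (cmod ((indicator (cball 0 (real k)) x - 1) * fn v x))\<^sup>2)" for k
    unfolding norm_l2_sq
  proof (rule integral_cong_AE)
    show "AE x in lebesgue. (cmod (fn (mul (\<lambda>x. indicator (cball 0 (real k)) x) v - v) x))\<^sup>2 = (cmod ((indicator (cball 0 (real k)) x - 1) * fn v x))\<^sup>2"
      using fn_mul[OF b[of k], of v] fn_diff[of "mul (\<lambda>x. indicator (cball 0 (real k)) x) v" v]
      by eventually_elim (simp add: left_diff_distrib)
    show "(\<lambda>x. (cmod ((indicator (cball 0 (real k)) x - 1) * fn v x))\<^sup>2) \<in> borel_measurable lebesgue" by (rule m)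
  qed simp
  have "(\<lambda>k. LINT x|lebesgue. (cmod ((indicator (cball 0 (real k)) x - 1) * fn v x))\<^sup>2) \<longlonglongrightarrow> (LINT x|(lebesgue :: (real^'n) measure). 0)"
  proof (rule integral_dominated_convergence)
    show "integrable lebesgue (\<lambda>x. (cmod (fn v x))\<^sup>2)" by (simp add: L2_D(2))
    show "AE x in lebesgue. (\<lambda>k. (cmod ((indicator (cball 0 (real k)) x - 1) * fn v x))\<^sup>2) \<longlonglongrightarrow> 0"
    proof (rule AE_I2)
      fix x :: "real^'n"
      obtain n :: nat where n: "norm x \<le> real n" using real_arch_simple by blast
      have "\<forall>\<^sub>F k in sequentially. (cmod ((indicator (cball 0 (real k)) x - 1) * fn v x))\<^sup>2 = 0"
        using eventually_ge_at_top[of n] by eventually_elim (use n in \<open>simp add: indicator_def\<close>)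
      then show "(\<lambda>k. (cmod ((indicator (cball 0 (real k)) x - 1) * fn v x))\<^sup>2) \<longlonglongrightarrow> 0"
        by (rule tendsto_eventually)
    qed
    show "AE x in lebesgue. norm ((cmod ((indicator (cball 0 (real k)) x - 1) * fn v x))\<^sup>2) \<le> (cmod (fn v x))\<^sup>2" for k
      by (intro AE_I2) (auto simp: indicator_def)
    show "(\<lambda>x. (cmod ((indicator (cball 0 (real k)) x - 1) * fn v x))\<^sup>2) \<in> borel_measurable lebesgue" for k
      by (rule m)
  qed simp
  then have "(\<lambda>k. (norm (mul (\<lambda>x. indicator (cball 0 (real k)) x) v - v))\<^sup>2) \<longlonglongrightarrow> 0" unfolding sq by simp
  then have "(\<lambda>k. sqrt ((norm (mul (\<lambda>x. indicator (cball 0 (real k)) x) v - v))\<^sup>2)) \<longlonglongrightarrow> sqrt 0" by (rule tendsto_real_sqrt)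
  then have "(\<lambda>k. norm (mul (\<lambda>x. indicator (cball 0 (real k)) x) v - v)) \<longlonglongrightarrow> 0" by simp
  then show ?thesis by (simp add: tendsto_norm_zero_iff LIM_zero_iff)
qed

lemma Cb1_const: "(\<lambda>x. z) \<in> Cb1"
proof -
  have "partial i (\<lambda>x. z) = (\<lambda>x :: real^'a. 0)" for i by (rule ext) simp
  then show ?thesis unfolding Cb1_def using Ck_const[of 1 z] by simp
qed

subsection \<open>The extended inverse\<close>

locale extended_inverse = coercive_l2 a b V A c \<mu> c0 Bb
  for a :: "'n::finite \<Rightarrow> 'n \<Rightarrow> 'n cfun" and b V A c \<mu> c0 Bb +
  fixes H :: "'n cfun \<Rightarrow> 'n cfun"
  assumes H: "\<And>f. f \<in> sobolev 2 \<Longrightarrow> H f \<in> L2 \<and> cls (H f) = A (cls f)"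
begin

text \<open>\<open>A_diff\<close> yields additivity only. Complex homogeneity comes from regarding
  the scalar as a constant multiplier, which commutes with \<open>D\<close>, the coefficients and
  \<open>V\<close>.\<close>

lemma A_lin:
  assumes u: "u \<in> H2" and v: "v \<in> H2"
  shows "u + mul (\<lambda>x. z) v \<in> H2" "A (u + mul (\<lambda>x. z) v) = A u + mul (\<lambda>x. z) (A v)"
proof -
  have p: "partial i (\<lambda>x. z) x = 0 * z" for i :: 'n and x by simp
  have pz: "partial i (\<lambda>x. z) = (\<lambda>x. 0)" for i :: 'n by (rule ext) simp
  note zv = H2_mul[OF Cb1_const Cb1_const p v]
  have z0: "mul (\<lambda>x. 0) w = 0" for w :: "'n l2" using mul_of_real[of 0 w] by simp
  have D: "D i (mul (\<lambda>x. z) v) = mul (\<lambda>x. z) (D i v)" for i by (simp add: zv(2) z0)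
  have com: "mul m (mul (\<lambda>x. z) w) = mul (\<lambda>x. z) (mul m w)" if "bdd_mult m" for m w
    using that by (simp add: mul_mul mult.commute)
  have D1: "D i (mul (\<lambda>x. z) w) = mul (\<lambda>x. z) (D i w)" if "w \<in> H1" for i and w :: "'n l2"
    unfolding D_mul[OF Cb1_const that] pz z0 by simp
  have mul_sum: "mul (\<lambda>x. z) (\<Sum>i\<in>I. f i) = (\<Sum>i\<in>I. mul (\<lambda>x. z) (f i))" for I and f :: "'n \<Rightarrow> 'n l2"
    using bounded_linear_mul[OF bdd_mult_const, THEN bounded_linear.linear, THEN linear_sum] .
  have mul_minus: "mul (\<lambda>x. z) (- w) = - mul (\<lambda>x. z) w" for w :: "'n l2"
    using bounded_linear_mul[OF bdd_mult_const, THEN bounded_linear.linear, THEN linear_neg] .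
  have Az: "A (mul (\<lambda>x. z) v) = mul (\<lambda>x. z) (A v)"
    unfolding A_def elliptic_cls_def D V_mul[OF Cb1_const v zv(1)]
    by (simp only: com[OF a_bdd_mult(1)] com[OF b] D1[OF H1_mul[OF a H2_D[OF v]]] mul_add[OF bdd_mult_const] mul_sum mul_minus)
  show uv: "u + mul (\<lambda>x. z) v \<in> H2" by (intro subspace_add subspace_H2 u zv(1))
  have "A u = A ((u + mul (\<lambda>x. z) v) - mul (\<lambda>x. z) v)" by simp
  also have "\<dots> = A (u + mul (\<lambda>x. z) v) - A (mul (\<lambda>x. z) v)" by (rule A_diff[OF uv zv(1)])
  finally show "A (u + mul (\<lambda>x. z) v) = A u + mul (\<lambda>x. z) (A v)" by (simp add: Az)
qed

section \<open>The inverse on rapidly decaying functions\<close>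

definition rapid :: "'n cfun set" where "rapid = (\<Inter>t. wL2 t)"

lemma rapidD: "F \<in> rapid \<Longrightarrow> F \<in> wL2 t" by (simp add: rapid_def)

lemma rapid_L2: "F \<in> rapid \<Longrightarrow> F \<in> L2"
  using wL2_L2[OF order_refl rapidD, of F 0] by (simp add: rw_zero)

lemma rapid_lin: "F \<in> rapid \<Longrightarrow> G \<in> rapid \<Longrightarrow> (\<lambda>x. F x + z * G x) \<in> rapid"
  by (simp add: rapid_def wL2_lin)

lemma alg_inverse:
  assumes F: "F \<in> rapid"
  shows "alg_inverse H F \<in> sobolev 2" "A (cls (alg_inverse H F)) = cls F"
proof -
  have "(\<lambda>x. rw 1 s x * fn (cls F) x) \<in> L2" for s
  proof (rule L2_AE_cong[OF wL2_L2[OF order_refl rapidD[OF F]]])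
    show "AE x in lebesgue. rw 1 s x * F x = rw 1 s x * fn (cls F) x"
      using fn_cls[OF rapid_L2[OF F]] by eventually_elim simp
  qed simp
  then obtain u where u: "u \<in> H2" "A u = cls F" using solve by blast
  have "cls (H (fn u)) = cls F" using H[OF fn_sobolev[OF u(1)]] u(2) by simp
  then have "AE x in lebesgue. H (fn u) x = F x"
    using cls_eq_iff[OF _ rapid_L2[OF F]] H[OF fn_sobolev[OF u(1)]] by blast
  then have "fn u \<in> sobolev 2 \<and> (AE x in lebesgue. H (fn u) x = F x)" using fn_sobolev[OF u(1)] by blast
  then have *: "alg_inverse H F \<in> sobolev 2 \<and> (AE x in lebesgue. H (alg_inverse H F) x = F x)"
    unfolding alg_inverse_def
    by (rule someI[of "\<lambda>u. u \<in> sobolev 2 \<and> (AE x in lebesgue. H u x = F x)"])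
  then show "alg_inverse H F \<in> sobolev 2" by simp
  show "A (cls (alg_inverse H F)) = cls F" using * H cls_eqI by metis
qed

lemma alg_inverse_lin:
  assumes F: "F \<in> rapid" and G: "G \<in> rapid"
  shows "AE x in lebesgue. alg_inverse H (\<lambda>x. F x + z * G x) x = alg_inverse H F x + z * alg_inverse H G x"
proof -
  note FG = rapid_lin[OF F G, of z]
  have s: "alg_inverse H F \<in> L2" "cls (alg_inverse H F) \<in> H2" "alg_inverse H G \<in> L2" "cls (alg_inverse H G) \<in> H2"
    "alg_inverse H (\<lambda>x. F x + z * G x) \<in> L2" "cls (alg_inverse H (\<lambda>x. F x + z * G x)) \<in> H2"
    using alg_inverse(1)[OF F] alg_inverse(1)[OF G] alg_inverse(1)[OF FG] by (auto simp: sobolev_2_iff)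
  have "cls (alg_inverse H (\<lambda>x. F x + z * G x)) = cls (alg_inverse H F) + mul (\<lambda>x. z) (cls (alg_inverse H G))"
  proof (rule A_inj)
    show "A (cls (alg_inverse H (\<lambda>x. F x + z * G x))) = A (cls (alg_inverse H F) + mul (\<lambda>x. z) (cls (alg_inverse H G)))"
      unfolding A_lin(2)[OF s(2) s(4)] alg_inverse(2)[OF F] alg_inverse(2)[OF G] alg_inverse(2)[OF FG]
      using rapid_L2[OF F] rapid_L2[OF G] by (simp add: cls_add cls_cmult L2_cmult)
  qed (use s A_lin(1) in auto)
  also have "\<dots> = cls (\<lambda>x. alg_inverse H F x + z * alg_inverse H G x)"
    using s by (simp add: cls_add cls_cmult L2_cmult)
  finally show ?thesis using s by (subst (asm) cls_eq_iff) (auto intro: L2_add L2_cmult)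
qed

text \<open>The threshold is packaged as a predicate so that \<open>R\<close> can be chosen later
  from \<open>s\<close> or from the number of iterations; the constant \<open>2 / c0\<close> depends
  on neither.\<close>

definition admissible :: "real \<Rightarrow> bool" where
  "admissible \<eta>0 \<longleftrightarrow> \<eta>0 > 0 \<and> (\<forall>R s F. R \<ge> 1 \<longrightarrow> \<bar>s - \<mu>\<bar> * R powr (\<mu> - 1) \<le> \<eta>0 \<longrightarrow> F \<in> rapid \<longrightarrow>
     alg_inverse H F \<in> wL2 (s - 2 * \<mu>) \<and> norm (WR R (s - 2 * \<mu>) (alg_inverse H F)) \<le> 2 / c0 * norm (WR R s F))"

lemma admissible_exists: "\<exists>\<eta>0. admissible \<eta>0"
proof -
  obtain \<eta>0 where \<eta>0: "\<eta>0 > 0" "\<And>R s l u. \<lbrakk>R \<ge> 1; \<bar>s - \<mu>\<bar> * R powr (\<mu> - 1) \<le> \<eta>0; l \<ge> 0; u \<in> H2;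
      (\<lambda>x. rw R s x * fn (A u + l *\<^sub>R u) x) \<in> L2\<rbrakk>
    \<Longrightarrow> (\<lambda>x. rw R (s - 2 * \<mu>) x * fn u x) \<in> L2 \<and>
       norm (cls (\<lambda>x. rw R (s - 2 * \<mu>) x * fn u x)) \<le> 2 / c0 * norm (cls (\<lambda>x. rw R s x * fn (A u + l *\<^sub>R u) x))"
    using weighted_estimate by blast
  have "alg_inverse H F \<in> wL2 (s - 2 * \<mu>) \<and> norm (WR R (s - 2 * \<mu>) (alg_inverse H F)) \<le> 2 / c0 * norm (WR R s F)"
    if R: "R \<ge> 1" and s: "\<bar>s - \<mu>\<bar> * R powr (\<mu> - 1) \<le> \<eta>0" and F: "F \<in> rapid" for R s F
  proof -
    define u where "u = cls (alg_inverse H F)"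
    have al: "alg_inverse H F \<in> L2" using alg_inverse(1)[OF F] by (simp add: sobolev_2_iff)
    have u: "u \<in> H2" "A u + 0 *\<^sub>R u = cls F" using alg_inverse[OF F] by (auto simp: u_def sobolev_2_iff)
    have ae1: "AE x in lebesgue. rw R s x * F x = rw R s x * fn (A u + 0 *\<^sub>R u) x"
      unfolding u(2) using fn_cls[OF rapid_L2[OF F]] by eventually_elim simp
    have ae2: "AE x in lebesgue. rw R (s - 2 * \<mu>) x * fn u x = rw R (s - 2 * \<mu>) x * alg_inverse H F x"
      unfolding u_def using fn_cls[OF al] by eventually_elim simp
    have L: "(\<lambda>x. rw R s x * fn (A u + 0 *\<^sub>R u) x) \<in> L2"
      by (rule L2_AE_cong[OF wL2_L2[OF R rapidD[OF F]] _ ae1]) (use R in simp)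
    note est = \<eta>0(2)[OF R s order_refl u(1) L]
    have "(\<lambda>x. rw R (s - 2 * \<mu>) x * alg_inverse H F x) \<in> L2"
      by (rule L2_AE_cong[OF conjunct1[OF est] _ ae2]) (use R al in \<open>auto dest: L2_D(1)\<close>)
    then have "alg_inverse H F \<in> wL2 (s - 2 * \<mu>)" by (rule wL2I[OF R L2_D(1)[OF al]])
    moreover have "norm (WR R (s - 2 * \<mu>) (alg_inverse H F)) \<le> 2 / c0 * norm (WR R s F)"
      using conjunct2[OF est] unfolding WR_def cls_eqI[OF ae1] cls_eqI[OF ae2] .
    ultimately show ?thesis by blast
  qed
  then show ?thesis using \<eta>0(1) unfolding admissible_def by blast
qed

lemma admissible_scale:
  assumes "admissible \<eta>0" obtains R where "R \<ge> 1" "\<bar>s - \<mu>\<bar> * R powr (\<mu> - 1) \<le> \<eta>0"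
  using exists_scale[OF \<mu>(2), of \<eta>0 "\<bar>s - \<mu>\<bar>"] assms by (auto simp: admissible_def)

lemma alg_inverse_wL2: "F \<in> rapid \<Longrightarrow> alg_inverse H F \<in> wL2 (s - 2 * \<mu>)"
proof -
  assume F: "F \<in> rapid"
  obtain \<eta>0 where \<eta>0: "admissible \<eta>0" using admissible_exists by blast
  obtain R where "R \<ge> 1" "\<bar>s - \<mu>\<bar> * R powr (\<mu> - 1) \<le> \<eta>0" using admissible_scale[OF \<eta>0] by blast
  then show ?thesis using \<eta>0 F unfolding admissible_def by blast
qed

text \<open>The body of the choice in \<open>ext_inverse\<close> with the exponent \<open>s\<close>
  made explicit.\<close>

definition Ext :: "real \<Rightarrow> 'n cfun \<Rightarrow> 'n cfun \<Rightarrow> bool" where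
  "Ext s f u \<longleftrightarrow> f \<in> wL2 s \<and> u \<in> wL2 (s - 2 * \<mu>) \<and>
     (\<exists>F :: nat \<Rightarrow> 'n cfun. (\<forall>k. F k \<in> (\<Inter>t. wL2 t) \<and> alg_inverse H (F k) \<in> wL2 (s - 2 * \<mu>)) \<and>
        (\<lambda>k. wL2_norm s (\<lambda>x. F k x - f x)) \<longlonglongrightarrow> 0 \<and>
        (\<lambda>k. wL2_norm (s - 2 * \<mu>) (\<lambda>x. alg_inverse H (F k) x - u x)) \<longlonglongrightarrow> 0)"

lemma Ext_iff:
  "Ext s f u \<longleftrightarrow> f \<in> wL2 s \<and> u \<in> wL2 (s - 2 * \<mu>) \<and>
     (\<exists>F. (\<forall>k. F k \<in> rapid) \<and> (\<lambda>k. WR 1 s (F k)) \<longlonglongrightarrow> WR 1 s f \<and>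
        (\<lambda>k. WR 1 (s - 2 * \<mu>) (alg_inverse H (F k))) \<longlonglongrightarrow> WR 1 (s - 2 * \<mu>) u)"
proof -
  have "(\<exists>F :: nat \<Rightarrow> 'n cfun. (\<forall>k. F k \<in> (\<Inter>t. wL2 t) \<and> alg_inverse H (F k) \<in> wL2 (s - 2 * \<mu>)) \<and>
        (\<lambda>k. wL2_norm s (\<lambda>x. F k x - f x)) \<longlonglongrightarrow> 0 \<and>
        (\<lambda>k. wL2_norm (s - 2 * \<mu>) (\<lambda>x. alg_inverse H (F k) x - u x)) \<longlonglongrightarrow> 0)
     \<longleftrightarrow> (\<exists>F. (\<forall>k. F k \<in> rapid) \<and> (\<lambda>k. WR 1 s (F k)) \<longlonglongrightarrow> WR 1 s f \<and>
        (\<lambda>k. WR 1 (s - 2 * \<mu>) (alg_inverse H (F k))) \<longlonglongrightarrow> WR 1 (s - 2 * \<mu>) u)" (is "?L \<longleftrightarrow> ?R")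
    if f: "f \<in> wL2 s" and u: "u \<in> wL2 (s - 2 * \<mu>)"
  proof -
    have "(\<forall>k. F k \<in> (\<Inter>t. wL2 t) \<and> alg_inverse H (F k) \<in> wL2 (s - 2 * \<mu>)) \<and>
        (\<lambda>k. wL2_norm s (\<lambda>x. F k x - f x)) \<longlonglongrightarrow> 0 \<and>
        (\<lambda>k. wL2_norm (s - 2 * \<mu>) (\<lambda>x. alg_inverse H (F k) x - u x)) \<longlonglongrightarrow> 0
      \<longleftrightarrow> (\<forall>k. F k \<in> rapid) \<and> (\<lambda>k. WR 1 s (F k)) \<longlonglongrightarrow> WR 1 s f \<and>
        (\<lambda>k. WR 1 (s - 2 * \<mu>) (alg_inverse H (F k))) \<longlonglongrightarrow> WR 1 (s - 2 * \<mu>) u" for F :: "nat \<Rightarrow> 'n cfun"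
    proof (cases "\<forall>k. F k \<in> rapid")
      case True
      then have T: "F k \<in> wL2 s" "alg_inverse H (F k) \<in> wL2 (s - 2 * \<mu>)" for k
        using rapidD alg_inverse_wL2 by blast+
      show ?thesis using True T unfolding wL2_tendsto_iff[OF T(1) f] wL2_tendsto_iff[OF T(2) u]
        by (simp add: rapid_def)
    next
      case False then show ?thesis by (auto simp: rapid_def)
    qed
    then show ?thesis by simp
  qed
  then show ?thesis unfolding Ext_def by blast
qed

lemma Ext_mono:
  assumes E: "Ext s f u" and t: "t \<le> s" shows "Ext t f u"
proof -
  obtain F where F: "\<And>k. F k \<in> rapid" "(\<lambda>k. WR 1 s (F k)) \<longlonglongrightarrow> WR 1 s f"
        "(\<lambda>k. WR 1 (s - 2 * \<mu>) (alg_inverse H (F k))) \<longlonglongrightarrow> WR 1 (s - 2 * \<mu>) u"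
    and f: "f \<in> wL2 s" "u \<in> wL2 (s - 2 * \<mu>)" using E unfolding Ext_iff by blast
  have "(\<lambda>k. WR 1 t (F k)) \<longlonglongrightarrow> WR 1 t f"
    by (rule WR_tendsto_mono[OF t rapidD[OF F(1)] f(1) F(2)])
  moreover have "(\<lambda>k. WR 1 (t - 2 * \<mu>) (alg_inverse H (F k))) \<longlonglongrightarrow> WR 1 (t - 2 * \<mu>) u"
    by (rule WR_tendsto_mono[OF _ alg_inverse_wL2[OF F(1)] f(2) F(3)]) (use t in simp)
  ultimately show ?thesis unfolding Ext_iff using F(1) f t wL2_mono[OF f(1) t] wL2_mono[OF f(2), of "t - 2 * \<mu>"] by auto
qed

lemma Ext_lin:
  assumes E: "Ext s f u" "Ext s g v" shows "Ext s (\<lambda>x. f x + z * g x) (\<lambda>x. u x + z * v x)"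
proof -
  obtain F where F: "\<And>k. F k \<in> rapid" "(\<lambda>k. WR 1 s (F k)) \<longlonglongrightarrow> WR 1 s f"
        "(\<lambda>k. WR 1 (s - 2 * \<mu>) (alg_inverse H (F k))) \<longlonglongrightarrow> WR 1 (s - 2 * \<mu>) u"
    and f: "f \<in> wL2 s" "u \<in> wL2 (s - 2 * \<mu>)" using E(1) unfolding Ext_iff by blast
  obtain G where G: "\<And>k. G k \<in> rapid" "(\<lambda>k. WR 1 s (G k)) \<longlonglongrightarrow> WR 1 s g"
        "(\<lambda>k. WR 1 (s - 2 * \<mu>) (alg_inverse H (G k))) \<longlonglongrightarrow> WR 1 (s - 2 * \<mu>) v"
    and g: "g \<in> wL2 s" "v \<in> wL2 (s - 2 * \<mu>)" using E(2) unfolding Ext_iff by blast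
  have lin: "(\<lambda>k. X k + mul (\<lambda>x. z) (Y k)) \<longlonglongrightarrow> x + mul (\<lambda>x. z) y" if "X \<longlonglongrightarrow> x" "Y \<longlonglongrightarrow> y" for X Y and x y :: "'n l2"
    using that by (intro tendsto_add bounded_linear.tendsto[OF bounded_linear_mul[OF bdd_mult_const]])
  have "(\<lambda>k. WR 1 s (\<lambda>x. F k x + z * G k x)) \<longlonglongrightarrow> WR 1 s (\<lambda>x. f x + z * g x)"
    using lin[OF F(2) G(2)] by (simp add: WR_lin rapidD F(1) G(1) f g)
  moreover have "(\<lambda>k. WR 1 (s - 2 * \<mu>) (alg_inverse H (\<lambda>x. F k x + z * G k x))) \<longlonglongrightarrow> WR 1 (s - 2 * \<mu>) (\<lambda>x. u x + z * v x)"
    unfolding WR_cong[OF alg_inverse_lin[OF F(1) G(1)]]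
    using lin[OF F(3) G(3)] by (simp add: WR_lin alg_inverse_wL2 F(1) G(1) f g)
  ultimately show ?thesis unfolding Ext_iff
    by (intro conjI wL2_lin f g exI[of _ "\<lambda>k x. F k x + z * G k x"]) (auto intro: rapid_lin F(1) G(1))
qed

lemma Ext_cong:
  assumes E: "Ext s f u" and f: "AE x in lebesgue. f x = f' x" "f' \<in> borel_measurable lebesgue"
    and u: "AE x in lebesgue. u x = u' x" "u' \<in> borel_measurable lebesgue"
  shows "Ext s f' u'"
  using E wL2_cong[OF _ f] wL2_cong[OF _ u] unfolding Ext_iff WR_cong[OF f(1)] WR_cong[OF u(1)] by blast

lemma Ext_estimate:
  assumes \<eta>0: "admissible \<eta>0" and R: "R \<ge> 1" "\<bar>s - \<mu>\<bar> * R powr (\<mu> - 1) \<le> \<eta>0" and E: "Ext s f u"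
  shows "norm (WR R (s - 2 * \<mu>) u) \<le> 2 / c0 * norm (WR R s f)"
proof -
  obtain F where F: "\<And>k. F k \<in> rapid" "(\<lambda>k. WR 1 s (F k)) \<longlonglongrightarrow> WR 1 s f"
        "(\<lambda>k. WR 1 (s - 2 * \<mu>) (alg_inverse H (F k))) \<longlonglongrightarrow> WR 1 (s - 2 * \<mu>) u"
    and f: "f \<in> wL2 s" "u \<in> wL2 (s - 2 * \<mu>)" using E unfolding Ext_iff by blast
  have 1: "(\<lambda>k. WR R s (F k)) \<longlonglongrightarrow> WR R s f"
    by (rule WR_tendsto_scale[OF order_refl R(1) rapidD[OF F(1)] f(1) F(2)])
  have 2: "(\<lambda>k. WR R (s - 2 * \<mu>) (alg_inverse H (F k))) \<longlonglongrightarrow> WR R (s - 2 * \<mu>) u"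
    by (rule WR_tendsto_scale[OF order_refl R(1) alg_inverse_wL2[OF F(1)] f(2) F(3)])
  show ?thesis
  proof (rule LIMSEQ_le)
    show "(\<lambda>k. norm (WR R (s - 2 * \<mu>) (alg_inverse H (F k)))) \<longlonglongrightarrow> norm (WR R (s - 2 * \<mu>) u)" by (rule tendsto_norm[OF 2])
    show "(\<lambda>k. 2 / c0 * norm (WR R s (F k))) \<longlonglongrightarrow> 2 / c0 * norm (WR R s f)" by (intro tendsto_intros 1)
    show "\<exists>N. \<forall>n\<ge>N. norm (WR R (s - 2 * \<mu>) (alg_inverse H (F n))) \<le> 2 / c0 * norm (WR R s (F n))"
      using \<eta>0 R F(1) unfolding admissible_def by blast
  qed
qed

text \<open>Both extensions are also extensions at the smaller exponent. There the difference
  extends 0, and \<open>Ext_estimate\<close> makes it 0. Allowing \<open>s\<close> and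
  \<open>t\<close> to differ is what turns the extensions into a single operator.\<close>

lemma Ext_unique:
  assumes E: "Ext s f u" "Ext t g v" and fg: "AE x in lebesgue. f x = g x"
  shows "AE x in lebesgue. u x = v x"
proof -
  define r where "r = min s t"
  obtain \<eta>0 where \<eta>0: "admissible \<eta>0" using admissible_exists by blast
  obtain R where R: "R \<ge> 1" "\<bar>r - \<mu>\<bar> * R powr (\<mu> - 1) \<le> \<eta>0" using admissible_scale[OF \<eta>0] by blast
  have E': "Ext r (\<lambda>x. f x + - 1 * g x) (\<lambda>x. u x + - 1 * v x)"
    by (intro Ext_lin Ext_mono[OF E(1)] Ext_mono[OF E(2)]) (auto simp: r_def)
  have "WR R r (\<lambda>x. f x + - 1 * g x) = WR R r (\<lambda>x. 0)"
    by (rule WR_cong) (use fg in eventually_elim, simp)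
  also have "\<dots> = 0" by (simp add: WR_def cls_zero)
  finally have z: "WR R r (\<lambda>x. f x + - 1 * g x) = 0" .
  have "norm (WR R (r - 2 * \<mu>) (\<lambda>x. u x + - 1 * v x)) \<le> 0"
    using Ext_estimate[OF \<eta>0 R E'] unfolding z by simp
  then have n: "WR R (r - 2 * \<mu>) (\<lambda>x. u x + - 1 * v x) = 0" by (simp only: norm_le_zero_iff)
  have w: "(\<lambda>x. u x + - 1 * v x) \<in> wL2 (r - 2 * \<mu>)" using E' unfolding Ext_iff by blast
  have "AE x in lebesgue. u x + - 1 * v x = 0" by (rule WR_eq_0[OF R(1) w n])
  then show ?thesis by eventually_elim simp
qed

lemma truncation_rapid:
  assumes f: "f \<in> wL2 s" shows "(\<lambda>x. indicator (cball 0 (real k)) x * f x) \<in> rapid"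
proof -
  have m: "(\<lambda>x :: real^'n. indicator (cball 0 (real k)) x :: complex) \<in> borel_measurable lebesgue"
    by (intro borel_measurable_indicator) simp
  have "(\<lambda>x. indicator (cball 0 (real k)) x * f x) \<in> wL2 t" for t
  proof -
    have "(\<lambda>x. rw 1 t x * (indicator (cball 0 (real k)) x * f x)) \<in> L2"
    proof (rule L2_bound[OF wL2_L2[OF order_refl f]])
      show "AE x in lebesgue. cmod (rw 1 t x * (indicator (cball 0 (real k)) x * f x)) \<le> (1 + real k) powr \<bar>t - s\<bar> * cmod (rw 1 s x * f x)"
      proof (rule AE_I2)
        fix x :: "real^'n"
        show "cmod (rw 1 t x * (indicator (cball 0 (real k)) x * f x)) \<le> (1 + real k) powr \<bar>t - s\<bar> * cmod (rw 1 s x * f x)"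
        proof (cases "x \<in> cball 0 (real k)")
          case True
          have r: "1 \<le> rb 1 x" "rb 1 x \<le> 1 + real k" using rb_ge_R[of 1 x] rb_le[of 1 x] True by auto
          have "rb 1 x powr t = rb 1 x powr (t - s) * rb 1 x powr s" using r by (simp add: powr_add[symmetric])
          also have "\<dots> \<le> rb 1 x powr \<bar>t - s\<bar> * rb 1 x powr s" using r by (intro mult_right_mono powr_mono) auto
          also have "\<dots> \<le> (1 + real k) powr \<bar>t - s\<bar> * rb 1 x powr s" using r by (intro mult_right_mono powr_mono2) auto
          finally show ?thesis using True by (simp add: norm_mult cmod_rw mult_right_mono mult.assoc[symmetric])
        qed simp
      qed
      show "(\<lambda>x. rw 1 t x * (indicator (cball 0 (real k)) x * f x)) \<in> borel_measurable lebesgue"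
        using m wL2_measurable[OF f] by simp
    qed
    then show ?thesis using m wL2_measurable[OF f] by (simp add: wL2_iff)
  qed
  then show ?thesis by (simp add: rapid_def)
qed

text \<open>Truncations of \<open>f\<close> to balls are rapidly decaying and converge to
  \<open>f\<close>. The estimate applied to their differences makes the images Cauchy in the
  weighted space, and completeness provides the limit.\<close>

lemma Ext_exists:
  assumes f: "f \<in> wL2 s" shows "\<exists>u. Ext s f u"
proof -
  obtain \<eta>0 where \<eta>0: "admissible \<eta>0" using admissible_exists by blast
  obtain R where R: "R \<ge> 1" "\<bar>s - \<mu>\<bar> * R powr (\<mu> - 1) \<le> \<eta>0" using admissible_scale[OF \<eta>0] by blast
  define F where "F k x = indicator (cball 0 (real k)) x * f x" for k :: nat and x
  have F: "F k \<in> rapid" for k unfolding F_def[abs_def] by (rule truncation_rapid[OF f])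
  have WF: "WR 1 s (F k) = mul (\<lambda>x. indicator (cball 0 (real k)) x) (WR 1 s f)" for k
    unfolding WR_def mul_cls[OF bdd_mult_truncation wL2_L2[OF order_refl f]] by (simp add: F_def mult_ac)
  have c1: "(\<lambda>k. WR 1 s (F k)) \<longlonglongrightarrow> WR 1 s f" unfolding WF by (rule mul_truncation_tendsto)
  have cR: "(\<lambda>k. WR R s (F k)) \<longlonglongrightarrow> WR R s f"
    by (rule WR_tendsto_scale[OF order_refl R(1) rapidD[OF F] f c1])
  define U where "U k = WR R (s - 2 * \<mu>) (alg_inverse H (F k))" for k
  have "norm (U j - U k) \<le> 2 / c0 * norm (WR R s (F j) - WR R s (F k))" for j k
  proof -
    note l = rapid_lin[OF F F, of j "-1" k]
    have "U j - U k = WR R (s - 2 * \<mu>) (alg_inverse H (\<lambda>x. F j x + - 1 * F k x))"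
      unfolding U_def WR_cong[OF alg_inverse_lin[OF F F]] WR_lin[OF R(1) alg_inverse_wL2[OF F] alg_inverse_wL2[OF F]]
      by (simp add: mul_minus_one)
    moreover have "WR R s (\<lambda>x. F j x + - 1 * F k x) = WR R s (F j) - WR R s (F k)"
      unfolding WR_lin[OF R(1) rapidD[OF F] rapidD[OF F]] by (simp add: mul_minus_one)
    moreover have "norm (WR R (s - 2 * \<mu>) (alg_inverse H (\<lambda>x. F j x + - 1 * F k x))) \<le> 2 / c0 * norm (WR R s (\<lambda>x. F j x + - 1 * F k x))"
      using \<eta>0 R l unfolding admissible_def by blast
    ultimately show ?thesis by simp
  qed
  then have bnd: "norm (U j - U k) \<le> norm ((2 / c0) *\<^sub>R WR R s (F j) - (2 / c0) *\<^sub>R WR R s (F k)) + norm (0 - 0 :: real)" for j k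
    using c0 by (simp add: scaleR_diff_right[symmetric])
  have "Cauchy U"
  proof (rule Cauchy_bound[OF _ _ bnd])
    show "Cauchy (\<lambda>k. (2 / c0) *\<^sub>R WR R s (F k))" by (rule LIMSEQ_imp_Cauchy[OF tendsto_scaleR[OF tendsto_const cR]])
    show "Cauchy (\<lambda>k::nat. 0 :: real)" by (rule LIMSEQ_imp_Cauchy[OF tendsto_const])
  qed
  then obtain G where G: "U \<longlonglongrightarrow> G" using Cauchy_convergent convergent_def by blast
  have R0: "R > 0" using R by simp
  \<comment> \<open>Removing the weight from the limit class \<open>G\<close>, which is the limit of
    the weighted images.\<close>
  define u where "u x = rw R (- (s - 2 * \<mu>)) x * fn G x" for x
  have e: "rw R (s - 2 * \<mu>) x * u x = fn G x" for x
    unfolding u_def mult.assoc[symmetric] rw_add[OF R0] by (simp add: rw_zero[OF R0])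
  have um: "u \<in> borel_measurable lebesgue" unfolding u_def[abs_def] using R0 by simp
  have u: "u \<in> wL2 (s - 2 * \<mu>)" by (rule wL2I[OF R(1) um]) (simp add: e)
  have WG: "WR R (s - 2 * \<mu>) u = G" by (simp add: WR_def e)
  have "(\<lambda>k. WR 1 (s - 2 * \<mu>) (alg_inverse H (F k))) \<longlonglongrightarrow> WR 1 (s - 2 * \<mu>) u"
    by (rule WR_tendsto_scale[OF R(1) order_refl alg_inverse_wL2[OF F] u]) (use G in \<open>simp add: WG U_def[abs_def]\<close>)
  then show ?thesis unfolding Ext_iff using f u F c1 by blast
qed

abbreviation G where "G \<equiv> ext_inverse \<mu> H"

text \<open>The choice in \<open>ext_inverse\<close> may have been made at some other exponent
  \<open>t\<close>; \<open>Ext_unique\<close> shows that its value still agrees with the extension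
  at the given \<open>s\<close>.\<close>

lemma Ext_G: assumes f: "f \<in> wL2 s" shows "Ext s f (G f)"
proof -
  obtain u where u: "Ext s f u" using Ext_exists[OF f] by blast
  have "G f = (SOME u. \<exists>s. Ext s f u)" unfolding ext_inverse_def Ext_def ..
  moreover have "\<exists>u. \<exists>s. Ext s f u" using u by blast
  then have "\<exists>s. Ext s f (SOME u. \<exists>s. Ext s f u)" by (rule someI_ex)
  ultimately obtain t where t: "Ext t f (G f)" by metis
  have ae: "AE x in lebesgue. u x = G f x" by (rule Ext_unique[OF u t]) simp
  have "G f \<in> wL2 (t - 2 * \<mu>)" using t unfolding Ext_iff by blast
  then have "G f \<in> borel_measurable lebesgue" by (rule wL2_measurable)
  with u AE_I2 wL2_measurable[OF f] ae show ?thesis by (rule Ext_cong) simp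
qed

lemma G_pow_wL2: "f \<in> wL2 s \<Longrightarrow> (G ^^ m) f \<in> wL2 (s - 2 * \<mu> * real m)"
proof (induction m)
  case (Suc m)
  then have "Ext (s - 2 * \<mu> * real m) ((G ^^ m) f) (G ((G ^^ m) f))" by (intro Ext_G) simp
  then show ?case by (simp add: Ext_iff algebra_simps)
qed simp

text \<open>The exponent drops by 2\<mu> at each application, so step \<open>j\<close> is an
  estimate at \<open>s - 2 * \<mu> * real j\<close>. A single \<open>R\<close> admissible for all of
  them keeps the intermediate norms compatible, and the constant is a pure m-th power.\<close>

lemma G_pow_estimate:
  assumes \<eta>0: "admissible \<eta>0" and R: "R \<ge> 1" and f: "f \<in> wL2 s"
  shows "(\<And>j. j < m \<Longrightarrow> \<bar>s - 2 * \<mu> * real j - \<mu>\<bar> * R powr (\<mu> - 1) \<le> \<eta>0) \<Longrightarrow>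
    norm (WR R (s - 2 * \<mu> * real m) ((G ^^ m) f)) \<le> (2 / c0) ^ m * norm (WR R s f)"
proof (induction m)
  case (Suc m)
  have e: "s - 2 * \<mu> * real (Suc m) = (s - 2 * \<mu> * real m) - 2 * \<mu>" by (simp add: algebra_simps)
  have "norm (WR R ((s - 2 * \<mu> * real m) - 2 * \<mu>) (G ((G ^^ m) f))) \<le> 2 / c0 * norm (WR R (s - 2 * \<mu> * real m) ((G ^^ m) f))"
    by (rule Ext_estimate[OF \<eta>0 R _ Ext_G[OF G_pow_wL2[OF f]]]) (use Suc.prems in simp)
  also have "\<dots> \<le> 2 / c0 * ((2 / c0) ^ m * norm (WR R s f))"
    using c0 Suc by (intro mult_left_mono) auto
  finally show ?case unfolding e by (simp add: mult.assoc)
qed simp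

text \<open>Powers act on representatives, so the induction hypothesis is an equality almost
  everywhere; \<open>Ext_unique\<close> carries it through one more application.\<close>

lemma G_pow_lin:
  assumes f: "f \<in> wL2 s" and g: "g \<in> wL2 s"
  shows "AE x in lebesgue. (G ^^ m) (\<lambda>x. f x + z * g x) x = (G ^^ m) f x + z * (G ^^ m) g x"
proof (induction m)
  case (Suc m)
  have "Ext (s - 2 * \<mu> * real m) (\<lambda>x. (G ^^ m) f x + z * (G ^^ m) g x) (\<lambda>x. G ((G ^^ m) f) x + z * G ((G ^^ m) g) x)"
    by (intro Ext_lin Ext_G G_pow_wL2 f g)
  from Ext_unique[OF Ext_G[OF G_pow_wL2[OF wL2_lin[OF f g]]] this Suc] show ?case by simp
qed simp

lemma G_pow_cmult:
  assumes g: "g \<in> wL2 s"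
  shows "AE x in lebesgue. (G ^^ m) (\<lambda>x. z * g x) x = z * (G ^^ m) g x"
proof -
  have z: "(\<lambda>x :: real^'n. 0) \<in> wL2 s" by (simp add: wL2_iff L2_zero)
  have "AE x in lebesgue. (G ^^ m) (\<lambda>x. 0) x = (0 :: complex)"
    using G_pow_lin[OF z z, of m 1] by (auto elim: eventually_mono)
  with G_pow_lin[OF z g, of m z] show ?thesis by eventually_elim simp
qed

end

subsection \<open>Bounds for the powers of the extended inverse\<close>

lemma L2_opnorm_le:
  fixes T :: "'n::finite cfun \<Rightarrow> 'n cfun"
  assumes "\<And>f. f \<in> L2 \<Longrightarrow> L2_norm (T f) \<le> K * L2_norm f" "K \<ge> 0" shows "L2_opnorm T \<le> K"
  unfolding L2_opnorm_def
proof (rule cSUP_least)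
  have "(\<lambda>x. 0) \<in> {f \<in> (L2 :: 'n cfun set). L2_norm f \<le> 1}" by (simp add: L2_zero L2_norm_def)
  then show "{f \<in> (L2 :: 'n cfun set). L2_norm f \<le> 1} \<noteq> {}" by blast
  fix f :: "'n cfun" assume f: "f \<in> {f \<in> L2. L2_norm f \<le> 1}"
  then have "L2_norm (T f) \<le> K * L2_norm f" using assms(1) by blast
  also have "\<dots> \<le> K * 1" using f assms(2) by (intro mult_left_mono) auto
  finally show "L2_norm (T f) \<le> K" by simp
qed

lemma L2_iff_wL2: "f \<in> L2 \<longleftrightarrow> f \<in> wL2 0"
  using L2_D(1) by (auto simp: wL2_iff rw_zero)

lemma norm_WR_0: "R \<ge> 1 \<Longrightarrow> f \<in> L2 \<Longrightarrow> norm (WR R 0 f) = L2_norm f"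
  by (simp add: WR_def rw_zero norm_cls)

context extended_inverse
begin

text \<open>With p = 2\<mu>N, the product with \<open>w\<close> on the left runs through exponents
  from 0 down to -p, the one with \<open>w\<close> on the right from p down to 0. In both cases the
  distances to \<mu> are at most 2N, so one condition on \<open>R\<close> suffices, and
  \<open>w\<close> absorbs the weight \<open>rw R p\<close> at the price \<open>B\<close>.\<close>

lemma bounded_G_pow:
  assumes \<eta>0: "admissible \<eta>0" and R: "R \<ge> 1" "(2 * real N) * R powr (\<mu> - 1) \<le> \<eta>0" and N: "N \<ge> 1"
    and w: "w \<in> borel_measurable lebesgue" "\<And>x. cmod (w x) * rb R x powr (2 * \<mu> * real N) \<le> B"
  shows "bounded_L2_op (mult_op w \<circ> (G ^^ N))" "bounded_L2_op ((G ^^ N) \<circ> mult_op w)"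
    "L2_opnorm (mult_op w \<circ> (G ^^ N)) \<le> B * (2 / c0) ^ N" "L2_opnorm ((G ^^ N) \<circ> mult_op w) \<le> B * (2 / c0) ^ N"
proof -
  define p where "p = 2 * \<mu> * real N"
  define m where "m x = w x * rw R p x" for x
  have R0: "R > 0" using R by simp
  have B: "B \<ge> 0" using w(2)[of 0] by (rule order_trans[rotated]) simp
  have mB: "cmod (m x) \<le> B" for x using w(2)[of x] by (simp add: m_def norm_mult cmod_rw p_def)
  have m: "bdd_mult m" by (rule bmI[OF _ mB]) (use w(1) R0 in \<open>simp add: m_def[abs_def]\<close>)
  have K: "B * (2 / c0) ^ N \<ge> 0" using B c0 by simp
  have cond: "\<bar>t\<bar> * R powr (\<mu> - 1) \<le> \<eta>0" if "\<bar>t\<bar> \<le> 2 * real N" for t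
  proof -
    have "\<bar>t\<bar> * R powr (\<mu> - 1) \<le> (2 * real N) * R powr (\<mu> - 1)" using that by (intro mult_right_mono) auto
    then show ?thesis using R(2) by linarith
  qed
  have jN: "0 \<le> 2 * \<mu> * real j" "2 * \<mu> * real j \<le> 2 * real N - 2 * \<mu> * 1" "2 * \<mu> * real j \<le> p - 2 * \<mu>" "p \<le> 2 * real N" if "j < N" for j
  proof -
    have j: "real j + 1 \<le> real N" using that by simp
    show "0 \<le> 2 * \<mu> * real j" using \<mu> by simp
    have "2 * \<mu> * (real j + 1) \<le> 2 * \<mu> * real N" using \<mu> j by (intro mult_left_mono) auto
    then show "2 * \<mu> * real j \<le> p - 2 * \<mu>" by (simp add: p_def algebra_simps)
    moreover have "2 * \<mu> * real N \<le> 2 * 1 * real N" using \<mu> by (intro mult_right_mono mult_left_mono) auto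
    then show "p \<le> 2 * real N" by (simp add: p_def)
    ultimately show "2 * \<mu> * real j \<le> 2 * real N - 2 * \<mu> * 1" by simp
  qed
  have est1: "(G ^^ N) f \<in> wL2 (- p) \<and> norm (WR R (- p) ((G ^^ N) f)) \<le> (2 / c0) ^ N * L2_norm f" if f: "f \<in> L2" for f
  proof -
    have f0: "f \<in> wL2 0" using f by (simp add: L2_iff_wL2)
    have "norm (WR R (0 - 2 * \<mu> * real N) ((G ^^ N) f)) \<le> (2 / c0) ^ N * norm (WR R 0 f)"
    proof (rule G_pow_estimate[OF \<eta>0 R(1) f0])
      fix j assume j: "j < N"
      show "\<bar>0 - 2 * \<mu> * real j - \<mu>\<bar> * R powr (\<mu> - 1) \<le> \<eta>0"
        by (intro cond abs_leI) (use jN[OF j] \<mu> in linarith)+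
    qed
    then show ?thesis using G_pow_wL2[OF f0, of N] by (simp add: p_def norm_WR_0[OF R(1) f])
  qed
  have wf: "(\<lambda>x. w x * f x) \<in> wL2 p \<and> norm (WR R p (\<lambda>x. w x * f x)) \<le> B * L2_norm f" if f: "f \<in> L2" for f
  proof -
    have e: "rw R p x * (w x * f x) = m x * f x" for x by (simp add: m_def)
    have "(\<lambda>x. rw R p x * (w x * f x)) \<in> L2" unfolding e by (rule L2_mult_bdd_mult[OF m f])
    then have "(\<lambda>x. w x * f x) \<in> wL2 p" using w(1) L2_D(1)[OF f] by (intro wL2I[OF R(1)]) auto
    moreover have "norm (WR R p (\<lambda>x. w x * f x)) \<le> B * norm (cls f)"
      unfolding WR_def e mul_cls[OF m f, symmetric] by (rule norm_mul_le[OF m mB])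
    ultimately show ?thesis by (simp add: norm_cls[OF f])
  qed
  have est2: "(G ^^ N) (\<lambda>x. w x * f x) \<in> L2 \<and> L2_norm ((G ^^ N) (\<lambda>x. w x * f x)) \<le> (B * (2 / c0) ^ N) * L2_norm f" if f: "f \<in> L2" for f
  proof -
    note wfp = conjunct1[OF wf[OF f]]
    have GL: "(G ^^ N) (\<lambda>x. w x * f x) \<in> L2"
      using G_pow_wL2[OF wfp, of N] by (simp add: L2_iff_wL2 p_def)
    have "norm (WR R (p - 2 * \<mu> * real N) ((G ^^ N) (\<lambda>x. w x * f x))) \<le> (2 / c0) ^ N * norm (WR R p (\<lambda>x. w x * f x))"
    proof (rule G_pow_estimate[OF \<eta>0 R(1) wfp])
      fix j assume j: "j < N"
      show "\<bar>p - 2 * \<mu> * real j - \<mu>\<bar> * R powr (\<mu> - 1) \<le> \<eta>0"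
        by (intro cond abs_leI) (use jN[OF j] \<mu> in linarith)+
    qed
    also have "\<dots> \<le> (2 / c0) ^ N * (B * L2_norm f)" using c0 wf[OF f] by (intro mult_left_mono) auto
    finally show ?thesis using GL norm_WR_0[OF R(1) GL] by (simp add: p_def mult_ac)
  qed
  have e1: "w x * g x = m x * (rw R (- p) x * g x)" for g :: "'n cfun" and x
  proof -
    have "m x * (rw R (- p) x * g x) = w x * (rw R p x * rw R (- p) x) * g x" by (simp add: m_def)
    also have "rw R p x * rw R (- p) x = 1" unfolding rw_add[OF R0] by (simp add: rw_zero[OF R0])
    finally show ?thesis by (simp only: mult_1_right)
  qed
  have est3: "(\<lambda>x. w x * (G ^^ N) f x) \<in> L2 \<and> L2_norm (\<lambda>x. w x * (G ^^ N) f x) \<le> (B * (2 / c0) ^ N) * L2_norm f" if f: "f \<in> L2" for f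
  proof -
    note g = wL2_L2[OF R(1) conjunct1[OF est1[OF f]]]
    have L: "(\<lambda>x. w x * (G ^^ N) f x) \<in> L2" unfolding e1 by (rule L2_mult_bdd_mult[OF m g])
    have "norm (cls (\<lambda>x. w x * (G ^^ N) f x)) \<le> B * norm (WR R (- p) ((G ^^ N) f))"
      unfolding e1 mul_cls[OF m g, symmetric] WR_def by (rule norm_mul_le[OF m mB])
    also have "\<dots> \<le> B * ((2 / c0) ^ N * L2_norm f)" using est1[OF f] B by (intro mult_left_mono) auto
    finally show ?thesis using L by (simp add: norm_cls mult_ac)
  qed
  have lin1: "AE x in lebesgue. (G ^^ N) (\<lambda>y. f y + g y) x = (G ^^ N) f x + (G ^^ N) g x" if "f \<in> wL2 s" "g \<in> wL2 s" for f g s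
    using G_pow_lin[OF that, of N 1] by simp
  show "bounded_L2_op (mult_op w \<circ> (G ^^ N))"
    unfolding bounded_L2_op_def o_def mult_op_def[abs_def]
  proof (intro conjI ballI allI)
    fix f g :: "'n cfun" and z :: complex assume f: "f \<in> L2"
    show "(\<lambda>x. w x * (G ^^ N) f x) \<in> L2" using est3[OF f] by blast
    show "AE x in lebesgue. w x * (G ^^ N) (\<lambda>y. z * f y) x = z * (w x * (G ^^ N) f x)"
      using G_pow_cmult[of f 0 N z] f by (auto simp: L2_iff_wL2 elim: eventually_mono)
    assume g: "g \<in> L2"
    show "AE x in lebesgue. w x * (G ^^ N) (\<lambda>y. f y + g y) x = w x * (G ^^ N) f x + w x * (G ^^ N) g x"
      using lin1[of f 0 g] f g by (auto simp: L2_iff_wL2 distrib_left elim: eventually_mono)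
  next
    show "\<exists>K. \<forall>f\<in>L2. L2_norm (\<lambda>x. w x * (G ^^ N) f x) \<le> K * L2_norm f" using est3 by blast
  qed
  show "bounded_L2_op ((G ^^ N) \<circ> mult_op w)"
    unfolding bounded_L2_op_def o_def mult_op_def[abs_def]
  proof (intro conjI ballI allI)
    fix f g :: "'n cfun" and z :: complex assume f: "f \<in> L2"
    show "(G ^^ N) (\<lambda>x. w x * f x) \<in> L2" using est2[OF f] by blast
    show "AE x in lebesgue. (G ^^ N) (\<lambda>x. w x * (z * f x)) x = z * (G ^^ N) (\<lambda>x. w x * f x) x"
      using G_pow_cmult[OF conjunct1[OF wf[OF f]], of N z] by (simp add: mult.left_commute)
    assume g: "g \<in> L2"
    show "AE x in lebesgue. (G ^^ N) (\<lambda>x. w x * (f x + g x)) x = (G ^^ N) (\<lambda>x. w x * f x) x + (G ^^ N) (\<lambda>x. w x * g x) x"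
      using lin1[OF conjunct1[OF wf[OF f]] conjunct1[OF wf[OF g]]] by (simp add: distrib_left)
  next
    show "\<exists>K. \<forall>f\<in>L2. L2_norm ((G ^^ N) (\<lambda>x. w x * f x)) \<le> K * L2_norm f" using est2 by blast
  qed
  show "L2_opnorm (mult_op w \<circ> (G ^^ N)) \<le> B * (2 / c0) ^ N"
    by (rule L2_opnorm_le[OF _ K]) (use est3 in \<open>auto simp: o_def mult_op_def[abs_def]\<close>)
  show "L2_opnorm ((G ^^ N) \<circ> mult_op w) \<le> B * (2 / c0) ^ N"
    by (rule L2_opnorm_le[OF _ K]) (use est2 in \<open>auto simp: o_def mult_op_def[abs_def]\<close>)
qed

end

section \<open>Elementary bounds for the remaining weight and the choice of its scale\<close>

lemma powr_exp_le:
  fixes t q :: real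
  assumes "t > 0" "q > 0" shows "t powr q * exp (- t) \<le> q powr q"
proof -
  \<comment> \<open>Raised to the power \<open>q\<close>, this gives the bound without locating the
    maximum of the left-hand side.\<close>
  have "t / q \<le> exp (t / q)" using exp_ge_add_one_self[of "t / q"] by linarith
  then have "t \<le> q * exp (t / q)" using assms by (simp add: field_simps)
  then have "t powr q \<le> (q * exp (t / q)) powr q" using assms by (intro powr_mono2) auto
  also have "\<dots> = q powr q * exp t" using assms by (simp add: powr_mult exp_powr_real)
  finally have "t powr q * exp (- t) \<le> q powr q * exp t * exp (- t)" by (intro mult_right_mono) auto
  also have "\<dots> = q powr q" by (simp add: mult.assoc mult_exp_exp)
  finally show ?thesis .
qed

lemma powr_mult_nat: "x > 0 \<Longrightarrow> x powr (y * real N) = (x powr y) ^ N"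
  by (simp add: powr_powr[symmetric] powr_realpow)

context
  fixes \<mu> \<gamma> M :: real and N :: nat
  assumes mu: "0 < \<mu>" "\<mu> < 1" and gam: "\<gamma> = 2 * \<mu> / (1 - \<mu>)" and M: "M \<ge> 1" and N: "N \<ge> 1"
begin

text \<open>The power of N is the one for which \<open>radius powr (\<mu> - 1)\<close> equals
  \<open>M powr (\<mu> - 1)\<close> divided by N, cancelling the growth of the exponents;
  \<open>M\<close> then provides the smallness.\<close>

definition "radius = M * real N powr (1 / (1 - \<mu>))"

lemma radius_ge: "radius \<ge> real N" "radius \<ge> 1"
proof -
  have "1 * real N powr 1 \<le> radius" unfolding radius_def
    using mu M N by (intro mult_mono powr_mono) (auto simp: field_simps)
  then show "radius \<ge> real N" using N by simp
  then show "radius \<ge> 1" using N by simp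
qed

lemma radius_powr: "radius powr (2 * \<mu> * real N) = (M powr (2 * \<mu>)) ^ N * real N powr (\<gamma> * real N)"
proof -
  have "radius powr (2 * \<mu> * real N) = M powr (2 * \<mu> * real N) * real N powr (1 / (1 - \<mu>) * (2 * \<mu> * real N))"
    unfolding radius_def using M N by (simp add: powr_mult powr_powr)
  moreover have "1 / (1 - \<mu>) * (2 * \<mu> * real N) = \<gamma> * real N" by (simp add: gam)
  ultimately show ?thesis using M by (simp add: powr_mult_nat)
qed

lemma radius_condition: "(2 * real N) * radius powr (\<mu> - 1) = 2 * M powr (\<mu> - 1)"
proof -
  have "radius powr (\<mu> - 1) = M powr (\<mu> - 1) * real N powr (1 / (1 - \<mu>) * (\<mu> - 1))"
    unfolding radius_def using M N by (simp add: powr_mult powr_powr)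
  moreover have "1 / (1 - \<mu>) * (\<mu> - 1) = - 1" using mu by (simp add: field_simps)
  ultimately show ?thesis using N by (simp add: powr_neg_one)
qed

text \<open>\<open>rb radius x\<close> is at most twice the larger of \<open>radius\<close> and
  \<open>jbracket x\<close>. The first alternative is \<open>radius_powr\<close>. In the second,
  with y = \<open>jbracket x powr (1 - \<mu>)\<close>, the weight
  \<open>jbracket x powr (2 * \<mu> * real N)\<close> equals y^(\<gamma>N), and
  \<open>powr_exp_le\<close> with exponent \<gamma>N yields the same power of N.\<close>

lemma exponential_weight_bound:
  assumes \<alpha>: "\<alpha> > 0"
  shows "exp (- \<alpha> * jbracket x powr (1 - \<mu>)) * rb radius x powr (2 * \<mu> * real N)
    \<le> (2 powr (2 * \<mu>) * (M powr (2 * \<mu>) + (\<gamma> / \<alpha>) powr \<gamma>)) ^ N * real N powr (\<gamma> * real N)"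
proof -
  define p where "p = 2 * \<mu> * real N"
  define q where "q = \<gamma> * real N"
  define y where "y = jbracket x powr (1 - \<mu>)"
  have g: "\<gamma> > 0" using mu by (simp add: gam)
  have p: "p > 0" and q: "q > 0" using mu N g by (auto simp: p_def q_def)
  have j: "jbracket x \<ge> 1" by (rule jbracket_ge_1)
  have y: "y > 0" using j by (simp add: y_def)
  let ?a = "M powr (2 * \<mu>)" and ?b = "(\<gamma> / \<alpha>) powr \<gamma>"
  have ab: "?a \<ge> 0" "?b \<ge> 0" by auto
  have "rb radius x \<le> radius + jbracket x"
    using rb_le[of radius x] radius_ge(2) rb_ge_norm[of x 1] by (simp add: jbracket_rb)
  then have r: "rb radius x \<le> 2 * max radius (jbracket x)" by linarith
  have "rb radius x > 0" by (rule rb_pos) (use radius_ge in simp)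
  then have "rb radius x powr p \<le> (2 * max radius (jbracket x)) powr p"
    using r p by (intro powr_mono2) auto
  also have "\<dots> = 2 powr p * max radius (jbracket x) powr p" using radius_ge j by (subst powr_mult) auto
  also have "\<dots> \<le> 2 powr p * (radius powr p + jbracket x powr p)"
    by (intro mult_left_mono) (auto simp: max_def)
  finally have "exp (- \<alpha> * y) * rb radius x powr p \<le> exp (- \<alpha> * y) * (2 powr p * (radius powr p + jbracket x powr p))"
    by (intro mult_left_mono) auto
  also have "\<dots> = 2 powr p * (exp (- \<alpha> * y) * radius powr p + exp (- \<alpha> * y) * jbracket x powr p)" by (simp add: algebra_simps)
  also have "\<dots> \<le> 2 powr p * (?a ^ N * real N powr q + ?b ^ N * real N powr q)"
  proof (intro mult_left_mono add_mono)
    have "exp (- \<alpha> * y) * radius powr p \<le> 1 * radius powr p"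
      using \<alpha> y by (intro mult_right_mono) (auto simp: mult_nonneg_nonneg)
    then show "exp (- \<alpha> * y) * radius powr p \<le> ?a ^ N * real N powr q" by (simp add: radius_powr p_def q_def)
    have pq: "(1 - \<mu>) * q = p" using mu by (simp add: p_def q_def gam)
    have "jbracket x powr p = y powr q" by (simp only: y_def powr_powr pq)
    moreover have "y powr q = (1 / \<alpha>) powr q * (\<alpha> * y) powr q"
      using \<alpha> y by (simp add: powr_mult[symmetric])
    ultimately have "exp (- \<alpha> * y) * jbracket x powr p = (1 / \<alpha>) powr q * ((\<alpha> * y) powr q * exp (- (\<alpha> * y)))" by simp
    also have "\<dots> \<le> (1 / \<alpha>) powr q * q powr q"
      using \<alpha> y q by (intro mult_left_mono powr_exp_le) auto
    also have "\<dots> = (\<gamma> / \<alpha> * real N) powr q" using \<alpha> g q by (subst powr_mult[symmetric]) (auto simp: q_def)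
    also have "\<dots> = (\<gamma> / \<alpha>) powr q * real N powr q" using \<alpha> g by (subst powr_mult) auto
    also have "(\<gamma> / \<alpha>) powr q = ?b ^ N" unfolding q_def using \<alpha> g by (intro powr_mult_nat) simp
    finally show "exp (- \<alpha> * y) * jbracket x powr p \<le> ?b ^ N * real N powr q" .
  qed simp
  also have "\<dots> = 2 powr p * (?a ^ N + ?b ^ N) * real N powr q" by (simp add: algebra_simps)
  also have "\<dots> \<le> 2 powr p * (?a + ?b) ^ N * real N powr q"
  proof -
    \<comment> \<open>The two N-th powers are merged into one, since the final bound has the form of
      a single N-th power.\<close>
    have "x ^ k + z ^ k \<le> (x + z) ^ k" if "x \<ge> 0" "z \<ge> 0" "k \<ge> 1" for x z :: real and k :: nat
      using that(3)
    proof (induction k rule: dec_induct)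
      case (step k)
      have "x ^ Suc k + z ^ Suc k \<le> (x + z) * (x ^ k + z ^ k)" using that by (simp add: algebra_simps)
      also have "\<dots> \<le> (x + z) * (x + z) ^ k" using step that by (intro mult_left_mono) auto
      finally show ?case by simp
    qed simp
    from this[OF ab N] show ?thesis by (intro mult_right_mono mult_left_mono) auto
  qed
  also have "2 powr p * (?a + ?b) ^ N = (2 powr (2 * \<mu>) * (?a + ?b)) ^ N"
    unfolding p_def by (subst powr_mult_nat) (auto simp: power_mult_distrib)
  finally show ?thesis by (simp add: y_def p_def q_def)
qed

text \<open>Factoring out the scale costs (1 + \<rho>/radius)^(2\<mu>N), at most exp(2\<mu>N
  \<rho>/radius), and \<open>radius \<ge> real N\<close> bounds this by exp(2\<rho>). The support
  radius thus enters through a factor independent of N, so the geometric constant in part (b) can be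
  the same for all cut-offs.\<close>

lemma compact_weight_bound:
  assumes "norm x \<le> \<rho>" "\<rho> \<ge> 0"
  shows "rb radius x powr (2 * \<mu> * real N) \<le> exp (2 * \<rho>) * (M powr (2 * \<mu>)) ^ N * real N powr (\<gamma> * real N)"
proof -
  define p where "p = 2 * \<mu> * real N"
  have p: "p > 0" using mu N by (simp add: p_def)
  have R: "radius > 0" using radius_ge by simp
  have "rb radius x \<le> radius + \<rho>" using rb_le[of radius x] R assms by simp
  also have "\<dots> = radius * (1 + \<rho> / radius)" using R by (simp add: field_simps)
  also have "\<dots> \<le> radius * exp (\<rho> / radius)" using R by (intro mult_left_mono exp_ge_add_one_self) auto
  finally have "rb radius x powr p \<le> (radius * exp (\<rho> / radius)) powr p"
    using p rb_pos[OF R, of x] by (intro powr_mono2) auto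
  also have "\<dots> = exp (p * (\<rho> / radius)) * radius powr p" using R by (simp add: powr_mult exp_powr_real mult.commute)
  also have "\<dots> \<le> exp (2 * \<rho>) * radius powr p"
  proof (intro mult_right_mono)
    have "p \<le> 2 * 1 * real N" unfolding p_def using mu by (intro mult_right_mono mult_left_mono) auto
    then have "p \<le> 2 * radius" using radius_ge(1) by linarith
    then have "p * \<rho> \<le> 2 * radius * \<rho>" using assms(2) by (intro mult_right_mono)
    then have "p * (\<rho> / radius) \<le> 2 * \<rho>" using R by (simp add: field_simps)
    then show "exp (p * (\<rho> / radius)) \<le> exp (2 * \<rho>)" by simp
  qed simp
  also have "radius powr p = (M powr (2 * \<mu>)) ^ N * real N powr (\<gamma> * real N)" unfolding p_def by (rule radius_powr)
  finally show ?thesis by (simp add: p_def mult.assoc)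
qed

end

theorem theorem2p1:
  fixes a :: "'n::finite \<Rightarrow> 'n \<Rightarrow> real ^ 'n \<Rightarrow> complex"
    and b :: "'n \<Rightarrow> real ^ 'n \<Rightarrow> complex"
    and V0 :: "real ^ 'n \<Rightarrow> complex"
    and H0 G0 :: "(real ^ 'n \<Rightarrow> complex) \<Rightarrow> (real ^ 'n \<Rightarrow> complex)"
    and c c0 \<mu> \<gamma> :: real
  assumes H0: "H0 = elliptic_op a b V0"
    and a_meas: "\<And>i j. a i j \<in> borel_measurable lebesgue"
    and b_meas: "\<And>j. b j \<in> borel_measurable lebesgue"
    and V0_meas: "V0 \<in> borel_measurable lebesgue"
    and a_Cb1: "\<And>i j. a i j \<in> Cb1"
    and b_Cb1: "\<And>j. b j \<in> Cb1"
    and c_pos: "c > 0"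
    and elliptic: "\<And>x (\<xi> :: real ^ 'n).
           (\<Sum>i\<in>UNIV. \<Sum>j\<in>UNIV. Re (a i j x) * \<xi> $ i * \<xi> $ j) \<ge> c * (norm \<xi>)\<^sup>2"
    and V0_bound: "laplacian_bounded_zero V0"
    and accretive: "\<And>u. u \<in> sobolev 2 \<Longrightarrow> Re (L2_inner (H0 u) u) \<ge> 0"
    and mu: "0 < \<mu>" "\<mu> < 1"
    and c0_pos: "c0 > 0"
    and coercive: "\<And>u. u \<in> sobolev 2 \<Longrightarrow>
           cmod (L2_inner (H0 u) u) \<ge>
             c0 * ((grad_norm u)\<^sup>2 + (L2_norm (\<lambda>x. of_real (jbracket x powr (- \<mu>)) * u x))\<^sup>2)"
    and b_decay: "\<And>j. bdd_above (range (\<lambda>x. cmod (of_real (jbracket x powr \<mu>) * b j x)))"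
    and gamma: "\<gamma> = 2 * \<mu> / (1 - \<mu>)"
    and G0: "G0 = ext_inverse \<mu> H0"
  shows
    "(\<forall>\<alpha>>0. \<exists>C>0. \<forall>N\<ge>1.
        let w = mult_op (\<lambda>x. of_real (exp (- \<alpha> * jbracket x powr (1 - \<mu>)))) in
        bounded_L2_op (w \<circ> (G0 ^^ N)) \<and> bounded_L2_op ((G0 ^^ N) \<circ> w) \<and>
        L2_opnorm (w \<circ> (G0 ^^ N)) + L2_opnorm ((G0 ^^ N) \<circ> w)
          \<le> C ^ N * real N powr (\<gamma> * real N)) \<and>
     (\<exists>C>0. \<forall>\<phi>\<in>test_functions. \<exists>C\<phi>>0. \<forall>N\<ge>1.
        bounded_L2_op (mult_op \<phi> \<circ> (G0 ^^ N)) \<and> bounded_L2_op ((G0 ^^ N) \<circ> mult_op \<phi>) \<and>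
        L2_opnorm (mult_op \<phi> \<circ> (G0 ^^ N)) + L2_opnorm ((G0 ^^ N) \<circ> mult_op \<phi>)
          \<le> C\<phi> * C ^ N * real N powr (\<gamma> * real N))"
proof -
  define A where "A = elliptic_cls a b (pot V0)"
  obtain Bb where "coercive_l2 a b (pot V0) A c \<mu> c0 Bb"
    using coercive_l2_elliptic_op[OF V0_meas a_Cb1 b_Cb1 c_pos elliptic V0_bound accretive[unfolded H0] mu c0_pos
        coercive[unfolded H0] b_decay] unfolding A_def by blast
  then interpret coercive_l2 a b "pot V0" A c \<mu> c0 Bb .
  interpret extended_inverse a b "pot V0" A c \<mu> c0 Bb H0
    by unfold_locales (use elliptic_op_L2[OF a_Cb1 Cb1_bdd_mult[OF b_Cb1] V0_bound] in \<open>simp add: H0 A_def\<close>)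
  obtain \<eta>0 where \<eta>0: "admissible \<eta>0" using admissible_exists by blast
  then have "\<eta>0 > 0" by (simp add: admissible_def)
  \<comment> \<open>\<open>M\<close> depends on the threshold only; by
    \<open>radius_condition\<close> it then makes \<open>radius \<mu> M N\<close> admissible for
    every N.\<close>
  then obtain M where M: "M \<ge> 1" "2 * M powr (\<mu> - 1) \<le> \<eta>0" using exists_scale[OF mu(2)] by blast
  define Q where "Q = 2 / c0"
  have Q: "Q > 0" using c0_pos by (simp add: Q_def)
  have pow: "bounded_L2_op (mult_op w \<circ> (G0 ^^ N)) \<and> bounded_L2_op ((G0 ^^ N) \<circ> mult_op w) \<and>
      L2_opnorm (mult_op w \<circ> (G0 ^^ N)) + L2_opnorm ((G0 ^^ N) \<circ> mult_op w) \<le> 2 * (B * Q ^ N)"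
    if N: "N \<ge> 1" and w: "w \<in> borel_measurable lebesgue" "\<And>x. cmod (w x) * rb (radius \<mu> M N) x powr (2 * \<mu> * real N) \<le> B"
    for N w B
  proof -
    have c: "(2 * real N) * radius \<mu> M N powr (\<mu> - 1) \<le> \<eta>0"
      unfolding radius_condition[OF mu gamma M(1) N] by (rule M(2))
    show ?thesis
      using bounded_G_pow[OF \<eta>0 radius_ge(2)[OF mu gamma M(1) N] c N w] unfolding G0 Q_def by auto
  qed
  show ?thesis
  proof (intro conjI allI impI)
    fix \<alpha> :: real assume \<alpha>: "\<alpha> > 0"
    define K where "K = 2 powr (2 * \<mu>) * (M powr (2 * \<mu>) + (\<gamma> / \<alpha>) powr \<gamma>)"
    have "M powr (2 * \<mu>) > 0" using M by simp
    then have K: "K > 0" unfolding K_def by (intro mult_pos_pos add_pos_nonneg) auto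
    define w :: "real ^ 'n \<Rightarrow> complex" where "w x = of_real (exp (- \<alpha> * jbracket x powr (1 - \<mu>)))" for x
    have wm: "w \<in> borel_measurable lebesgue"
    proof -
      have "jbracket x \<noteq> 0" for x :: "real ^ 'n" using jbracket_ge_1[of x] by linarith
      then have "continuous_on UNIV w" unfolding w_def[abs_def] jbracket_rb
        by (intro continuous_intros continuous_rb) auto
      then show ?thesis by (rule continuous_lebesgue_measurable)
    qed
    show "\<exists>C>0. \<forall>N\<ge>1.
        let w = mult_op (\<lambda>x. of_real (exp (- \<alpha> * jbracket x powr (1 - \<mu>)))) in
        bounded_L2_op (w \<circ> (G0 ^^ N)) \<and> bounded_L2_op ((G0 ^^ N) \<circ> w) \<and>
        L2_opnorm (w \<circ> (G0 ^^ N)) + L2_opnorm ((G0 ^^ N) \<circ> w)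
          \<le> C ^ N * real N powr (\<gamma> * real N)"
      unfolding Let_def w_def[abs_def, symmetric]
    proof (intro exI[of _ "2 * K * Q"] conjI allI impI)
      show "2 * K * Q > 0" using K Q by simp
      fix N :: nat assume N: "1 \<le> N"
      have wb: "cmod (w x) * rb (radius \<mu> M N) x powr (2 * \<mu> * real N) \<le> K ^ N * real N powr (\<gamma> * real N)" for x
        using exponential_weight_bound[OF mu gamma M(1) N \<alpha>, of x] by (simp add: w_def K_def)
      note P = pow[OF N wm wb]
      show "bounded_L2_op (mult_op w \<circ> (G0 ^^ N))" "bounded_L2_op ((G0 ^^ N) \<circ> mult_op w)" using P by blast+
      \<comment> \<open>The 2 comes from the two operator norms; part (a) has no prefactor, so it is
        absorbed by \<open>2 \<le> 2 ^ N\<close>.\<close>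
      have "2 * (K ^ N * real N powr (\<gamma> * real N) * Q ^ N) \<le> 2 ^ N * (K ^ N * real N powr (\<gamma> * real N) * Q ^ N)"
        using K Q N by (intro mult_right_mono self_le_power) auto
      also have "\<dots> = (2 * K * Q) ^ N * real N powr (\<gamma> * real N)" by (simp add: power_mult_distrib)
      finally show "L2_opnorm (mult_op w \<circ> (G0 ^^ N)) + L2_opnorm ((G0 ^^ N) \<circ> mult_op w) \<le> (2 * K * Q) ^ N * real N powr (\<gamma> * real N)"
        using P by linarith
    qed
  next
    show "\<exists>C>0. \<forall>\<phi>\<in>test_functions. \<exists>C\<phi>>0. \<forall>N\<ge>1.
        bounded_L2_op (mult_op \<phi> \<circ> (G0 ^^ N)) \<and> bounded_L2_op ((G0 ^^ N) \<circ> mult_op \<phi>) \<and>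
        L2_opnorm (mult_op \<phi> \<circ> (G0 ^^ N)) + L2_opnorm ((G0 ^^ N) \<circ> mult_op \<phi>)
          \<le> C\<phi> * C ^ N * real N powr (\<gamma> * real N)"
    proof (rule exI[of _ "M powr (2 * \<mu>) * Q"], intro conjI ballI)
      show "M powr (2 * \<mu>) * Q > 0" using M Q by simp
      fix \<phi> :: "real ^ 'n \<Rightarrow> complex" assume \<phi>: "\<phi> \<in> test_functions"
      obtain L where L: "compact L" "\<And>x. x \<notin> L \<Longrightarrow> \<phi> x = 0" using test_functionsE[OF \<phi>] by blast
      have c\<phi>: "continuous_on UNIV \<phi>" using Ck_continuous[OF test_Ck[OF \<phi>]] .
      obtain B where B: "B \<ge> 0" "\<And>x. cmod (\<phi> x) \<le> B" using compact_support_bounded[OF c\<phi> L] by blast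
      obtain \<rho> where \<rho>: "\<rho> > 0" "\<And>x. x \<in> L \<Longrightarrow> norm x \<le> \<rho>"
        using compact_imp_bounded[OF L(1)] unfolding bounded_pos by blast
      \<comment> \<open>All dependence on the cut-off sits here: its supremum, raised by 1 to be
        positive, and the radius of its support.\<close>
      let ?C = "2 * ((B + 1) * exp (2 * \<rho>))"
      show "\<exists>C\<phi>>0. \<forall>N\<ge>1.
        bounded_L2_op (mult_op \<phi> \<circ> (G0 ^^ N)) \<and> bounded_L2_op ((G0 ^^ N) \<circ> mult_op \<phi>) \<and>
        L2_opnorm (mult_op \<phi> \<circ> (G0 ^^ N)) + L2_opnorm ((G0 ^^ N) \<circ> mult_op \<phi>)
          \<le> C\<phi> * (M powr (2 * \<mu>) * Q) ^ N * real N powr (\<gamma> * real N)"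
      proof (intro exI[of _ ?C] conjI allI impI)
        show "?C > 0" using B by simp
        fix N :: nat assume N: "1 \<le> N"
        define E where "E = exp (2 * \<rho>) * (M powr (2 * \<mu>)) ^ N * real N powr (\<gamma> * real N)"
        have E: "E \<ge> 0" by (simp add: E_def)
        have wb: "cmod (\<phi> x) * rb (radius \<mu> M N) x powr (2 * \<mu> * real N) \<le> (B + 1) * E" for x
        proof (cases "x \<in> L")
          case True
          have "rb (radius \<mu> M N) x powr (2 * \<mu> * real N) \<le> E"
            unfolding E_def using \<rho> True by (intro compact_weight_bound[OF mu gamma M(1) N]) auto
          then show ?thesis using B E by (intro mult_mono) (auto intro: add_increasing2)
        qed (use L B E in simp)
        note P = pow[OF N continuous_lebesgue_measurable[OF c\<phi>] wb]
        show "bounded_L2_op (mult_op \<phi> \<circ> (G0 ^^ N))" "bounded_L2_op ((G0 ^^ N) \<circ> mult_op \<phi>)" using P by blast+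
        have "2 * ((B + 1) * E * Q ^ N) = ?C * (M powr (2 * \<mu>) * Q) ^ N * real N powr (\<gamma> * real N)"
          by (simp add: E_def power_mult_distrib)
        then show "L2_opnorm (mult_op \<phi> \<circ> (G0 ^^ N)) + L2_opnorm ((G0 ^^ N) \<circ> mult_op \<phi>)
          \<le> ?C * (M powr (2 * \<mu>) * Q) ^ N * real N powr (\<gamma> * real N)"
          using P by linarith
      qed
    qed
  qed
qed

end
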